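(* Let $\mathcal B=(B_g)_{g\in G}$ be a unital Fell bundle over a discrete group $G$ having the Haagerup PD-approximation property with an implementing net $\{T^i\}_{i\in I}$ such that each $T^i_g$ ($i\in I$, $g\in G$) is a compact $B_e$-module map on $B_g$ (considered as a right Hilbert $B_e$-module). Moreover, assume that for every $g\in G$ there exists an orthonormal basis $\{u_\gamma(g):\gamma\in J_g\}$ for $B_g$. Then $C_r^*(\mathcal B)$ has the Hilbert $B_e$-module Haagerup property with respect to $E_e$.
   Context: **Fell bundles.** A Fell bundle $\mathcal B=(B_g)_{g\in G}$ over a discrete group $G$ (with unit $e$) is a family of Banach spaces (their disjoint union is also denoted $\mathcal B$) with an associative multiplication $\mathcal B\times\mathcal B\to\mathcal B$ such that $B_gB_h\subseteq B_{gh}$, bilinear on each $B_g\times B_h$, $\|ab\|\le\|a\|\|b\|$, and an involutive anti-multiplicative map $b\mapsto b^*$ which is conjugate-linear and isometric from $B_g$ onto $B_{g^{-1}}$, such that $\|b^*b\|=\|b\|^2$ and $b^*b\ge 0$ in the $C^*$-algebra $B_e$ for all $b\in\mathcal B$. $\mathcal B$ is unital if $B_e$ is unital. Each $B_g$ is a right Hilbert $B_e$-module with $\langle b,c\rangle_{B_e}=b^*c$. **Haagerup PD-approximation property.** A $\mathcal B$-bundle map is a family $T=(T_g)_{g\in G}$ of bounded linear maps $T_g:B_g\to B_g$; it is positive definite if $\sum_{i,j=1}^n b_i\,T_{g_i^{-1}g_j}(a_i^*a_j)\,b_j^*\ge 0$ in $B_e$ for all $n\in\mathbb N$, $g_1,\dots,g_n\in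 G$ and $a_i,b_i\in B_{g_i}$. $\mathcal B$ has the Haagerup PD-approximation property if there is a net $\{T^i\}_{i\in I}$ of $\mathcal B$-bundle maps (an implementing net) with: (i) each $T^i$ is positive definite and $g\mapsto\|T^i_g\|$ is in $C_0(G)$; (ii) $\sup_i\|T_e^i\|<\infty$; (iii) $\lim_i\|T^i_g(b)-b\|=0$ for all $g\in G$, $b\in B_g$. **Compact maps and orthonormal bases.** For a right Hilbert $B$-module $X$, a finite rank map on $X$ is a finite sum of maps $\theta_{\xi,\eta}(x)=\xi\langle\eta,x\rangle_B$, $\xi,\eta\in X$; a compact map is a bounded map that is a norm limit of finite rank maps (it is then a right $B$-module map). If $B$ is unital, an orthonormal basis of $X$ is a family $\{u_j\}_{j\in J}$ in $X$ with $\langle u_j,u_k\rangle_B=1_B$ if $j=k$ and $0$ otherwise, such that for every $x\in X$ there exist $\widehat x_j\in B$ with $x=\sum_{j\in J}u_j\widehat x_j$ (unconditional convergence in norm). **Reduced cross-sectional algebra.** $C_c(\mathcal B)$ is the space of finitely supported sections of $\mathcal B$; $\ell^2(\mathcal B)$ is the right Hilbert $B_e$-module completion of $C_c(\mathcal B)$ for $\langle\xi,\eta\rangle_{B_e}=\sum_g\xi(g)^*\eta(g)$, $(\xi\cdot b)(g)=\xi(g)b$. For $b\in B_g$, $\lambda_g^{\mathcal B}(b)$ is the adjointable operator on $\ell^2(\mathcal B)$ with $(\lambda^{\mathcal B}_g(b)\xi)(h)=b\,\xi(g^{-1}h)$. $C_r^*(\mathcal B)$ is the $C^*$-algebra generated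 by all $\lambda_g^{\mathcal B}(b)$, $g\in G$, $b\in B_g$. $B_e$ is identified with $\lambda_e^{\mathcal B}(B_e)$, and $E_e:C_r^*(\mathcal B)\to B_e$ is the faithful conditional expectation satisfying $E_e(\lambda_g^{\mathcal B}(b))=b$ if $g=e$ and $=0$ if $g\ne e$. **Hilbert $B_e$-module Haagerup property.** $\mathcal H_{\mathcal B}$ is the right Hilbert $B_e$-module completion of $C_r^*(\mathcal B)$ for the inner product $\langle x,y\rangle_{E_e}=E_e(x^*y)$, with norm $\|x\|_{E_e}=\|E_e(x^*x)\|^{1/2}$. If $\Phi$ is a completely positive map on $C_r^*(\mathcal B)$ with $E_e\circ\Phi\le E_e$ (on positive elements), then $\Phi$ induces a bounded map $\tilde\Phi$ on $\mathcal H_{\mathcal B}$. $C_r^*(\mathcal B)$ has the Hilbert $B_e$-module Haagerup property with respect to $E_e$ if there is a net $\{\Phi_i\}_{i\in I}$ of completely positive $B_e$-bimodule maps on $C_r^*(\mathcal B)$ with: (a) $E_e\circ\Phi_i\le E_e$ for every $i$; (b) $\sup_i\|\tilde\Phi_i\|<\infty$; (c) each $\tilde\Phi_i$ is a compact map on $\mathcal H_{\mathcal B}$; (d) $\|\tilde\Phi_i(x)-x\|_{E_e}\to_i 0$ for all $x\in C_r^*(\mathcal B)$. *)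

theory Defs
  imports "HOL-Analysis.Analysis" "HOL-Library.Function_Algebras"
begin

section \<open>Complex vector spaces, norms on subspaces\<close>

class complex_vector = ab_group_add +
  fixes scaleC :: "complex \<Rightarrow> 'a \<Rightarrow> 'a" (infixr "*\<^sub>C" 75)
  assumes scaleC_add_right: "c *\<^sub>C (x + y) = c *\<^sub>C x + c *\<^sub>C y"
    and scaleC_add_left: "(c + d) *\<^sub>C x = c *\<^sub>C x + d *\<^sub>C x"
    and scaleC_scaleC: "c *\<^sub>C d *\<^sub>C x = (c * d) *\<^sub>C x"
    and scaleC_one: "1 *\<^sub>C x = x"

instantiation "fun" :: (type, complex_vector) complex_vector
begin

definition scaleC_fun :: "complex \<Rightarrow> ('a \<Rightarrow> 'b) \<Rightarrow> 'a \<Rightarrow> 'b" where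
  "scaleC_fun c f = (\<lambda>x. c *\<^sub>C f x)"

instance
  by standard (simp_all add: scaleC_fun_def fun_eq_iff scaleC_add_right scaleC_add_left
      scaleC_scaleC scaleC_one)

end

abbreviation csubspace :: "'a::complex_vector set \<Rightarrow> bool" where
  "csubspace \<equiv> module.subspace scaleC"

definition clinear_on :: "'a::complex_vector set \<Rightarrow> ('a \<Rightarrow> 'b::complex_vector) \<Rightarrow> bool" where
  "clinear_on S f \<longleftrightarrow>
     (\<forall>x\<in>S. \<forall>y\<in>S. f (x + y) = f x + f y) \<and> (\<forall>c. \<forall>x\<in>S. f (c *\<^sub>C x) = c *\<^sub>C f x)"

definition complete_on :: "'a::complex_vector set \<Rightarrow> ('a \<Rightarrow> real) \<Rightarrow> bool" where
  "complete_on S n \<longleftrightarrow>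
     (\<forall>s. (\<forall>k. s k \<in> S) \<and> (\<forall>\<epsilon>>0. \<exists>N. \<forall>k\<ge>N. \<forall>l\<ge>N. n (s k - s l) < \<epsilon>) \<longrightarrow>
          (\<exists>x\<in>S. (\<lambda>k::nat. n (s k - x)) \<longlonglongrightarrow> 0))"

definition banach_on :: "'a::complex_vector set \<Rightarrow> ('a \<Rightarrow> real) \<Rightarrow> bool" where
  "banach_on S n \<longleftrightarrow> csubspace S \<and>
     (\<forall>x\<in>S. 0 \<le> n x \<and> (n x = 0 \<longleftrightarrow> x = 0)) \<and>
     (\<forall>x\<in>S. \<forall>y\<in>S. n (x + y) \<le> n x + n y) \<and>
     (\<forall>c. \<forall>x\<in>S. n (c *\<^sub>C x) = cmod c * n x) \<and>
     complete_on S n"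

definition bounded_on :: "'a set \<Rightarrow> ('a \<Rightarrow> real) \<Rightarrow> ('a \<Rightarrow> 'a) \<Rightarrow> bool" where
  "bounded_on S n f \<longleftrightarrow> (\<exists>C. \<forall>x\<in>S. n (f x) \<le> C * n x)"

text \<open>As for \<open>onorm\<close> in the library, the quotient is 0 at the zero vector. The supremum is
  meaningful only for maps that are bounded.\<close>

definition op_norm :: "'a set \<Rightarrow> ('a \<Rightarrow> real) \<Rightarrow> ('a \<Rightarrow> 'a) \<Rightarrow> real" where
  "op_norm S n f = (SUP x\<in>S. n (f x) / n x)"

definition bounded_op :: "'a::complex_vector set \<Rightarrow> ('a \<Rightarrow> real) \<Rightarrow> ('a \<Rightarrow> 'a) \<Rightarrow> bool" where
  "bounded_op S n f \<longleftrightarrow> (\<forall>x\<in>S. f x \<in> S) \<and> clinear_on S f \<and> bounded_on S n f"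

section \<open>Nets\<close>

definition directed_set :: "'i set \<Rightarrow> ('i \<Rightarrow> 'i \<Rightarrow> bool) \<Rightarrow> bool" where
  "directed_set I le \<longleftrightarrow> I \<noteq> {} \<and> (\<forall>i\<in>I. le i i) \<and>
     (\<forall>i\<in>I. \<forall>j\<in>I. \<forall>k\<in>I. le i j \<longrightarrow> le j k \<longrightarrow> le i k) \<and>
     (\<forall>i\<in>I. \<forall>j\<in>I. \<exists>k\<in>I. le i k \<and> le j k)"

definition net_filter :: "'i set \<Rightarrow> ('i \<Rightarrow> 'i \<Rightarrow> bool) \<Rightarrow> 'i filter" where
  "net_filter I le = (INF i\<in>I. principal {k\<in>I. le i k})"

section \<open>\<open>C\<^sup>*\<close>-algebras with explicit carrier\<close>

record 'a cstar_data =
  ccar :: "'a set"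
  cmul :: "'a \<Rightarrow> 'a \<Rightarrow> 'a"
  cstar :: "'a \<Rightarrow> 'a"
  cnorm :: "'a \<Rightarrow> real"

definition cpos :: "'a cstar_data \<Rightarrow> 'a \<Rightarrow> bool" where
  "cpos A a \<longleftrightarrow> (\<exists>c\<in>ccar A. a = cmul A (cstar A c) c)"

definition cle :: "'a::complex_vector cstar_data \<Rightarrow> 'a \<Rightarrow> 'a \<Rightarrow> bool" where
  "cle A a b \<longleftrightarrow> cpos A (b - a)"

text \<open>Positivity in the matrix algebra \<open>M\<^sub>n(A)\<close>: \<open>x = c\<^sup>*c\<close> for some \<open>c\<close> in \<open>M\<^sub>n(A)\<close>.\<close>

definition mat_pos :: "'a::complex_vector cstar_data \<Rightarrow> nat \<Rightarrow> (nat \<Rightarrow> nat \<Rightarrow> 'a) \<Rightarrow> bool" where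
  "mat_pos A n x \<longleftrightarrow> (\<exists>c. (\<forall>i<n. \<forall>j<n. c i j \<in> ccar A) \<and>
     (\<forall>i<n. \<forall>j<n. x i j = (\<Sum>k<n. cmul A (cstar A (c k i)) (c k j))))"

definition completely_positive :: "'a::complex_vector cstar_data \<Rightarrow> ('a \<Rightarrow> 'a) \<Rightarrow> bool" where
  "completely_positive A \<Phi> \<longleftrightarrow> (\<forall>x\<in>ccar A. \<Phi> x \<in> ccar A) \<and> clinear_on (ccar A) \<Phi> \<and>
     (\<forall>n x. mat_pos A n x \<longrightarrow> mat_pos A n (\<lambda>i j. \<Phi> (x i j)))"

definition is_cunit :: "'a cstar_data \<Rightarrow> 'a \<Rightarrow> bool" where
  "is_cunit A u \<longleftrightarrow> u \<in> ccar A \<and> (\<forall>a\<in>ccar A. cmul A u a = a \<and> cmul A a u = a)"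

definition cunital :: "'a cstar_data \<Rightarrow> bool" where
  "cunital A \<longleftrightarrow> (\<exists>u. is_cunit A u)"

definition cunit :: "'a cstar_data \<Rightarrow> 'a" where
  "cunit A = (THE u. is_cunit A u)"

definition cstar_subalgebra :: "'a::complex_vector cstar_data \<Rightarrow> 'a set \<Rightarrow> bool" where
  "cstar_subalgebra A S \<longleftrightarrow> S \<subseteq> ccar A \<and> csubspace S \<and>
     (\<forall>x\<in>S. \<forall>y\<in>S. cmul A x y \<in> S) \<and> (\<forall>x\<in>S. cstar A x \<in> S) \<and>
     (\<forall>s x. (\<forall>k. s k \<in> S) \<and> x \<in> ccar A \<and> (\<lambda>k::nat. cnorm A (s k - x)) \<longlonglongrightarrow> 0 \<longrightarrow> x \<in> S)"

definition cstar_generated :: "'a::complex_vector cstar_data \<Rightarrow> 'a set \<Rightarrow> 'a cstar_data" where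
  "cstar_generated A G = A\<lparr>ccar := \<Inter>{S. cstar_subalgebra A S \<and> G \<subseteq> S}\<rparr>"

section \<open>Hilbert modules\<close>

text \<open>\<open>hip\<close> is conjugate-linear in the first and linear in the second variable.\<close>

record ('x, 'b) hmodule =
  hcar :: "'x set"
  hact :: "'x \<Rightarrow> 'b \<Rightarrow> 'x"
  hip :: "'x \<Rightarrow> 'x \<Rightarrow> 'b"

definition hnorm :: "'b cstar_data \<Rightarrow> ('x, 'b) hmodule \<Rightarrow> 'x \<Rightarrow> real" where
  "hnorm A X x = sqrt (cnorm A (hip X x x))"

locale hilbert_module =
  fixes A :: "'b::complex_vector cstar_data" and X :: "('x::complex_vector, 'b) hmodule"
  assumes subspace: "csubspace (hcar X)"
    and act_closed: "\<And>x a. \<lbrakk>x \<in> hcar X; a \<in> ccar A\<rbrakk> \<Longrightarrow> hact X x a \<in> hcar X"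
    and act_add_left: "\<And>x y a. \<lbrakk>x \<in> hcar X; y \<in> hcar X; a \<in> ccar A\<rbrakk> \<Longrightarrow>
          hact X (x + y) a = hact X x a + hact X y a"
    and act_add_right: "\<And>x a b. \<lbrakk>x \<in> hcar X; a \<in> ccar A; b \<in> ccar A\<rbrakk> \<Longrightarrow>
          hact X x (a + b) = hact X x a + hact X x b"
    and act_scale_left: "\<And>c x a. \<lbrakk>x \<in> hcar X; a \<in> ccar A\<rbrakk> \<Longrightarrow>
          hact X (c *\<^sub>C x) a = c *\<^sub>C hact X x a"
    and act_scale_right: "\<And>c x a. \<lbrakk>x \<in> hcar X; a \<in> ccar A\<rbrakk> \<Longrightarrow>
          hact X x (c *\<^sub>C a) = c *\<^sub>C hact X x a"
    and act_mul: "\<And>x a b. \<lbrakk>x \<in> hcar X; a \<in> ccar A; b \<in> ccar A\<rbrakk> \<Longrightarrow>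
          hact X x (cmul A a b) = hact X (hact X x a) b"
    and ip_closed: "\<And>x y. \<lbrakk>x \<in> hcar X; y \<in> hcar X\<rbrakk> \<Longrightarrow> hip X x y \<in> ccar A"
    and ip_add: "\<And>x y z. \<lbrakk>x \<in> hcar X; y \<in> hcar X; z \<in> hcar X\<rbrakk> \<Longrightarrow>
          hip X x (y + z) = hip X x y + hip X x z"
    and ip_scale: "\<And>c x y. \<lbrakk>x \<in> hcar X; y \<in> hcar X\<rbrakk> \<Longrightarrow> hip X x (c *\<^sub>C y) = c *\<^sub>C hip X x y"
    and ip_act: "\<And>x y a. \<lbrakk>x \<in> hcar X; y \<in> hcar X; a \<in> ccar A\<rbrakk> \<Longrightarrow>
          hip X x (hact X y a) = cmul A (hip X x y) a"
    and ip_star: "\<And>x y. \<lbrakk>x \<in> hcar X; y \<in> hcar X\<rbrakk> \<Longrightarrow> cstar A (hip X x y) = hip X y x"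
    and ip_pos: "\<And>x. x \<in> hcar X \<Longrightarrow> cpos A (hip X x x)"
    and ip_definite: "\<And>x. \<lbrakk>x \<in> hcar X; hip X x x = 0\<rbrakk> \<Longrightarrow> x = 0"
    and complete: "complete_on (hcar X) (hnorm A X)"

text \<open>\<open>hilbert_completion A X H j\<close>: the Hilbert module \<open>H\<close> together with the embedding \<open>j\<close> is a
  completion of the inner product module \<open>X\<close>; this determines \<open>(H, j)\<close> up to a unique
  unitary.\<close>

definition hilbert_completion :: "'b::complex_vector cstar_data \<Rightarrow>
    ('x::complex_vector, 'b) hmodule \<Rightarrow> ('y::complex_vector, 'b) hmodule \<Rightarrow> ('x \<Rightarrow> 'y) \<Rightarrow> bool" where
  "hilbert_completion A X H j \<longleftrightarrow> hilbert_module A H \<and>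
     (\<forall>x\<in>hcar X. j x \<in> hcar H) \<and> clinear_on (hcar X) j \<and>
     (\<forall>x\<in>hcar X. \<forall>a\<in>ccar A. j (hact X x a) = hact H (j x) a) \<and>
     (\<forall>x\<in>hcar X. \<forall>y\<in>hcar X. hip H (j x) (j y) = hip X x y) \<and>
     (\<forall>h\<in>hcar H. \<forall>\<epsilon>>0. \<exists>x\<in>hcar X. hnorm A H (j x - h) < \<epsilon>)"

definition finite_rank :: "('x::complex_vector, 'b) hmodule \<Rightarrow> ('x \<Rightarrow> 'x) \<Rightarrow> bool" where
  "finite_rank X F \<longleftrightarrow> (\<exists>n::nat. \<exists>\<xi> \<eta>. (\<forall>i<n. \<xi> i \<in> hcar X \<and> \<eta> i \<in> hcar X) \<and>
     (\<forall>x\<in>hcar X. F x = (\<Sum>i<n. hact X (\<xi> i) (hip X (\<eta> i) x))))"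

definition compact_map ::
    "'b cstar_data \<Rightarrow> ('x::complex_vector, 'b) hmodule \<Rightarrow> ('x \<Rightarrow> 'x) \<Rightarrow> bool" where
  "compact_map A X K \<longleftrightarrow> bounded_op (hcar X) (hnorm A X) K \<and>
     (\<exists>F. (\<forall>k. finite_rank X (F k)) \<and>
          (\<lambda>k::nat. op_norm (hcar X) (hnorm A X) (\<lambda>x. F k x - K x)) \<longlonglongrightarrow> 0)"

definition orthonormal_basis :: "'b::complex_vector cstar_data \<Rightarrow>
    ('x::complex_vector, 'b) hmodule \<Rightarrow> 'j set \<Rightarrow> ('j \<Rightarrow> 'x) \<Rightarrow> bool" where
  "orthonormal_basis A X J u \<longleftrightarrow> (\<forall>j\<in>J. u j \<in> hcar X) \<and>
     (\<forall>j\<in>J. \<forall>k\<in>J. hip X (u j) (u k) = (if j = k then cunit A else 0)) \<and>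
     (\<forall>x\<in>hcar X. \<exists>c. (\<forall>j\<in>J. c j \<in> ccar A) \<and>
        ((\<lambda>F. hnorm A X (x - (\<Sum>j\<in>F. hact X (u j) (c j)))) \<longlongrightarrow> 0) (finite_subsets_at_top J))"

text \<open>An operator on \<open>X\<close> is represented by a function that vanishes off the carrier, so that the
  operators on \<open>X\<close> form a subspace of the function space and are equal iff they agree on the
  carrier.\<close>

definition adjointable_ops ::
    "'b cstar_data \<Rightarrow> ('x::complex_vector, 'b) hmodule \<Rightarrow> ('x \<Rightarrow> 'x) set" where
  "adjointable_ops A X = {S. bounded_op (hcar X) (hnorm A X) S \<and> (\<forall>x. x \<notin> hcar X \<longrightarrow> S x = 0) \<and>
     (\<exists>S'. (\<forall>y\<in>hcar X. S' y \<in> hcar X) \<and>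
           (\<forall>x\<in>hcar X. \<forall>y\<in>hcar X. hip X (S x) y = hip X x (S' y)))}"

definition adjoint_op :: "('x::complex_vector, 'b) hmodule \<Rightarrow> ('x \<Rightarrow> 'x) \<Rightarrow> 'x \<Rightarrow> 'x" where
  "adjoint_op X S = (\<lambda>y. if y \<in> hcar X
     then THE z. z \<in> hcar X \<and> (\<forall>x\<in>hcar X. hip X (S x) y = hip X x z) else 0)"

definition adjointable_algebra ::
    "'b cstar_data \<Rightarrow> ('x::complex_vector, 'b) hmodule \<Rightarrow> ('x \<Rightarrow> 'x) cstar_data" where
  "adjointable_algebra A X = \<lparr>ccar = adjointable_ops A X, cmul = (\<lambda>S R. S \<circ> R),
     cstar = adjoint_op X, cnorm = op_norm (hcar X) (hnorm A X)\<rparr>"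

section \<open>Fell bundles\<close>

text \<open>The discrete group is a type of class \<open>group_add\<close>, which is not assumed commutative: the
  product, inverse and unit of the group are written \<open>g + h\<close>, \<open>- g\<close> and \<open>0\<close>.

  The fibres are subspaces of one ambient complex vector space. This is no restriction, since any
  family of vector spaces embeds in a common one, and no relation between different fibres is
  imposed. As a vector may lie in several fibres, the norm, multiplication and involution carry
  the indices of the fibres: \<open>fmul B g h\<close> is the multiplication \<open>B\<^sub>g \<times> B\<^sub>h \<rightarrow> B\<^sub>g\<^sub>h\<close>.\<close>

record ('g, 'b) fell_data =
  fib :: "'g \<Rightarrow> 'b set"
  fnorm :: "'g \<Rightarrow> 'b \<Rightarrow> real"
  fmul :: "'g \<Rightarrow> 'g \<Rightarrow> 'b \<Rightarrow> 'b \<Rightarrow> 'b"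
  fstar :: "'g \<Rightarrow> 'b \<Rightarrow> 'b"

definition unit_fibre :: "('g::group_add, 'b) fell_data \<Rightarrow> 'b cstar_data" where
  "unit_fibre B = \<lparr>ccar = fib B 0, cmul = fmul B 0 0, cstar = fstar B 0, cnorm = fnorm B 0\<rparr>"

locale fell_bundle =
  fixes B :: "('g::group_add, 'b::complex_vector) fell_data"
  assumes banach: "\<And>g. banach_on (fib B g) (fnorm B g)"
    and mul_closed: "\<And>g h a b. \<lbrakk>a \<in> fib B g; b \<in> fib B h\<rbrakk> \<Longrightarrow> fmul B g h a b \<in> fib B (g + h)"
    and mul_add_left: "\<And>g h a a' b. \<lbrakk>a \<in> fib B g; a' \<in> fib B g; b \<in> fib B h\<rbrakk> \<Longrightarrow>
          fmul B g h (a + a') b = fmul B g h a b + fmul B g h a' b"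
    and mul_add_right: "\<And>g h a b b'. \<lbrakk>a \<in> fib B g; b \<in> fib B h; b' \<in> fib B h\<rbrakk> \<Longrightarrow>
          fmul B g h a (b + b') = fmul B g h a b + fmul B g h a b'"
    and mul_scale_left: "\<And>g h c a b. \<lbrakk>a \<in> fib B g; b \<in> fib B h\<rbrakk> \<Longrightarrow>
          fmul B g h (c *\<^sub>C a) b = c *\<^sub>C fmul B g h a b"
    and mul_scale_right: "\<And>g h c a b. \<lbrakk>a \<in> fib B g; b \<in> fib B h\<rbrakk> \<Longrightarrow>
          fmul B g h a (c *\<^sub>C b) = c *\<^sub>C fmul B g h a b"
    and mul_assoc: "\<And>g h k a b d. \<lbrakk>a \<in> fib B g; b \<in> fib B h; d \<in> fib B k\<rbrakk> \<Longrightarrow>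
          fmul B (g + h) k (fmul B g h a b) d = fmul B g (h + k) a (fmul B h k b d)"
    and mul_norm: "\<And>g h a b. \<lbrakk>a \<in> fib B g; b \<in> fib B h\<rbrakk> \<Longrightarrow>
          fnorm B (g + h) (fmul B g h a b) \<le> fnorm B g a * fnorm B h b"
    and star_closed: "\<And>g b. b \<in> fib B g \<Longrightarrow> fstar B g b \<in> fib B (- g)"
    and star_add: "\<And>g a b. \<lbrakk>a \<in> fib B g; b \<in> fib B g\<rbrakk> \<Longrightarrow>
          fstar B g (a + b) = fstar B g a + fstar B g b"
    and star_scale: "\<And>g c b. b \<in> fib B g \<Longrightarrow> fstar B g (c *\<^sub>C b) = cnj c *\<^sub>C fstar B g b"
    and star_star: "\<And>g b. b \<in> fib B g \<Longrightarrow> fstar B (- g) (fstar B g b) = b"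
    and star_mul: "\<And>g h a b. \<lbrakk>a \<in> fib B g; b \<in> fib B h\<rbrakk> \<Longrightarrow>
          fstar B (g + h) (fmul B g h a b) = fmul B (- h) (- g) (fstar B h b) (fstar B g a)"
    and star_norm: "\<And>g b. b \<in> fib B g \<Longrightarrow> fnorm B (- g) (fstar B g b) = fnorm B g b"
    and star_mul_norm: "\<And>g b. b \<in> fib B g \<Longrightarrow>
          fnorm B 0 (fmul B (- g) g (fstar B g b) b) = (fnorm B g b)\<^sup>2"
    and star_mul_pos: "\<And>g b. b \<in> fib B g \<Longrightarrow>
          cpos (unit_fibre B) (fmul B (- g) g (fstar B g b) b)"

definition fibre_module :: "('g::group_add, 'b) fell_data \<Rightarrow> 'g \<Rightarrow> ('b, 'b) hmodule" where
  "fibre_module B g = \<lparr>hcar = fib B g, hact = fmul B g 0,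
     hip = (\<lambda>b c. fmul B (- g) g (fstar B g b) c)\<rparr>"

section \<open>The Haagerup PD-approximation property\<close>

definition bundle_map :: "('g, 'b::complex_vector) fell_data \<Rightarrow> ('g \<Rightarrow> 'b \<Rightarrow> 'b) \<Rightarrow> bool" where
  "bundle_map B T \<longleftrightarrow> (\<forall>g. bounded_op (fib B g) (fnorm B g) (T g))"

definition positive_definite ::
    "('g::group_add, 'b::complex_vector) fell_data \<Rightarrow> ('g \<Rightarrow> 'b \<Rightarrow> 'b) \<Rightarrow> bool" where
  "positive_definite B T \<longleftrightarrow>
     (\<forall>(n::nat) g a b. (\<forall>i<n. a i \<in> fib B (g i) \<and> b i \<in> fib B (g i)) \<longrightarrow>
        cpos (unit_fibre B) (\<Sum>i<n. \<Sum>j<n.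
          fmul B (g j) (- g j)
            (fmul B (g i) (- g i + g j) (b i)
               (T (- g i + g j) (fmul B (- g i) (g j) (fstar B (g i) (a i)) (a j))))
            (fstar B (g j) (b j))))"

definition haagerup_PD_net :: "('g::group_add, 'b::complex_vector) fell_data \<Rightarrow>
    'i set \<Rightarrow> ('i \<Rightarrow> 'i \<Rightarrow> bool) \<Rightarrow> ('i \<Rightarrow> 'g \<Rightarrow> 'b \<Rightarrow> 'b) \<Rightarrow> bool" where
  "haagerup_PD_net B I le T \<longleftrightarrow> directed_set I le \<and>
     (\<forall>i\<in>I. bundle_map B (T i) \<and> positive_definite B (T i) \<and>
        ((\<lambda>g. op_norm (fib B g) (fnorm B g) (T i g)) \<longlongrightarrow> 0) cofinite) \<and>
     bdd_above ((\<lambda>i. op_norm (fib B 0) (fnorm B 0) (T i 0)) ` I) \<and>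
     (\<forall>g. \<forall>b\<in>fib B g. ((\<lambda>i. fnorm B g (T i g b - b)) \<longlongrightarrow> 0) (net_filter I le))"

section \<open>The reduced cross-sectional algebra\<close>

definition sections_module :: "('g::group_add, 'b::complex_vector) fell_data \<Rightarrow>
    ('g \<Rightarrow> 'b, 'b) hmodule" where
  "sections_module B = \<lparr>hcar = {\<xi>. (\<forall>g. \<xi> g \<in> fib B g) \<and> finite {g. \<xi> g \<noteq> 0}},
     hact = (\<lambda>\<xi> b g. fmul B g 0 (\<xi> g) b),
     hip = (\<lambda>\<xi> \<eta>. \<Sum>g | \<xi> g \<noteq> 0. fmul B (- g) g (fstar B g (\<xi> g)) (\<eta> g))\<rparr>"

text \<open>In the following, \<open>(L, \<iota>)\<close> is a completion of \<^term>\<open>sections_module B\<close>, that is, \<open>L\<close> is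
  \<open>\<ell>\<^sup>2(B)\<close>. The operator \<open>\<lambda>\<^sub>g(b)\<close> is given by its values on the finitely supported sections.\<close>

definition regular_rep :: "('g::group_add, 'b::complex_vector) fell_data \<Rightarrow>
    ('l::complex_vector, 'b) hmodule \<Rightarrow> (('g \<Rightarrow> 'b) \<Rightarrow> 'l) \<Rightarrow> 'g \<Rightarrow> 'b \<Rightarrow> 'l \<Rightarrow> 'l" where
  "regular_rep B L \<iota> g b = (THE S. S \<in> adjointable_ops (unit_fibre B) L \<and>
     (\<forall>\<xi>\<in>hcar (sections_module B). S (\<iota> \<xi>) = \<iota> (\<lambda>h. fmul B g (- g + h) b (\<xi> (- g + h)))))"

definition reduced_algebra :: "('g::group_add, 'b::complex_vector) fell_data \<Rightarrow>
    ('l::complex_vector, 'b) hmodule \<Rightarrow> (('g \<Rightarrow> 'b) \<Rightarrow> 'l) \<Rightarrow> ('l \<Rightarrow> 'l) cstar_data" where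
  "reduced_algebra B L \<iota> = cstar_generated (adjointable_algebra (unit_fibre B) L)
     {regular_rep B L \<iota> g b | g b. b \<in> fib B g}"

text \<open>\<open>emb\<close> identifies \<open>A\<close> with a subalgebra of \<open>D\<close>.\<close>

definition faithful_conditional_expectation :: "'b::complex_vector cstar_data \<Rightarrow>
    'a::complex_vector cstar_data \<Rightarrow> ('b \<Rightarrow> 'a) \<Rightarrow> ('a \<Rightarrow> 'b) \<Rightarrow> bool" where
  "faithful_conditional_expectation A D emb E \<longleftrightarrow>
     (\<forall>x\<in>ccar D. E x \<in> ccar A) \<and> clinear_on (ccar D) E \<and>
     (\<forall>x\<in>ccar D. cnorm A (E x) \<le> cnorm D x) \<and>
     (\<forall>x\<in>ccar D. cpos D x \<longrightarrow> cpos A (E x)) \<and>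
     (\<forall>a\<in>ccar A. E (emb a) = a) \<and>
     (\<forall>a\<in>ccar A. \<forall>x\<in>ccar D. \<forall>b\<in>ccar A.
        E (cmul D (cmul D (emb a) x) (emb b)) = cmul A (cmul A a (E x)) b) \<and>
     (\<forall>x\<in>ccar D. E (cmul D (cstar D x) x) = 0 \<longrightarrow> x = 0)"

text \<open>The stated properties determine \<open>E\<^sub>e\<close> on \<open>C\<^sub>r\<^sup>*(B)\<close>; its values elsewhere are irrelevant.\<close>

definition cond_exp :: "('g::group_add, 'b::complex_vector) fell_data \<Rightarrow>
    ('l::complex_vector, 'b) hmodule \<Rightarrow> (('g \<Rightarrow> 'b) \<Rightarrow> 'l) \<Rightarrow> ('l \<Rightarrow> 'l) \<Rightarrow> 'b" where
  "cond_exp B L \<iota> = (SOME E.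
     faithful_conditional_expectation (unit_fibre B) (reduced_algebra B L \<iota>)
       (regular_rep B L \<iota> 0) E \<and>
     (\<forall>g. \<forall>b\<in>fib B g. E (regular_rep B L \<iota> g b) = (if g = 0 then b else 0)))"

section \<open>The Hilbert module Haagerup property\<close>

definition expectation_module :: "('g::group_add, 'b::complex_vector) fell_data \<Rightarrow>
    ('l::complex_vector, 'b) hmodule \<Rightarrow> (('g \<Rightarrow> 'b) \<Rightarrow> 'l) \<Rightarrow> ('l \<Rightarrow> 'l, 'b) hmodule" where
  "expectation_module B L \<iota> = (let D = reduced_algebra B L \<iota> in
     \<lparr>hcar = ccar D, hact = (\<lambda>x b. cmul D x (regular_rep B L \<iota> 0 b)),
      hip = (\<lambda>x y. cond_exp B L \<iota> (cmul D (cstar D x) y))\<rparr>)"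

text \<open>The bounded map on the completion \<open>(H, j)\<close> of \<open>X\<close> that extends \<open>\<Phi>\<close>.\<close>

definition induced_map :: "'b cstar_data \<Rightarrow> ('x, 'b) hmodule \<Rightarrow>
    ('y::complex_vector, 'b) hmodule \<Rightarrow> ('x \<Rightarrow> 'y) \<Rightarrow> ('x \<Rightarrow> 'x) \<Rightarrow> 'y \<Rightarrow> 'y" where
  "induced_map A X H j \<Phi> = (THE \<Psi>. bounded_op (hcar H) (hnorm A H) \<Psi> \<and>
     (\<forall>h. h \<notin> hcar H \<longrightarrow> \<Psi> h = 0) \<and> (\<forall>x\<in>hcar X. \<Psi> (j x) = j (\<Phi> x)))"

definition bimodule_map :: "'b cstar_data \<Rightarrow> 'a cstar_data \<Rightarrow> ('b \<Rightarrow> 'a) \<Rightarrow> ('a \<Rightarrow> 'a) \<Rightarrow> bool" where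
  "bimodule_map A D emb \<Phi> \<longleftrightarrow> (\<forall>a\<in>ccar A. \<forall>x\<in>ccar D. \<forall>b\<in>ccar A.
     \<Phi> (cmul D (cmul D (emb a) x) (emb b)) = cmul D (cmul D (emb a) (\<Phi> x)) (emb b))"

text \<open>Here \<open>(H, j)\<close> is a completion of \<^term>\<open>expectation_module B L \<iota>\<close>. A formula cannot quantify
  over the type of the indices of a net. The index type chosen here loses nothing: given any net
  as required, choose for each finite subset \<open>F\<close> of the algebra and each \<open>n\<close> a member that moves
  every element of \<open>F\<close> by less than \<open>1 / (n + 1)\<close>; this is again a net as required, indexed by
  the pairs \<open>(F, n)\<close>.\<close>

definition hilbert_module_haagerup :: "('g::group_add, 'b::complex_vector) fell_data \<Rightarrow>
    ('l::complex_vector, 'b) hmodule \<Rightarrow> (('g \<Rightarrow> 'b) \<Rightarrow> 'l) \<Rightarrow>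
    ('h::complex_vector, 'b) hmodule \<Rightarrow> (('l \<Rightarrow> 'l) \<Rightarrow> 'h) \<Rightarrow> bool" where
  "hilbert_module_haagerup B L \<iota> H j \<longleftrightarrow>
     (let A = unit_fibre B; D = reduced_algebra B L \<iota>; E = cond_exp B L \<iota>;
          ind = induced_map A (expectation_module B L \<iota>) H j in
      \<exists>(I :: (('l \<Rightarrow> 'l) set \<times> nat) set) le \<Phi>. directed_set I le \<and>
        (\<forall>i\<in>I. completely_positive D (\<Phi> i) \<and> bimodule_map A D (regular_rep B L \<iota> 0) (\<Phi> i) \<and>
           (\<forall>x\<in>ccar D. cpos D x \<longrightarrow> cle A (E (\<Phi> i x)) (E x)) \<and>
           compact_map A H (ind (\<Phi> i))) \<and>
        bdd_above ((\<lambda>i. op_norm (hcar H) (hnorm A H) (ind (\<Phi> i))) ` I) \<and>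
        (\<forall>x\<in>ccar D. ((\<lambda>i. hnorm A H (ind (\<Phi> i) (j x) - j x)) \<longlongrightarrow> 0) (net_filter I le)))"

end

theory Submission
  imports Defs
begin

text \<open>Write \<open>A = B\<^sub>e\<close>. Let \<open>\<Lambda>(f)\<close> be the operator \<open>\<Sum>\<^sub>g \<lambda>\<^sub>g(f(g))\<close> for a finitely supported section \<open>f\<close>. After
  rescaling, so that \<open>\<parallel>T\<^sub>e(1)\<parallel> \<le> 1\<close>, a positive definite bundle map \<open>T\<close> defines a map
  \<open>\<Lambda>(f) \<mapsto> \<Lambda>(T f)\<close>. An orthonormal basis provides an isometry in every nonzero fibre, and conjugation
  with isometries turns positive definiteness of \<open>T\<close> into positivity of
  \<open>\<Sum>\<^sub>i\<^sub>j \<langle>\<xi>\<^sub>i, \<Lambda>(T(f\<^sub>i\<^sup>* f\<^sub>j)) \<xi>\<^sub>j\<rangle>\<close> for finitely supported \<open>\<xi>\<^sub>i\<close>. Since \<open>t - \<Lambda>(f)\<close> is a square in the reduced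
  algebra for \<open>t \<ge> \<parallel>\<Lambda>(f)\<parallel>\<close>, this positivity also bounds \<open>\<Lambda>(T f)\<close>, so the map extends to the reduced
  algebra. The extension is completely positive: a matrix over the algebra that is positive as a
  quadratic form on \<open>L\<^sup>n\<close> has a square root with entries in the algebra. The completion of the algebra
  with respect to \<open>E\<^sub>e\<close> is again a copy of \<open>\<ell>\<^sup>2(B)\<close>, on which the extension acts as the direct sum of the
  \<open>T\<^sub>g\<close>. This sum is compact because each \<open>T\<^sub>g\<close> is and \<open>\<parallel>T\<^sub>g\<parallel> \<rightarrow> 0\<close>.

  Positivity in abstract \<open>C\<^sup>*\<close>-algebras needs no spectral theory here: \<open>a\<close> is positive if and only
  if it is self-adjoint and \<open>\<parallel>t - a\<parallel> \<le> t\<close> for some \<open>t \<ge> 0\<close>.\<close>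

section \<open>Normed subspaces of a complex vector space\<close>

text \<open>The inner product of \<open>\<ell>\<^sup>2(B)\<close> takes values in \<open>A\<close>,
  so a common bound of the norms \<open>\<parallel>T\<^sub>g\<parallel>\<close> does not by itself
  bound the direct sum of the \<open>T\<^sub>g\<close>. What can be summed over the fibres is the
  inequality \<open>T\<^sub>g(b)\<^sup>* T\<^sub>g(b) \<le> r\<^sup>2 b\<^sup>* b\<close> in
  \<open>A\<close>, and it is obtained from an adjoint of \<open>T\<^sub>g\<close>. Compactness
  supplies the adjoint, because finite rank maps have one and the adjointable operators are
  complete. The adjoint also makes \<open>T\<^sub>g\<close> right \<open>A\<close>-linear. Positive
  definiteness makes \<open>T\<close> compatible with the involution, hence left
  \<open>A\<close>-linear, and then \<open>E\<^sub>e(\<Phi>(x)) = T\<^sub>e(1) E\<^sub>e(x)\<close>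
  with \<open>T\<^sub>e(1)\<close> central. This is why the norm of \<open>T\<^sub>e(1)\<close>
  alone decides about the rescaling. The obstacle in the positivity step is that positive
  definiteness pairs elements of the same fibre, while the coefficients of
  \<open>\<Lambda>(T(f\<^sup>* f))\<close> between two sections involve unrelated degrees. The
  uniform bound 2 of the maps comes from splitting an operator into two self-adjoint parts.\<close>

interpretation cv: vector_space "scaleC :: complex \<Rightarrow> 'a \<Rightarrow> 'a::complex_vector"
  by standard (simp_all add: scaleC_add_right scaleC_add_left scaleC_scaleC scaleC_one)

lemma scaleC_simps [simp]:
  fixes x :: "'a::complex_vector"
  shows "1 *\<^sub>C x = x" "c *\<^sub>C d *\<^sub>C x = (c * d) *\<^sub>C x" "(0::complex) *\<^sub>C x = 0" "c *\<^sub>C (0::'a) = 0"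
    "c *\<^sub>C (- x) = - (c *\<^sub>C x)" "(- c) *\<^sub>C x = - (c *\<^sub>C x)" "(c *\<^sub>C x = 0) = (c = 0 \<or> x = 0)"
  by simp_all

lemma scaleC_two: "2 *\<^sub>C x = x + (x::'a::complex_vector)"
proof -
  have "(1 + 1) *\<^sub>C x = x + x" by (simp only: cv.scale_left_distrib scaleC_simps)
  thus ?thesis by simp
qed

lemma clinear_onI:
  "\<lbrakk>\<And>x y. \<lbrakk>x \<in> S; y \<in> S\<rbrakk> \<Longrightarrow> f (x + y) = f x + f y;
    \<And>c x. x \<in> S \<Longrightarrow> f (c *\<^sub>C x) = c *\<^sub>C f x\<rbrakk> \<Longrightarrow> clinear_on S f"
  by (simp add: clinear_on_def)

locale clinear_map =
  fixes S :: "'a::complex_vector set" and f :: "'a \<Rightarrow> 'b::complex_vector"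
  assumes dom: "csubspace S" and lin: "clinear_on S f"
begin

lemma add: "\<lbrakk>x \<in> S; y \<in> S\<rbrakk> \<Longrightarrow> f (x + y) = f x + f y"
  using lin by (simp add: clinear_on_def)

lemma scale: "x \<in> S \<Longrightarrow> f (c *\<^sub>C x) = c *\<^sub>C f x"
  using lin by (simp add: clinear_on_def)

lemma zero [simp]: "f 0 = 0"
  using scale[of 0 0] cv.subspace_0[OF dom] by simp

lemma minus: "x \<in> S \<Longrightarrow> f (- x) = - f x"
  using scale[of x "-1"] by simp

lemma diff: "\<lbrakk>x \<in> S; y \<in> S\<rbrakk> \<Longrightarrow> f (x - y) = f x - f y"
  using add[of x "- y"] minus[of y] cv.subspace_neg[OF dom] by simp

lemma sum: "(\<And>i. i \<in> I \<Longrightarrow> g i \<in> S) \<Longrightarrow> f (\<Sum>i\<in>I. g i) = (\<Sum>i\<in>I. f (g i))"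
  by (induction I rule: infinite_finite_induct) (auto simp: add cv.subspace_sum[OF dom])

end

locale normed_carrier =
  fixes S :: "'a::complex_vector set" and n :: "'a \<Rightarrow> real"
  assumes sub: "csubspace S"
    and nonneg: "x \<in> S \<Longrightarrow> 0 \<le> n x"
    and eq_0: "x \<in> S \<Longrightarrow> n x = 0 \<longleftrightarrow> x = 0"
    and tri: "\<lbrakk>x \<in> S; y \<in> S\<rbrakk> \<Longrightarrow> n (x + y) \<le> n x + n y"
    and norm_scale: "x \<in> S \<Longrightarrow> n (c *\<^sub>C x) = cmod c * n x"
begin

lemma zero_in [simp, intro]: "0 \<in> S" by (rule cv.subspace_0[OF sub])
lemma add_in [simp, intro]: "\<lbrakk>x \<in> S; y \<in> S\<rbrakk> \<Longrightarrow> x + y \<in> S" by (rule cv.subspace_add[OF sub])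
lemma diff_in [simp, intro]: "\<lbrakk>x \<in> S; y \<in> S\<rbrakk> \<Longrightarrow> x - y \<in> S" by (rule cv.subspace_diff[OF sub])
lemma neg_in [simp, intro]: "x \<in> S \<Longrightarrow> - x \<in> S" by (rule cv.subspace_neg[OF sub])
lemma scale_in [simp, intro]: "x \<in> S \<Longrightarrow> c *\<^sub>C x \<in> S" by (rule cv.subspace_scale[OF sub])
lemma sum_in [simp, intro]: "(\<And>i. i \<in> I \<Longrightarrow> f i \<in> S) \<Longrightarrow> (\<Sum>i\<in>I. f i) \<in> S"
  by (rule cv.subspace_sum[OF sub])

lemma norm_0 [simp]: "n 0 = 0" using eq_0[of 0] by simp

lemma norm_minus: "x \<in> S \<Longrightarrow> n (- x) = n x"
  using norm_scale[of x "-1"] by simp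

lemma norm_diff_commute: "\<lbrakk>x \<in> S; y \<in> S\<rbrakk> \<Longrightarrow> n (x - y) = n (y - x)"
  using norm_minus[of "x - y"] by simp

lemma norm_diff_le: "\<lbrakk>x \<in> S; y \<in> S\<rbrakk> \<Longrightarrow> n (x - y) \<le> n x + n y"
  using tri[of x "- y"] norm_minus[of y] by simp

lemma tri_diff: "\<lbrakk>x \<in> S; y \<in> S; z \<in> S\<rbrakk> \<Longrightarrow> n (x - z) \<le> n (x - y) + n (y - z)"
  using tri[of "x - y" "y - z"] by simp

lemma norm_sum_le: "(\<And>i. i \<in> I \<Longrightarrow> f i \<in> S) \<Longrightarrow> n (\<Sum>i\<in>I. f i) \<le> (\<Sum>i\<in>I. n (f i))"
  by (induction I rule: infinite_finite_induct) (auto intro!: order_trans[OF tri])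

lemma norm_rev_tri: "\<lbrakk>x \<in> S; y \<in> S\<rbrakk> \<Longrightarrow> \<bar>n x - n y\<bar> \<le> n (x - y)"
  using tri[of "x - y" y] tri[of "y - x" x] norm_diff_commute[of x y] by simp

section \<open>Norm convergence of sequences inside a carrier\<close>

definition conv :: "(nat \<Rightarrow> 'a) \<Rightarrow> 'a \<Rightarrow> bool" where
  "conv s x \<longleftrightarrow> (\<forall>k. s k \<in> S) \<and> x \<in> S \<and> (\<lambda>k. n (s k - x)) \<longlonglongrightarrow> 0"

lemma convD: "conv s x \<Longrightarrow> s k \<in> S" "conv s x \<Longrightarrow> x \<in> S"
  "conv s x \<Longrightarrow> (\<lambda>k. n (s k - x)) \<longlonglongrightarrow> 0"
  by (simp_all add: conv_def)

lemma convI_le: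
  assumes "\<And>k. s k \<in> S" "x \<in> S" "\<And>k. n (s k - x) \<le> r k" "r \<longlonglongrightarrow> 0"
  shows "conv s x"
proof -
  have "(\<lambda>k. n (s k - x)) \<longlonglongrightarrow> 0"
    by (rule tendsto_sandwich[OF _ _ tendsto_const assms(4)]) (use assms in \<open>auto intro!: always_eventually nonneg\<close>)
  thus ?thesis using assms by (simp add: conv_def)
qed

lemma conv_const: "x \<in> S \<Longrightarrow> conv (\<lambda>_. x) x"
  by (simp add: conv_def)

lemma conv_add: assumes "conv s x" "conv t y" shows "conv (\<lambda>k. s k + t k) (x + y)"
proof (rule convI_le[where r = "\<lambda>k. n (s k - x) + n (t k - y)"])
  show "(\<lambda>k. n (s k - x) + n (t k - y)) \<longlonglongrightarrow> 0"
    using tendsto_add[OF convD(3)[OF assms(1)] convD(3)[OF assms(2)]] by simp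
  show "n (s k + t k - (x + y)) \<le> n (s k - x) + n (t k - y)" for k
    using tri[of "s k - x" "t k - y"] convD[OF assms(1)] convD[OF assms(2)]
    by (simp add: algebra_simps)
qed (use assms in \<open>auto simp: convD\<close>)

lemma conv_scale: assumes "conv s x" shows "conv (\<lambda>k. c *\<^sub>C s k) (c *\<^sub>C x)"
proof (rule convI_le[where r = "\<lambda>k. cmod c * n (s k - x)"])
  show "(\<lambda>k. cmod c * n (s k - x)) \<longlonglongrightarrow> 0"
    using tendsto_mult[OF tendsto_const convD(3)[OF assms], of "cmod c"] by simp
  show "n (c *\<^sub>C s k - c *\<^sub>C x) \<le> cmod c * n (s k - x)" for k
    using norm_scale[of "s k - x" c] convD[OF assms] by (simp add: cv.scale_right_diff_distrib)
qed (use assms in \<open>auto simp: convD\<close>)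

lemma conv_minus: "conv s x \<Longrightarrow> conv (\<lambda>k. - s k) (- x)"
  using conv_scale[of s x "-1"] by simp

lemma conv_diff: "\<lbrakk>conv s x; conv t y\<rbrakk> \<Longrightarrow> conv (\<lambda>k. s k - t k) (x - y)"
  using conv_add[OF _ conv_minus, of s x t y] by simp

lemma conv_sum: "(\<And>i. i \<in> I \<Longrightarrow> conv (s i) (x i)) \<Longrightarrow> conv (\<lambda>k. \<Sum>i\<in>I. s i k) (\<Sum>i\<in>I. x i)"
  by (induction I rule: infinite_finite_induct) (auto intro!: conv_add simp: conv_const)

lemma conv_norm: assumes "conv s x" shows "(\<lambda>k. n (s k)) \<longlonglongrightarrow> n x"
proof (rule LIM_zero_cancel, rule Lim_null_comparison[OF always_eventually convD(3)[OF assms]], rule allI)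
  show "norm (n (s k) - n x) \<le> n (s k - x)" for k
    using norm_rev_tri[OF convD(1,2)[OF assms]] by simp
qed

lemma conv_unique: assumes "conv s x" "conv s y" shows "x = y"
proof -
  note S = convD(2)[OF assms(1)] convD(2)[OF assms(2)]
  have "conv (\<lambda>k. s k - s k) (x - y)" by (rule conv_diff[OF assms])
  from conv_norm[OF this] have "(\<lambda>k. 0::real) \<longlonglongrightarrow> n (x - y)" by simp
  hence "n (x - y) = 0" by (simp add: LIMSEQ_const_iff)
  moreover have "x - y \<in> S" by (intro diff_in S)
  ultimately have "x - y = 0" by (simp only: eq_0)
  thus ?thesis by simp
qed

lemma conv_norm_le: assumes "conv s x" "\<And>k. n (s k) \<le> C" shows "n x \<le> C"
  using LIMSEQ_le_const2[OF conv_norm[OF assms(1)], of C] assms(2) by simp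

lemma norm_le_epsilon: "\<lbrakk>x \<in> S; \<And>\<epsilon>. \<epsilon> > 0 \<Longrightarrow> n x \<le> \<epsilon>\<rbrakk> \<Longrightarrow> x = 0"
  using eq_0[of x] nonneg[of x] by (meson dense_ge order_antisym)

text \<open>Density is phrased along a map \<open>P\<close>, because the dense subspaces in use are
  images of the finitely supported sections under \<open>\<iota>\<close> and
  \<open>Lam\<close>.\<close>

lemma dense_conv:
  assumes "\<And>\<epsilon>. \<epsilon> > 0 \<Longrightarrow> \<exists>s\<in>U. n (P s - x) < \<epsilon>" "x \<in> S" "\<And>s. s \<in> U \<Longrightarrow> P s \<in> S"
  obtains s where "\<And>k. s k \<in> U" "conv (\<lambda>k. P (s k)) x"
proof -
  have "\<forall>k. \<exists>s\<in>U. n (P s - x) < 1 / real (Suc k)" by (intro allI assms) simp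
  then obtain s where s: "\<And>k. s k \<in> U" "\<And>k. n (P (s k) - x) < 1 / real (Suc k)" by metis
  have "conv (\<lambda>k. P (s k)) x"
  proof (rule convI_le)
    show "(\<lambda>k. 1 / real (Suc k)) \<longlonglongrightarrow> 0" by (rule LIMSEQ_Suc[OF lim_1_over_n])
  qed (use s assms in \<open>auto intro: less_imp_le\<close>)
  with s that show ?thesis by blast
qed

end

lemma complete_onD:
  assumes "complete_on S n" "\<And>k. s k \<in> S" "\<forall>\<epsilon>>0. \<exists>N. \<forall>k\<ge>N. \<forall>l\<ge>N. n (s k - s l) < \<epsilon>"
  shows "\<exists>x\<in>S. (\<lambda>k. n (s k - x)) \<longlonglongrightarrow> 0"
  using assms(1)[unfolded complete_on_def, rule_format, of s] assms(2,3) by blast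

lemma banach_on_normed: "banach_on S n \<Longrightarrow> normed_carrier S n"
  by (auto simp: banach_on_def normed_carrier_def)

lemma bounded_conv:
  assumes X: "normed_carrier X n" and Y: "normed_carrier Y m"
    and f: "\<And>x. x \<in> X \<Longrightarrow> f x \<in> Y" and diff: "\<And>x y. \<lbrakk>x \<in> X; y \<in> X\<rbrakk> \<Longrightarrow> f (x - y) = f x - f y"
    and bd: "\<And>x. x \<in> X \<Longrightarrow> m (f x) \<le> C * n x"
    and s: "normed_carrier.conv X n s x"
  shows "normed_carrier.conv Y m (\<lambda>k. f (s k)) (f x)"
proof -
  interpret X: normed_carrier X n by fact
  interpret Y: normed_carrier Y m by fact
  show ?thesis
  proof (rule Y.convI_le[where r = "\<lambda>k. C * n (s k - x)"])
    show "(\<lambda>k. C * n (s k - x)) \<longlonglongrightarrow> 0"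
      using tendsto_mult[OF tendsto_const X.convD(3)[OF s], of C] by simp
    show "m (f (s k) - f x) \<le> C * n (s k - x)" for k
      using bd[of "s k - x"] diff[of "s k" x] X.convD[OF s] by simp
  qed (use f X.convD[OF s] in auto)
qed

text \<open>The value of the extension at \<open>x\<close> is the unique \<open>y\<close> whose distance from \<open>Q s\<close> is at
  most \<open>C\<close> times the distance of \<open>x\<close> from \<open>P s\<close>, for all \<open>s\<close>.\<close>

lemma bounded_extension:
  assumes X: "normed_carrier X n" and Y: "normed_carrier Y m" and comp: "complete_on Y m"
    and S: "csubspace S"
    and P: "\<And>s. s \<in> S \<Longrightarrow> P s \<in> X" "clinear_on S P" and Q: "\<And>s. s \<in> S \<Longrightarrow> Q s \<in> Y" "clinear_on S Q"
    and dense: "\<And>x \<epsilon>. \<lbrakk>x \<in> X; \<epsilon> > 0\<rbrakk> \<Longrightarrow> \<exists>s\<in>S. n (P s - x) < \<epsilon>"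
    and bound: "\<And>s. s \<in> S \<Longrightarrow> m (Q s) \<le> C * n (P s)" and C: "C \<ge> 0"
  obtains \<Psi> where "\<And>x. x \<in> X \<Longrightarrow> \<Psi> x \<in> Y" "clinear_on X \<Psi>" "\<And>x. x \<in> X \<Longrightarrow> m (\<Psi> x) \<le> C * n x"
    "\<And>s. s \<in> S \<Longrightarrow> \<Psi> (P s) = Q s" "\<And>x. x \<notin> X \<Longrightarrow> \<Psi> x = 0"
proof -
  interpret X: normed_carrier X n by fact
  interpret Y: normed_carrier Y m by fact
  interpret P: clinear_map S P by (rule clinear_map.intro[OF S P(2)])
  interpret Q: clinear_map S Q by (rule clinear_map.intro[OF S Q(2)])
  note [simp] = P(1) Q(1) cv.subspace_0[OF S] cv.subspace_add[OF S] cv.subspace_diff[OF S]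
    cv.subspace_scale[OF S]
  define R where "R x y \<longleftrightarrow> y \<in> Y \<and> (\<forall>s\<in>S. m (Q s - y) \<le> C * n (P s - x))" for x y
  have bdiff: "m (Q s - Q t) \<le> C * n (P s - P t)" if "s \<in> S" "t \<in> S" for s t
    using bound[of "s - t"] that by (simp add: P.diff Q.diff)
  have ex: "\<exists>y. R x y" if x: "x \<in> X" for x
  proof -
    obtain s where s: "\<And>k. s k \<in> S" "X.conv (\<lambda>k. P (s k)) x"
      using X.dense_conv[where U = S and P = P, OF dense x] x by auto
    note lim = X.convD(3)[OF s(2)]
    have "\<forall>\<epsilon>>0. \<exists>N. \<forall>k\<ge>N. \<forall>l\<ge>N. m (Q (s k) - Q (s l)) < \<epsilon>"
    proof (intro allI impI)
      fix \<epsilon> :: real assume e: "\<epsilon> > 0"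
      \<comment> \<open>\<open>C + 1\<close> in the denominator covers \<open>C = 0\<close>; the
        tolerance is halved because two approximants are compared.\<close>
      define d where "d = \<epsilon> / (C + 1) / 2"
      have "d + d = \<epsilon> / (C + 1)" unfolding d_def by (rule field_sum_of_halves)
      hence "C * (d + d) = \<epsilon> * (C / (C + 1))" by simp
      moreover have "\<epsilon> * (C / (C + 1)) < \<epsilon> * 1" using e C by (intro mult_strict_left_mono) auto
      ultimately have d: "d > 0" "C * (d + d) < \<epsilon>" using e C by (auto simp: d_def)
      obtain N where N: "\<forall>k\<ge>N. norm (n (P (s k) - x) - 0) < d" using LIMSEQ_D[OF lim d(1)] by blast
      have "m (Q (s k) - Q (s l)) < \<epsilon>" if "k \<ge> N" "l \<ge> N" for k l
      proof -
        have "n (P (s k) - P (s l)) \<le> n (P (s k) - x) + n (x - P (s l))"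
          using X.tri_diff[of "P (s k)" x "P (s l)"] x s by simp
        also have "\<dots> \<le> d + d" using N that x s X.norm_diff_commute[of x "P (s l)"]
          by (intro add_mono) (auto simp: abs_less_iff less_imp_le)
        finally have "C * n (P (s k) - P (s l)) \<le> C * (d + d)" using C by (rule mult_left_mono)
        thus ?thesis using bdiff[of "s k" "s l"] s d by auto
      qed
      thus "\<exists>N. \<forall>k\<ge>N. \<forall>l\<ge>N. m (Q (s k) - Q (s l)) < \<epsilon>" by blast
    qed
    then obtain y where y: "y \<in> Y" "(\<lambda>k. m (Q (s k) - y)) \<longlonglongrightarrow> 0"
      using complete_onD[OF comp, of "\<lambda>k. Q (s k)"] s by auto
    have "m (Q t - y) \<le> C * n (P t - x)" if t: "t \<in> S" for t
    proof (rule LIMSEQ_le_const)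
      show "(\<lambda>k. C * (n (P t - x) + n (P (s k) - x)) + m (Q (s k) - y)) \<longlonglongrightarrow> C * n (P t - x)"
        by (rule tendsto_eq_intros lim y refl)+ simp
      have "m (Q t - y) \<le> C * (n (P t - x) + n (P (s k) - x)) + m (Q (s k) - y)" for k
      proof -
        have "m (Q t - y) \<le> m (Q t - Q (s k)) + m (Q (s k) - y)"
          using Y.tri_diff[of "Q t" "Q (s k)" y] t s y by simp
        moreover have "m (Q t - Q (s k)) \<le> C * n (P t - P (s k))" using bdiff t s by simp
        moreover have "n (P t - P (s k)) \<le> n (P t - x) + n (P (s k) - x)"
          using X.tri_diff[of "P t" x "P (s k)"] X.norm_diff_commute[of x "P (s k)"] t s x by simp
        then have "C * n (P t - P (s k)) \<le> C * (n (P t - x) + n (P (s k) - x))"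
          using C by (rule mult_left_mono)
        ultimately show ?thesis by linarith
      qed
      thus "\<exists>N. \<forall>k\<ge>N. m (Q t - y) \<le> C * (n (P t - x) + n (P (s k) - x)) + m (Q (s k) - y)" by blast
    qed
    with y show ?thesis by (auto simp: R_def)
  qed
  have near: "\<exists>s\<in>S. C * n (P s - x) \<le> \<epsilon>" if x: "x \<in> X" and e: "\<epsilon> > 0" for x \<epsilon>
  proof -
    obtain s where "s \<in> S" "n (P s - x) < \<epsilon> / (C + 1)"
      using dense[OF x, of "\<epsilon> / (C + 1)"] e C by auto
    moreover have "C * n (P s - x) \<le> C * (\<epsilon> / (C + 1))" using calculation C
      by (intro mult_left_mono) auto
    moreover have "C * (\<epsilon> / (C + 1)) \<le> \<epsilon>" using C e by (simp add: field_simps)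
    ultimately show ?thesis by (meson order_trans)
  qed
  have uniq: "y = z" if "R x y" "R x z" "x \<in> X" for x y z
  proof -
    note X = that(3)
    have "y - z = 0"
    proof (rule Y.norm_le_epsilon)
      fix \<epsilon> :: real assume "\<epsilon> > 0"
      then obtain s where s: "s \<in> S" "C * n (P s - x) \<le> \<epsilon>/2" using near[OF X, of "\<epsilon>/2"] by auto
      have "m (y - z) \<le> m (y - Q s) + m (Q s - z)" using Y.tri_diff[of y "Q s" z] that s
        by (simp add: R_def)
      also have "m (y - Q s) = m (Q s - y)" using that s by (intro Y.norm_diff_commute) (auto simp: R_def)
      also have "\<dots> + m (Q s - z) \<le> \<epsilon>/2 + \<epsilon>/2"
        using that s by (intro add_mono order_trans[OF _ s(2)]) (auto simp: R_def)
      finally show "m (y - z) \<le> \<epsilon>" by simp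
    qed (use that in \<open>auto simp: R_def\<close>)
    thus ?thesis by simp
  qed
  have R_add: "R (x + x') (y + y')" if "R x y" "R x' y'" and X: "x \<in> X" "x' \<in> X" for x x' y y'
    unfolding R_def
  proof (intro conjI ballI)
    show "y + y' \<in> Y" using that by (simp add: R_def)
    fix s assume s: "s \<in> S"
    show "m (Q s - (y + y')) \<le> C * n (P s - (x + x'))"
    proof (rule field_le_epsilon)
      fix \<epsilon> :: real assume "\<epsilon> > 0"
      then obtain t where t: "t \<in> S" "C * n (P t - x) \<le> \<epsilon>/2" using near[OF X(1), of "\<epsilon>/2"] by auto
      \<comment> \<open>Only \<open>x\<close> is approximated, by \<open>P t\<close>. Then
        \<open>P (s - t)\<close> misses \<open>x'\<close> by the distance of \<open>P s\<close> from
        \<open>x + x'\<close> up to a small error, and the relation for \<open>x'\<close> is applied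
        at \<open>s - t\<close>.\<close>
      have "Q s - (y + y') = (Q t - y) + (Q (s - t) - y')" using s t by (simp add: Q.diff)
      then have "m (Q s - (y + y')) = m ((Q t - y) + (Q (s - t) - y'))" by (rule arg_cong)
      also have "\<dots> \<le> m (Q t - y) + m (Q (s - t) - y')"
        using Y.tri[of "Q t - y" "Q (s - t) - y'"] s t that X by (simp add: R_def)
      also have "\<dots> \<le> C * n (P t - x) + C * n (P (s - t) - x')"
        using that X s t by (intro add_mono) (auto simp: R_def)
      also have "P (s - t) - x' = (P s - (x + x')) - (P t - x)" using s t by (simp add: P.diff)
      also have "C * n (P t - x) + C * n ((P s - (x + x')) - (P t - x)) \<le>
          C * n (P t - x) + C * (n (P s - (x + x')) + n (P t - x))"
        using C X s t by (intro add_left_mono mult_left_mono X.norm_diff_le) auto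
      also have "\<dots> \<le> C * n (P s - (x + x')) + \<epsilon>" using t by (simp add: algebra_simps)
      finally show "m (Q s - (y + y')) \<le> C * n (P s - (x + x')) + \<epsilon>" .
    qed
  qed
  have R_scale: "R (c *\<^sub>C x) (c *\<^sub>C y)" if "R x y" "x \<in> X" for c x y
  proof (cases "c = 0")
    case True thus ?thesis using bound by (auto simp: R_def)
  next
    case False
    show ?thesis unfolding R_def
    proof (intro conjI ballI)
      show "c *\<^sub>C y \<in> Y" using that by (simp add: R_def)
      fix s assume s: "s \<in> S"
      let ?t = "(1/c) *\<^sub>C s"
      have "Q s - c *\<^sub>C y = c *\<^sub>C (Q ?t - y)" "P s - c *\<^sub>C x = c *\<^sub>C (P ?t - x)"
        using s False by (simp_all add: Q.scale P.scale cv.scale_right_diff_distrib)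
      moreover have "m (Q ?t - y) \<le> C * n (P ?t - x)" using that s unfolding R_def by auto
      ultimately show "m (Q s - c *\<^sub>C y) \<le> C * n (P s - c *\<^sub>C x)"
        using that s Y.norm_scale[of "Q ?t - y" c] X.norm_scale[of "P ?t - x" c]
          mult_left_mono[of "m (Q ?t - y)" "C * n (P ?t - x)" "cmod c"]
        by (simp add: R_def mult.left_commute)
    qed
  qed
  define \<Psi> where "\<Psi> x = (if x \<in> X then THE y. R x y else 0)" for x
  have \<Psi>: "R x (\<Psi> x)" if "x \<in> X" for x
    using ex[OF that] uniq that unfolding \<Psi>_def by (auto intro: theI)
  have \<Psi>_eq: "\<Psi> x = y" if "R x y" "x \<in> X" for x y
    using uniq[OF \<Psi>] that by blast
  show ?thesis
  proof
    show "\<Psi> x \<in> Y" if "x \<in> X" for x using \<Psi>[OF that] by (simp add: R_def)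
    show "clinear_on X \<Psi>" by (auto intro!: clinear_onI \<Psi>_eq R_add R_scale \<Psi>)
    show "m (\<Psi> x) \<le> C * n x" if x: "x \<in> X" for x
    proof -
      have "m (Q 0 - \<Psi> x) \<le> C * n (P 0 - x)" using \<Psi>[OF x] unfolding R_def by (metis cv.subspace_0[OF S])
      thus ?thesis using Y.norm_minus[of "\<Psi> x"] X.norm_minus[OF x] \<Psi>[OF x] by (simp add: R_def)
    qed
    show "\<Psi> (P s) = Q s" if s: "s \<in> S" for s
      using s bdiff[OF _ s] by (intro \<Psi>_eq) (auto simp: R_def)
    show "\<Psi> x = 0" if "x \<notin> X" for x using that by (simp add: \<Psi>_def)
  qed
qed

section \<open>Square roots in Banach algebras with isometric involution\<close>

text \<open>The iteration for square roots needs a complete submultiplicative norm and an isometric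
  involution; the \<open>C\<^sup>*\<close>-identity enters with \<open>cstar_alg\<close>. The norm
  of the unit is bounded by 1 rather than equal to 1, because the algebra may be zero.\<close>

locale star_banach =
  fixes A :: "'a::complex_vector cstar_data"
  assumes banach: "banach_on (ccar A) (cnorm A)"
    and unit: "is_cunit A (cunit A)" and norm_unit: "cnorm A (cunit A) \<le> 1"
    and mul_closed [simp, intro]: "\<lbrakk>a \<in> ccar A; b \<in> ccar A\<rbrakk> \<Longrightarrow> cmul A a b \<in> ccar A"
    and mul_add_left: "\<lbrakk>a \<in> ccar A; b \<in> ccar A; c \<in> ccar A\<rbrakk> \<Longrightarrow> cmul A (a + b) c = cmul A a c + cmul A b c"
    and mul_add_right: "\<lbrakk>a \<in> ccar A; b \<in> ccar A; c \<in> ccar A\<rbrakk> \<Longrightarrow> cmul A a (b + c) = cmul A a b + cmul A a c"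
    and mul_scale_left: "\<lbrakk>a \<in> ccar A; b \<in> ccar A\<rbrakk> \<Longrightarrow> cmul A (z *\<^sub>C a) b = z *\<^sub>C cmul A a b"
    and mul_scale_right: "\<lbrakk>a \<in> ccar A; b \<in> ccar A\<rbrakk> \<Longrightarrow> cmul A a (z *\<^sub>C b) = z *\<^sub>C cmul A a b"
    and mul_assoc: "\<lbrakk>a \<in> ccar A; b \<in> ccar A; c \<in> ccar A\<rbrakk> \<Longrightarrow>
        cmul A (cmul A a b) c = cmul A a (cmul A b c)"
    and norm_mul: "\<lbrakk>a \<in> ccar A; b \<in> ccar A\<rbrakk> \<Longrightarrow> cnorm A (cmul A a b) \<le> cnorm A a * cnorm A b"
    and star_closed [simp, intro]: "a \<in> ccar A \<Longrightarrow> cstar A a \<in> ccar A"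
    and star_add: "\<lbrakk>a \<in> ccar A; b \<in> ccar A\<rbrakk> \<Longrightarrow> cstar A (a + b) = cstar A a + cstar A b"
    and star_scale: "a \<in> ccar A \<Longrightarrow> cstar A (z *\<^sub>C a) = cnj z *\<^sub>C cstar A a"
    and star_star [simp]: "a \<in> ccar A \<Longrightarrow> cstar A (cstar A a) = a"
    and star_mul: "\<lbrakk>a \<in> ccar A; b \<in> ccar A\<rbrakk> \<Longrightarrow> cstar A (cmul A a b) = cmul A (cstar A b) (cstar A a)"
    and norm_star: "a \<in> ccar A \<Longrightarrow> cnorm A (cstar A a) = cnorm A a"
begin

sublocale normed_carrier "ccar A" "cnorm A"
  by (rule banach_on_normed[OF banach])

abbreviation mul (infixl "\<odot>" 70) where "a \<odot> b \<equiv> cmul A a b"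
abbreviation "st \<equiv> cstar A"
abbreviation "nm \<equiv> cnorm A"
abbreviation "car \<equiv> ccar A"
abbreviation one ("\<one>") where "\<one> \<equiv> cunit A"

lemma complete: "complete_on car nm" using banach by (simp add: banach_on_def)

lemma one_in [simp, intro]: "\<one> \<in> car" using unit by (simp add: is_cunit_def)
lemma one_mul [simp]: "a \<in> car \<Longrightarrow> \<one> \<odot> a = a" using unit by (simp add: is_cunit_def)
lemma mul_one [simp]: "a \<in> car \<Longrightarrow> a \<odot> \<one> = a" using unit by (simp add: is_cunit_def)

lemma left_mul_linear: "a \<in> car \<Longrightarrow> clinear_map car (\<lambda>b. a \<odot> b)"
  by (auto intro!: clinear_map.intro clinear_onI sub simp: mul_add_right mul_scale_right)

lemma right_mul_linear: "a \<in> car \<Longrightarrow> clinear_map car (\<lambda>b. b \<odot> a)"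
  by (auto intro!: clinear_map.intro clinear_onI sub simp: mul_add_left mul_scale_left)

lemma mul_zero [simp]: "a \<in> car \<Longrightarrow> a \<odot> 0 = 0" "a \<in> car \<Longrightarrow> 0 \<odot> a = 0"
  using clinear_map.zero[OF left_mul_linear] clinear_map.zero[OF right_mul_linear] by auto

lemma mul_minus: "\<lbrakk>a \<in> car; b \<in> car\<rbrakk> \<Longrightarrow> a \<odot> (- b) = - (a \<odot> b)" "\<lbrakk>a \<in> car; b \<in> car\<rbrakk> \<Longrightarrow> (- a) \<odot> b = - (a \<odot> b)"
  using clinear_map.minus[OF left_mul_linear] clinear_map.minus[OF right_mul_linear] by auto

lemma mul_diff_right: "\<lbrakk>a \<in> car; b \<in> car; c \<in> car\<rbrakk> \<Longrightarrow> a \<odot> (b - c) = a \<odot> b - a \<odot> c"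
  using clinear_map.diff[OF left_mul_linear] by auto

lemma mul_diff_left: "\<lbrakk>a \<in> car; b \<in> car; c \<in> car\<rbrakk> \<Longrightarrow> (a - b) \<odot> c = a \<odot> c - b \<odot> c"
  using clinear_map.diff[OF right_mul_linear] by auto

lemma mul_sum_right: "\<lbrakk>a \<in> car; \<And>i. i \<in> I \<Longrightarrow> f i \<in> car\<rbrakk> \<Longrightarrow> a \<odot> (\<Sum>i\<in>I. f i) = (\<Sum>i\<in>I. a \<odot> f i)"
  by (rule clinear_map.sum[OF left_mul_linear])

lemma mul_sum_left: "\<lbrakk>a \<in> car; \<And>i. i \<in> I \<Longrightarrow> f i \<in> car\<rbrakk> \<Longrightarrow> (\<Sum>i\<in>I. f i) \<odot> a = (\<Sum>i\<in>I. f i \<odot> a)"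
  by (rule clinear_map.sum[OF right_mul_linear])

lemma star_minus: "a \<in> car \<Longrightarrow> st (- a) = - st a" using star_scale[of a "-1"] by simp

lemma star_diff: "\<lbrakk>a \<in> car; b \<in> car\<rbrakk> \<Longrightarrow> st (a - b) = st a - st b"
  using star_add[of a "- b"] star_minus[of b] by simp

lemma star_zero [simp]: "st 0 = 0" using star_scale[of 0 0] by simp

lemma star_sum: "(\<And>i. i \<in> I \<Longrightarrow> f i \<in> car) \<Longrightarrow> st (\<Sum>i\<in>I. f i) = (\<Sum>i\<in>I. st (f i))"
  by (induction I rule: infinite_finite_induct) (auto simp: star_add)

lemma star_one [simp]: "st \<one> = \<one>"
  using star_mul[of "st \<one>" \<one>] by simp

lemmas expand = mul_add_left mul_add_right mul_diff_left mul_diff_right mul_minus mul_scale_left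
  mul_scale_right mul_assoc star_add star_diff star_minus star_scale star_mul

section \<open>Continuity of the operations and square roots of elements close to the unit\<close>

lemma conv_star: assumes "conv s x" shows "conv (\<lambda>k. st (s k)) (st x)"
proof (rule convI_le[where r = "\<lambda>k. nm (s k - x)"])
  show "nm (st (s k) - st x) \<le> nm (s k - x)" for k
    using norm_star[of "s k - x"] convD[OF assms] by (simp add: star_diff)
qed (use assms in \<open>auto simp: convD\<close>)

lemma conv_mul: assumes s: "conv s x" and t: "conv t y" shows "conv (\<lambda>k. s k \<odot> t k) (x \<odot> y)"
proof (rule convI_le[where r = "\<lambda>k. nm (s k) * nm (t k - y) + nm (s k - x) * nm y"])
  note [simp] = convD(1,2)[OF s] convD(1,2)[OF t]
  show "(\<lambda>k. nm (s k) * nm (t k - y) + nm (s k - x) * nm y) \<longlonglongrightarrow> 0"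
    by (rule tendsto_eq_intros conv_norm[OF s] convD(3)[OF s] convD(3)[OF t] refl)+ simp
  show "nm (s k \<odot> t k - x \<odot> y) \<le> nm (s k) * nm (t k - y) + nm (s k - x) * nm y" for k
  proof -
    have "s k \<odot> t k - x \<odot> y = s k \<odot> (t k - y) + (s k - x) \<odot> y" by (simp add: expand)
    thus ?thesis using tri[of "s k \<odot> (t k - y)" "(s k - x) \<odot> y"]
        norm_mul[of "s k" "t k - y"] norm_mul[of "s k - x" y] by simp
  qed
qed (use assms in \<open>auto simp: convD\<close>)

text \<open>Square roots stay in every such set. Taken as a commutant, the set yields commutation
  relations of the root; taken as a concrete algebra of operators, it keeps the root inside.\<close>

definition closed_alg :: "'a set \<Rightarrow> bool" where
  "closed_alg U \<longleftrightarrow> csubspace U \<and> (\<forall>x\<in>U. \<forall>y\<in>U. x \<odot> y \<in> U) \<and>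
     (\<forall>s x. (\<forall>k. s k \<in> U) \<and> conv s x \<longrightarrow> x \<in> U)"

lemma closed_alg_car: "closed_alg car"
  using sub by (auto simp: closed_alg_def convD)

lemma closed_alg_commutant: "c \<in> car \<Longrightarrow> closed_alg {x \<in> car. c \<odot> x = x \<odot> c}"
  unfolding closed_alg_def
proof (intro conjI ballI allI impI)
  assume c: "c \<in> car"
  show "csubspace {x \<in> car. c \<odot> x = x \<odot> c}" using c by (intro cv.subspaceI) (auto simp: expand)
  show "x \<odot> y \<in> {x \<in> car. c \<odot> x = x \<odot> c}" if "x \<in> {x \<in> car. c \<odot> x = x \<odot> c}" "y \<in> {x \<in> car. c \<odot> x = x \<odot> c}" for x y
    using that c mul_assoc[of c x y] by (auto simp: mul_assoc)
  fix s x assume s: "(\<forall>k. s k \<in> {x \<in> car. c \<odot> x = x \<odot> c}) \<and> conv s x"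
  have "conv (\<lambda>k. c \<odot> s k) (c \<odot> x)" "conv (\<lambda>k. s k \<odot> c) (x \<odot> c)"
    using s conv_mul[OF conv_const[OF c], of s x] conv_mul[OF _ conv_const[OF c], of s x] by auto
  moreover have "(\<lambda>k. c \<odot> s k) = (\<lambda>k. s k \<odot> c)" using s by auto
  ultimately have "c \<odot> x = x \<odot> c" by (metis conv_unique)
  thus "x \<in> {x \<in> car. c \<odot> x = x \<odot> c}" using s by (auto dest: convD(2))
qed

text \<open>The scalar sequence majorizing the iteration for \<open>1 - sqrt (1 - x)\<close> when \<open>\<parallel>x\<parallel> \<le> 1\<close>.\<close>

primrec sqr :: "nat \<Rightarrow> real" where
  "sqr 0 = 0"
| "sqr (Suc k) = (1 + (sqr k)\<^sup>2) / 2"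

text \<open>A fixed point \<open>v\<close> satisfies \<open>2 v = x + v\<^sup>2\<close>, which is
  \<open>(1 - v)\<^sup>2 = 1 - x\<close>.\<close>

primrec sqy :: "'a \<Rightarrow> nat \<Rightarrow> 'a" where
  "sqy x 0 = 0"
| "sqy x (Suc k) = (1/2) *\<^sub>C (x + sqy x k \<odot> sqy x k)"

lemma sqr_bounds: "0 \<le> sqr k \<and> sqr k \<le> 1 \<and> sqr k \<le> sqr (Suc k)"
proof (induction k)
  case (Suc k)
  have "(sqr k)\<^sup>2 \<le> (sqr (Suc k))\<^sup>2" using Suc by (intro power_mono) auto
  moreover have "(sqr (Suc k))\<^sup>2 \<le> 1" using Suc power_mono[of "sqr k" 1 2]
    by (intro power_le_one) auto
  ultimately show ?case by simp
qed simp

lemma sqy_in: "x \<in> U \<Longrightarrow> closed_alg U \<Longrightarrow> sqy x k \<in> U"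
  by (induction k) (auto simp: closed_alg_def intro!: cv.subspace_0 cv.subspace_add cv.subspace_scale)

text \<open>The commutant of \<open>x\<close> contains every iterate, so \<open>x\<close> lies in
  the commutant of \<open>sqy x l\<close>, which then contains all iterates.\<close>

lemma sqy_commute: "x \<in> car \<Longrightarrow> sqy x k \<odot> sqy x l = sqy x l \<odot> sqy x k"
proof -
  assume x: "x \<in> car"
  have xl: "x \<odot> sqy x l = sqy x l \<odot> x" for l
    using sqy_in[OF _ closed_alg_commutant[OF x], of x l] x by simp
  hence "x \<in> {y \<in> car. sqy x l \<odot> y = y \<odot> sqy x l}" using x by simp
  from sqy_in[OF this closed_alg_commutant[OF sqy_in[OF x closed_alg_car]]] show ?thesis by simp
qed

lemma sqy_bounds:
  assumes x: "x \<in> car" "nm x \<le> 1"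
  shows "nm (sqy x k) \<le> sqr k \<and> nm (sqy x (Suc k) - sqy x k) \<le> sqr (Suc k) - sqr k"
proof (induction k)
  case 0 thus ?case using x norm_scale[of x "1/2"] by simp
next
  case (Suc k)
  note [simp] = sqy_in[OF x(1) closed_alg_car] x(1)
  let ?y = "sqy x k" and ?z = "sqy x (Suc k)"
  have *: "nm ?z \<le> sqr (Suc k)"
  proof -
    have "nm ?z = 1/2 * nm (x + ?y \<odot> ?y)" using norm_scale[of "x + ?y \<odot> ?y" "1/2"] by simp
    also have "\<dots> \<le> 1/2 * (1 + (sqr k)\<^sup>2)"
      using tri[of x "?y \<odot> ?y"] norm_mul[of ?y ?y] Suc nonneg[of ?y]
        mult_mono[of "nm ?y" "sqr k" "nm ?y" "sqr k"] x(2) sqr_bounds[of k]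
      by (intro mult_left_mono) (auto simp: power2_eq_square)
    finally show ?thesis by simp
  qed
  \<comment> \<open>The difference of two squares factors because the iterates commute. The scalar
    sequence obeys the same recursion with 1 in place of \<open>x\<close>, so the two factors are
    bounded by its difference and its sum.\<close>
  have "sqy x (Suc (Suc k)) - ?z = (1/2) *\<^sub>C ((?z - ?y) \<odot> (?z + ?y))"
    using sqy_commute[OF x(1), of k "Suc k"] x
    by (simp add: mul_add_right mul_diff_left cv.scale_right_diff_distrib cv.scale_right_distrib del: sqy.simps)
      (simp add: cv.scale_right_diff_distrib cv.scale_right_distrib)
  hence "nm (sqy x (Suc (Suc k)) - ?z) = 1/2 * nm ((?z - ?y) \<odot> (?z + ?y))"
    using norm_scale[of "(?z - ?y) \<odot> (?z + ?y)" "1/2"] by (simp del: sqy.simps)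
  also have "\<dots> \<le> 1/2 * ((sqr (Suc k) - sqr k) * (sqr (Suc k) + sqr k))"
    using norm_mul[of "?z - ?y" "?z + ?y"] Suc * tri[of ?z ?y] nonneg[of "?z + ?y"] sqr_bounds[of k]
      nonneg[of "?z - ?y"]
      mult_mono[of "nm (?z - ?y)" "sqr (Suc k) - sqr k" "nm (?z + ?y)" "sqr (Suc k) + sqr k"]
    by (simp del: sqy.simps sqr.simps)
  also have "\<dots> = sqr (Suc (Suc k)) - sqr (Suc k)"
    by (simp add: power2_eq_square algebra_simps add_divide_distrib diff_divide_distrib)
  finally show ?case using * by blast
qed

lemma sqrt_exists:
  assumes x: "x \<in> car" "st x = x" "nm x \<le> 1"
  obtains v where "v \<in> car" "st v = v" "nm v \<le> 1" "(\<one> - v) \<odot> (\<one> - v) = \<one> - x"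
    "\<And>U. \<lbrakk>closed_alg U; x \<in> U\<rbrakk> \<Longrightarrow> v \<in> U"
proof -
  note y [simp] = sqy_in[OF x(1) closed_alg_car]
  have inc: "incseq sqr" using sqr_bounds by (simp add: incseq_Suc_iff)
  have "convergent sqr" using sqr_bounds inc
    by (intro Bseq_mono_convergent BseqI'[where K = 1]) (auto simp: incseq_def)
  hence Cau: "Cauchy sqr" by (rule convergent_Cauchy)
  have dif: "nm (sqy x (k + l) - sqy x k) \<le> sqr (k + l) - sqr k" for k l
  proof (induction l)
    case (Suc l)
    have "nm (sqy x (Suc (k + l)) - sqy x k) \<le> nm (sqy x (Suc (k + l)) - sqy x (k + l)) + nm (sqy x (k + l) - sqy x k)"
      by (intro tri_diff y)
    thus ?case using Suc conjunct2[OF sqy_bounds[OF x(1,3), of "k + l"]] by simp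
  qed simp
  have dif': "nm (sqy x k - sqy x l) \<le> \<bar>sqr k - sqr l\<bar>" for k l
    using dif[of k "l - k"] dif[of l "k - l"] norm_diff_commute[of "sqy x k" "sqy x l"]
      incseqD[OF inc, of k l] incseqD[OF inc, of l k]
    by (cases "k \<le> l") auto
  have "\<exists>v\<in>car. (\<lambda>k. nm (sqy x k - v)) \<longlonglongrightarrow> 0"
  proof -
    have "\<forall>\<epsilon>>0. \<exists>N. \<forall>k\<ge>N. \<forall>l\<ge>N. nm (sqy x k - sqy x l) < \<epsilon>"
      using Cau dif' unfolding Cauchy_def dist_real_def by (meson le_less_trans)
    thus ?thesis using complete y unfolding complete_on_def by blast
  qed
  then obtain v where v: "conv (sqy x) v" by (auto simp: conv_def)
  note [simp] = convD(2)[OF v]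
  have U: "v \<in> U" if "closed_alg U" "x \<in> U" for U
    using v sqy_in[OF that(2,1)] that unfolding closed_alg_def by blast
  have "conv (\<lambda>k. sqy x (Suc k)) v"
    using v LIMSEQ_Suc[OF convD(3)[OF v]] by (auto simp: conv_def simp del: sqy.simps)
  moreover have "conv (\<lambda>k. sqy x (Suc k)) ((1/2) *\<^sub>C (x + v \<odot> v))"
    using v x by (auto intro!: conv_scale conv_add conv_mul conv_const)
  ultimately have "v = (1/2) *\<^sub>C (x + v \<odot> v)" by (rule conv_unique)
  from arg_cong[OF this, of "scaleC 2"] have "2 *\<^sub>C v = x + v \<odot> v" by simp
  hence "v + v = x + v \<odot> v" by (simp only: scaleC_two)
  hence eq: "(\<one> - v) \<odot> (\<one> - v) = \<one> - x" by (simp add: expand algebra_simps)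
  have sty: "st (sqy x k) = sqy x k" for k
    by (induction k) (use x in \<open>simp_all add: star_scale star_add star_mul\<close>)
  hence sa: "st v = v" using conv_unique[OF conv_star[OF v]] v by (simp add: fun_eq_iff)
  have "nm (sqy x k) \<le> 1" for k
    using conjunct1[OF sqy_bounds[OF x(1,3), of k]] sqr_bounds[of k] by linarith
  hence "nm v \<le> 1" by (rule conv_norm_le[OF v])
  from that[OF _ sa this eq U] show ?thesis by simp
qed

end

section \<open>The positive cone of a \<open>C\<^sup>*\<close>-algebra\<close>

abbreviation rsc :: "real \<Rightarrow> 'a::complex_vector \<Rightarrow> 'a" where "rsc r a \<equiv> complex_of_real r *\<^sub>C a"

locale cstar_alg = star_banach +
  assumes cstar_id: "a \<in> ccar A \<Longrightarrow> cnorm A (cmul A (cstar A a) a) = (cnorm A a)\<^sup>2"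
begin

definition sa :: "'a \<Rightarrow> bool" where "sa a \<longleftrightarrow> a \<in> car \<and> st a = a"

text \<open>For self-adjoint \<open>a\<close> the ball condition confines the spectrum to the
  interval from 0 to \<open>2 t\<close>. In this form the cone is closed under sums by the triangle
  inequality.\<close>

definition pos :: "'a \<Rightarrow> bool" where
  "pos a \<longleftrightarrow> sa a \<and> (\<exists>t\<ge>0. nm (rsc t \<one> - a) \<le> t)"

primrec pw :: "'a \<Rightarrow> nat \<Rightarrow> 'a" where
  "pw a 0 = \<one>"
| "pw a (Suc k) = a \<odot> pw a k"

lemma saD: "sa a \<Longrightarrow> a \<in> car" "sa a \<Longrightarrow> st a = a" by (simp_all add: sa_def)

lemma sa_intros: "sa a \<Longrightarrow> sa b \<Longrightarrow> sa (a + b)" "sa a \<Longrightarrow> sa b \<Longrightarrow> sa (a - b)" "sa a \<Longrightarrow> sa (- a)"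
  "sa a \<Longrightarrow> sa (rsc r a)" "sa \<one>" "sa 0" "x \<in> car \<Longrightarrow> sa (st x \<odot> x)" "x \<in> car \<Longrightarrow> sa (x \<odot> st x)"
  "sa a \<Longrightarrow> sa (a \<odot> a)"
  by (auto simp: sa_def expand)

lemma posD: "pos a \<Longrightarrow> a \<in> car" "pos a \<Longrightarrow> st a = a" "pos a \<Longrightarrow> sa a" by (auto simp: pos_def sa_def)

lemma norm_rsc: "a \<in> car \<Longrightarrow> nm (rsc r a) = \<bar>r\<bar> * nm a" by (simp add: norm_scale)

lemma norm_sa_sq: "sa a \<Longrightarrow> nm (a \<odot> a) = (nm a)\<^sup>2" using cstar_id[of a] by (simp add: sa_def)

lemma norm_rescale_le: "\<lbrakk>a \<in> car; t > 0; nm a \<le> t\<rbrakk> \<Longrightarrow> nm ((1 / complex_of_real t) *\<^sub>C a) \<le> 1"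
  by (simp add: norm_scale norm_divide)

lemma pw_in [simp]: "a \<in> car \<Longrightarrow> pw a k \<in> car" by (induction k) auto

lemma pw_add: "a \<in> car \<Longrightarrow> pw a (k + l) = pw a k \<odot> pw a l"
  by (induction k) (auto simp: mul_assoc)

lemma sa_pw: assumes "sa a" shows "sa (pw a k)"
proof (induction k)
  case (Suc k)
  have "st (pw a (Suc k)) = pw a k \<odot> pw a 1" using Suc assms by (simp add: sa_def star_mul)
  also have "\<dots> = pw a (Suc k)" using pw_add[of a k 1] assms by (simp add: sa_def)
  finally show ?case using assms by (simp add: sa_def)
qed (simp add: sa_def)

lemma norm_pw: assumes "sa a" shows "nm (pw a (2 ^ k)) = nm a ^ (2 ^ k)"
proof (induction k)
  case (Suc k)
  have "pw a (2 ^ Suc k) = pw a (2 ^ k) \<odot> pw a (2 ^ k)" using pw_add[of a "2^k" "2^k"] assms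
    by (simp add: sa_def mult_2)
  thus ?case using norm_sa_sq[OF sa_pw[OF assms]] Suc
    by (simp add: mult.commute flip: power_mult)
qed (use assms in \<open>simp add: sa_def\<close>)

text \<open>The norm of a self-adjoint element is its spectral radius, so linear growth of the powers is
  enough.\<close>

lemma norm_le_1_of_growth:
  assumes y: "sa y" and growth: "\<And>k. nm (pw y k) \<le> 1 + real k * C"
  shows "nm y \<le> 1"
proof (rule ccontr)
  assume "\<not> nm y \<le> 1"
  hence b: "nm y > 1" by simp
  define c where "c = inverse (nm y)"
  have c: "norm c < 1" "c > 0" "nm y * c = 1" using b by (auto simp: c_def field_simps)
  \<comment> \<open>Multiplying the growth bound at \<open>n = 2 ^ k\<close> by \<open>c ^ n\<close>
    leaves 1 on the left, while the right side tends to 0 because \<open>c < 1\<close>.\<close>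
  have "(\<lambda>n. c ^ n + C * (real n * c ^ n)) \<longlonglongrightarrow> 0 + C * 0"
    using c by (intro tendsto_intros powser_times_n_limit_0 LIMSEQ_power_zero) auto
  hence "(\<lambda>k. c ^ (2 ^ k) + C * (real (2 ^ k) * c ^ (2 ^ k))) \<longlonglongrightarrow> 0"
    using LIMSEQ_subseq_LIMSEQ[of "\<lambda>n. c ^ n + C * (real n * c ^ n)" 0 "\<lambda>k. 2 ^ k"]
    by (simp add: strict_mono_def o_def)
  moreover have "1 \<le> c ^ (2 ^ k) + C * (real (2 ^ k) * c ^ (2 ^ k))" for k
  proof -
    have "nm y ^ (2 ^ k) \<le> 1 + real (2 ^ k) * C" using growth[of "2 ^ k"] norm_pw[OF y, of k] by simp
    hence "nm y ^ (2 ^ k) * c ^ (2 ^ k) \<le> (1 + real (2 ^ k) * C) * c ^ (2 ^ k)"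
      using c by (intro mult_right_mono) auto
    moreover have "nm y ^ (2 ^ k) * c ^ (2 ^ k) = 1" by (simp only: power_mult_distrib[symmetric] c(3) power_one)
    ultimately show ?thesis by (simp only: distrib_left distrib_right mult_1 mult_1_right mult.commute mult.left_commute)
  qed
  ultimately have "1 \<le> (0::real)" by (intro LIMSEQ_le_const) auto
  thus False by simp
qed

text \<open>With \<open>w\<^sup>2 = 1 - s\<^sup>2\<close> the element \<open>s + i w\<close> is unitary, hence \<open>\<parallel>w\<parallel> \<le> 1\<close>.\<close>

lemma norm_one_minus_sq:
  assumes s: "sa s" "nm s \<le> 1"
  shows "nm (\<one> - s \<odot> s) \<le> 1"
proof -
  note [simp] = saD[OF s(1)]
  have "nm (s \<odot> s) \<le> 1" unfolding norm_sa_sq[OF s(1)] using s by (intro power_le_one nonneg saD)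
  moreover have "s \<odot> s \<in> car" "st (s \<odot> s) = s \<odot> s" by (simp_all add: star_mul)
  ultimately obtain v where v: "v \<in> car" "st v = v" "(\<one> - v) \<odot> (\<one> - v) = \<one> - s \<odot> s"
    "\<And>U. \<lbrakk>closed_alg U; s \<odot> s \<in> U\<rbrakk> \<Longrightarrow> v \<in> U"
    using sqrt_exists[of "s \<odot> s"] by metis
  define w where "w = \<one> - v"
  have w [simp]: "w \<in> car" "st w = w" "w \<odot> w = \<one> - s \<odot> s" using v by (auto simp: w_def star_diff)
  have "s \<odot> v = v \<odot> s" using v(4)[OF closed_alg_commutant, of s] by (simp add: mul_assoc)
  hence comm: "s \<odot> w = w \<odot> s" using v by (simp add: w_def expand)
  define z where "z = s + \<i> *\<^sub>C w"
  have z [simp]: "z \<in> car" by (simp add: z_def)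
  have "st z \<odot> z = \<one>"
    by (simp add: z_def expand comm cv.scale_right_distrib cv.scale_right_diff_distrib)
  hence "(nm z)\<^sup>2 \<le> 1" using cstar_id[of z] norm_unit by simp
  hence nz: "nm z \<le> 1" using power2_le_imp_le[of "nm z" 1] by simp
  have "(2 * \<i>) *\<^sub>C w = z - st z"
    using scaleC_two[of "\<i> *\<^sub>C w"] by (simp add: z_def expand)
  hence "2 * nm w \<le> 2" using norm_diff_le[of z "st z"] nz norm_star[of z] norm_scale[of w "2 * \<i>"]
    by (simp add: norm_mult)
  hence "nm w \<le> 1" by simp
  thus ?thesis using norm_sa_sq[of w] w nonneg[of w] by (simp add: sa_def power_le_one)
qed

section \<open>Square roots and stability of the positive cone\<close>

lemma pos_scale: assumes "pos a" "0 \<le> r" shows "pos (rsc r a)"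
proof -
  obtain t where t: "t \<ge> 0" "nm (rsc t \<one> - a) \<le> t" using assms by (auto simp: pos_def)
  have "rsc (r * t) \<one> - rsc r a = rsc r (rsc t \<one> - a)" by (simp add: cv.scale_right_diff_distrib)
  hence "nm (rsc (r * t) \<one> - rsc r a) = r * nm (rsc t \<one> - a)"
    using norm_rsc[of "rsc t \<one> - a" r] assms by (simp add: posD)
  also have "\<dots> \<le> r * t" using t assms by (intro mult_left_mono) auto
  finally show ?thesis using assms t unfolding pos_def
    by (auto intro!: sa_intros exI[of _ "r * t"])
qed

text \<open>Raising \<open>t\<close> by 1 costs at most 1 in the norm, so \<open>t\<close> may be
  taken positive and divided by.\<close>

lemma pos_strict_bound: assumes "pos a" obtains t where "t > 0" "nm (rsc t \<one> - a) \<le> t"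
proof -
  obtain t where t: "t \<ge> 0" "nm (rsc t \<one> - a) \<le> t" using assms by (auto simp: pos_def)
  have eq: "rsc (t + 1) \<one> - a = \<one> + (rsc t \<one> - a)" by (simp add: cv.scale_left_distrib)
  have "nm (rsc (t + 1) \<one> - a) \<le> t + 1"
    unfolding eq using tri[of \<one> "rsc t \<one> - a"] norm_unit t posD[OF assms] by simp
  with t that[of "t + 1"] show ?thesis by simp
qed

text \<open>With \<open>t\<close> from \<open>pos_strict_bound\<close>, the element
  \<open>x = 1 - a/t\<close> has norm at most 1, and \<open>sqrt t\<close> times the root
  \<open>1 - v\<close> of \<open>1 - x\<close> squares to \<open>a\<close>. The bound
  \<open>nm v \<le> 1\<close> is exactly the ball condition for this root.\<close>

lemma pos_root:
  assumes a: "pos a"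
  obtains s where "sa s" "s \<odot> s = a" "pos s" "\<And>U. \<lbrakk>closed_alg U; a \<in> U; \<one> \<in> U\<rbrakk> \<Longrightarrow> s \<in> U"
proof -
  note [simp] = posD(1,2)[OF a]
  obtain t where t: "t > 0" "nm (rsc t \<one> - a) \<le> t" using pos_strict_bound[OF a] .
  define x where "x = rsc (1/t) (rsc t \<one> - a)"
  have "nm x = nm (rsc t \<one> - a) / t" using t norm_rsc[of "rsc t \<one> - a" "1/t"] by (simp add: x_def)
  hence x: "x \<in> car" "st x = x" "nm x \<le> 1" using t by (simp_all add: x_def expand)
  have x': "\<one> - x = rsc (1/t) a" using t by (simp add: x_def cv.scale_right_diff_distrib)
  obtain v where v: "v \<in> car" "st v = v" "nm v \<le> 1" "(\<one> - v) \<odot> (\<one> - v) = \<one> - x"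
    "\<And>U. \<lbrakk>closed_alg U; x \<in> U\<rbrakk> \<Longrightarrow> v \<in> U" using sqrt_exists[OF x] by metis
  define s where "s = rsc (sqrt t) (\<one> - v)"
  have sas: "sa s" using v by (auto simp: s_def intro!: sa_intros) (simp add: sa_def)
  have tt: "complex_of_real (sqrt t) * complex_of_real (sqrt t) = complex_of_real t"
    using t by (simp flip: of_real_mult)
  have "s \<odot> s = rsc t ((\<one> - v) \<odot> (\<one> - v))"
    using v(1) by (simp add: s_def mul_scale_left mul_scale_right tt)
  also have "\<dots> = a" using t by (simp add: v(4) x')
  finally have ss: "s \<odot> s = a" .
  have "rsc (sqrt t) \<one> - s = rsc (sqrt t) v" by (simp add: s_def cv.scale_right_diff_distrib)
  hence "nm (rsc (sqrt t) \<one> - s) \<le> sqrt t" using v t norm_rsc[of v "sqrt t"] by (simp add: mult_left_le)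
  hence "pos s" using sas t unfolding pos_def by (intro conjI exI[of _ "sqrt t"]) auto
  moreover have "s \<in> U" if U: "closed_alg U" "a \<in> U" "\<one> \<in> U" for U
  proof -
    have cs: "csubspace U" using U by (simp add: closed_alg_def)
    have "x \<in> U" unfolding x_def
      using U by (intro cv.subspace_scale[OF cs] cv.subspace_diff[OF cs])
    hence "v \<in> U" using v(5) U by blast
    thus ?thesis unfolding s_def using U by (intro cv.subspace_scale[OF cs] cv.subspace_diff[OF cs])
  qed
  ultimately show ?thesis using that sas ss by blast
qed

lemma norm_sq_bound: assumes s: "sa s" "nm s \<le> r" shows "nm (rsc (r\<^sup>2) \<one> - s \<odot> s) \<le> r\<^sup>2"
proof (cases "r = 0")
  case True
  hence "s = 0" using s eq_0[of s] nonneg[of s] by (auto simp: sa_def)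
  thus ?thesis using True by simp
next
  case False
  hence r: "r > 0" using s nonneg[of s] by (auto simp: sa_def)
  let ?s = "rsc (1/r) s"
  have "nm (\<one> - ?s \<odot> ?s) \<le> 1" using s r norm_rsc[of s "1/r"]
    by (intro norm_one_minus_sq sa_intros) (auto simp: sa_def)
  moreover have "rsc (r\<^sup>2) \<one> - s \<odot> s = rsc (r\<^sup>2) (\<one> - ?s \<odot> ?s)"
    using s r by (simp add: sa_def expand cv.scale_right_diff_distrib power2_eq_square flip: of_real_mult of_real_divide)
  ultimately show ?thesis using s r norm_rsc[of "\<one> - ?s \<odot> ?s" "r\<^sup>2"] by (simp add: sa_def mult_left_le)
qed

lemma pos_sq: "sa s \<Longrightarrow> pos (s \<odot> s)"
  using norm_sq_bound[of s "nm s"] by (auto simp: pos_def sa_intros intro: exI[of _ "(nm s)\<^sup>2"])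

text \<open>Any bound of the norm serves as the constant in the ball condition. This uniformity lets
  one constant work along a whole sequence in \<open>pos_closed\<close>.\<close>

lemma pos_bound: assumes "pos a" "nm a \<le> t" shows "nm (rsc t \<one> - a) \<le> t"
proof -
  obtain s where s: "sa s" "s \<odot> s = a" using pos_root[OF assms(1)] by metis
  have t: "t \<ge> 0" using assms nonneg[of a] by (auto simp: posD)
  have "(nm s)\<^sup>2 \<le> t" using norm_sa_sq[OF s(1)] s(2) assms by simp
  hence "nm s \<le> sqrt t" by (rule real_le_rsqrt)
  from norm_sq_bound[OF s(1) this] show ?thesis using t s by simp
qed

lemma posI_bound: "\<lbrakk>sa a; nm (rsc t \<one> - a) \<le> t\<rbrakk> \<Longrightarrow> pos a"
  using nonneg[of "rsc t \<one> - a"] unfolding pos_def sa_def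
  by (intro conjI exI[of _ t]) auto

lemma pos_zero [simp]: "pos 0" by (rule posI_bound[where t = 0]) (auto simp: sa_intros)

lemma pos_add: assumes "pos a" "pos b" shows "pos (a + b)"
proof -
  obtain t u where t: "t \<ge> 0" "nm (rsc t \<one> - a) \<le> t" and u: "u \<ge> 0" "nm (rsc u \<one> - b) \<le> u"
    using assms unfolding pos_def by blast
  note [simp] = posD(1,2)[OF assms(1)] posD(1,2)[OF assms(2)]
  have eq: "rsc (t + u) \<one> - (a + b) = (rsc t \<one> - a) + (rsc u \<one> - b)" by (simp add: cv.scale_left_distrib)
  have "nm (rsc (t + u) \<one> - (a + b)) \<le> t + u"
    unfolding eq using tri[of "rsc t \<one> - a" "rsc u \<one> - b"] t u by simp
  thus ?thesis by (rule posI_bound[OF sa_intros(1)[OF posD(3)[OF assms(1)] posD(3)[OF assms(2)]]])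
qed

lemma pos_sum: "(\<And>i. i \<in> I \<Longrightarrow> pos (f i)) \<Longrightarrow> pos (\<Sum>i\<in>I. f i)"
  by (induction I rule: infinite_finite_induct) (auto intro: pos_add)

lemma pos_closed: assumes s: "conv s a" and pos: "\<And>k. pos (s k)" shows "pos a"
proof -
  note [simp] = convD(1,2)[OF s]
  have "Bseq (\<lambda>k. nm (s k))" using conv_norm[OF s] by (intro convergent_imp_Bseq) (auto simp: convergent_def)
  then obtain K where K: "\<And>k. norm (nm (s k)) \<le> K" by (auto simp: Bseq_def)
  have "nm (rsc K \<one> - s k) \<le> K" for k using K[of k] by (intro pos_bound pos) simp
  hence "nm (rsc K \<one> - a) \<le> K" using conv_norm_le[OF conv_diff[OF conv_const s], of "rsc K \<one>" K] by simp
  moreover have "st a = a" using conv_unique[OF conv_star[OF s]] s pos by (simp add: posD)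
  ultimately show ?thesis by (intro posI_bound) (auto simp: sa_def)
qed

lemma commute_root:
  assumes "pos a" "c \<in> car" "c \<odot> a = a \<odot> c"
  obtains s where "sa s" "s \<odot> s = a" "pos s" "c \<odot> s = s \<odot> c"
proof -
  obtain s where s: "sa s" "s \<odot> s = a" "pos s" "\<And>U. \<lbrakk>closed_alg U; a \<in> U; \<one> \<in> U\<rbrakk> \<Longrightarrow> s \<in> U"
    using pos_root[OF assms(1)] by metis
  moreover have "c \<odot> s = s \<odot> c" using s(4)[OF closed_alg_commutant[OF assms(2)]] assms by (simp add: posD)
  ultimately show ?thesis using that by blast
qed

text \<open>Commuting square roots \<open>s\<close>, \<open>r\<close> of \<open>a\<close> and \<open>b\<close> give the modulus square
  \<open>(s + i r)\<^sup>* (s + i r) = a + b\<close>.\<close>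

lemma commuting_sum_modulus:
  assumes a: "pos a" and b: "pos b" and comm: "a \<odot> b = b \<odot> a"
  obtains s z where "sa s" "s \<odot> s = a" "z \<in> car" "st z \<odot> z = a + b" "s + s = z + st z"
proof -
  obtain s where s: "sa s" "s \<odot> s = a" "b \<odot> s = s \<odot> b"
    using commute_root[OF a posD(1)[OF b]] comm by metis
  obtain r where r: "sa r" "r \<odot> r = b" "s \<odot> r = r \<odot> s"
    using commute_root[OF b saD(1)[OF s(1)]] s(3) by metis
  note [simp] = saD[OF s(1)] saD[OF r(1)]
  let ?z = "s + \<i> *\<^sub>C r"
  have "st ?z \<odot> ?z = a + b"
    by (simp add: expand r s(2) cv.scale_right_distrib cv.scale_right_diff_distrib)
  moreover have "s + s = ?z + st ?z" by (simp add: expand)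
  ultimately show ?thesis using that[of s ?z] s by simp
qed

text \<open>For the pair \<open>a\<close>, \<open>- a\<close> the modulus square of \<open>z\<close>
  is 0. So \<open>z\<close> vanishes, and with it its real part \<open>s\<close>, whose square is
  \<open>a\<close>.\<close>

lemma pos_antisym: assumes a: "pos a" "pos (- a)" shows "a = 0"
proof -
  obtain s z where s: "sa s" "s \<odot> s = a" "z \<in> car" "st z \<odot> z = 0" "s + s = z + st z"
    using commuting_sum_modulus[OF a] by (auto simp: mul_minus posD[OF a(1)])
  have "z = 0" using cstar_id[OF s(3)] s(3,4) by (simp add: eq_0)
  hence "2 *\<^sub>C s = 0" using s(5) by (simp add: scaleC_two)
  thus ?thesis using s(2) by auto
qed

text \<open>For the pair \<open>a\<close>, \<open>t - a\<close> the modulus square is the scalar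
  \<open>t\<close>; hence \<open>z\<close> and its real part \<open>s\<close> have norm at most
  \<open>sqrt t\<close>.\<close>

lemma pos_le_one_norm: assumes a: "pos a" "pos (rsc t \<one> - a)" "t \<ge> 0" shows "nm a \<le> t"
proof -
  note [simp] = posD(1,2)[OF a(1)]
  obtain s z where s: "sa s" "s \<odot> s = a" "z \<in> car" "st z \<odot> z = rsc t \<one>" "s + s = z + st z"
    using commuting_sum_modulus[OF a(1,2)] by (auto simp: expand)
  have "(nm z)\<^sup>2 \<le> t" using cstar_id[OF s(3)] s(4) norm_rsc[of \<one> t] norm_unit a(3)
    mult_left_mono[of "nm \<one>" 1 t] by simp
  hence z: "nm z \<le> sqrt t" by (rule real_le_rsqrt)
  have "2 * nm s = nm (2 *\<^sub>C s)" using saD[OF s(1)] norm_scale[of s 2] by simp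
  also have "\<dots> \<le> nm z + nm (st z)" unfolding scaleC_two s(5) using s(3) by (intro tri) auto
  finally have "nm s \<le> sqrt t" using z norm_star[OF s(3)] by simp
  hence "(nm s)\<^sup>2 \<le> t" using power_mono[of "nm s" "sqrt t" 2] a(3) nonneg[of s] saD[OF s(1)] by simp
  thus ?thesis using norm_sa_sq[OF s(1)] s(2) by simp
qed

lemma pos_one_minus: assumes "sa x" "nm x \<le> t" shows "pos (rsc t \<one> - x)"
  using assms nonneg[of x] by (intro posI_bound[where t = t] sa_intros) (auto simp: saD)

lemma pos_norm_mono: assumes "pos a" "pos (b - a)" shows "nm a \<le> nm b"
proof -
  have b: "pos b" using pos_add[OF assms] by simp
  have "pos ((rsc (nm b) \<one> - b) + (b - a))" 
    by (rule pos_add[OF pos_one_minus[OF posD(3)[OF b] order_refl] assms(2)])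
  thus ?thesis using assms(1) nonneg[of b] posD[OF b] by (intro pos_le_one_norm) auto
qed

text \<open>In terms of functions, \<open>f\<close> equals 0 or \<open>m\<close> at each point.
  After rescaling, the powers of \<open>1 - f'\<close> have the form \<open>1 - f' S(k)\<close> with
  \<open>S(k + 1) = 1 + (1 - m') S(k)\<close>. As \<open>1 - m'\<close> has norm at most 1, the
  powers grow at most linearly, and \<open>norm_le_1_of_growth\<close> applies.\<close>

lemma pos_of_idempotent_relation:
  assumes f: "sa f" and m: "pos m" and fm: "f \<odot> f = f \<odot> m"
  shows "pos f"
proof -
  obtain t where t: "t > 0" "nm (rsc t \<one> - m) \<le> t" using pos_strict_bound[OF m] .
  note [simp] = saD[OF f] posD(1,2)[OF m]
  define f' m' where "f' = rsc (1/t) f" and "m' = rsc (1/t) m"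
  have [simp]: "f' \<in> car" "m' \<in> car" "st f' = f'" "st m' = m'" by (auto simp: f'_def m'_def star_scale)
  have ff: "f' \<odot> f' = f' \<odot> m'" by (simp add: f'_def m'_def expand fm)
  have "\<one> - m' = rsc (1/t) (rsc t \<one> - m)" using t by (simp add: m'_def cv.scale_right_diff_distrib)
  hence nm': "nm (\<one> - m') \<le> 1" using t norm_rescale_le by simp
  have "\<exists>S\<in>car. nm S \<le> real k \<and> pw (\<one> - f') k = \<one> - f' \<odot> S" for k
  proof (induction k)
    case (Suc k)
    then obtain S where S: "S \<in> car" "nm S \<le> real k" "pw (\<one> - f') k = \<one> - f' \<odot> S" by auto
    let ?S = "\<one> + (\<one> - m') \<odot> S"
    have ffS: "f' \<odot> (f' \<odot> S) = f' \<odot> (m' \<odot> S)" using S(1) ff mul_assoc[of f' f' S] by (simp add: mul_assoc)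
    have "pw (\<one> - f') (Suc k) = (\<one> - f') \<odot> (\<one> - f' \<odot> S)" by (simp add: S(3))
    also have "\<dots> = \<one> - f' \<odot> ?S" using S(1) by (simp add: expand ffS algebra_simps)
    finally have "pw (\<one> - f') (Suc k) = \<one> - f' \<odot> ?S" .
    moreover have "nm ((\<one> - m') \<odot> S) \<le> 1 * real k"
      using S nm' nonneg[of "\<one> - m'"] nonneg[of S] by (intro order_trans[OF norm_mul] mult_mono) auto
    hence "nm ?S \<le> real (Suc k)" using tri[of \<one> "(\<one> - m') \<odot> S"] S(1) norm_unit by simp
    ultimately show ?case using S(1) by (intro bexI[of _ ?S]) auto
  qed (auto intro!: bexI[of _ 0])
  hence "nm (pw (\<one> - f') k) \<le> 1 + real k * nm f'" for k
  proof -
    obtain S where S: "S \<in> car" "nm S \<le> real k" "pw (\<one> - f') k = \<one> - f' \<odot> S"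
      using \<open>\<exists>S\<in>car. nm S \<le> real k \<and> pw (\<one> - f') k = \<one> - f' \<odot> S\<close> by auto
    have "nm (f' \<odot> S) \<le> nm f' * real k"
      using S nonneg[of f'] by (intro order_trans[OF norm_mul] mult_left_mono) auto
    thus ?thesis using S norm_diff_le[of \<one> "f' \<odot> S"] norm_unit by (simp add: mult.commute)
  qed
  hence "nm (\<one> - f') \<le> 1" by (intro norm_le_1_of_growth) (auto simp: sa_def star_diff)
  hence "pos f'" by (intro posI_bound[where t = 1]) (auto simp: sa_def)
  from pos_scale[OF this, of t] show ?thesis using t by (simp add: f'_def)
qed

text \<open>Replaces the equality of the nonzero spectra of \<open>d\<^sup>* d\<close> and
  \<open>d d\<^sup>*\<close>: the powers of \<open>1 + e e\<^sup>*\<close> are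
  \<open>1 + e S(k) e\<^sup>*\<close> with \<open>S(k + 1) = 1 + (1 + e\<^sup>* e) S(k)\<close>. So
  the norm bound 1 for \<open>1 + e\<^sup>* e\<close> gives linear growth and passes to
  \<open>1 + e e\<^sup>*\<close>.\<close>

lemma neg_star_swap:
  assumes d: "d \<in> car" and neg: "pos (- (st d \<odot> d))"
  shows "pos (- (d \<odot> st d))"
proof -
  obtain t where t: "t > 0" "nm (rsc t \<one> - - (st d \<odot> d)) \<le> t" using pos_strict_bound[OF neg] .
  define e where "e = rsc (1 / sqrt t) d"
  have [simp]: "e \<in> car" using d by (simp add: e_def)
  have ee: "st e \<odot> e = rsc (1/t) (st d \<odot> d)" "e \<odot> st e = rsc (1/t) (d \<odot> st d)"
    using d t by (simp_all add: e_def expand flip: of_real_mult)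
  have "\<one> + st e \<odot> e = rsc (1/t) (rsc t \<one> - - (st d \<odot> d))"
    using t by (simp add: ee cv.scale_right_distrib)
  hence n1: "nm (\<one> + st e \<odot> e) \<le> 1"
    using t norm_rescale_le[of "rsc t \<one> - - (st d \<odot> d)" t] d by simp
  have "\<exists>S\<in>car. nm S \<le> real k \<and> pw (\<one> + e \<odot> st e) k = \<one> + e \<odot> (S \<odot> st e)" for k
  proof (induction k)
    case (Suc k)
    then obtain S where S: "S \<in> car" "nm S \<le> real k" "pw (\<one> + e \<odot> st e) k = \<one> + e \<odot> (S \<odot> st e)" by auto
    let ?S = "\<one> + (\<one> + st e \<odot> e) \<odot> S"
    have "pw (\<one> + e \<odot> st e) (Suc k) = \<one> + e \<odot> (?S \<odot> st e)" using S by (simp add: expand algebra_simps)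
    moreover have "nm ((\<one> + st e \<odot> e) \<odot> S) \<le> 1 * real k"
      using S n1 nonneg[of "\<one> + st e \<odot> e"] nonneg[of S] by (intro order_trans[OF norm_mul] mult_mono) auto
    hence "nm ?S \<le> real (Suc k)" using tri[of \<one> "(\<one> + st e \<odot> e) \<odot> S"] S(1) norm_unit by simp
    ultimately show ?case using S(1) by (intro bexI[of _ ?S]) auto
  qed (auto intro!: bexI[of _ 0])
  hence "nm (pw (\<one> + e \<odot> st e) k) \<le> 1 + real k * (nm e * nm e)" for k
  proof -
    obtain S where S: "S \<in> car" "nm S \<le> real k" "pw (\<one> + e \<odot> st e) k = \<one> + e \<odot> (S \<odot> st e)"
      using \<open>\<exists>S\<in>car. nm S \<le> real k \<and> pw (\<one> + e \<odot> st e) k = \<one> + e \<odot> (S \<odot> st e)\<close> by auto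
    have "nm (S \<odot> st e) \<le> real k * nm e" using S nonneg[of e] norm_star[of e]
      by (intro order_trans[OF norm_mul]) (auto intro: mult_right_mono simp: norm_star)
    hence "nm (e \<odot> (S \<odot> st e)) \<le> nm e * (real k * nm e)"
      using S nonneg[of e] norm_mul[of e "S \<odot> st e"] mult_left_mono[of "nm (S \<odot> st e)" "real k * nm e" "nm e"]
      by simp
    thus ?thesis using S tri[of \<one> "e \<odot> (S \<odot> st e)"] norm_unit by (simp add: mult.left_commute)
  qed
  hence "nm (\<one> + e \<odot> st e) \<le> 1" by (intro norm_le_1_of_growth) (simp_all add: sa_def expand)
  hence "pos (- (e \<odot> st e))" by (intro posI_bound[where t = 1]) (simp_all add: sa_def expand)
  from pos_scale[OF this, of t] show ?thesis using t by (simp add: ee)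
qed

text \<open>Let \<open>m\<close> be the absolute value of \<open>a = c\<^sup>* c\<close>, so that
  \<open>f = m - a\<close> is twice the negative part. Then \<open>d = c f\<close> has
  \<open>d\<^sup>* d = f a f = - f\<^sup>3 / 2 \<le> 0\<close>, hence
  \<open>d d\<^sup>* \<le> 0\<close> too. But \<open>d\<^sup>* d + d d\<^sup>*\<close> is a positive
  multiple of a sum of two squares of self-adjoint elements, which forces \<open>f = 0\<close> and
  \<open>a = m\<close>.\<close>

theorem pos_star_mul:
  assumes c: "c \<in> car"
  shows "pos (st c \<odot> c)"
proof -
  define a where "a = st c \<odot> c"
  have a: "sa a" using c by (auto simp: a_def intro: sa_intros)
  note [simp] = saD[OF a] c
  obtain m where m: "sa m" "m \<odot> m = a \<odot> a" "pos m" "a \<odot> m = m \<odot> a"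
    using commute_root[OF pos_sq[OF a] saD(1)[OF a]] by (auto simp: mul_assoc)
  note [simp] = saD[OF m(1)]
  define f where "f = m - a"
  have f: "sa f" using a m by (auto simp: f_def intro: sa_intros)
  note [simp] = saD[OF f]
  have "f \<odot> f = f \<odot> (m + m)" by (simp add: f_def expand m(2,4) algebra_simps)
  hence posf: "pos f" using f m by (intro pos_of_idempotent_relation[OF f pos_add]) auto
  have faf: "(f \<odot> a) \<odot> f + (f \<odot> a) \<odot> f = - ((f \<odot> f) \<odot> f)"
  proof -
    have fa: "f \<odot> a = - (f \<odot> m)" by (simp add: f_def expand m(2,4))
    have "f \<odot> a + f \<odot> a = - (f \<odot> f)"
      by (simp add: f_def expand m(2,4) algebra_simps)
    thus ?thesis by (simp add: mul_minus(2) flip: mul_add_left)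
  qed
  obtain s where s: "sa s" "s \<odot> s = f" "f \<odot> s = s \<odot> f"
    using commute_root[OF posf saD(1)[OF f]] by auto
  note [simp] = saD[OF s(1)]
  have "sa (f \<odot> s)" by (auto simp: sa_def star_mul s(3))
  \<comment> \<open>The cube of \<open>f\<close> is the square of \<open>f s\<close>, where
    \<open>s\<close> is the root of \<open>f\<close>.\<close>
  from pos_sq[OF this] have f3: "pos ((f \<odot> f) \<odot> f)"
  proof -
    have "s \<odot> (f \<odot> s) = f \<odot> (s \<odot> s)" using s(3) mul_assoc[of s f s] mul_assoc[of f s s] by simp
    hence "(f \<odot> s) \<odot> (f \<odot> s) = (f \<odot> f) \<odot> (s \<odot> s)"
      using mul_assoc[of f s "f \<odot> s"] mul_assoc[of f f "s \<odot> s"] by simp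
    thus ?thesis using \<open>pos (f \<odot> s \<odot> (f \<odot> s))\<close> s(2) by simp
  qed
  define d where "d = c \<odot> f"
  have [simp]: "d \<in> car" by (simp add: d_def)
  have dd: "st d \<odot> d = (f \<odot> a) \<odot> f" by (simp add: d_def a_def expand)
  have "pos (- (st d \<odot> d + st d \<odot> d))" using f3 faf by (simp add: dd)
  from pos_scale[OF this, of "1/2"] have neg: "pos (- (st d \<odot> d))"
    by (simp flip: scaleC_two)
  have neg': "pos (- (d \<odot> st d))" by (rule neg_star_swap[OF _ neg]) simp
  let ?h = "d + st d" and ?k = "\<i> *\<^sub>C (d - st d)"
  have "sa ?h" "sa ?k" by (auto simp: sa_def expand cv.scale_right_diff_distrib)
  hence "pos (?h \<odot> ?h + ?k \<odot> ?k)" by (intro pos_add pos_sq)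
  also have "?h \<odot> ?h + ?k \<odot> ?k = (st d \<odot> d + st d \<odot> d) + (d \<odot> st d + d \<odot> st d)"
    by (simp add: expand algebra_simps cv.scale_right_diff_distrib)
  finally have "pos (((st d \<odot> d + st d \<odot> d) + (d \<odot> st d + d \<odot> st d)) + (- (d \<odot> st d) + - (d \<odot> st d)))"
    by (rule pos_add[OF _ pos_add[OF neg' neg']])
  hence "pos (st d \<odot> d + st d \<odot> d)" by (simp add: algebra_simps)
  hence "st d \<odot> d + st d \<odot> d = 0" using \<open>pos (- (st d \<odot> d + st d \<odot> d))\<close> by (rule pos_antisym)
  hence "(f \<odot> f) \<odot> f = 0" using faf by (simp add: dd)
  hence "(f \<odot> f) \<odot> (f \<odot> f) = 0" using mul_assoc[of "f \<odot> f" f f] by simp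
  hence "((nm f)\<^sup>2)\<^sup>2 = 0" using norm_sa_sq[OF f] norm_sa_sq[OF sa_intros(9)[OF f]] by simp
  hence "f = 0" using eq_0[of f] by simp
  thus ?thesis using m(3) by (simp add: f_def a_def)
qed

lemma cpos_iff: "cpos A a \<longleftrightarrow> pos a"
proof
  assume "pos a"
  then obtain s where "sa s" "s \<odot> s = a" using pos_root by metis
  thus "cpos A a" by (auto simp: cpos_def sa_def intro!: bexI[of _ s])
qed (auto simp: cpos_def pos_star_mul)

lemma pos_conj: assumes "pos a" "b \<in> car" shows "pos (st b \<odot> (a \<odot> b))"
proof -
  obtain s where s: "sa s" "s \<odot> s = a" using pos_root[OF assms(1)] by metis
  have "st b \<odot> (a \<odot> b) = st (s \<odot> b) \<odot> (s \<odot> b)" using s assms by (simp add: expand sa_def flip: s(2))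
  thus ?thesis using pos_star_mul[of "s \<odot> b"] s assms by (simp add: sa_def)
qed

definition leq (infix "\<sqsubseteq>" 50) where "a \<sqsubseteq> b \<longleftrightarrow> pos (b - a)"

lemma leq_sum: "(\<And>i. i \<in> I \<Longrightarrow> f i \<sqsubseteq> g i) \<Longrightarrow> (\<Sum>i\<in>I. f i) \<sqsubseteq> (\<Sum>i\<in>I. g i)"
  using pos_sum[of I "\<lambda>i. g i - f i"] by (simp add: leq_def sum_subtractf)

lemma pos_leq_norm: "pos a \<Longrightarrow> a \<sqsubseteq> b \<Longrightarrow> nm a \<le> nm b"
  using pos_norm_mono by (simp add: leq_def)

end

section \<open>Adjointable operators on Hilbert modules\<close>

lemma scaleC_apply: "(c *\<^sub>C f) x = c *\<^sub>C f x" by (simp add: scaleC_fun_def)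

lemma cunit_eqI: "is_cunit A u \<Longrightarrow> cunit A = u"
  unfolding cunit_def by (rule the_equality) (assumption, metis is_cunit_def)

context normed_carrier
begin

lemma op_norm_le:
  assumes "\<And>x. x \<in> S \<Longrightarrow> n (f x) \<le> C * n x" "0 \<le> C" shows "op_norm S n f \<le> C"
  unfolding op_norm_def
proof (rule cSUP_least)
  fix x assume x: "x \<in> S"
  show "n (f x) / n x \<le> C"
    using assms(1)[OF x] assms(2) nonneg[OF x] by (cases "n x = 0") (auto simp: divide_simps mult.commute)
qed (use zero_in in blast)

lemma bounded_op_bdd:
  assumes "bounded_on S n f" "\<And>x. x \<in> S \<Longrightarrow> f x \<in> S"
  shows "bdd_above ((\<lambda>x. n (f x) / n x) ` S)"
proof -
  obtain C where C: "\<And>x. x \<in> S \<Longrightarrow> n (f x) \<le> C * n x" using assms by (auto simp: bounded_on_def)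
  \<comment> \<open>On the zero space \<open>bounded_on\<close> admits negative constants, while the
    quotient at 0 is 0; hence the absolute value.\<close>
  show ?thesis
  proof (rule bdd_aboveI2[where M = "\<bar>C\<bar>"])
    fix x assume x: "x \<in> S"
    have "C * n x \<le> \<bar>C\<bar> * n x" using nonneg[OF x] by (intro mult_right_mono) auto
    with C[OF x] have "n (f x) \<le> \<bar>C\<bar> * n x" by linarith
    thus "n (f x) / n x \<le> \<bar>C\<bar>"
      using nonneg[OF x] by (cases "n x = 0") (auto simp: divide_simps)
  qed
qed

lemma le_op_norm:
  assumes f: "bounded_on S n f" "\<And>x. x \<in> S \<Longrightarrow> f x \<in> S" and x: "x \<in> S"
  shows "n (f x) \<le> op_norm S n f * n x"
proof (cases "n x = 0")
  case True
  thus ?thesis using f x by (auto simp: bounded_on_def)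
next
  case False
  have "n (f x) / n x \<le> op_norm S n f"
    unfolding op_norm_def by (rule cSUP_upper[OF x bounded_op_bdd[OF f]])
  thus ?thesis using False nonneg[OF x] by (simp add: divide_simps)
qed

lemma op_norm_nonneg:
  assumes "bounded_on S n f" "\<And>x. x \<in> S \<Longrightarrow> f x \<in> S"
  shows "0 \<le> op_norm S n f"
proof -
  have "n (f 0) / n 0 \<le> op_norm S n f"
    unfolding op_norm_def by (rule cSUP_upper[OF zero_in bounded_op_bdd[OF assms]])
  thus ?thesis by simp
qed

end

locale hmod = A: cstar_alg A + hilbert_module A X
  for A :: "'b::complex_vector cstar_data" and X :: "('x::complex_vector, 'b) hmodule"
begin

abbreviation "H \<equiv> hcar X"
abbreviation "ip \<equiv> hip X"
abbreviation "act \<equiv> hact X"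
abbreviation "hn \<equiv> hnorm A X"

context
  notes [simp] = cv.subspace_0[OF subspace] cv.subspace_add[OF subspace] cv.subspace_diff[OF subspace]
    cv.subspace_scale[OF subspace] cv.subspace_neg[OF subspace] act_closed ip_closed
begin

lemma ip_linear: "x \<in> H \<Longrightarrow> clinear_map H (ip x)"
  by (auto intro!: clinear_map.intro clinear_onI subspace simp: ip_add ip_scale)

lemma ip_zero [simp]: "x \<in> H \<Longrightarrow> ip x 0 = 0" by (rule clinear_map.zero[OF ip_linear])

lemma ip_diff: "\<lbrakk>x \<in> H; y \<in> H; z \<in> H\<rbrakk> \<Longrightarrow> ip x (y - z) = ip x y - ip x z"
  by (rule clinear_map.diff[OF ip_linear])

lemma ip_sum: "\<lbrakk>x \<in> H; \<And>i. i \<in> I \<Longrightarrow> f i \<in> H\<rbrakk> \<Longrightarrow> ip x (\<Sum>i\<in>I. f i) = (\<Sum>i\<in>I. ip x (f i))"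
  by (rule clinear_map.sum[OF ip_linear])

lemma ip_add_left: "\<lbrakk>x \<in> H; y \<in> H; z \<in> H\<rbrakk> \<Longrightarrow> ip (x + y) z = ip x z + ip y z"
  by (metis ip_star ip_add A.star_add ip_closed cv.subspace_add[OF subspace])

lemma ip_scale_left: "\<lbrakk>x \<in> H; y \<in> H\<rbrakk> \<Longrightarrow> ip (c *\<^sub>C x) y = cnj c *\<^sub>C ip x y"
  by (metis ip_star ip_scale A.star_scale ip_closed cv.subspace_scale[OF subspace])

lemma ip_diff_left: "\<lbrakk>x \<in> H; y \<in> H; z \<in> H\<rbrakk> \<Longrightarrow> ip (x - y) z = ip x z - ip y z"
  using ip_add_left[of x "- y" z] ip_scale_left[of y z "-1"] by simp

lemma ip_zero_left [simp]: "x \<in> H \<Longrightarrow> ip 0 x = 0"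
  using ip_scale_left[of 0 x 0] by simp

lemma ip_sum_left:
  assumes "y \<in> H" "\<And>i. i \<in> I \<Longrightarrow> f i \<in> H" shows "ip (\<Sum>i\<in>I. f i) y = (\<Sum>i\<in>I. ip (f i) y)"
  using assms(2)
  by (induction I rule: infinite_finite_induct)
    (auto simp: assms(1) ip_add_left cv.subspace_sum[OF subspace])

lemma ip_act_left: "\<lbrakk>x \<in> H; y \<in> H; a \<in> ccar A\<rbrakk> \<Longrightarrow> ip (act x a) y = cmul A (cstar A a) (ip x y)"
  by (metis ip_star ip_act A.star_mul ip_closed act_closed)

lemma ip_self_pos: "x \<in> H \<Longrightarrow> A.pos (ip x x)" using ip_pos A.cpos_iff by blast

lemma hn_sq: "x \<in> H \<Longrightarrow> (hn x)\<^sup>2 = cnorm A (ip x x)"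
  by (simp add: hnorm_def A.nonneg)

lemma cauchy_schwarz_leq:
  assumes x: "x \<in> H" and y: "y \<in> H"
  shows "A.leq (cmul A (ip y x) (ip x y)) (rsc ((hn x)\<^sup>2) (ip y y))"
proof (cases "x = 0")
  case True thus ?thesis using y by (simp add: A.leq_def hnorm_def)
next
  case False
  note [simp] = x y
  define r where "r = (hn x)\<^sup>2"
  have r: "r > 0" using False ip_definite[OF x] A.eq_0[of "ip x x"] A.nonneg[of "ip x x"]
    by (auto simp: r_def hn_sq less_le)
  define a where "a = ip x y"
  have [simp]: "a \<in> ccar A" by (simp add: a_def)
  have a': "ip y x = cstar A a" by (simp add: a_def ip_star)
  \<comment> \<open>In the scalar case this is the multiple \<open>- r\<close> of the component of
    \<open>y\<close> orthogonal to \<open>x\<close>. Over \<open>A\<close> the element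
    \<open>ip x x\<close> need not be the scalar \<open>r\<close>, and the added positive term
    \<open>a\<^sup>* (r - ip x x) a\<close> compensates.\<close>
  let ?z = "act x a - rsc r y"
  have "A.pos (ip ?z ?z)" by (rule ip_self_pos) simp
  moreover have "A.pos (cmul A (cstar A a) (cmul A (rsc r (cunit A) - ip x x) a))"
    using r by (intro A.pos_conj A.pos_one_minus A.posD(3) ip_self_pos) (auto simp: r_def hn_sq)
  ultimately have "A.pos (ip ?z ?z + cmul A (cstar A a) (cmul A (rsc r (cunit A) - ip x x) a))"
    by (rule A.pos_add)
  also have "ip ?z ?z + cmul A (cstar A a) (cmul A (rsc r (cunit A) - ip x x) a) =
      rsc r (rsc r (ip y y) - cmul A (cstar A a) a)"
    by (simp add: ip_diff ip_diff_left ip_scale ip_scale_left ip_act ip_act_left A.expand a'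
        flip: a_def) (simp add: cv.scale_right_diff_distrib)
  finally have "A.pos (rsc r (rsc r (ip y y) - cmul A (cstar A a) a))" .
  from A.pos_scale[OF this, of "1/r"] show ?thesis using r by (simp add: A.leq_def a' flip: r_def a_def)
qed

lemma cauchy_schwarz:
  assumes x: "x \<in> H" and y: "y \<in> H" shows "cnorm A (ip x y) \<le> hn x * hn y"
proof -
  have "(cnorm A (ip x y))\<^sup>2 = cnorm A (cmul A (ip y x) (ip x y))"
    using A.cstar_id[of "ip x y"] x y by (simp add: ip_star)
  also have "\<dots> \<le> cnorm A (rsc ((hn x)\<^sup>2) (ip y y))"
    using A.pos_leq_norm[OF _ cauchy_schwarz_leq[OF x y]] A.pos_star_mul[of "ip x y"] x y
    by (simp add: ip_star)
  also have "\<dots> = (hn x * hn y)\<^sup>2" using A.norm_rsc[of "ip y y" "(hn x)\<^sup>2"] x y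
    by (simp add: hn_sq power_mult_distrib A.nonneg)
  finally show ?thesis by (rule power2_le_imp_le) (use x y in \<open>simp add: hnorm_def A.nonneg\<close>)
qed

lemma hnorm_scale: assumes "x \<in> H" shows "hn (c *\<^sub>C x) = cmod c * hn x"
proof -
  have "ip (c *\<^sub>C x) (c *\<^sub>C x) = (c * cnj c) *\<^sub>C ip x x"
    using assms by (simp add: ip_scale ip_scale_left)
  hence "cnorm A (ip (c *\<^sub>C x) (c *\<^sub>C x)) = (cmod c)\<^sup>2 * cnorm A (ip x x)"
    using A.norm_scale[of "ip x x" "c * cnj c"] assms by (simp add: norm_mult power2_eq_square)
  thus ?thesis by (simp add: hnorm_def real_sqrt_mult)
qed

lemma hnorm_tri: assumes x: "x \<in> H" and y: "y \<in> H" shows "hn (x + y) \<le> hn x + hn y"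
proof (rule power2_le_imp_le)
  note [simp] = x y
  have "(hn (x + y))\<^sup>2 = cnorm A ((ip x x + ip x y) + (ip y x + ip y y))"
    by (simp add: hn_sq ip_add ip_add_left algebra_simps)
  also have "\<dots> \<le> (cnorm A (ip x x) + cnorm A (ip x y)) + (cnorm A (ip y x) + cnorm A (ip y y))"
    by (intro order_trans[OF A.tri] add_mono A.tri) auto
  also have "\<dots> \<le> ((hn x)\<^sup>2 + hn x * hn y) + (hn y * hn x + (hn y)\<^sup>2)"
    by (intro add_mono cauchy_schwarz) (auto simp: hn_sq)
  also have "\<dots> = (hn x + hn y)\<^sup>2" by (simp add: power2_eq_square algebra_simps)
  finally show "(hn (x + y))\<^sup>2 \<le> (hn x + hn y)\<^sup>2" .
qed (simp add: x y hnorm_def A.nonneg)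

lemma hnorm_eq_0: "x \<in> H \<Longrightarrow> hn x = 0 \<longleftrightarrow> x = 0"
  using ip_definite[of x] by (auto simp: hnorm_def A.eq_0)

end

lemmas [simp] = act_closed ip_closed

sublocale X: normed_carrier H hn
  by (rule normed_carrier.intro) (simp_all add: subspace hnorm_eq_0 hnorm_tri hnorm_scale, simp add: hnorm_def A.nonneg)

lemma norm_ip_self: "x \<in> H \<Longrightarrow> cnorm A (ip x x) = (hn x)\<^sup>2" by (simp add: hn_sq)

lemma ip_nondeg: assumes "x \<in> H" "\<And>y. y \<in> H \<Longrightarrow> ip y x = 0" shows "x = 0"
  using assms ip_definite by blast

lemma ip_eqI: assumes "x \<in> H" "z \<in> H" "\<And>y. y \<in> H \<Longrightarrow> ip y x = ip y z" shows "x = z"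
  using ip_nondeg[of "x - z"] assms by (simp add: ip_diff)

lemma conv_ip_right: assumes x: "x \<in> H" and s: "X.conv s y" shows "A.conv (\<lambda>k. ip x (s k)) (ip x y)"
  by (rule bounded_conv[OF X.normed_carrier_axioms A.normed_carrier_axioms _ _ _ s, where C = "hn x"])
    (use x in \<open>auto simp: ip_diff cauchy_schwarz\<close>)

lemma conv_ip_left: assumes "x \<in> H" "X.conv s y" shows "A.conv (\<lambda>k. ip (s k) x) (ip y x)"
  using A.conv_star[OF conv_ip_right[OF assms]] assms X.convD[OF assms(2)] by (simp add: ip_star)

lemma conv_ip:
  assumes s: "X.conv s x" and t: "X.conv t y" shows "A.conv (\<lambda>k. ip (s k) (t k)) (ip x y)"
proof (rule A.convI_le[where r = "\<lambda>k. hn (s k) * hn (t k - y) + hn (s k - x) * hn y"])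
  note [simp] = X.convD(1,2)[OF s] X.convD(1,2)[OF t]
  show "(\<lambda>k. hn (s k) * hn (t k - y) + hn (s k - x) * hn y) \<longlonglongrightarrow> 0"
    by (rule tendsto_eq_intros X.conv_norm[OF s] X.convD(3)[OF s] X.convD(3)[OF t] refl)+ simp
  fix k
  have eq: "ip (s k) (t k) - ip x y = ip (s k) (t k - y) + ip (s k - x) y"
    by (simp add: ip_diff ip_diff_left)
  show "cnorm A (ip (s k) (t k) - ip x y) \<le> hn (s k) * hn (t k - y) + hn (s k - x) * hn y"
    unfolding eq by (intro order_trans[OF A.tri] add_mono cauchy_schwarz) auto
qed (use X.convD[OF s] X.convD[OF t] in simp_all)

section \<open>The \<open>C\<^sup>*\<close>-algebra of adjointable operators\<close>

abbreviation "Adj \<equiv> adjointable_algebra A X"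
abbreviation "ops \<equiv> adjointable_ops A X"
abbreviation "opn \<equiv> op_norm H hn"
abbreviation "adj \<equiv> adjoint_op X"

lemma Adj_simps [simp]: "ccar Adj = ops" "cmul Adj S R = S \<circ> R" "cstar Adj = adj" "cnorm Adj = opn"
  by (simp_all add: adjointable_algebra_def)

text \<open>The formal adjoint \<open>S'\<close> makes \<open>S\<close> linear, because inner
  products separate the points of the module.\<close>

lemma opsI:
  assumes S: "\<And>x. x \<in> H \<Longrightarrow> S x \<in> H" "\<And>x. x \<notin> H \<Longrightarrow> S x = 0"
    and S': "\<And>x. x \<in> H \<Longrightarrow> S' x \<in> H"
    and ip: "\<And>x y. \<lbrakk>x \<in> H; y \<in> H\<rbrakk> \<Longrightarrow> ip (S x) y = ip x (S' y)"
    and bd: "\<And>x. x \<in> H \<Longrightarrow> hn (S x) \<le> C * hn x"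
  shows "S \<in> ops"
proof -
  have "clinear_on H S"
    by (rule clinear_onI; rule ip_eqI; (simp add: S)?)
      (metis S S' X.add_in X.scale_in ip ip_star ip_add ip_scale)+
  moreover have "bounded_on H hn S" unfolding bounded_on_def using bd by blast
  ultimately show ?thesis using S S' ip unfolding adjointable_ops_def bounded_op_def
    by (intro CollectI conjI allI ballI impI exI[of _ S']) simp_all
qed

lemma opsD:
  assumes "S \<in> ops"
  shows "x \<in> H \<Longrightarrow> S x \<in> H" "x \<notin> H \<Longrightarrow> S x = 0" "clinear_on H S" "bounded_on H hn S" "clinear_map H S"
  using assms subspace by (auto simp: adjointable_ops_def bounded_op_def clinear_map_def)

lemma ops_ext: assumes "S \<in> ops" "R \<in> ops" "\<And>x. x \<in> H \<Longrightarrow> S x = R x" shows "S = R"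
proof
  show "S x = R x" for x using assms by (cases "x \<in> H") (simp_all add: opsD(2))
qed

lemma adj_spec:
  assumes S: "S \<in> ops" and y: "y \<in> H"
  shows "adj S y \<in> H" "\<And>x. x \<in> H \<Longrightarrow> ip (S x) y = ip x (adj S y)"
proof -
  obtain S' where S': "\<And>y. y \<in> H \<Longrightarrow> S' y \<in> H" "\<And>x y. \<lbrakk>x \<in> H; y \<in> H\<rbrakk> \<Longrightarrow> ip (S x) y = ip x (S' y)"
    using S unfolding adjointable_ops_def by blast
  let ?P = "\<lambda>z. z \<in> H \<and> (\<forall>x\<in>H. ip (S x) y = ip x z)"
  define z where "z = (THE z. ?P z)"
  have z: "?P z" unfolding z_def
  proof (rule theI)
    show "?P (S' y)" using S' y by blast
    show "z = S' y" if "?P z" for z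
    proof (rule ip_eqI)
      show "ip x z = ip x (S' y)" if "x \<in> H" for x using \<open>?P z\<close> S'(2)[OF that y] that by simp
    qed (use that S'(1)[OF y] in blast)+
  qed
  have "adj S y = z" using y by (simp add: adjoint_op_def z_def)
  with z show "adj S y \<in> H" "\<And>x. x \<in> H \<Longrightarrow> ip (S x) y = ip x (adj S y)" by simp_all
qed

lemma adj_spec': "\<lbrakk>S \<in> ops; x \<in> H; y \<in> H\<rbrakk> \<Longrightarrow> ip (adj S x) y = ip x (S y)"
  by (metis adj_spec ip_star opsD(1))

lemma opn_bound: "\<lbrakk>S \<in> ops; x \<in> H\<rbrakk> \<Longrightarrow> hn (S x) \<le> opn S * hn x"
  by (rule X.le_op_norm) (simp_all add: opsD(1,4))

lemma opn_nonneg: "S \<in> ops \<Longrightarrow> 0 \<le> opn S"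
  by (rule X.op_norm_nonneg) (simp_all add: opsD(1,4))

lemma adj_bound: assumes S: "S \<in> ops" and y: "y \<in> H" shows "hn (adj S y) \<le> opn S * hn y"
proof (cases "hn (adj S y) = 0")
  case False
  note [simp] = adj_spec(1)[OF S y] y
  have "(hn (adj S y))\<^sup>2 = cnorm A (ip (S (adj S y)) y)" using S by (simp add: hn_sq adj_spec)
  also have "\<dots> \<le> hn (S (adj S y)) * hn y" using S by (intro cauchy_schwarz) (simp_all add: opsD(1))
  also have "\<dots> \<le> (opn S * hn (adj S y)) * hn y"
    using S by (intro mult_right_mono opn_bound X.nonneg) auto
  finally have "hn (adj S y) * hn (adj S y) \<le> hn (adj S y) * (opn S * hn y)"
    by (simp add: power2_eq_square mult_ac)
  moreover have "hn (adj S y) > 0" using False X.nonneg[of "adj S y"] by simp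
  ultimately show ?thesis by simp
qed (use S y opn_nonneg X.nonneg in simp)

lemma adj_in: assumes S: "S \<in> ops" shows "adj S \<in> ops"
proof (rule opsI[where S' = S and C = "opn S"])
  show "adj S x = 0" if "x \<notin> H" for x using that by (simp add: adjoint_op_def)
qed (use S in \<open>simp_all add: adj_spec adj_spec' adj_bound opsD(1)\<close>)

lemma adj_eqI:
  assumes "S \<in> ops" "R \<in> ops" "\<And>x y. \<lbrakk>x \<in> H; y \<in> H\<rbrakk> \<Longrightarrow> ip (S x) y = ip x (R y)" shows "adj S = R"
proof (rule ops_ext)
  fix y assume y: "y \<in> H"
  show "adj S y = R y"
    by (rule ip_eqI) (use assms y in \<open>simp_all add: adj_spec(1) opsD(1) flip: adj_spec(2)\<close>)
qed (use assms in \<open>simp_all add: adj_in\<close>)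

lemma adj_adj: "S \<in> ops \<Longrightarrow> adj (adj S) = S"
  by (rule adj_eqI) (auto simp: adj_in adj_spec')

lemma ops_add: assumes "S \<in> ops" "R \<in> ops" shows "S + R \<in> ops"
proof (rule opsI[where S' = "adj S + adj R" and C = "opn S + opn R"])
  fix x assume x: "x \<in> H"
  have "hn (S x + R x) \<le> hn (S x) + hn (R x)" using assms x by (intro X.tri) (simp_all add: opsD(1))
  also have "\<dots> \<le> opn S * hn x + opn R * hn x" using assms x by (intro add_mono opn_bound)
  finally show "hn ((S + R) x) \<le> (opn S + opn R) * hn x" by (simp add: algebra_simps)
qed (use assms in \<open>simp_all add: opsD(1,2) adj_spec ip_add ip_add_left\<close>)

lemma ops_scale: assumes "S \<in> ops" shows "c *\<^sub>C S \<in> ops"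
proof (rule opsI[where S' = "cnj c *\<^sub>C adj S" and C = "cmod c * opn S"])
  fix x assume x: "x \<in> H"
  show "hn ((c *\<^sub>C S) x) \<le> cmod c * opn S * hn x"
    using opn_bound[OF assms x] opsD(1)[OF assms x]
    by (simp add: scaleC_apply X.norm_scale mult.assoc mult_left_mono)
qed (use assms in \<open>simp_all add: scaleC_apply opsD(1,2) adj_spec ip_scale ip_scale_left\<close>)

lemma ops_comp: assumes "S \<in> ops" "R \<in> ops" shows "S \<circ> R \<in> ops"
proof (rule opsI[where S' = "adj R \<circ> adj S" and C = "opn S * opn R"])
  fix x assume x: "x \<in> H"
  have "hn (S (R x)) \<le> opn S * hn (R x)" using assms x by (intro opn_bound) (simp_all add: opsD(1))
  also have "\<dots> \<le> opn S * (opn R * hn x)" using assms x by (intro mult_left_mono opn_bound opn_nonneg)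
  finally show "hn ((S \<circ> R) x) \<le> opn S * opn R * hn x" by (simp add: mult.assoc)
qed (use assms in \<open>simp_all add: opsD(1,2) adj_spec clinear_map.zero[OF opsD(5)]\<close>)

definition idop :: "'x \<Rightarrow> 'x" where "idop x = (if x \<in> H then x else 0)"

lemma idop_in: "idop \<in> ops"
  by (rule opsI[where S' = idop and C = 1]) (auto simp: idop_def)

lemma idop_unit: "is_cunit Adj idop"
proof -
  have "idop (a x) = a x" "a (idop x) = a x" if "a \<in> ops" for a x
    using that by (cases "x \<in> H"; simp add: idop_def opsD(1,2) clinear_map.zero[OF opsD(5)])+
  thus ?thesis by (auto simp: is_cunit_def idop_in fun_eq_iff)
qed

lemma idop_apply [simp]: "x \<in> H \<Longrightarrow> idop x = x" by (simp add: idop_def)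

lemma cunit_Adj [simp]: "cunit Adj = idop" by (rule cunit_eqI[OF idop_unit])

lemma ops_subspace: "csubspace ops"
  using ops_add ops_scale ops_scale[OF idop_in, of 0] by (intro cv.subspaceI) auto

lemma ops_diff: "\<lbrakk>S \<in> ops; R \<in> ops\<rbrakk> \<Longrightarrow> S - R \<in> ops" by (rule cv.subspace_diff[OF ops_subspace])

lemma opn_le: "\<lbrakk>\<And>x. x \<in> H \<Longrightarrow> hn (S x) \<le> C * hn x; 0 \<le> C\<rbrakk> \<Longrightarrow> opn S \<le> C" by (rule X.op_norm_le)

lemma opn_eq_0: assumes S: "S \<in> ops" shows "opn S = 0 \<longleftrightarrow> S = 0"
proof
  assume "opn S = 0"
  have "S x = 0" for x
  proof (cases "x \<in> H")
    case True
    have "hn (S x) \<le> 0" using opn_bound[OF S True] \<open>opn S = 0\<close> by simp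
    thus ?thesis using X.nonneg[of "S x"] X.eq_0[of "S x"] opsD(1)[OF S True] by simp
  qed (use S in \<open>simp add: opsD\<close>)
  thus "S = 0" by auto
next
  assume "S = 0"
  thus "opn S = 0" using opn_nonneg[OF S] opn_le[of S 0] by simp
qed

lemma opn_tri: assumes "S \<in> ops" "R \<in> ops" shows "opn (S + R) \<le> opn S + opn R"
proof (rule opn_le)
  fix x assume x: "x \<in> H"
  have "hn (S x + R x) \<le> hn (S x) + hn (R x)" using assms x by (intro X.tri) (simp_all add: opsD(1))
  also have "\<dots> \<le> opn S * hn x + opn R * hn x" using assms x by (intro add_mono opn_bound)
  finally show "hn ((S + R) x) \<le> (opn S + opn R) * hn x" by (simp add: algebra_simps)
qed (use assms opn_nonneg in simp)

lemma opn_scale_le: assumes "S \<in> ops" shows "opn (c *\<^sub>C S) \<le> cmod c * opn S"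
proof (rule opn_le)
  fix x assume x: "x \<in> H"
  show "hn ((c *\<^sub>C S) x) \<le> cmod c * opn S * hn x"
    using opn_bound[OF assms x] opsD(1)[OF assms x]
    by (simp add: scaleC_apply X.norm_scale mult.assoc mult_left_mono)
qed (use assms opn_nonneg in simp)

lemma opn_scale: assumes "S \<in> ops" shows "opn (c *\<^sub>C S) = cmod c * opn S"
proof (cases "c = 0")
  case True thus ?thesis using opn_scale_le[OF assms, of 0] opn_nonneg[OF ops_scale[OF assms, of 0]] by simp
next
  case False
  have "opn ((1/c) *\<^sub>C c *\<^sub>C S) \<le> cmod (1/c) * opn (c *\<^sub>C S)" by (rule opn_scale_le[OF ops_scale[OF assms]])
  hence "cmod c * opn S \<le> opn (c *\<^sub>C S)" using False by (simp add: norm_divide divide_simps mult.commute)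
  thus ?thesis using opn_scale_le[OF assms] by (intro antisym) auto
qed

lemma opn_comp: assumes "S \<in> ops" "R \<in> ops" shows "opn (S \<circ> R) \<le> opn S * opn R"
proof (rule opn_le)
  fix x assume x: "x \<in> H"
  have "hn (S (R x)) \<le> opn S * hn (R x)" using assms x by (intro opn_bound) (simp_all add: opsD(1))
  also have "\<dots> \<le> opn S * (opn R * hn x)" using assms x by (intro mult_left_mono opn_bound opn_nonneg)
  finally show "hn ((S \<circ> R) x) \<le> opn S * opn R * hn x" by (simp add: mult.assoc)
qed (use assms opn_nonneg in simp)

lemma opn_adj: assumes "S \<in> ops" shows "opn (adj S) = opn S"
proof -
  have "opn (adj S) \<le> opn S" if "S \<in> ops" for S by (intro opn_le adj_bound opn_nonneg that)
  from this[OF assms] this[OF adj_in[OF assms]] show ?thesis by (simp add: adj_adj[OF assms])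
qed

lemma opn_cstar: assumes S: "S \<in> ops" shows "opn (adj S \<circ> S) = (opn S)\<^sup>2"
proof (rule antisym)
  show "opn (adj S \<circ> S) \<le> (opn S)\<^sup>2"
    using opn_comp[OF adj_in[OF S] S] by (simp add: opn_adj[OF S] power2_eq_square)
  have nn: "opn (adj S \<circ> S) \<ge> 0" using S by (intro opn_nonneg ops_comp adj_in)
  have "opn S \<le> sqrt (opn (adj S \<circ> S))"
  proof (rule opn_le)
    fix x assume x: "x \<in> H"
    have "(hn (S x))\<^sup>2 = cnorm A (ip x ((adj S \<circ> S) x))" using S x by (simp add: hn_sq opsD adj_spec)
    also have "\<dots> \<le> hn x * hn ((adj S \<circ> S) x)" using S x by (intro cauchy_schwarz) (simp_all add: opsD(1) adj_in)
    also have "\<dots> \<le> hn x * (opn (adj S \<circ> S) * hn x)"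
      using S x by (intro mult_left_mono opn_bound X.nonneg ops_comp adj_in)
    also have "\<dots> = (sqrt (opn (adj S \<circ> S)) * hn x)\<^sup>2" using nn by (simp add: power_mult_distrib power2_eq_square)
    finally show "hn (S x) \<le> sqrt (opn (adj S \<circ> S)) * hn x"
      by (rule power2_le_imp_le) (use nn x X.nonneg in simp)
  qed (use nn in simp)
  thus "(opn S)\<^sup>2 \<le> opn (adj S \<circ> S)" using power_mono[OF _ opn_nonneg[OF S], of "sqrt (opn (adj S \<circ> S))" 2] nn by simp
qed

text \<open>The pointwise limit of a Cauchy sequence is adjointable because the adjoints have the
  same mutual distances (\<open>as\<close>): they converge pointwise as well, and their limit is the
  adjoint.\<close>

lemma ops_complete: "complete_on ops opn"
  unfolding complete_on_def
proof (intro allI impI)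
  fix s :: "nat \<Rightarrow> 'x \<Rightarrow> 'x"
  assume s: "(\<forall>k. s k \<in> ops) \<and> (\<forall>\<epsilon>>0. \<exists>N. \<forall>k\<ge>N. \<forall>l\<ge>N. opn (s k - s l) < \<epsilon>)"
  have ex: "\<exists>R. \<forall>x\<in>H. X.conv (\<lambda>k. t k x) (R x)"
    if t: "\<And>k. t k \<in> ops" "\<forall>\<epsilon>>0. \<exists>N. \<forall>k\<ge>N. \<forall>l\<ge>N. opn (t k - t l) < \<epsilon>" for t
  proof -
    have ex: "\<exists>y\<in>H. (\<lambda>k. hn (t k x - y)) \<longlonglongrightarrow> 0" if x: "x \<in> H" for x
    proof (rule complete_onD[OF complete])
      show "\<forall>\<epsilon>>0. \<exists>N. \<forall>k\<ge>N. \<forall>l\<ge>N. hn (t k x - t l x) < \<epsilon>"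
      proof (intro allI impI)
        fix \<epsilon> :: real assume e: "\<epsilon> > 0"
        have h: "0 \<le> hn x" by (rule X.nonneg[OF x])
        obtain N where N: "\<forall>k\<ge>N. \<forall>l\<ge>N. opn (t k - t l) < \<epsilon> / (hn x + 1)"
          using t(2)[rule_format, of "\<epsilon> / (hn x + 1)"] e h by auto
        have "hn (t k x - t l x) < \<epsilon>" if "k \<ge> N" "l \<ge> N" for k l
        proof -
          have "hn ((t k - t l) x) \<le> opn (t k - t l) * hn x" by (intro opn_bound ops_diff t x)
          also have "\<dots> \<le> opn (t k - t l) * (hn x + 1)"
            by (intro mult_left_mono opn_nonneg ops_diff t) simp
          also have "\<dots> < \<epsilon>" using N that h by (simp add: divide_simps split: if_splits)
          finally show ?thesis by simp
        qed
        thus "\<exists>N. \<forall>k\<ge>N. \<forall>l\<ge>N. hn (t k x - t l x) < \<epsilon>" by blast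
      qed
    qed (use t x in \<open>simp_all add: opsD(1)\<close>)
    have "\<exists>y. X.conv (\<lambda>k. t k x) y" if "x \<in> H" for x
      using ex[OF that] opsD(1)[OF t(1) that] by (auto simp: X.conv_def)
    thus ?thesis by (intro bchoice ballI)
  qed
  have as: "opn (adj (s k) - adj (s l)) = opn (s k - s l)" for k l
  proof -
    have "adj (s k - s l) = adj (s k) - adj (s l)"
      using s by (intro adj_eqI ops_diff adj_in) (simp_all add: ip_diff ip_diff_left opsD(1) adj_spec)
    thus ?thesis using opn_adj[of "s k - s l"] s ops_diff by simp
  qed
  obtain R0 where R0: "\<And>x. x \<in> H \<Longrightarrow> X.conv (\<lambda>k. s k x) (R0 x)" using ex[of s] s by blast
  have "\<exists>R. \<forall>x\<in>H. X.conv (\<lambda>k. adj (s k) x) (R x)"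
    using ex[of "\<lambda>k. adj (s k)"] s by (simp add: adj_in as)
  then obtain R' where R': "\<And>x. x \<in> H \<Longrightarrow> X.conv (\<lambda>k. adj (s k) x) (R' x)" by blast
  define R where "R x = (if x \<in> H then R0 x else 0)" for x
  have R: "X.conv (\<lambda>k. s k x) (R x)" if "x \<in> H" for x using R0[OF that] that by (simp add: R_def)
  have near: "hn (s k x - R x) \<le> \<epsilon> * hn x" if N: "\<forall>k\<ge>N. \<forall>l\<ge>N. opn (s k - s l) < \<epsilon>" "k \<ge> N" and x: "x \<in> H" for N k \<epsilon> x
  proof -
    have "X.conv (\<lambda>l. s (l + N) x) (R x)" using R[OF x] LIMSEQ_ignore_initial_segment[OF X.convD(3)[OF R[OF x]]]
      by (simp add: X.conv_def)
    hence "X.conv (\<lambda>l. s k x - s (l + N) x) (s k x - R x)"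
      using s x by (intro X.conv_diff X.conv_const) (simp_all add: opsD(1))
    thus ?thesis
    proof (rule X.conv_norm_le)
      fix l
      have "hn ((s k - s (l + N)) x) \<le> opn (s k - s (l + N)) * hn x" using s x by (intro opn_bound ops_diff) auto
      also have "\<dots> \<le> \<epsilon> * hn x" using N x by (intro mult_right_mono X.nonneg) (auto intro: less_imp_le)
      finally show "hn (s k x - s (l + N) x) \<le> \<epsilon> * hn x" by simp
    qed
  qed
  obtain N1 where N1: "\<forall>k\<ge>N1. \<forall>l\<ge>N1. opn (s k - s l) < 1" using s by (meson zero_less_one)
  have Rops: "R \<in> ops"
  proof (rule opsI[where S' = R' and C = "1 + opn (s N1)"])
    show "R x \<in> H" if "x \<in> H" for x using R[OF that] by (rule X.convD)
    show "R' x \<in> H" if "x \<in> H" for x using R'[OF that] by (rule X.convD)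
    show "R x = 0" if "x \<notin> H" for x using that by (simp add: R_def)
    show "ip (R x) y = ip x (R' y)" if "x \<in> H" "y \<in> H" for x y
    proof (rule A.conv_unique)
      show "A.conv (\<lambda>k. ip (s k x) y) (ip (R x) y)" by (intro conv_ip_left R that)
      show "A.conv (\<lambda>k. ip (s k x) y) (ip x (R' y))"
        using conv_ip_right[OF that(1) R'[OF that(2)]] s that by (simp add: adj_spec)
    qed
    fix x assume x: "x \<in> H"
    have Rx: "R x \<in> H" "s N1 x \<in> H" using X.convD(2)[OF R[OF x]] s x by (simp_all add: opsD(1))
    have "hn (R x) \<le> hn (R x - s N1 x) + hn (s N1 x)" using X.tri[of "R x - s N1 x" "s N1 x"] Rx by simp
    also have "\<dots> \<le> 1 * hn x + opn (s N1) * hn x"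
      using near[OF N1 order_refl x] X.norm_diff_commute[OF Rx] s x by (intro add_mono opn_bound) auto
    finally show "hn (R x) \<le> (1 + opn (s N1)) * hn x" by (simp add: algebra_simps)
  qed
  have "(\<lambda>k. opn (s k - R)) \<longlonglongrightarrow> 0"
  proof (rule LIMSEQ_I)
    fix r :: real assume r: "0 < r"
    then obtain N where N: "\<forall>k\<ge>N. \<forall>l\<ge>N. opn (s k - s l) < r / 2" using s by (meson half_gt_zero)
    have "opn (s k - R) \<le> r / 2" if "k \<ge> N" for k using near[OF N that] r by (intro opn_le) auto
    hence "opn (s k - R) < r" if "k \<ge> N" for k using r that by fastforce
    moreover have "0 \<le> opn (s k - R)" for k using s by (intro opn_nonneg ops_diff Rops) auto
    ultimately show "\<exists>N. \<forall>k\<ge>N. norm (opn (s k - R) - 0) < r" using r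
      by (intro exI[of _ N]) simp
  qed
  with Rops show "\<exists>x\<in>ops. (\<lambda>k. opn (s k - x)) \<longlonglongrightarrow> 0" by blast
qed

sublocale Adj: cstar_alg Adj
proof unfold_locales
  show "banach_on (ccar Adj) (cnorm Adj)"
    using ops_subspace opn_nonneg opn_eq_0 opn_tri opn_scale ops_complete by (auto simp: banach_on_def)
  show "is_cunit Adj (cunit Adj)" using idop_unit by simp
  show "cnorm Adj (cunit Adj) \<le> 1" by (simp add: opn_le)
  note s = adj_in ops_comp ops_add ops_scale
  show "cmul Adj a (z *\<^sub>C b) = z *\<^sub>C cmul Adj a b" if "a \<in> ccar Adj" "b \<in> ccar Adj" for a b z
    using that clinear_map.scale[OF opsD(5)] clinear_map.zero[OF opsD(5)]
    by (auto simp: fun_eq_iff scaleC_apply opsD) (metis opsD(1,2) scaleC_simps(4))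
  show "cmul Adj a (b + c) = cmul Adj a b + cmul Adj a c"
    if "a \<in> ccar Adj" "b \<in> ccar Adj" "c \<in> ccar Adj" for a b c
    using that clinear_map.add[OF opsD(5), of a] clinear_map.zero[OF opsD(5), of a]
    by (simp add: fun_eq_iff) (metis add.right_neutral opsD(1,2))
  show "cstar Adj (a + b) = cstar Adj a + cstar Adj b" if "a \<in> ccar Adj" "b \<in> ccar Adj" for a b
    using that by (simp, intro adj_eqI) (simp_all add: s ip_add ip_add_left opsD(1) adj_spec)
  show "cstar Adj (z *\<^sub>C a) = cnj z *\<^sub>C cstar Adj a" if "a \<in> ccar Adj" for a z
    using that by (simp, intro adj_eqI) (simp_all add: s scaleC_apply ip_scale ip_scale_left opsD(1) adj_spec)
  show "cstar Adj (cmul Adj a b) = cmul Adj (cstar Adj b) (cstar Adj a)" if "a \<in> ccar Adj" "b \<in> ccar Adj" for a b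
    using that by (simp, intro adj_eqI) (simp_all add: s opsD(1) adj_spec)
  show "cmul Adj (z *\<^sub>C a) b = z *\<^sub>C cmul Adj a b" for a b z by (simp add: fun_eq_iff scaleC_apply)
qed (auto simp: ops_comp adj_in adj_adj opn_comp opn_adj opn_cstar fun_eq_iff)

text \<open>The adjoint moves \<open>K\<close> to the other side, where \<open>ip_act\<close>
  applies. Right linearity of the compact maps \<open>T\<^sub>g\<close> over the unit fibre is
  derived from this.\<close>

lemma ops_act: assumes K: "K \<in> ops" and x: "x \<in> H" and a: "a \<in> ccar A" shows "K (act x a) = act (K x) a"
proof (rule ip_eqI)
  fix y assume y: "y \<in> H"
  show "ip y (K (act x a)) = ip y (act (K x) a)"
    using K x y a by (simp add: adj_spec'[symmetric] ip_act opsD adj_spec)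
qed (use assms in \<open>simp_all add: opsD(1)\<close>)

lemma hnorm_act_le: assumes "x \<in> H" "a \<in> ccar A" shows "hn (act x a) \<le> hn x * cnorm A a"
proof (rule power2_le_imp_le)
  have "(hn (act x a))\<^sup>2 = cnorm A (cmul A (cstar A a) (cmul A (ip x x) a))"
    using assms by (simp add: hn_sq ip_act ip_act_left A.mul_assoc)
  also have "\<dots> \<le> cnorm A a * (cnorm A (ip x x) * cnorm A a)"
    using assms A.norm_mul[of "ip x x" a] A.norm_mul[of "cstar A a" "cmul A (ip x x) a"]
      mult_left_mono[of "cnorm A (cmul A (ip x x) a)" "cnorm A (ip x x) * cnorm A a" "cnorm A a"]
    by (simp add: A.norm_star A.nonneg)
  also have "\<dots> = (hn x * cnorm A a)\<^sup>2" using assms by (simp add: hn_sq power_mult_distrib power2_eq_square[of "cnorm A a"])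
  finally show "(hn (act x a))\<^sup>2 \<le> (hn x * cnorm A a)\<^sup>2" .
qed (use assms X.nonneg A.nonneg in simp)

lemma pos_form: assumes K: "Adj.pos K" and x: "x \<in> H" shows "A.pos (ip x (K x))"
proof -
  obtain R where R: "Adj.sa R" "R \<circ> R = K" using Adj.pos_root[OF K] by (metis Adj_simps(2))
  hence "R \<in> ops" "adj R = R" by (auto simp: Adj.sa_def)
  hence "ip x (K x) = ip (R x) (R x)" using x R(2) adj_spec(2)[of R "R x" x] by (auto simp: opsD)
  thus ?thesis using ip_self_pos[of "R x"] opsD(1)[OF \<open>R \<in> ops\<close> x] by simp
qed

text \<open>Positivity of \<open>t\<^sup>2 - K\<^sup>* K\<close>, tested at \<open>x\<close>. Unlike
  a bound of norms, such an inequality in \<open>A\<close> may be summed over orthogonal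
  components.\<close>

lemma ops_leq: assumes K: "K \<in> ops" and t: "opn K \<le> t" and x: "x \<in> H"
  shows "A.leq (ip (K x) (K x)) (rsc (t\<^sup>2) (ip x x))"
proof -
  have "Adj.pos (rsc (t\<^sup>2) idop - (adj K \<circ> K))"
    using Adj.pos_one_minus[of "adj K \<circ> K" "t\<^sup>2"] Adj.sa_intros(7)[of K] K opn_cstar[OF K]
      power_mono[OF t opn_nonneg[OF K]] by simp
  from pos_form[OF this x] show ?thesis using K x
    by (simp add: A.leq_def ip_diff ip_scale scaleC_apply opsD adj_spec)
qed

text \<open>Polarization at \<open>W x\<close> and \<open>t x\<close> turns a two-sided bound of the quadratic form into a bound of
  the operator norm.\<close>

lemma opn_le_of_form_bound:
  assumes W: "Adj.sa W" and t: "t > 0"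
    and up: "\<And>x. x \<in> H \<Longrightarrow> A.pos (rsc t (ip x x) - ip x (W x))"
    and low: "\<And>x. x \<in> H \<Longrightarrow> A.pos (rsc t (ip x x) + ip x (W x))"
  shows "opn W \<le> t"
proof (rule opn_le)
  fix x assume x [simp]: "x \<in> H"
  have Wops: "W \<in> ops" "adj W = W" using W by (auto simp: Adj.sa_def)
  note [simp] = opsD(1)[OF Wops(1)] clinear_map.add[OF opsD(5)[OF Wops(1)]]
    clinear_map.diff[OF opsD(5)[OF Wops(1)]] clinear_map.scale[OF opsD(5)[OF Wops(1)]]
  have sym: "ip y (W z) = ip (W y) z" if "y \<in> H" "z \<in> H" for y z
    using adj_spec(2)[OF Wops(1), of z y] that Wops by simp
  let ?u = "W x" and ?v = "rsc t x" and ?p = "ip (W x) (W x)" and ?q = "ip x x"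
  \<comment> \<open>In the difference of the two forms of \<open>W\<close> the terms in
    \<open>?u\<close> alone and in \<open>?v\<close> alone cancel; the mixed terms add up to four
    times \<open>t ?p\<close>.\<close>
  have "A.pos ((rsc t (ip (?u + ?v) (?u + ?v)) - ip (?u + ?v) (W (?u + ?v))) +
        (rsc t (ip (?u - ?v) (?u - ?v)) + ip (?u - ?v) (W (?u - ?v))))"
    by (intro A.pos_add up low) auto
  also have "\<dots> = rsc t (?p + ?p) + rsc t (rsc (t\<^sup>2) (?q + ?q)) - rsc t ((?p + ?p) + (?p + ?p))"
    by (simp add: ip_add ip_add_left ip_diff ip_diff_left ip_scale ip_scale_left sym
        cv.scale_right_diff_distrib cv.scale_right_distrib power2_eq_square mult.assoc algebra_simps)
  also have "\<dots> = rsc (2 * t) (rsc (t\<^sup>2) ?q - ?p)"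
  proof -
    have "rsc (2 * t) y = rsc t y + rsc t y" for y :: 'b
      using scaleC_two[of "rsc t y"] by simp
    thus ?thesis by (simp only: cv.scale_right_diff_distrib cv.scale_right_distrib) (simp add: algebra_simps)
  qed
  finally have "A.pos (rsc (2 * t) (rsc (t\<^sup>2) ?q - ?p))" .
  from A.pos_scale[OF this, of "1 / (2 * t)"] have "A.leq ?p (rsc (t\<^sup>2) ?q)" using t by (simp add: A.leq_def)
  from A.pos_leq_norm[OF _ this] have "cnorm A ?p \<le> t\<^sup>2 * cnorm A ?q"
    using A.norm_rsc[of ?q "t\<^sup>2"] ip_self_pos by simp
  hence "(hn (W x))\<^sup>2 \<le> (t * hn x)\<^sup>2" by (simp add: norm_ip_self power_mult_distrib)
  thus "hn (W x) \<le> t * hn x" by (rule power2_le_imp_le) (use t X.nonneg in simp)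
qed (use t in simp)

text \<open>For \<open>t > opn K\<close> the operator \<open>t - K\<close> is positive, and its form
  is at most \<open>t\<close> times that of the identity because the form of \<open>K\<close> is
  positive. So \<open>opn_le_of_form_bound\<close> yields the ball condition for
  \<open>K\<close>.\<close>

lemma form_pos_root:
  assumes K: "Adj.sa K" and pos: "\<And>x. x \<in> H \<Longrightarrow> A.pos (ip x (K x))"
    and U: "Adj.closed_alg U" "K \<in> U" "idop \<in> U"
  obtains R where "R \<in> U" "R \<in> ops" "adj R = R" "R \<circ> R = K"
proof -
  have Kops: "K \<in> ops" using K by (simp add: Adj.sa_def)
  \<comment> \<open>The summand 1 keeps \<open>t\<close> positive when \<open>K = 0\<close>.\<close>
  define t where "t = opn K + 1"
  have t: "t > 0" using opn_nonneg[OF Kops] by (simp add: t_def)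
  have "opn (rsc t idop - K) \<le> t"
  proof (rule opn_le_of_form_bound[OF _ t])
    show "Adj.sa (rsc t idop - K)"
      using Adj.sa_intros(2)[OF Adj.sa_intros(4)[OF Adj.sa_intros(5)] K, of t] by simp
    fix x assume x [simp]: "x \<in> H"
    have K': "Adj.pos (rsc t idop - K)" using Adj.pos_one_minus[OF K, of t] by (simp add: t_def)
    show "A.pos (rsc t (ip x x) - ip x ((rsc t idop - K) x))"
      using pos[OF x] Kops by (simp add: ip_diff ip_scale scaleC_apply opsD)
    show "A.pos (rsc t (ip x x) + ip x ((rsc t idop - K) x))"
      using t by (intro A.pos_add A.pos_scale ip_self_pos pos_form[OF K']) auto
  qed
  hence "Adj.pos K" using Adj.posI_bound[OF K, of t] by simp
  then obtain R where "Adj.sa R" "R \<circ> R = K" "\<And>U. \<lbrakk>Adj.closed_alg U; K \<in> U; idop \<in> U\<rbrakk> \<Longrightarrow> R \<in> U"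
    using Adj.pos_root[of K] by (metis Adj_simps(2) cunit_Adj)
  thus ?thesis using that U by (auto simp: Adj.sa_def)
qed

end

section \<open>Fibres of a unital Fell bundle\<close>

lemma sum_fun_apply: "(\<Sum>i\<in>I. f i) x = (\<Sum>i\<in>I. f i x)"
  by (induction I rule: infinite_finite_induct) auto

lemma (in normed_carrier) dense_conv_ex:
  assumes "\<And>\<epsilon>. \<epsilon> > 0 \<Longrightarrow> \<exists>s\<in>U. n (P s - x) < \<epsilon>" "x \<in> S" "\<And>s. s \<in> U \<Longrightarrow> P s \<in> S"
  shows "\<exists>s. (\<forall>k. s k \<in> U) \<and> conv (\<lambda>k. P (s k)) x"
  using dense_conv[of U P x] assms by metis

lemma complete_on_cong:
  fixes S :: "'a::complex_vector set"
  assumes "complete_on S n" "csubspace S" "\<And>x. x \<in> S \<Longrightarrow> m x = n x"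
  shows "complete_on S m"
  unfolding complete_on_def
proof (intro allI impI)
  fix s :: "nat \<Rightarrow> 'a" assume s: "(\<forall>k. s k \<in> S) \<and> (\<forall>\<epsilon>>0. \<exists>N. \<forall>k\<ge>N. \<forall>l\<ge>N. m (s k - s l) < \<epsilon>)"
  have eq: "m (s k - x) = n (s k - x)" if "x \<in> S" for k x
    using s that by (intro assms(3) cv.subspace_diff[OF assms(2)]) auto
  obtain x where "x \<in> S" "(\<lambda>k. n (s k - x)) \<longlonglongrightarrow> 0"
    using complete_onD[OF assms(1), of s] s by (auto simp: eq)
  thus "\<exists>x\<in>S. (\<lambda>k. m (s k - x)) \<longlonglongrightarrow> 0" by (auto simp: eq)
qed

locale fell_unital = fell_bundle B for B :: "('g::group_add, 'b::complex_vector) fell_data" +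
  assumes unital: "cunital (unit_fibre B)"
begin

abbreviation "F \<equiv> fib B"
abbreviation "Ae \<equiv> unit_fibre B"
abbreviation "e1 \<equiv> cunit (unit_fibre B)"

lemma Ae_simps [simp]: "ccar Ae = F 0" "cmul Ae = fmul B 0 0" "cstar Ae = fstar B 0" "cnorm Ae = fnorm B 0"
  by (simp_all add: unit_fibre_def)

sublocale N: normed_carrier "fib B g" "fnorm B g" for g
  by (rule banach_on_normed[OF banach])

lemma unit_fib: "is_cunit Ae e1"
  using unital cunit_eqI unfolding cunital_def by metis

sublocale U: cstar_alg Ae
proof unfold_locales
  show "is_cunit Ae e1" by (rule unit_fib)
  have e1: "e1 \<in> F 0" using unit_fib by (simp add: is_cunit_def)
  have "fmul B 0 0 (fstar B 0 e1) e1 = fstar B 0 e1"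
    using unit_fib star_closed[OF e1] by (simp add: is_cunit_def)
  hence "(fnorm B 0 e1)\<^sup>2 = fnorm B 0 e1" using star_mul_norm[OF e1] star_norm[OF e1] by simp
  thus "cnorm Ae e1 \<le> 1" by (auto simp: power2_eq_square)
  show "cnorm Ae (cmul Ae (cstar Ae a) a) = (cnorm Ae a)\<^sup>2" if "a \<in> ccar Ae" for a
    using star_mul_norm[of a 0] that by simp
  fix a b c assume abc: "a \<in> ccar Ae" "b \<in> ccar Ae" "c \<in> ccar Ae"
  show "cmul Ae a b \<in> ccar Ae" using mul_closed[of a 0 b 0] abc by simp
  show "cmul Ae (cmul Ae a b) c = cmul Ae a (cmul Ae b c)" using mul_assoc[of a 0 b 0 c 0] abc by simp
  show "cnorm Ae (cmul Ae a b) \<le> cnorm Ae a * cnorm Ae b" using mul_norm[of a 0 b 0] abc by simp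
  show "cstar Ae a \<in> ccar Ae" using star_closed[of a 0] abc by simp
  show "cstar Ae (cstar Ae a) = a" using star_star[of a 0] abc by simp
  show "cstar Ae (cmul Ae a b) = cmul Ae (cstar Ae b) (cstar Ae a)" using star_mul[of a 0 b 0] abc by simp
  show "cnorm Ae (cstar Ae a) = cnorm Ae a" using star_norm[of a 0] abc by simp
qed (simp_all add: banach mul_add_left mul_add_right mul_scale_left mul_scale_right star_add star_scale)

lemma mul_in [simp]: "\<lbrakk>a \<in> F g; b \<in> F h; k = g + h\<rbrakk> \<Longrightarrow> fmul B g h a b \<in> F k"
  using mul_closed by simp

lemma star_in [simp]: "\<lbrakk>b \<in> F g; k = - g\<rbrakk> \<Longrightarrow> fstar B g b \<in> F k"
  using star_closed by simp

lemma assoc: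
  "\<lbrakk>a \<in> F g; b \<in> F h; d \<in> F k; x = g + h; y = h + k\<rbrakk> \<Longrightarrow>
    fmul B x k (fmul B g h a b) d = fmul B g y a (fmul B h k b d)"
  using mul_assoc by simp

lemma star_mul': "\<lbrakk>a \<in> F g; b \<in> F h; x = g + h; y = - h; z = - g\<rbrakk> \<Longrightarrow>
    fstar B x (fmul B g h a b) = fmul B y z (fstar B h b) (fstar B g a)"
  using star_mul by simp

lemma star_star': "\<lbrakk>b \<in> F g; h = - g\<rbrakk> \<Longrightarrow> fstar B h (fstar B g b) = b"
  using star_star by simp

lemma left_mul_map: "a \<in> F g \<Longrightarrow> clinear_map (F h) (fmul B g h a)"
  by (auto intro!: clinear_map.intro clinear_onI N.sub simp: mul_add_right mul_scale_right)

lemma right_mul_map: "b \<in> F h \<Longrightarrow> clinear_map (F g) (\<lambda>a. fmul B g h a b)"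
  by (auto intro!: clinear_map.intro clinear_onI N.sub simp: mul_add_left mul_scale_left)

lemma mul_0 [simp]: "a \<in> F g \<Longrightarrow> fmul B g h a 0 = 0" "b \<in> F h \<Longrightarrow> fmul B g h 0 b = 0"
  using clinear_map.zero[OF left_mul_map] clinear_map.zero[OF right_mul_map] by auto

lemma star_0 [simp]: "fstar B g 0 = 0" using star_scale[of 0 g 0] by simp

lemma star_sub: "\<lbrakk>a \<in> F g; b \<in> F g\<rbrakk> \<Longrightarrow> fstar B g (a - b) = fstar B g a - fstar B g b"
  using star_add[of a g "- b"] star_scale[of b g "-1"] by simp

lemmas mul_sub_right = clinear_map.diff[OF left_mul_map]
lemmas mul_sub_left = clinear_map.diff[OF right_mul_map]

lemma e1_in [simp]: "e1 \<in> F 0" using U.one_in by simp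
lemma e1_star [simp]: "fstar B 0 e1 = e1" using U.star_one by simp

text \<open>The product \<open>b b\<^sup>*\<close> lies in the unit fibre, where \<open>e1\<close>
  is neutral. Hence \<open>c = e1 b - b\<close> satisfies \<open>c c\<^sup>* = 0\<close>, and the
  \<open>C\<^sup>*\<close>-identity for \<open>c\<^sup>*\<close> gives \<open>c = 0\<close>.\<close>

lemma e1_mul [simp]: assumes b: "b \<in> F g" shows "fmul B 0 g e1 b = b"
proof -
  let ?c = "fmul B 0 g e1 b - b" and ?bb = "fmul B g (- g) b (fstar B g b)"
  have bb: "fmul B 0 0 e1 ?bb = ?bb" "fmul B 0 0 ?bb e1 = ?bb" using U.one_mul[of ?bb] U.mul_one[of ?bb] b by simp_all
  have eb: "fmul B g (- g) (fmul B 0 g e1 b) (fstar B g b) = ?bb"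
    using assoc[OF e1_in b star_in[OF b refl], of g 0] bb by simp
  have be: "fmul B g (- g) x (fmul B (- g) 0 (fstar B g b) e1) = fmul B 0 0 (fmul B g (- g) x (fstar B g b)) e1"
    if "x \<in> F g" for x using assoc[OF that star_in[OF b refl] e1_in, of 0 "- g"] by simp
  have c: "?c \<in> F g" using b by simp
  have "fmul B g (- g) ?c (fstar B g ?c) = 0"
    using b by (simp add: star_sub star_mul' mul_sub_right mul_sub_left eb be bb)
  hence "(fnorm B (- g) (fstar B g ?c))\<^sup>2 = 0"
    using star_mul_norm[OF star_closed[OF c]] c by (simp add: star_star')
  thus ?thesis using star_norm[OF c] N.eq_0[OF c] by simp
qed

lemma mul_e1 [simp]: assumes b: "b \<in> F g" shows "fmul B g 0 b e1 = b"
proof -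
  have "fstar B (- g) (fmul B 0 (- g) e1 (fstar B g b)) = fmul B g 0 b e1"
    by (subst star_mul'[OF e1_in star_in[OF b refl]]) (use b in \<open>simp_all add: star_star'\<close>)
  thus ?thesis using b by (simp add: star_star')
qed

text \<open>Writing \<open>a = s\<^sup>2\<close> with \<open>s\<close> self-adjoint gives
  \<open>c\<^sup>* a c = (s c)\<^sup>* (s c)\<close>, which is positive by the axiom for the fibre
  at \<open>h\<close>.\<close>

lemma fib_conj_pos: assumes "U.pos a" "c \<in> F h" shows "U.pos (fmul B (- h) h (fstar B h c) (fmul B 0 h a c))"
proof -
  obtain s where s: "U.sa s" "fmul B 0 0 s s = a" using U.pos_root[OF assms(1)] by (metis Ae_simps(2))
  hence s': "s \<in> F 0" "fstar B 0 s = s" by (auto simp: U.sa_def)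
  have "fmul B (- h) h (fstar B h c) (fmul B 0 h a c) =
      fmul B (- h) h (fstar B h (fmul B 0 h s c)) (fmul B 0 h s c)"
    using s' assms(2) assoc[of "fstar B h c" "- h" s 0 "fmul B 0 h s c" h "- h" h]
    by (simp add: star_mul' assoc[of s 0 s 0 c h 0 h] flip: s(2))
  thus ?thesis using star_mul_pos[of "fmul B 0 h s c" h] s' assms(2) by (simp add: U.cpos_iff)
qed

text \<open>Conjugation of \<open>\<parallel>b\<parallel>\<^sup>2 - b\<^sup>* b \<ge> 0\<close> by
  \<open>c\<close>. This is the coordinatewise estimate behind the boundedness of the regular
  representation.\<close>

lemma mul_mul_leq:
  assumes b: "b \<in> F g" and c: "c \<in> F h"
  shows "U.leq (fmul B (- (g + h)) (g + h) (fstar B (g + h) (fmul B g h b c)) (fmul B g h b c))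
    (rsc ((fnorm B g b)\<^sup>2) (fmul B (- h) h (fstar B h c) c))"
proof -
  let ?bb = "fmul B (- g) g (fstar B g b) b"
  have p: "U.pos (rsc ((fnorm B g b)\<^sup>2) e1 - ?bb)"
    using b star_mul_pos[OF b] star_mul_norm[OF b]
    by (intro U.pos_one_minus U.posD(3)) (auto simp: U.cpos_iff)
  have k: "- (g + h) + g = - h" by (simp add: minus_add add.assoc)
  have "fmul B (- (g + h)) (g + h) (fmul B (- h) (- g) (fstar B h c) (fstar B g b)) (fmul B g h b c) =
      fmul B (- h) h (fstar B h c) (fmul B (- g) (g + h) (fstar B g b) (fmul B g h b c))"
    by (rule assoc) (use b c in \<open>simp_all add: minus_add\<close>)
  also have "fmul B (- g) (g + h) (fstar B g b) (fmul B g h b c) = fmul B 0 h ?bb c"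
    by (rule assoc[symmetric]) (use b c in simp_all)
  finally have "fmul B (- (g + h)) (g + h) (fstar B (g + h) (fmul B g h b c)) (fmul B g h b c) =
      fmul B (- h) h (fstar B h c) (fmul B 0 h ?bb c)"
    using b c by (simp add: star_mul)
  thus ?thesis using fib_conj_pos[OF p c] b c
    by (simp add: U.leq_def mul_sub_left mul_sub_right mul_scale_left mul_scale_right)
qed

lemma fibre_simps [simp]: "hcar (fibre_module B g) = F g" "hact (fibre_module B g) = fmul B g 0"
    "hip (fibre_module B g) b c = fmul B (- g) g (fstar B g b) c"
  by (simp_all add: fibre_module_def)

lemma fibre_norm: "b \<in> F g \<Longrightarrow> hnorm Ae (fibre_module B g) b = fnorm B g b"
  by (simp add: hnorm_def star_mul_norm N.nonneg)

sublocale M: hmod Ae "fibre_module B g" for g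
proof unfold_locales
  let ?X = "fibre_module B g"
  show "csubspace (hcar ?X)" using N.sub by simp
  show "complete_on (hcar ?X) (hnorm Ae ?X)"
  proof (rule complete_on_cong)
    show "complete_on (hcar ?X) (fnorm B g)" using banach[of g] unfolding banach_on_def by simp
  qed (simp_all add: N.sub fibre_norm)
  fix x y z :: 'b and a b c
  assume x: "x \<in> hcar ?X"
  show "cpos Ae (hip ?X x x)" using star_mul_pos x by simp
  show "x = 0" if "hip ?X x x = 0" using star_mul_norm[of x g] that x N.eq_0[of x g] by simp
  show "hact ?X x a \<in> hcar ?X" if "a \<in> ccar Ae" using that x by simp
  show "hact ?X x (a + b) = hact ?X x a + hact ?X x b" if "a \<in> ccar Ae" "b \<in> ccar Ae"
    using x that by (simp add: mul_add_right)
  show "hact ?X (c *\<^sub>C x) a = c *\<^sub>C hact ?X x a" if "a \<in> ccar Ae" for c using x that by (simp add: mul_scale_left)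
  show "hact ?X x (c *\<^sub>C a) = c *\<^sub>C hact ?X x a" if "a \<in> ccar Ae" for c using x that by (simp add: mul_scale_right)
  show "hact ?X x (cmul Ae a b) = hact ?X (hact ?X x a) b" if "a \<in> ccar Ae" "b \<in> ccar Ae"
    using x that by (simp add: assoc)
  assume y: "y \<in> hcar ?X"
  show "hact ?X (x + y) a = hact ?X x a + hact ?X y a" if "a \<in> ccar Ae" using x y that by (simp add: mul_add_left)
  show "hip ?X x y \<in> ccar Ae" using x y by simp
  show "hip ?X x (c *\<^sub>C y) = c *\<^sub>C hip ?X x y" for c using x y star_closed[of x g] by (simp add: mul_scale_right)
  show "hip ?X x (hact ?X y a) = cmul Ae (hip ?X x y) a" if "a \<in> ccar Ae"
    using x y that assoc[of "fstar B g x" "- g" y g a 0 0 g] by simp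
  show "cstar Ae (hip ?X x y) = hip ?X y x"
    using x y star_mul'[of "fstar B g x" "- g" y g 0 "- g" g] by (simp add: star_star')
  assume z: "z \<in> hcar ?X"
  show "hip ?X x (y + z) = hip ?X x y + hip ?X x z" using x y z star_closed[of x g] by (simp add: mul_add_right)
qed

section \<open>Completions of the module of sections\<close>

definition single :: "'g \<Rightarrow> 'b \<Rightarrow> 'g \<Rightarrow> 'b" where "single g b = (\<lambda>h. if h = g then b else 0)"

abbreviation "supp f \<equiv> {g. f g \<noteq> 0}"

abbreviation "S0 \<equiv> hcar (sections_module B)"

lemma S0_iff: "f \<in> S0 \<longleftrightarrow> (\<forall>g. f g \<in> F g) \<and> finite (supp f)" by (simp add: sections_module_def)

lemma S0D: "f \<in> S0 \<Longrightarrow> f g \<in> F g" "f \<in> S0 \<Longrightarrow> finite (supp f)" by (simp_all add: S0_iff)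

lemma S0_subspace: "csubspace S0"
proof (rule cv.subspaceI)
  show "0 \<in> S0" by (simp add: S0_iff)
  show "f + f' \<in> S0" if "f \<in> S0" "f' \<in> S0" for f f'
  proof -
    have "finite (supp (f + f'))" by (rule finite_subset[of _ "supp f \<union> supp f'"]) (use that in \<open>auto simp: S0_iff\<close>)
    thus ?thesis using that by (simp add: S0_iff)
  qed
  show "c *\<^sub>C f \<in> S0" if "f \<in> S0" for c f
  proof -
    have "finite (supp (c *\<^sub>C f))" by (rule finite_subset[of _ "supp f"]) (use that in \<open>auto simp: S0_iff scaleC_apply\<close>)
    thus ?thesis using that by (simp add: S0_iff scaleC_apply)
  qed
qed

lemma single_supp: "supp (single g b) \<subseteq> {g}" by (auto simp: single_def)

lemma single_in [simp]: "b \<in> F g \<Longrightarrow> single g b \<in> S0"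
  using finite_subset[of "supp (single g b)" "{g}"] by (auto simp: S0_iff single_def)

lemma S0_sum [simp]: "(\<And>i. i \<in> I \<Longrightarrow> f i \<in> S0) \<Longrightarrow> (\<Sum>i\<in>I. f i) \<in> S0"
  by (rule cv.subspace_sum[OF S0_subspace])

lemma single_linear: "clinear_map (F g) (single g)"
  by (auto intro!: clinear_map.intro clinear_onI N.sub simp: single_def fun_eq_iff scaleC_apply)

lemma S0_expand: assumes "finite K" "supp f \<subseteq> K" shows "f = (\<Sum>g\<in>K. single g (f g))"
proof
  fix h
  have "(\<Sum>g\<in>K. single g (f g)) h = (\<Sum>g\<in>K. if h = g then f g else 0)" by (simp add: single_def sum_fun_apply)
  also have "\<dots> = f h" using assms by (auto simp: sum.delta')
  finally show "f h = (\<Sum>g\<in>K. single g (f g)) h" by simp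
qed

lemma S0_induct:
  assumes f: "f \<in> S0" and P: "\<And>g b. b \<in> F g \<Longrightarrow> P (single g b)" "P 0"
    "\<And>f f'. \<lbrakk>f \<in> S0; f' \<in> S0; P f; P f'\<rbrakk> \<Longrightarrow> P (f + f')"
  shows "P f"
proof -
  have "P (\<Sum>g\<in>K. single g (f g))" if "finite K" for K
    using that
  proof (induction K)
    case (insert g K)
    have "P (single g (f g) + (\<Sum>g\<in>K. single g (f g)))" using f insert by (intro P S0_sum single_in S0D)
    thus ?case unfolding sum.insert[OF insert(1,2)] .
  next
    case empty
    show ?case unfolding sum.empty by (rule P(2))
  qed
  from this[OF S0D(2)[OF f]] show ?thesis by (subst S0_expand[OF S0D(2)[OF f] order_refl])
qed

lemma sec_ip: assumes "f \<in> S0" "f' \<in> S0" "finite K" "supp f \<subseteq> K"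
  shows "hip (sections_module B) f f' = (\<Sum>g\<in>K. fmul B (- g) g (fstar B g (f g)) (f' g))"
  using assms by (auto simp: sections_module_def intro!: sum.mono_neutral_left)

end

text \<open>Used twice: for the given completion \<open>L\<close>, and for \<open>H\<close> with the
  embedding \<open>j (Lam f)\<close>, which turns out to be a completion of the same module.\<close>

locale sec_completion = fell_unital B for B :: "('g::group_add, 'b::complex_vector) fell_data" +
  fixes L :: "('l::complex_vector, 'b) hmodule" and \<iota> :: "('g \<Rightarrow> 'b) \<Rightarrow> 'l"
  assumes compl: "hilbert_completion (unit_fibre B) (sections_module B) L \<iota>"
begin

sublocale L: hmod Ae L
  using compl U.cstar_alg_axioms by (simp add: hilbert_completion_def hmod_def)

abbreviation "HL \<equiv> hcar L"
abbreviation "hn \<equiv> hnorm (unit_fibre B) L"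

definition d :: "'g \<Rightarrow> 'b \<Rightarrow> 'l" where "d g b = \<iota> (single g b)"

lemma \<iota>_linear: "clinear_map S0 \<iota>"
  using compl S0_subspace by (simp add: hilbert_completion_def clinear_map_def)

lemma \<iota>_in [simp]: "f \<in> S0 \<Longrightarrow> \<iota> f \<in> HL" using compl by (simp add: hilbert_completion_def)

lemma d_in [simp]: "b \<in> F g \<Longrightarrow> d g b \<in> HL" by (simp add: d_def)

lemma d_linear: "clinear_map (F g) (d g)"
  unfolding d_def
  by (intro clinear_map.intro clinear_onI N.sub)
    (simp_all add: clinear_map.add[OF single_linear] clinear_map.scale[OF single_linear]
      clinear_map.add[OF \<iota>_linear] clinear_map.scale[OF \<iota>_linear])

lemma \<iota>_expand: assumes "f \<in> S0" "finite K" "supp f \<subseteq> K" shows "\<iota> f = (\<Sum>g\<in>K. d g (f g))"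
proof -
  have "\<iota> f = \<iota> (\<Sum>g\<in>K. single g (f g))" by (rule arg_cong[OF S0_expand[OF assms(2,3)]])
  also have "\<dots> = (\<Sum>g\<in>K. d g (f g))" unfolding d_def
    using assms(1) by (intro clinear_map.sum[OF \<iota>_linear] single_in S0D)
  finally show ?thesis .
qed

lemma ip_\<iota>: assumes "f \<in> S0" "f' \<in> S0" "finite K" "supp f \<subseteq> K"
  shows "hip L (\<iota> f) (\<iota> f') = (\<Sum>g\<in>K. fmul B (- g) g (fstar B g (f g)) (f' g))"
  using compl sec_ip[OF assms] assms by (simp add: hilbert_completion_def)

lemma ip_d: assumes "a \<in> F g" "b \<in> F h"
  shows "hip L (d g a) (d h b) = (if g = h then fmul B (- g) g (fstar B g a) b else 0)"
  using ip_\<iota>[OF single_in[OF assms(1)] single_in[OF assms(2)], of "{g}"] assms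
  by (simp add: d_def single_supp) (simp add: single_def)

lemma d_act: assumes "b \<in> F g" "a \<in> F 0" shows "hact L (d g b) a = d g (fmul B g 0 b a)"
proof -
  have "hact L (\<iota> (single g b)) a = \<iota> (hact (sections_module B) (single g b) a)"
    using compl assms by (simp add: hilbert_completion_def)
  also have "hact (sections_module B) (single g b) a = single g (fmul B g 0 b a)"
    using assms by (auto simp: sections_module_def single_def fun_eq_iff)
  finally show ?thesis by (simp add: d_def)
qed

lemma hn_d: "b \<in> F g \<Longrightarrow> hn (d g b) = fnorm B g b"
  by (simp add: hnorm_def ip_d star_mul_norm N.nonneg)

lemma \<iota>_dense: "\<lbrakk>x \<in> HL; \<epsilon> > 0\<rbrakk> \<Longrightarrow> \<exists>f\<in>S0. hn (\<iota> f - x) < \<epsilon>"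
  using compl by (simp add: hilbert_completion_def)

lemma \<iota>_conv: assumes "x \<in> HL" shows "\<exists>s. (\<forall>k. s k \<in> S0) \<and> L.X.conv (\<lambda>k. \<iota> (s k)) x"
  using L.X.dense_conv_ex[of S0 \<iota> x] \<iota>_dense[OF assms] assms \<iota>_in by simp

lemma dense_induct:
  assumes x: "x \<in> HL" and P: "\<And>g b. b \<in> F g \<Longrightarrow> P (d g b)"
    "\<And>x y. \<lbrakk>x \<in> HL; y \<in> HL; P x; P y\<rbrakk> \<Longrightarrow> P (x + y)"
    "\<And>s x. \<lbrakk>\<And>k. s k \<in> HL; \<And>k. P (s k); L.X.conv s x\<rbrakk> \<Longrightarrow> P x"
  shows "P x"
proof -
  have P0: "P 0" using P(1)[of 0 0] clinear_map.zero[OF d_linear] by simp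
  have "P (\<iota> f)" if "f \<in> S0" for f
    using that
    by (rule S0_induct[where P = "\<lambda>f. P (\<iota> f)"])
      (simp_all add: P0 clinear_map.zero[OF \<iota>_linear] clinear_map.add[OF \<iota>_linear] P(1,2) flip: d_def)
  moreover obtain s where "\<And>k. s k \<in> S0" "L.X.conv (\<lambda>k. \<iota> (s k)) x" using \<iota>_conv[OF x] by blast
  ultimately show ?thesis using P(3)[of "\<lambda>k. \<iota> (s k)" x] by simp
qed

definition bdl :: "('l \<Rightarrow> 'l) \<Rightarrow> bool" where
  "bdl f \<longleftrightarrow> bounded_op HL hn f"

lemma bdlD: assumes "bdl f"
  shows "x \<in> HL \<Longrightarrow> f x \<in> HL" "clinear_map HL f" "bounded_on HL hn f"
  using assms L.subspace by (auto simp: bdl_def bounded_op_def clinear_map_def)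

lemma bdl_bound: "\<lbrakk>bdl f; x \<in> HL\<rbrakk> \<Longrightarrow> hn (f x) \<le> op_norm HL hn f * hn x"
  by (rule L.X.le_op_norm) (simp_all add: bdlD(1,3))

lemma bdl_conv: assumes f: "bdl f" and s: "L.X.conv s x" shows "L.X.conv (\<lambda>k. f (s k)) (f x)"
  by (rule bounded_conv[OF L.X.normed_carrier_axioms L.X.normed_carrier_axioms _ _ _ s, where C = "op_norm HL hn f"])
    (simp_all add: bdlD(1)[OF f] clinear_map.diff[OF bdlD(2)[OF f]] bdl_bound[OF f])

lemma ops_bdl: "S \<in> L.ops \<Longrightarrow> bdl S" by (simp add: adjointable_ops_def bdl_def)

lemma bdl_eqI:
  assumes f: "bdl f" and g: "bdl g" and eq: "\<And>h c. c \<in> F h \<Longrightarrow> f (d h c) = g (d h c)" and x: "x \<in> HL"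
  shows "f x = g x"
  using x
proof (rule dense_induct)
  fix s x assume "\<And>k. f (s k) = g (s k)" "L.X.conv s x"
  thus "f x = g x" using bdl_conv[OF f, of s x] bdl_conv[OF g, of s x] by (auto dest: L.X.conv_unique)
qed (auto simp: eq clinear_map.add[OF bdlD(2)[OF f]] clinear_map.add[OF bdlD(2)[OF g]])

lemma ops_eqI:
  assumes "S \<in> L.ops" "R \<in> L.ops" "\<And>h c. c \<in> F h \<Longrightarrow> S (d h c) = R (d h c)" shows "S = R"
  by (rule L.ops_ext[OF assms(1,2)], rule bdl_eqI[OF ops_bdl[OF assms(1)] ops_bdl[OF assms(2)] assms(3)])

lemma ip_eq_by_d:
  assumes f: "bdl f" and g: "bdl g"
    and eq: "\<And>h c k a. \<lbrakk>c \<in> F h; a \<in> F k\<rbrakk> \<Longrightarrow> hip L (f (d h c)) (d k a) = hip L (d h c) (g (d k a))"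
    and x: "x \<in> HL" and y: "y \<in> HL"
  shows "hip L (f x) y = hip L x (g y)"
  using y
proof (rule dense_induct)
  note fl = clinear_map.add[OF bdlD(2)[OF f]] and gl = clinear_map.add[OF bdlD(2)[OF g]]
  fix k a assume a: "a \<in> F k"
  show "hip L (f x) (d k a) = hip L x (g (d k a))" using x
  proof (rule dense_induct)
    fix s x assume s: "\<And>k. s k \<in> HL" "\<And>i. hip L (f (s i)) (d k a) = hip L (s i) (g (d k a))" "L.X.conv s x"
    show "hip L (f x) (d k a) = hip L x (g (d k a))"
      using L.conv_ip_left[OF d_in[OF a] bdl_conv[OF f s(3)]] L.conv_ip_left[OF bdlD(1)[OF g d_in[OF a]] s(3)]
      by (simp add: s(2) U.conv_unique)
  qed (use a in \<open>simp_all add: eq fl L.ip_add_left bdlD(1)[OF f] bdlD(1)[OF g]\<close>)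
next
  fix s y assume s: "\<And>k. s k \<in> HL" "\<And>i. hip L (f x) (s i) = hip L x (g (s i))" "L.X.conv s y"
  show "hip L (f x) y = hip L x (g y)"
    using L.conv_ip_right[OF bdlD(1)[OF f x] s(3)] L.conv_ip_right[OF x bdl_conv[OF g s(3)]]
    by (simp add: s(2) U.conv_unique)
qed (use x in \<open>simp_all add: clinear_map.add[OF bdlD(2)[OF g]] L.ip_add bdlD(1)[OF f] bdlD(1)[OF g]\<close>)

text \<open>Components in distinct fibres are orthogonal, and injectivity of \<open>\<phi>\<close>
  keeps the images orthogonal, so the inequalities in \<open>Ae\<close> add up before the norm is
  taken.\<close>

lemma norm_sum_le_coords:
  assumes K: "finite K" "inj_on \<phi> K" and a: "\<And>k. k \<in> K \<Longrightarrow> a k \<in> F (\<phi> k)" and b: "\<And>k. k \<in> K \<Longrightarrow> b k \<in> F k"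
    and le: "\<And>k. k \<in> K \<Longrightarrow> U.leq (fmul B (- \<phi> k) (\<phi> k) (fstar B (\<phi> k) (a k)) (a k))
        (rsc (r\<^sup>2) (fmul B (- k) k (fstar B k (b k)) (b k)))" and r: "r \<ge> 0"
  shows "hn (\<Sum>k\<in>K. d (\<phi> k) (a k)) \<le> r * hn (\<Sum>k\<in>K. d k (b k))"
proof -
  have ip: "hip L (\<Sum>k\<in>K. d (\<psi> k) (c k)) (\<Sum>k\<in>K. d (\<psi> k) (c k)) =
      (\<Sum>k\<in>K. fmul B (- \<psi> k) (\<psi> k) (fstar B (\<psi> k) (c k)) (c k))"
    if c: "\<And>k. k \<in> K \<Longrightarrow> c k \<in> F (\<psi> k)" and inj: "inj_on \<psi> K" for \<psi> c
  proof -
    have "hip L (\<Sum>k\<in>K. d (\<psi> k) (c k)) (\<Sum>k\<in>K. d (\<psi> k) (c k)) =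
        (\<Sum>k\<in>K. \<Sum>l\<in>K. hip L (d (\<psi> k) (c k)) (d (\<psi> l) (c l)))"
      using c by (simp add: L.ip_sum L.ip_sum_left L.X.sum_in) (rule sum.swap)
    also have "\<dots> = (\<Sum>k\<in>K. \<Sum>l\<in>K. if k = l then fmul B (- \<psi> k) (\<psi> k) (fstar B (\<psi> k) (c k)) (c k) else 0)"
      using c inj by (intro sum.cong refl) (auto simp: ip_d inj_on_eq_iff)
    finally show ?thesis using K by simp
  qed
  let ?x = "\<Sum>k\<in>K. d (\<phi> k) (a k)" and ?y = "\<Sum>k\<in>K. d k (b k)"
  have [simp]: "?x \<in> HL" "?y \<in> HL" using a b by (auto intro!: L.X.sum_in)
  have "U.leq (hip L ?x ?x) (rsc (r\<^sup>2) (hip L ?y ?y))"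
    using U.leq_sum[of K, OF le] ip[OF a K(2)] ip[OF b, of "\<lambda>k. k"] by (simp add: cv.scale_sum_right)
  from U.pos_leq_norm[OF _ this] have "fnorm B 0 (hip L ?x ?x) \<le> r\<^sup>2 * fnorm B 0 (hip L ?y ?y)"
    using L.ip_self_pos[of ?x] U.norm_rsc[of "hip L ?y ?y" "r\<^sup>2"] L.ip_closed[of ?y ?y] by simp
  hence "(hn ?x)\<^sup>2 \<le> (r * hn ?y)\<^sup>2"
    using L.norm_ip_self[of ?x] L.norm_ip_self[of ?y] by (simp add: power_mult_distrib)
  thus ?thesis by (rule power2_le_imp_le) (use r L.X.nonneg[of ?y] in simp)
qed

text \<open>Covers left translations (\<open>\<phi>\<close> a shift, \<open>R\<close> multiplication
  by a fixed \<open>b\<close>) as well as block diagonal operators (\<open>\<phi>\<close> the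
  identity, \<open>R\<close> a bundle map).\<close>

lemma coord_map:
  assumes \<phi>: "inj \<phi>" and R: "\<And>g b. b \<in> F g \<Longrightarrow> R g b \<in> F (\<phi> g)" "\<And>g. clinear_on (F g) (R g)"
    and le: "\<And>g b. b \<in> F g \<Longrightarrow> U.leq (fmul B (- \<phi> g) (\<phi> g) (fstar B (\<phi> g) (R g b)) (R g b))
        (rsc (r\<^sup>2) (fmul B (- g) g (fstar B g b) b))" and r: "r \<ge> 0"
  obtains \<Psi> where "bdl \<Psi>" "\<And>x. x \<in> HL \<Longrightarrow> hn (\<Psi> x) \<le> r * hn x" "\<And>x. x \<notin> HL \<Longrightarrow> \<Psi> x = 0"
    "\<And>g b. b \<in> F g \<Longrightarrow> \<Psi> (d g b) = d (\<phi> g) (R g b)"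
    "\<And>f K. \<lbrakk>f \<in> S0; finite K; supp f \<subseteq> K\<rbrakk> \<Longrightarrow> \<Psi> (\<iota> f) = (\<Sum>g\<in>K. d (\<phi> g) (R g (f g)))"
proof -
  have Rl: "clinear_map (F g) (R g)" for g using R(2) N.sub by (simp add: clinear_map_def)
  define Q where "Q f = (\<Sum>g\<in>supp f. d (\<phi> g) (R g (f g)))" for f
  have QK: "Q f = (\<Sum>g\<in>K. d (\<phi> g) (R g (f g)))" if "f \<in> S0" "finite K" "supp f \<subseteq> K" for f K
    unfolding Q_def using that
    by (intro sum.mono_neutral_left) (auto simp: clinear_map.zero[OF Rl] clinear_map.zero[OF d_linear])
  have Qin: "Q f \<in> HL" if "f \<in> S0" for f
    unfolding Q_def using that by (intro L.X.sum_in d_in R S0D)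
  have Ql: "clinear_on S0 Q"
  proof (rule clinear_onI)
    fix f f' assume f: "f \<in> S0" "f' \<in> S0"
    let ?K = "supp f \<union> supp f'"
    have K: "finite ?K" "supp (f + f') \<subseteq> ?K" "supp f \<subseteq> ?K" "supp f' \<subseteq> ?K" using S0D f by auto
    show "Q (f + f') = Q f + Q f'"
      using f R(1)
      by (simp add: QK[OF cv.subspace_add[OF S0_subspace] K(1,2)] QK[OF _ K(1,3)] QK[OF _ K(1,4)] S0D
          clinear_map.add[OF Rl] clinear_map.add[OF d_linear] sum.distrib)
  next
    fix c f assume f: "f \<in> S0"
    have K: "supp (c *\<^sub>C f) \<subseteq> supp f" by (auto simp: scaleC_apply)
    show "Q (c *\<^sub>C f) = c *\<^sub>C Q f"
      using f R(1)
      by (simp add: QK[OF cv.subspace_scale[OF S0_subspace] S0D(2) K] S0D QK[OF f S0D(2)[OF f]] scaleC_apply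
          clinear_map.scale[OF Rl] clinear_map.scale[OF d_linear] cv.scale_sum_right)
  qed
  have Qb: "hn (Q f) \<le> r * hn (\<iota> f)" if f: "f \<in> S0" for f
    unfolding Q_def \<iota>_expand[OF f S0D(2)[OF f] order_refl]
    using f r le by (intro norm_sum_le_coords inj_on_subset[OF \<phi>]) (auto simp: S0D R)
  obtain \<Psi> where \<Psi>: "\<And>x. x \<in> HL \<Longrightarrow> \<Psi> x \<in> HL" "clinear_on HL \<Psi>" "\<And>x. x \<in> HL \<Longrightarrow> hn (\<Psi> x) \<le> r * hn x"
    "\<And>f. f \<in> S0 \<Longrightarrow> \<Psi> (\<iota> f) = Q f" "\<And>x. x \<notin> HL \<Longrightarrow> \<Psi> x = 0"
    using bounded_extension[OF L.X.normed_carrier_axioms L.X.normed_carrier_axioms L.complete S0_subspace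
      \<iota>_in clinear_map.lin[OF \<iota>_linear] Qin Ql \<iota>_dense Qb r] by metis
  show ?thesis
  proof
    show "bdl \<Psi>" using \<Psi> by (auto simp: bdl_def bounded_op_def bounded_on_def)
    show "\<Psi> (d g b) = d (\<phi> g) (R g b)" if b: "b \<in> F g" for g b
    proof -
      have "supp (single g b) \<subseteq> {g}" by (auto simp: single_def)
      thus ?thesis using \<Psi>(4)[OF single_in[OF b]] QK[OF single_in[OF b], of "{g}"] by (simp add: d_def single_def)
    qed
    show "\<Psi> (\<iota> f) = (\<Sum>g\<in>K. d (\<phi> g) (R g (f g)))" if "f \<in> S0" "finite K" "supp f \<subseteq> K" for f K
      using \<Psi>(4) QK that by simp
  qed (use \<Psi> in auto)
qed

end

section \<open>The reduced cross-sectional algebra\<close>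

context fell_unital
begin

text \<open>The common shape of \<open>Lam\<close> and of its transform \<open>Qm\<close>, so that
  linearity is proved once for both.\<close>

definition sec_sum :: "('g \<Rightarrow> 'b \<Rightarrow> 'v::complex_vector) \<Rightarrow> ('g \<Rightarrow> 'b) \<Rightarrow> 'v" where
  "sec_sum W f = (\<Sum>g\<in>supp f. W g (f g))"

lemma sec_sum_K:
  assumes W: "\<And>g. clinear_map (F g) (W g)" and "finite K" "supp f \<subseteq> K"
  shows "sec_sum W f = (\<Sum>g\<in>K. W g (f g))"
  unfolding sec_sum_def using assms by (intro sum.mono_neutral_left) (auto simp: clinear_map.zero[OF W])

lemma sec_sum_linear:
  assumes W: "\<And>g. clinear_map (F g) (W g)" shows "clinear_map S0 (sec_sum W)"
proof (intro clinear_map.intro S0_subspace clinear_onI)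
  fix f f' assume f: "f \<in> S0" "f' \<in> S0"
  let ?K = "supp f \<union> supp f'"
  have K: "finite ?K" "supp (f + f') \<subseteq> ?K" "supp f \<subseteq> ?K" "supp f' \<subseteq> ?K" using S0D f by auto
  show "sec_sum W (f + f') = sec_sum W f + sec_sum W f'"
    using f by (simp add: sec_sum_K[OF W K(1,2)] sec_sum_K[OF W K(1,3)] sec_sum_K[OF W K(1,4)] S0D(1)
        clinear_map.add[OF W] sum.distrib)
next
  fix c f assume f: "f \<in> S0"
  have K: "supp (c *\<^sub>C f) \<subseteq> supp f" by (auto simp: scaleC_apply)
  have "sec_sum W (c *\<^sub>C f) = (\<Sum>g\<in>supp f. W g ((c *\<^sub>C f) g))" by (rule sec_sum_K[OF W S0D(2)[OF f] K])
  also have "\<dots> = c *\<^sub>C sec_sum W f"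
    using f by (simp add: sec_sum_def S0D(1) scaleC_apply clinear_map.scale[OF W] cv.scale_sum_right)
  finally show "sec_sum W (c *\<^sub>C f) = c *\<^sub>C sec_sum W f" .
qed

lemma sec_sum_single: assumes W: "\<And>g. clinear_map (F g) (W g)" shows "sec_sum W (single g b) = W g b"
  by (subst sec_sum_K[OF W, where K = "{g}"]) (simp_all add: single_supp, simp add: single_def)

end

context hmod
begin

lemma conv_apply: assumes s: "Adj.conv s K" and x: "x \<in> H" shows "X.conv (\<lambda>k. s k x) (K x)"
proof -
  have ops: "s k \<in> ops" "K \<in> ops" for k using Adj.convD(1,2)[OF s] by simp_all
  show ?thesis
  proof (rule X.convI_le[where r = "\<lambda>k. opn (s k - K) * hn x"])
    show "(\<lambda>k. opn (s k - K) * hn x) \<longlonglongrightarrow> 0"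
      using tendsto_mult[OF Adj.convD(3)[OF s] tendsto_const, of "hn x"] by simp
    show "hn (s k x - K x) \<le> opn (s k - K) * hn x" for k
      using opn_bound[OF ops_diff[OF ops] x] by simp
  qed (simp_all add: ops x opsD(1))
qed

end

context sec_completion
begin

section \<open>The regular representation and its values on finitely supported sections\<close>

abbreviation "lam \<equiv> regular_rep B L \<iota>"

text \<open>Both inner products vanish unless \<open>k = g + h\<close>, and otherwise associativity
  moves \<open>b\<^sup>*\<close> across. This provides the adjoint that places the translations
  among the adjointable operators.\<close>

lemma lam_ip:
  assumes b: "b \<in> F g" and c: "c \<in> F h" and a: "a \<in> F k"
  shows "hip L (d (g + h) (fmul B g h b c)) (d k a) = hip L (d h c) (d (- g + k) (fmul B (- g) k (fstar B g b) a))"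
proof (cases "k = g + h")
  case True
  have "fmul B (- k) k (fmul B (- h) (- g) (fstar B h c) (fstar B g b)) a =
      fmul B (- h) h (fstar B h c) (fmul B (- g) k (fstar B g b) a)"
    by (rule assoc) (use a b c True in \<open>simp_all add: minus_add\<close>)
  thus ?thesis using a b c True by (simp add: ip_d star_mul)
next
  case False
  hence "h \<noteq> - g + k" by (metis add.assoc add.right_inverse add_0)
  thus ?thesis using a b c False by (simp add: ip_d)
qed

lemma lam_ex0:
  assumes b: "b \<in> F g"
  shows "\<exists>\<Psi>. bdl \<Psi> \<and> (\<forall>x\<in>HL. hn (\<Psi> x) \<le> fnorm B g b * hn x) \<and> (\<forall>x. x \<notin> HL \<longrightarrow> \<Psi> x = 0) \<and>
    (\<forall>h. \<forall>c\<in>F h. \<Psi> (d h c) = d (g + h) (fmul B g h b c)) \<and>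
    (\<forall>f\<in>S0. \<Psi> (\<iota> f) = (\<Sum>h\<in>supp f. d (g + h) (fmul B g h b (f h))))"
proof -
  obtain \<Psi> where "bdl \<Psi>" "\<And>x. x \<in> HL \<Longrightarrow> hn (\<Psi> x) \<le> fnorm B g b * hn x" "\<And>x. x \<notin> HL \<Longrightarrow> \<Psi> x = 0"
    "\<And>h c. c \<in> F h \<Longrightarrow> \<Psi> (d h c) = d (g + h) (fmul B g h b c)"
    "\<And>f K. \<lbrakk>f \<in> S0; finite K; supp f \<subseteq> K\<rbrakk> \<Longrightarrow> \<Psi> (\<iota> f) = (\<Sum>h\<in>K. d (g + h) (fmul B g h b (f h)))"
  proof (rule coord_map[of "\<lambda>h. g + h" "\<lambda>h. fmul B g h b" "fnorm B g b"])
    show "inj (\<lambda>h. g + h)" by (simp add: inj_def)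
    show "clinear_on (F h) (fmul B g h b)" for h by (rule clinear_map.lin[OF left_mul_map[OF b]])
  qed (use b mul_mul_leq[OF b] N.nonneg[OF b] in \<open>simp_all\<close>)
  thus ?thesis by (intro exI[of _ \<Psi>]) (simp add: S0D(2))
qed

lemma shift_eq:
  assumes b: "b \<in> F g" and f: "f \<in> S0"
  shows "\<iota> (\<lambda>h. fmul B g (- g + h) b (f (- g + h))) = (\<Sum>h\<in>supp f. d (g + h) (fmul B g h b (f h)))"
proof -
  let ?s = "\<lambda>h. fmul B g (- g + h) b (f (- g + h))"
  let ?K = "(\<lambda>h. g + h) ` supp f"
  have sub: "supp ?s \<subseteq> ?K"
  proof
    fix x assume "x \<in> supp ?s"
    hence "f (- g + x) \<noteq> 0" using mul_0(1)[OF b] by auto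
    thus "x \<in> ?K" by (intro image_eqI[of _ _ "- g + x"]) (auto simp: add.assoc[symmetric])
  qed
  have fin: "finite ?K" using S0D(2)[OF f] by simp
  have "?s x \<in> F x" for x using b S0D(1)[OF f, of "- g + x"] by (simp add: add.assoc[symmetric])
  hence s: "?s \<in> S0" using finite_subset[OF sub fin] by (simp add: S0_iff)
  show ?thesis unfolding \<iota>_expand[OF s fin sub] by (subst sum.reindex) (simp_all add: inj_on_def add.assoc[symmetric])
qed

lemma lam_spec:
  assumes b: "b \<in> F g"
  shows "lam g b \<in> L.ops" "L.opn (lam g b) \<le> fnorm B g b"
    "\<And>h c. c \<in> F h \<Longrightarrow> lam g b (d h c) = d (g + h) (fmul B g h b c)"
proof -
  let ?P = "\<lambda>S. S \<in> L.ops \<and> (\<forall>f\<in>S0. S (\<iota> f) = \<iota> (\<lambda>h. fmul B g (- g + h) b (f (- g + h))))"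
  obtain S where S: "bdl S" "\<forall>x\<in>HL. hn (S x) \<le> fnorm B g b * hn x" "\<forall>x. x \<notin> HL \<longrightarrow> S x = 0"
    "\<forall>h. \<forall>c\<in>F h. S (d h c) = d (g + h) (fmul B g h b c)"
    "\<forall>f\<in>S0. S (\<iota> f) = (\<Sum>h\<in>supp f. d (g + h) (fmul B g h b (f h)))"
    using lam_ex0[OF b] by blast
  \<comment> \<open>The same construction for \<open>b\<^sup>*\<close> serves as the
    adjoint.\<close>
  obtain S' where S': "bdl S'" "\<forall>h. \<forall>c\<in>F h. S' (d h c) = d (- g + h) (fmul B (- g) h (fstar B g b) c)"
    using lam_ex0[OF star_closed[OF b]] by blast
  have ops: "S \<in> L.ops"
  proof (rule L.opsI[where S' = S' and C = "fnorm B g b"])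
    show "hip L (S x) y = hip L x (S' y)" if "x \<in> HL" "y \<in> HL" for x y
      using ip_eq_by_d[OF S(1) S'(1) _ that] S(4) S'(2) lam_ip[OF b] by simp
  qed (simp_all add: S S' bdlD(1)[OF S(1)] bdlD(1)[OF S'(1)])
  hence PS: "?P S" using S(5) shift_eq[OF b] by simp
  have "lam g b = S" unfolding regular_rep_def
  proof (rule the_equality)
    show "?P S" by (rule PS)
    show "R = S" if R: "?P R" for R
    proof (rule ops_eqI)
      show "R (d h c) = S (d h c)" if "c \<in> F h" for h c
        using R PS single_in[OF that] unfolding d_def by metis
    qed (use R ops in blast)+
  qed
  thus "lam g b \<in> L.ops" "\<And>h c. c \<in> F h \<Longrightarrow> lam g b (d h c) = d (g + h) (fmul B g h b c)"
    "L.opn (lam g b) \<le> fnorm B g b"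
    using ops S(2,4) L.opn_le[of S "fnorm B g b"] N.nonneg[OF b] by simp_all
qed

lemmas lam_in [simp] = lam_spec(1)
lemmas lam_d = lam_spec(3)

lemma lam_star: assumes b: "b \<in> F g" shows "L.adj (lam g b) = lam (- g) (fstar B g b)"
  by (rule L.adj_eqI[OF _ _ ip_eq_by_d])
    (use b lam_ip[OF b] in \<open>simp_all add: lam_d[OF b] lam_d[OF star_closed[OF b]] ops_bdl\<close>)

lemma lam_mul: assumes a: "a \<in> F g" and b: "b \<in> F h" shows "lam g a \<circ> lam h b = lam (g + h) (fmul B g h a b)"
  by (rule ops_eqI) (use a b in \<open>simp_all add: L.ops_comp lam_d assoc add.assoc\<close>)

lemma lam_linear: "clinear_map (F g) (lam g)"
proof (intro clinear_map.intro clinear_onI N.sub)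
  show "lam g (a + b) = lam g a + lam g b" if "a \<in> F g" "b \<in> F g" for a b
    by (rule ops_eqI) (use that in \<open>simp_all add: L.ops_add lam_d mul_add_left clinear_map.add[OF d_linear]\<close>)
  show "lam g (c *\<^sub>C a) = c *\<^sub>C lam g a" if "a \<in> F g" for a c
    by (rule ops_eqI) (use that in \<open>simp_all add: L.ops_scale lam_d mul_scale_left scaleC_apply clinear_map.scale[OF d_linear]\<close>)
qed

lemma lam_one: "lam 0 e1 = L.idop"
  by (rule ops_eqI) (simp_all add: L.idop_in lam_d)

definition Lam :: "('g \<Rightarrow> 'b) \<Rightarrow> 'l \<Rightarrow> 'l" where "Lam = sec_sum lam"

lemma Lam_linear: "clinear_map S0 Lam" unfolding Lam_def by (rule sec_sum_linear[OF lam_linear])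

lemma Lam_single [simp]: "Lam (single g b) = lam g b" unfolding Lam_def by (rule sec_sum_single[OF lam_linear])

lemma Lam_in [simp]: "f \<in> S0 \<Longrightarrow> Lam f \<in> L.ops"
  unfolding Lam_def sec_sum_def by (intro cv.subspace_sum[OF L.ops_subspace] lam_in S0D)

lemma Lam_sum_single: "(\<And>i. i \<in> I \<Longrightarrow> b i \<in> F (g i)) \<Longrightarrow> Lam (\<Sum>i\<in>I. single (g i) (b i)) = (\<Sum>i\<in>I. lam (g i) (b i))"
  by (subst clinear_map.sum[OF Lam_linear]) simp_all

text \<open>The unit placed at the neutral element of the group. It is cyclic, by
  \<open>Lam_\<xi>0\<close>, and the conditional expectation is its vector functional.\<close>

definition \<xi>0 :: 'l where "\<xi>0 = d 0 e1"

lemma \<xi>0_in [simp]: "\<xi>0 \<in> HL" by (simp add: \<xi>0_def)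

lemma lam_\<xi>0: "b \<in> F g \<Longrightarrow> lam g b \<xi>0 = d g b" by (simp add: \<xi>0_def lam_d)

lemma Lam_\<xi>0: assumes "f \<in> S0" shows "Lam f \<xi>0 = \<iota> f"
  using assms by (simp add: Lam_def sec_sum_def sum_fun_apply lam_\<xi>0 S0D \<iota>_expand[OF assms S0D(2)[OF assms] order_refl])

text \<open>The sections whose images are \<open>\<Lambda>(f)\<^sup>*\<Lambda>(f')\<close>, \<open>\<Lambda>(f) \<Lambda>(f')\<close> and \<open>\<Lambda>(f)\<^sup>*\<close>.\<close>

definition sec_inner :: "('g \<Rightarrow> 'b) \<Rightarrow> ('g \<Rightarrow> 'b) \<Rightarrow> 'g \<Rightarrow> 'b" where
  "sec_inner f f' = (\<Sum>(g, h)\<in>supp f \<times> supp f'. single (- g + h) (fmul B (- g) h (fstar B g (f g)) (f' h)))"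

definition sec_mul :: "('g \<Rightarrow> 'b) \<Rightarrow> ('g \<Rightarrow> 'b) \<Rightarrow> 'g \<Rightarrow> 'b" where
  "sec_mul f f' = (\<Sum>(g, h)\<in>supp f \<times> supp f'. single (g + h) (fmul B g h (f g) (f' h)))"

definition sec_star :: "('g \<Rightarrow> 'b) \<Rightarrow> 'g \<Rightarrow> 'b" where
  "sec_star f = (\<Sum>g\<in>supp f. single (- g) (fstar B g (f g)))"

lemma sec_star_in [simp]: "f \<in> S0 \<Longrightarrow> sec_star f \<in> S0" unfolding sec_star_def by (intro S0_sum single_in) (simp add: S0D)
lemma sec_mul_in [simp]: "\<lbrakk>f \<in> S0; f' \<in> S0\<rbrakk> \<Longrightarrow> sec_mul f f' \<in> S0"
  unfolding sec_mul_def by (intro S0_sum) (auto simp: S0D)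
lemma sec_inner_in [simp]: "\<lbrakk>f \<in> S0; f' \<in> S0\<rbrakk> \<Longrightarrow> sec_inner f f' \<in> S0"
  unfolding sec_inner_def by (intro S0_sum) (auto simp: S0D)

lemma Lam_star: assumes f: "f \<in> S0" shows "Lam (sec_star f) = L.adj (Lam f)"
proof -
  have "Lam (sec_star f) = (\<Sum>g\<in>supp f. lam (- g) (fstar B g (f g)))"
    unfolding sec_star_def using f by (subst Lam_sum_single) (simp_all add: S0D)
  also have "\<dots> = (\<Sum>g\<in>supp f. L.adj (lam g (f g)))" using f by (simp add: lam_star S0D)
  also have "\<dots> = L.adj (Lam f)" using L.Adj.star_sum[of "supp f" "\<lambda>g. lam g (f g)"] f
    by (simp add: Lam_def sec_sum_def S0D)
  finally show ?thesis .
qed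

lemma Lam_mul: assumes f: "f \<in> S0" "f' \<in> S0" shows "Lam (sec_mul f f') = Lam f \<circ> Lam f'"
proof -
  have "Lam (sec_mul f f') = (\<Sum>x\<in>supp f \<times> supp f'. lam (fst x + snd x) (fmul B (fst x) (snd x) (f (fst x)) (f' (snd x))))"
    unfolding sec_mul_def case_prod_unfold using f by (subst Lam_sum_single) (simp_all add: S0D)
  also have "\<dots> = (\<Sum>g\<in>supp f. \<Sum>h\<in>supp f'. lam g (f g) \<circ> lam h (f' h))"
    using f by (simp add: sum.cartesian_product lam_mul S0D case_prod_unfold)
  also have "\<dots> = Lam f \<circ> Lam f'"
    using f L.Adj.mul_sum_left[of "Lam f'" "supp f" "\<lambda>g. lam g (f g)"]
      L.Adj.mul_sum_right[of _ "supp f'" "\<lambda>h. lam h (f' h)"]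
    by (simp add: Lam_def sec_sum_def S0D cv.subspace_sum[OF L.ops_subspace])
  finally show ?thesis .
qed

lemma Lam_inner: assumes f: "f \<in> S0" "f' \<in> S0" shows "Lam (sec_inner f f') = L.adj (Lam f) \<circ> Lam f'"
proof -
  have "Lam (sec_inner f f') = (\<Sum>x\<in>supp f \<times> supp f'. lam (- fst x + snd x) (fmul B (- fst x) (snd x) (fstar B (fst x) (f (fst x))) (f' (snd x))))"
    unfolding sec_inner_def case_prod_unfold using f by (subst Lam_sum_single) (simp_all add: S0D)
  also have "\<dots> = (\<Sum>g\<in>supp f. \<Sum>h\<in>supp f'. lam (- g) (fstar B g (f g)) \<circ> lam h (f' h))"
    using f by (simp add: sum.cartesian_product lam_mul S0D case_prod_unfold)
  also have "\<dots> = (\<Sum>g\<in>supp f. lam (- g) (fstar B g (f g))) \<circ> Lam f'"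
    using f L.Adj.mul_sum_left[of "Lam f'" "supp f" "\<lambda>g. lam (- g) (fstar B g (f g))"]
      L.Adj.mul_sum_right[of _ "supp f'" "\<lambda>h. lam h (f' h)"]
    by (simp add: Lam_def sec_sum_def S0D cv.subspace_sum[OF L.ops_subspace])
  also have "(\<Sum>g\<in>supp f. lam (- g) (fstar B g (f g))) = Lam (sec_star f)"
    unfolding sec_star_def using f by (subst Lam_sum_single) (simp_all add: S0D)
  finally show ?thesis unfolding Lam_star[OF f(1)] .
qed

section \<open>The reduced algebra and its dense subspace\<close>

abbreviation "D \<equiv> reduced_algebra B L \<iota>"

lemma D_simps [simp]: "cmul D x y = x \<circ> y" "cstar D = L.adj" "cnorm D = L.opn"
  by (simp_all add: reduced_algebra_def cstar_generated_def adjointable_algebra_def)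

lemma D_car: "ccar D = \<Inter>{S. cstar_subalgebra L.Adj S \<and> {lam g b | g b. b \<in> F g} \<subseteq> S}"
  by (simp add: reduced_algebra_def cstar_generated_def)

lemma D_sub: "ccar D \<subseteq> L.ops"
proof -
  have "cstar_subalgebra L.Adj L.ops"
    using L.ops_subspace by (auto simp: cstar_subalgebra_def L.ops_comp L.adj_in)
  thus ?thesis unfolding D_car by (intro Inter_lower) auto
qed

lemma D_ops [simp]: "x \<in> ccar D \<Longrightarrow> x \<in> L.ops" using D_sub by blast

lemma lam_D [simp]: "b \<in> F g \<Longrightarrow> lam g b \<in> ccar D" unfolding D_car by blast

lemma D_subspace: "csubspace (ccar D)"
  unfolding D_car by (intro cv.subspace_Inter) (auto simp: cstar_subalgebra_def)

lemma D_mul [simp]: "\<lbrakk>x \<in> ccar D; y \<in> ccar D\<rbrakk> \<Longrightarrow> x \<circ> y \<in> ccar D"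
  unfolding D_car by (auto simp: cstar_subalgebra_def)

lemma D_adj [simp]: "x \<in> ccar D \<Longrightarrow> L.adj x \<in> ccar D"
  unfolding D_car by (auto simp: cstar_subalgebra_def)

lemma D_closed: assumes s: "\<And>k. s k \<in> ccar D" and conv: "L.Adj.conv s x" shows "x \<in> ccar D"
  unfolding D_car
proof (rule InterI)
  fix S assume S: "S \<in> {S. cstar_subalgebra L.Adj S \<and> {lam g b | g b. b \<in> F g} \<subseteq> S}"
  hence "s k \<in> S" for k using s[of k] unfolding D_car by blast
  thus "x \<in> S" using S L.Adj.convD[OF conv] unfolding cstar_subalgebra_def mem_Collect_eq by (elim conjE) blast
qed

lemma D_closed_alg: "L.Adj.closed_alg (ccar D)"
  unfolding L.Adj.closed_alg_def
proof (intro conjI ballI allI impI)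
  show "x \<in> ccar D" if "(\<forall>k. s k \<in> ccar D) \<and> L.Adj.conv s x" for s x
    by (rule D_closed[of s]) (use that in auto)
qed (simp_all add: D_subspace)

lemma D_one [simp]: "L.idop \<in> ccar D" using lam_D[OF e1_in] by (simp add: lam_one)

lemma Lam_D [simp]: "f \<in> S0 \<Longrightarrow> Lam f \<in> ccar D"
  unfolding Lam_def sec_sum_def by (intro cv.subspace_sum[OF D_subspace] lam_D S0D)

lemma D_normed: "normed_carrier (ccar D) L.opn"
  using L.Adj.nonneg L.Adj.eq_0 L.Adj.tri L.Adj.norm_scale D_subspace by (auto simp: normed_carrier_def)

text \<open>The limits of operators \<open>Lam f\<close> form a closed self-adjoint subalgebra that
  contains the generators, so the intersection defining \<open>D\<close> is contained in it.\<close>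

lemma D_dense: assumes "x \<in> ccar D" shows "\<exists>s. (\<forall>k. s k \<in> S0) \<and> L.Adj.conv (\<lambda>k. Lam (s k)) x"
proof -
  define C where "C = {x \<in> L.ops. \<exists>s. (\<forall>k. s k \<in> S0) \<and> L.Adj.conv (\<lambda>k. Lam (s k)) x}"
  have CI: "x \<in> C" if "\<And>k. s k \<in> S0" "L.Adj.conv (\<lambda>k. Lam (s k)) x" for s x
    using that L.Adj.convD(2)[OF that(2)] unfolding C_def by auto
  have "cstar_subalgebra L.Adj C" unfolding cstar_subalgebra_def
  proof (intro conjI ballI allI impI)
    show "C \<subseteq> ccar L.Adj" by (auto simp: C_def)
    show "csubspace C"
    proof (rule cv.subspaceI)
      show "0 \<in> C"
      proof (rule CI[of "\<lambda>_. 0"])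
        show "0 \<in> S0" by (rule cv.subspace_0[OF S0_subspace])
        show "L.Adj.conv (\<lambda>k. Lam 0) 0" unfolding clinear_map.zero[OF Lam_linear]
          by (rule L.Adj.conv_const[OF L.Adj.zero_in])
      qed
      fix x c assume "x \<in> C"
      then obtain s where s: "\<And>k. s k \<in> S0" "L.Adj.conv (\<lambda>k. Lam (s k)) x" by (auto simp: C_def)
      show "c *\<^sub>C x \<in> C"
      proof (rule CI)
        show "c *\<^sub>C s k \<in> S0" for k by (rule cv.subspace_scale[OF S0_subspace s(1)])
        show "L.Adj.conv (\<lambda>k. Lam (c *\<^sub>C s k)) (c *\<^sub>C x)"
          using L.Adj.conv_scale[OF s(2)] unfolding clinear_map.scale[OF Lam_linear s(1)] .
      qed
      fix y assume "y \<in> C"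
      then obtain t where t: "\<And>k. t k \<in> S0" "L.Adj.conv (\<lambda>k. Lam (t k)) y" by (auto simp: C_def)
      show "x + y \<in> C"
      proof (rule CI)
        show "s k + t k \<in> S0" for k by (rule cv.subspace_add[OF S0_subspace s(1) t(1)])
        show "L.Adj.conv (\<lambda>k. Lam (s k + t k)) (x + y)"
          using L.Adj.conv_add[OF s(2) t(2)] unfolding clinear_map.add[OF Lam_linear s(1) t(1)] .
      qed
    qed
    fix x assume "x \<in> C"
    then obtain s where s: "\<And>k. s k \<in> S0" "L.Adj.conv (\<lambda>k. Lam (s k)) x" by (auto simp: C_def)
    show "cstar L.Adj x \<in> C"
      by (rule CI[of "\<lambda>k. sec_star (s k)"]) (use s L.Adj.conv_star[OF s(2)] in \<open>simp_all add: Lam_star\<close>)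
    fix y assume "y \<in> C"
    then obtain t where t: "\<And>k. t k \<in> S0" "L.Adj.conv (\<lambda>k. Lam (t k)) y" by (auto simp: C_def)
    show "cmul L.Adj x y \<in> C"
      by (rule CI[of "\<lambda>k. sec_mul (s k) (t k)"]) (use s t L.Adj.conv_mul[OF s(2) t(2)] in \<open>simp_all add: Lam_mul\<close>)
  next
    fix s x assume s: "(\<forall>k. s k \<in> C) \<and> x \<in> ccar L.Adj \<and> (\<lambda>k. cnorm L.Adj (s k - x)) \<longlonglongrightarrow> 0"
    have "\<exists>f\<in>S0. L.opn (Lam f - x) < \<epsilon>" if e: "\<epsilon> > 0" for \<epsilon>
    proof -
      have "(\<lambda>k. L.opn (s k - x)) \<longlonglongrightarrow> 0" using s by simp
      from LIMSEQ_D[OF this half_gt_zero[OF e]] obtain k where k: "L.opn (s k - x) < \<epsilon> / 2"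
        by (metis abs_less_iff diff_zero order_refl real_norm_def)
      have sk: "s k \<in> C" "s k \<in> L.ops" using s by (auto simp: C_def)
      obtain t where t: "\<And>k. t k \<in> S0" "L.Adj.conv (\<lambda>k. Lam (t k)) (s k)" using sk(1) unfolding C_def by blast
      have "(\<lambda>l. L.opn (Lam (t l) - s k)) \<longlonglongrightarrow> 0" using L.Adj.convD(3)[OF t(2)] by simp
      from LIMSEQ_D[OF this half_gt_zero[OF e]] obtain l where l: "L.opn (Lam (t l) - s k) < \<epsilon> / 2"
        by (metis abs_less_iff diff_zero order_refl real_norm_def)
      have "L.opn (Lam (t l) - x) \<le> L.opn (Lam (t l) - s k) + L.opn (s k - x)"
        using L.Adj.tri_diff[of "Lam (t l)" "s k" x] sk s t(1) by simp
      thus ?thesis using k l t(1) by (intro bexI[of _ "t l"]) auto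
    qed
    hence "\<exists>t. (\<forall>k. t k \<in> S0) \<and> L.Adj.conv (\<lambda>k. Lam (t k)) x"
      using L.Adj.dense_conv_ex[of S0 Lam x] s by simp
    thus "x \<in> C" using CI by blast
  qed
  moreover have "{lam g b | g b. b \<in> F g} \<subseteq> C"
  proof clarify
    fix g b assume b: "b \<in> F g"
    show "lam g b \<in> C" by (rule CI[of "\<lambda>_. single g b"]) (use b L.Adj.conv_const[of "lam g b"] in simp_all)
  qed
  ultimately have "x \<in> C" using assms unfolding D_car by blast
  thus ?thesis by (simp add: C_def)
qed

lemma D_induct:
  assumes x: "x \<in> ccar D" and P: "\<And>g b. b \<in> F g \<Longrightarrow> P (lam g b)"
    "\<And>x y. \<lbrakk>x \<in> ccar D; y \<in> ccar D; P x; P y\<rbrakk> \<Longrightarrow> P (x + y)"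
    "\<And>s x. \<lbrakk>\<And>k. s k \<in> ccar D; x \<in> ccar D; \<And>k. P (s k); L.Adj.conv s x\<rbrakk> \<Longrightarrow> P x"
  shows "P x"
proof -
  have P0: "P 0" using P(1)[of 0 0] clinear_map.zero[OF lam_linear] by simp
  have L: "P (Lam f)" if "f \<in> S0" for f
    using that
    by (rule S0_induct[where P = "\<lambda>f. P (Lam f)"])
      (simp_all add: P0 clinear_map.zero[OF Lam_linear] clinear_map.add[OF Lam_linear] P(1,2))
  obtain s where "\<And>k. s k \<in> S0" "L.Adj.conv (\<lambda>k. Lam (s k)) x" using D_dense[OF x] by blast
  thus ?thesis using P(3)[of "\<lambda>k. Lam (s k)" x] L x by simp
qed

end

section \<open>The conditional expectation and the completion of the reduced algebra\<close>

context sec_completion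
begin

definition Ex :: "('l \<Rightarrow> 'l) \<Rightarrow> 'b" where "Ex x = hip L \<xi>0 (x \<xi>0)"

lemma Ex_in [simp]: "x \<in> ccar D \<Longrightarrow> Ex x \<in> F 0"
  using L.ip_closed[OF \<xi>0_in L.opsD(1)[OF D_ops \<xi>0_in]] by (simp add: Ex_def)

lemma Ex_lam: "b \<in> F g \<Longrightarrow> Ex (lam g b) = (if g = 0 then b else 0)"
  by (cases "g = 0") (simp_all add: Ex_def \<xi>0_def lam_d ip_d)

lemma Ex_linear: "clinear_map (ccar D) Ex"
  by (intro clinear_map.intro clinear_onI D_subspace)
    (simp_all add: Ex_def L.ip_add L.opsD(1) scaleC_apply L.ip_scale)

lemma hn_\<xi>0: "hn \<xi>0 \<le> 1" using U.norm_unit by (simp add: \<xi>0_def hn_d)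

lemma hn_apply_\<xi>0: assumes "x \<in> L.ops" shows "hn (x \<xi>0) \<le> L.opn x"
  using L.opn_bound[OF assms \<xi>0_in] mult_left_mono[OF hn_\<xi>0 L.opn_nonneg[OF assms]] by simp

lemma Ex_bound: assumes "x \<in> ccar D" shows "fnorm B 0 (Ex x) \<le> L.opn x"
proof -
  have x: "x \<in> L.ops" "x \<xi>0 \<in> HL" using assms by (simp_all add: L.opsD(1))
  have "fnorm B 0 (Ex x) \<le> hn \<xi>0 * hn (x \<xi>0)" using L.cauchy_schwarz[OF \<xi>0_in x(2)] by (simp add: Ex_def)
  also have "\<dots> \<le> 1 * L.opn x"
    using hn_\<xi>0 hn_apply_\<xi>0[OF x(1)] L.X.nonneg[OF x(2)] by (intro mult_mono) auto
  finally show ?thesis by simp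
qed

lemma Ex_conv:
  assumes "L.Adj.conv s x" "\<And>k. s k \<in> ccar D" "x \<in> ccar D" shows "U.conv (\<lambda>k. Ex (s k)) (Ex x)"
  unfolding Ex_def by (rule L.conv_ip_right[OF \<xi>0_in L.conv_apply[OF assms(1) \<xi>0_in]])

text \<open>On generators both sides vanish unless \<open>g = 0\<close>, because
  \<open>g + h = h\<close> only then. Thus \<open>Ex y\<close> governs the diagonal coefficients of
  \<open>y\<close> in every degree, which makes the expectation faithful.\<close>

lemma D_coef:
  assumes y: "y \<in> ccar D" and a: "a \<in> F h" and b: "b \<in> F h"
  shows "hip L (d h a) (y (d h b)) = fmul B (- h) h (fstar B h a) (fmul B 0 h (Ex y) b)"
  using y
proof (rule D_induct)
  have da: "clinear_map (F h) (fmul B (- h) h (fstar B h a))" using star_closed[OF a] by (rule left_mul_map)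
  show "hip L (d h a) (lam g c (d h b)) = fmul B (- h) h (fstar B h a) (fmul B 0 h (Ex (lam g c)) b)"
    if "c \<in> F g" for g c
  proof -
    have "h = g + h \<longleftrightarrow> g = 0" by (metis add_0 add_right_cancel)
    thus ?thesis using that a b star_closed[OF a] by (simp add: lam_d ip_d Ex_lam)
  qed
  show "hip L (d h a) ((x + y) (d h b)) = fmul B (- h) h (fstar B h a) (fmul B 0 h (Ex (x + y)) b)"
    if "x \<in> ccar D" "y \<in> ccar D"
      "hip L (d h a) (x (d h b)) = fmul B (- h) h (fstar B h a) (fmul B 0 h (Ex x) b)"
      "hip L (d h a) (y (d h b)) = fmul B (- h) h (fstar B h a) (fmul B 0 h (Ex y) b)" for x y
    using that a b star_closed[OF a]
    by (simp add: L.ip_add L.opsD(1) clinear_map.add[OF Ex_linear] mul_add_left mul_add_right)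
  fix s x
  assume s: "\<And>k. s k \<in> ccar D" "x \<in> ccar D" "L.Adj.conv s x"
    "\<And>k. hip L (d h a) (s k (d h b)) = fmul B (- h) h (fstar B h a) (fmul B 0 h (Ex (s k)) b)"
  have l: "U.conv (\<lambda>k. hip L (d h a) (s k (d h b))) (hip L (d h a) (x (d h b)))"
    by (rule L.conv_ip_right[OF d_in[OF a] L.conv_apply[OF s(3) d_in[OF b]]])
  have r: "U.conv (\<lambda>k. fmul B (- h) h (fstar B h a) (fmul B 0 h (Ex (s k)) b))
      (fmul B (- h) h (fstar B h a) (fmul B 0 h (Ex x) b))"
  proof (rule bounded_conv[OF U.normed_carrier_axioms U.normed_carrier_axioms _ _ _ Ex_conv[OF s(3,1,2)],
        where f = "\<lambda>c. fmul B (- h) h (fstar B h a) (fmul B 0 h c b)" and C = "fnorm B h a * fnorm B h b"])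
    fix c assume c: "c \<in> ccar Ae"
    have "fnorm B (- h + h) (fmul B (- h) h (fstar B h a) (fmul B 0 h c b)) \<le>
        fnorm B (- h) (fstar B h a) * fnorm B (0 + h) (fmul B 0 h c b)"
      using mul_norm[of "fstar B h a" "- h" "fmul B 0 h c b" h] a b c by simp
    also have "\<dots> \<le> fnorm B h a * (fnorm B 0 c * fnorm B h b)"
      using mul_norm[of c 0 b h] a b c N.nonneg[OF a] by (simp add: star_norm mult_left_mono)
    finally show "cnorm Ae (fmul B (- h) h (fstar B h a) (fmul B 0 h c b)) \<le> fnorm B h a * fnorm B h b * cnorm Ae c"
      by (simp add: mult_ac)
  qed (use a b star_closed[OF a] in \<open>simp_all add: mul_sub_left mul_sub_right\<close>)
  show "hip L (d h a) (x (d h b)) = fmul B (- h) h (fstar B h a) (fmul B 0 h (Ex x) b)"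
    using l unfolding s(4) by (rule U.conv_unique[OF _ r])
qed

lemma Ex_faithful: assumes x: "x \<in> ccar D" and z: "Ex (L.adj x \<circ> x) = 0" shows "x = 0"
proof (rule ops_eqI)
  show "x \<in> L.ops" using x by simp
  show "0 \<in> L.ops" by (rule cv.subspace_0[OF L.ops_subspace])
  fix h c assume c: "c \<in> F h"
  have dc: "d h c \<in> HL" "x (d h c) \<in> HL" using x c by (simp_all add: L.opsD(1))
  have "hip L (d h c) ((L.adj x \<circ> x) (d h c)) = 0"
    using D_coef[of "L.adj x \<circ> x" c h c] x c z star_closed[OF c] by simp
  hence "hip L (x (d h c)) (x (d h c)) = 0" using L.adj_spec(2)[OF D_ops[OF x] dc(2,1)] by simp
  thus "x (d h c) = 0 (d h c)" using L.ip_definite[OF dc(2)] by simp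
qed

lemma lam0_\<xi>0: "a \<in> F 0 \<Longrightarrow> lam 0 a \<xi>0 = hact L \<xi>0 a"
  by (simp add: lam_\<xi>0) (simp add: \<xi>0_def d_act)

lemma Ex_spec: "faithful_conditional_expectation Ae D (lam 0) Ex"
  unfolding faithful_conditional_expectation_def
proof (intro conjI ballI impI)
  show "clinear_on (ccar D) Ex" by (rule clinear_map.lin[OF Ex_linear])
  fix x assume x: "x \<in> ccar D"
  show "cnorm Ae (Ex x) \<le> cnorm D x" using Ex_bound[OF x] by simp
  show "x = 0" if "Ex (cmul D (cstar D x) x) = 0" using Ex_faithful[OF x] that by simp
  show "cpos Ae (Ex x)" if p: "cpos D x"
  proof -
    obtain c where c: "c \<in> ccar D" "x = L.adj c \<circ> c" using p by (auto simp: cpos_def)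
    hence "Ex x = hip L (c \<xi>0) (c \<xi>0)" using L.adj_spec(2)[of c "c \<xi>0" \<xi>0] by (simp add: Ex_def L.opsD(1))
    thus ?thesis using L.ip_pos[of "c \<xi>0"] c by (simp add: L.opsD(1))
  qed
  fix a b assume ab: "a \<in> ccar Ae" "b \<in> ccar Ae"
  have "Ex (lam 0 a \<circ> x \<circ> lam 0 b) = hip L (L.adj (lam 0 a) \<xi>0) (x (lam 0 b \<xi>0))"
    using x ab L.adj_spec'[of "lam 0 a" \<xi>0 "x (lam 0 b \<xi>0)"] by (simp add: Ex_def L.opsD(1))
  also have "\<dots> = hip L (hact L \<xi>0 (fstar B 0 a)) (hact L (x \<xi>0) b)"
    using x ab star_closed[of a 0] lam0_\<xi>0[of "fstar B 0 a"]
    by (simp add: lam0_\<xi>0 L.ops_act lam_star)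
  also have "\<dots> = fmul B 0 0 (fmul B 0 0 a (Ex x)) b"
    using x ab L.ip_act_left[of \<xi>0 "hact L (x \<xi>0) b" "fstar B 0 a"] star_closed[of a 0]
      U.mul_assoc[of a "Ex x" b]
    by (simp add: L.opsD(1) L.ip_act star_star' Ex_def flip: Ex_def)
  finally show "Ex (cmul D (cmul D (lam 0 a) x) (lam 0 b)) = cmul Ae (cmul Ae a (Ex x)) b" by simp
qed (simp_all add: Ex_lam)

text \<open>\<open>cond_exp\<close> is a chosen map with the listed properties. Contractivity and
  the values on the generators determine such a map on the closure, and \<open>Ex\<close> is
  one.\<close>

lemma cond_exp_eq: assumes x: "x \<in> ccar D" shows "cond_exp B L \<iota> x = Ex x"
proof -
  let ?P = "\<lambda>E. faithful_conditional_expectation Ae D (lam 0) E \<and>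
     (\<forall>g. \<forall>b\<in>F g. E (lam g b) = (if g = 0 then b else 0))"
  define E where "E = cond_exp B L \<iota>"
  have "?P E" unfolding E_def cond_exp_def by (rule someI[of ?P Ex]) (simp add: Ex_spec Ex_lam)
  hence E: "\<And>x. x \<in> ccar D \<Longrightarrow> E x \<in> F 0" "clinear_on (ccar D) E"
      "\<And>x. x \<in> ccar D \<Longrightarrow> fnorm B 0 (E x) \<le> L.opn x"
      "\<And>g b. b \<in> F g \<Longrightarrow> E (lam g b) = (if g = 0 then b else 0)"
    unfolding faithful_conditional_expectation_def by simp_all
  have El: "clinear_map (ccar D) E" using E(2) D_subspace by (simp add: clinear_map_def)
  have "E x = Ex x" using x
  proof (rule D_induct[where P = "\<lambda>x. E x = Ex x"])
    fix s x assume s: "\<And>k. s k \<in> ccar D" "x \<in> ccar D" "\<And>k. E (s k) = Ex (s k)" "L.Adj.conv s x"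
    have c: "normed_carrier.conv (ccar D) L.opn s x"
      using s L.Adj.convD(3)[OF s(4)] by (simp add: normed_carrier.conv_def[OF D_normed])
    have "U.conv (\<lambda>k. E (s k)) (E x)"
      by (rule bounded_conv[OF D_normed U.normed_carrier_axioms _ clinear_map.diff[OF El] _ c, where C = 1])
        (simp_all add: E(1,3))
    thus "E x = Ex x" using Ex_conv[OF s(4,1,2)] unfolding s(3) by (rule U.conv_unique)
  qed (simp_all add: E(4) Ex_lam clinear_map.add[OF El] clinear_map.add[OF Ex_linear])
  thus ?thesis by (simp add: E_def)
qed

lemma expectation_simps [simp]: "hcar (expectation_module B L \<iota>) = ccar D"
    "hact (expectation_module B L \<iota>) x b = x \<circ> lam 0 b"
    "hip (expectation_module B L \<iota>) x y = cond_exp B L \<iota> (L.adj x \<circ> y)"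
  by (simp_all add: expectation_module_def Let_def)

text \<open>Evaluation at \<open>\<xi>0\<close> thus preserves inner products, which makes the
  completion \<open>H\<close> a second model of \<open>\<ell>\<^sup>2(B)\<close>.\<close>

lemma expectation_ip: assumes "x \<in> ccar D" "y \<in> ccar D"
  shows "hip (expectation_module B L \<iota>) x y = hip L (x \<xi>0) (y \<xi>0)"
  using assms L.adj_spec'[of "L.adj x" \<xi>0 "y \<xi>0"] L.adj_spec(2)[of x "y \<xi>0" \<xi>0]
  by (simp add: cond_exp_eq Ex_def L.opsD(1) L.adj_in L.adj_adj)

lemma Lam_act: assumes "f \<in> S0" "a \<in> F 0"
  shows "hact (sections_module B) f a \<in> S0" "Lam (hact (sections_module B) f a) = Lam f \<circ> lam 0 a"
proof -
  have r: "clinear_map (F g) (\<lambda>b. fmul B g 0 b a)" for g by (rule right_mul_map[OF assms(2)])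
  let ?f = "\<lambda>g. fmul B g 0 (f g) a"
  have sub: "supp ?f \<subseteq> supp f" using assms by (auto simp: mul_0)
  have in0: "?f \<in> S0" using assms finite_subset[OF sub] by (simp add: S0_iff)
  have eq: "hact (sections_module B) f a = ?f" by (simp add: sections_module_def)
  show "hact (sections_module B) f a \<in> S0" using in0 eq by simp
  have "Lam ?f = (\<Sum>g\<in>supp f. lam g (fmul B g 0 (f g) a))"
    unfolding Lam_def by (rule sec_sum_K[OF lam_linear S0D(2)[OF assms(1)] sub])
  also have "\<dots> = (\<Sum>g\<in>supp f. lam g (f g) \<circ> lam 0 a)" using assms by (simp add: lam_mul S0D)
  also have "\<dots> = Lam f \<circ> lam 0 a" using assms L.Adj.mul_sum_left[of "lam 0 a" "supp f" "\<lambda>g. lam g (f g)"]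
    by (simp add: Lam_def sec_sum_def S0D)
  finally show "Lam (hact (sections_module B) f a) = Lam f \<circ> lam 0 a" unfolding eq .
qed

end

locale alg_completion = sec_completion B L \<iota> for B :: "('g::group_add, 'b::complex_vector) fell_data"
    and L :: "('l::complex_vector, 'b) hmodule" and \<iota> :: "('g \<Rightarrow> 'b) \<Rightarrow> 'l" +
  fixes H :: "('h::complex_vector, 'b) hmodule" and j :: "('l \<Rightarrow> 'l) \<Rightarrow> 'h"
  assumes Hcompl: "hilbert_completion (unit_fibre B) (expectation_module B L \<iota>) H j"
begin

sublocale H: hmod Ae H
  using Hcompl U.cstar_alg_axioms by (simp add: hilbert_completion_def hmod_def)

lemma j_in [simp]: "x \<in> ccar D \<Longrightarrow> j x \<in> hcar H" using Hcompl by (simp add: hilbert_completion_def)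

lemma j_linear: "clinear_map (ccar D) j"
  using Hcompl D_subspace by (simp add: hilbert_completion_def clinear_map_def)

lemma ip_j: "\<lbrakk>x \<in> ccar D; y \<in> ccar D\<rbrakk> \<Longrightarrow> hip H (j x) (j y) = hip L (x \<xi>0) (y \<xi>0)"
  using Hcompl expectation_ip[of x y] by (simp add: hilbert_completion_def)

lemma hn_j: assumes "x \<in> ccar D" shows "hnorm Ae H (j x) = hn (x \<xi>0)" "hnorm Ae H (j x) \<le> L.opn x"
  using assms hn_apply_\<xi>0[of x] by (simp_all add: hnorm_def ip_j)

lemma j_dense: "\<lbrakk>h \<in> hcar H; \<epsilon> > 0\<rbrakk> \<Longrightarrow> \<exists>x\<in>ccar D. hnorm Ae H (j x - h) < \<epsilon>"
  using Hcompl by (simp add: hilbert_completion_def)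

text \<open>Inner products agree because \<open>Lam f \<xi>0 = \<iota> f\<close>. Density holds
  because the operators \<open>Lam f\<close> approximate \<open>D\<close> in the operator norm,
  which dominates the norm of \<open>H\<close>.\<close>

sublocale K: sec_completion B H "\<lambda>f. j (Lam f)"
proof unfold_locales
  show "hilbert_completion Ae (sections_module B) H (\<lambda>f. j (Lam f))"
    unfolding hilbert_completion_def
  proof (intro conjI ballI allI impI)
    show "hilbert_module Ae H" using Hcompl by (simp add: hilbert_completion_def)
    show "clinear_on S0 (\<lambda>f. j (Lam f))"
      by (rule clinear_onI)
        (simp_all add: clinear_map.add[OF Lam_linear] clinear_map.scale[OF Lam_linear]
          clinear_map.add[OF j_linear] clinear_map.scale[OF j_linear])
    fix f assume f: "f \<in> S0"
    show "j (Lam f) \<in> hcar H" using f by simp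
    show "j (Lam (hact (sections_module B) f a)) = hact H (j (Lam f)) a" if "a \<in> ccar Ae" for a
    proof -
      have "j (hact (expectation_module B L \<iota>) (Lam f) a) = hact H (j (Lam f)) a"
        using Hcompl that f unfolding hilbert_completion_def by simp
      thus ?thesis using f that Lam_act(2)[of f a] by simp
    qed
    fix f' assume f': "f' \<in> S0"
    show "hip H (j (Lam f)) (j (Lam f')) = hip (sections_module B) f f'"
      using compl f f' by (simp add: ip_j Lam_\<xi>0 hilbert_completion_def)
  next
    fix h \<epsilon> assume h: "h \<in> hcar H" and e: "(\<epsilon>::real) > 0"
    obtain x where x: "x \<in> ccar D" "hnorm Ae H (j x - h) < \<epsilon> / 2" using j_dense[OF h half_gt_zero[OF e]] by blast
    obtain s where s: "\<And>k. s k \<in> S0" "L.Adj.conv (\<lambda>k. Lam (s k)) x" using D_dense[OF x(1)] by blast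
    have "(\<lambda>l. L.opn (Lam (s l) - x)) \<longlonglongrightarrow> 0" using L.Adj.convD(3)[OF s(2)] by simp
    from LIMSEQ_D[OF this half_gt_zero[OF e]] obtain l where l: "L.opn (Lam (s l) - x) < \<epsilon> / 2"
      by (metis abs_less_iff diff_zero order_refl real_norm_def)
    have "hnorm Ae H (j (Lam (s l)) - j x) \<le> L.opn (Lam (s l) - x)"
      using hn_j(2)[OF cv.subspace_diff[OF D_subspace Lam_D[OF s(1)] x(1)]] s(1) x(1)
      by (simp add: clinear_map.diff[OF j_linear])
    hence "hnorm Ae H (j (Lam (s l)) - h) < \<epsilon>"
      using H.X.tri_diff[of "j (Lam (s l))" "j x" h] l x h s(1) by simp
    thus "\<exists>f\<in>S0. hnorm Ae H (j (Lam f) - h) < \<epsilon>" using s(1) by blast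
  qed
qed

lemma j_conv: assumes "L.Adj.conv s x" "\<And>k. s k \<in> ccar D" "x \<in> ccar D"
  shows "H.X.conv (\<lambda>k. j (s k)) (j x)"
proof -
  have c: "normed_carrier.conv (ccar D) L.opn s x"
    using assms L.Adj.convD(3)[OF assms(1)] by (simp add: normed_carrier.conv_def[OF D_normed])
  show ?thesis
    by (rule bounded_conv[OF D_normed H.X.normed_carrier_axioms _ clinear_map.diff[OF j_linear] _ c, where C = 1])
      (simp_all add: hn_j(2))
qed

end

section \<open>Positive definite bundle maps\<close>

text \<open>What the algebraic part keeps for a single member of the net: of the orthonormal bases
  an isometry in each nonzero fibre, of compactness the right linearity, and the normalization that
  rescaling achieves.\<close>

locale pd_bundle = fell_unital B for B :: "('g::group_add, 'b::complex_vector) fell_data" +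
  fixes T :: "'g \<Rightarrow> 'b \<Rightarrow> 'b"
  assumes bounded: "\<And>g. bounded_op (fib B g) (fnorm B g) (T g)"
    and pd: "positive_definite B T"
    and isometry: "\<And>g b. \<lbrakk>b \<in> fib B g; b \<noteq> 0\<rbrakk> \<Longrightarrow>
        \<exists>v\<in>fib B g. fmul B (- g) g (fstar B g v) v = cunit (unit_fibre B)"
    and right_linear: "\<And>g b a. \<lbrakk>b \<in> fib B g; a \<in> fib B 0\<rbrakk> \<Longrightarrow> T g (fmul B g 0 b a) = fmul B g 0 (T g b) a"
    and contractive: "fnorm B 0 (T 0 (cunit (unit_fibre B))) \<le> 1"
begin

lemma T_in [simp]: "b \<in> F g \<Longrightarrow> T g b \<in> F g"
  using bounded by (simp add: bounded_op_def)

lemma T_linear: "clinear_map (F g) (T g)"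
  using bounded N.sub by (simp add: bounded_op_def clinear_map_def)

lemma shift_degree: "- (q + g) + (q + h) = - g + (h::'g)"
  by (simp only: minus_add add.assoc minus_add_cancel)

lemma pd_pos:
  fixes n :: nat
  assumes "\<And>i. i < n \<Longrightarrow> a i \<in> F (g i)" "\<And>i. i < n \<Longrightarrow> b i \<in> F (g i)"
  shows "U.pos (\<Sum>i<n. \<Sum>j<n. fmul B (g j) (- g j) (fmul B (g i) (- g i + g j) (b i)
      (T (- g i + g j) (fmul B (- g i) (g j) (fstar B (g i) (a i)) (a j)))) (fstar B (g j) (b j)))"
  using pd[unfolded positive_definite_def, rule_format, of n a g b] assms by (simp add: U.cpos_iff)

text \<open>Positive definiteness only concerns elements \<open>a\<^sub>i\<close>, \<open>b\<^sub>i\<close> of the same fibre. Conjugation with an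
  isometry of the fibre at \<open>q\<close> allows to shift the degrees of the \<open>a\<^sub>i\<close> by \<open>q\<close>.\<close>

lemma pd_pos_shifted:
  fixes n :: nat
  assumes a: "\<And>i. i < n \<Longrightarrow> a i \<in> F (q + g i)" and b: "\<And>i. i < n \<Longrightarrow> b i \<in> F (g i)"
  shows "U.pos (\<Sum>i<n. \<Sum>j<n. fmul B (g j) (- g j) (fmul B (g i) (- g i + g j) (b i)
      (T (- g i + g j) (fmul B (- (q + g i)) (q + g j) (fstar B (q + g i) (a i)) (a j)))) (fstar B (g j) (b j)))"
    (is "U.pos (\<Sum>i<n. \<Sum>j<n. ?Z i j)")
proof (cases "\<forall>i<n. a i = 0 \<or> b i = 0")
  case True
  \<comment> \<open>Each \<open>?Z i j\<close> contains both \<open>a i\<close> and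
    \<open>b i\<close> as factors, and one of them is zero.\<close>
  have "?Z i j = 0" if ij: "i < n" "j < n" for i j
  proof (cases "a i = 0")
    case True
    thus ?thesis using a[OF ij(2)] b[OF ij(1)] b[OF ij(2)]
      by (simp add: clinear_map.zero[OF T_linear] mul_0(2)[OF star_closed])
  next
    case False
    hence "b i = 0" using True ij by blast
    moreover have "fmul B (- (q + g i)) (q + g j) (fstar B (q + g i) (a i)) (a j) \<in> F (- g i + g j)"
      using mul_closed[OF star_closed[OF a[OF ij(1)]] a[OF ij(2)]] unfolding shift_degree .
    ultimately show ?thesis using mul_0(2)[OF T_in, of _ "- g i + g j" "g i"]
        mul_0(2)[OF star_closed[OF b[OF ij(2)]], of "g j"] by simp
  qed
  thus ?thesis by simp
next
  case False
  then obtain i0 where i0: "i0 < n" "a i0 \<noteq> 0" "b i0 \<noteq> 0" by blast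
  obtain v where v: "v \<in> F (g i0)" "fmul B (- g i0) (g i0) (fstar B (g i0) v) v = e1"
    using isometry[OF b[OF i0(1)] i0(3)] by blast
  \<comment> \<open>The fibre at \<open>q\<close> has an isometry once it is nonzero. The witness is
    \<open>c = a v\<^sup>*\<close> with \<open>a\<close> the element at \<open>i0\<close> and
    \<open>v\<close> an isometry of the fibre of \<open>b i0\<close>: it satisfies
    \<open>c v = a\<close>.\<close>
  let ?c = "fmul B (q + g i0) (- g i0) (a i0) (fstar B (g i0) v)"
  have c: "?c \<in> F q" using a[OF i0(1)] v by (simp add: add.assoc)
  have "fmul B q (g i0) ?c v = fmul B (q + g i0) 0 (a i0) (fmul B (- g i0) (g i0) (fstar B (g i0) v) v)"
    by (rule assoc) (use a[OF i0(1)] v(1) in \<open>simp_all add: add.assoc\<close>)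
  also have "\<dots> = a i0" using v a[OF i0(1)] by simp
  finally have "?c \<noteq> 0" using i0(2) mul_0(2)[OF v(1)] by auto
  then obtain w where w: "w \<in> F q" "fmul B (- q) q (fstar B q w) w = e1" using isometry[OF c] by blast
  have deg: "- (q + g i) + (q + g j) = - g i + g j" for i j by (rule shift_degree)
  have Z: "?Z i j \<in> F 0" if "i < n" "j < n" for i j
    using a[OF that(1)] a[OF that(2)] b[OF that(1)] b[OF that(2)] by (simp add: deg)
  let ?S = "\<Sum>i<n. \<Sum>j<n. ?Z i j"
  have S: "?S \<in> F 0" using Z by (intro N.sum_in) auto
  \<comment> \<open>With \<open>b i\<close> replaced by \<open>w b i\<close>, both families have
    degrees \<open>q + g i\<close>, so positive definiteness applies, and every term of the form
    becomes \<open>w Z w\<^sup>*\<close>.\<close>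
  have tm: "fmul B (q + g j) (- (q + g j)) (fmul B (q + g i) (- (q + g i) + (q + g j)) (fmul B q (g i) w (b i))
      (T (- (q + g i) + (q + g j)) (fmul B (- (q + g i)) (q + g j) (fstar B (q + g i) (a i)) (a j))))
      (fstar B (q + g j) (fmul B q (g j) w (b j))) = fmul B q (- q) (fmul B q 0 w (?Z i j)) (fstar B q w)"
    if ij: "i < n" "j < n" for i j
  proof -
    note [simp] = a[OF ij(1)] a[OF ij(2)] b[OF ij(1)] b[OF ij(2)] w(1)
    let ?X = "T (- g i + g j) (fmul B (- (q + g i)) (q + g j) (fstar B (q + g i) (a i)) (a j))"
    have X: "?X \<in> F (- g i + g j)" by (simp add: deg)
    let ?Y = "fmul B (g i) (- g i + g j) (b i) ?X"
    have Y: "?Y \<in> F (g j)" using X by (simp add: add.assoc[symmetric])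
    have 1: "fmul B (q + g i) (- g i + g j) (fmul B q (g i) w (b i)) ?X = fmul B q (g j) w ?Y"
      by (rule assoc) (use X in \<open>simp_all add: add.assoc[symmetric]\<close>)
    have dq: "g j + (- g j - q) = - q" by (simp only: diff_conv_add_uminus add.assoc[symmetric] right_minus add_0)
    have 2: "fmul B (q + g j) (- g j + - q) (fmul B q (g j) w ?Y) (fmul B (- g j) (- q) (fstar B (g j) (b j)) (fstar B q w))
        = fmul B q (- q) w (fmul B (g j) (- g j + - q) ?Y (fmul B (- g j) (- q) (fstar B (g j) (b j)) (fstar B q w)))"
      by (rule assoc) (use Y in \<open>simp_all add: dq\<close>)
    have 3: "fmul B (g j) (- g j + - q) ?Y (fmul B (- g j) (- q) (fstar B (g j) (b j)) (fstar B q w)) =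
        fmul B 0 (- q) (?Z i j) (fstar B q w)"
      by (rule assoc[symmetric]) (use Y in simp_all)
    have 4: "fmul B q (- q) w (fmul B 0 (- q) (?Z i j) (fstar B q w)) = fmul B q (- q) (fmul B q 0 w (?Z i j)) (fstar B q w)"
      by (rule assoc[symmetric]) (use Z[OF ij] in simp_all)
    have st: "fstar B (q + g j) (fmul B q (g j) w (b j)) = fmul B (- g j) (- q) (fstar B (g j) (b j)) (fstar B q w)"
      by (rule star_mul) simp_all
    show ?thesis unfolding deg 1 st unfolding minus_add[of q "g j"] 2 3 4 ..
  qed
  have "U.pos (\<Sum>i<n. \<Sum>j<n. fmul B (q + g j) (- (q + g j)) (fmul B (q + g i) (- (q + g i) + (q + g j)) (fmul B q (g i) w (b i))
      (T (- (q + g i) + (q + g j)) (fmul B (- (q + g i)) (q + g j) (fstar B (q + g i) (a i)) (a j))))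
      (fstar B (q + g j) (fmul B q (g j) w (b j))))"
    using a b w by (intro pd_pos) simp_all
  also have "(\<Sum>i<n. \<Sum>j<n. fmul B (q + g j) (- (q + g j)) (fmul B (q + g i) (- (q + g i) + (q + g j)) (fmul B q (g i) w (b i))
      (T (- (q + g i) + (q + g j)) (fmul B (- (q + g i)) (q + g j) (fstar B (q + g i) (a i)) (a j))))
      (fstar B (q + g j) (fmul B q (g j) w (b j)))) = (\<Sum>i<n. \<Sum>j<n. fmul B q (- q) (fmul B q 0 w (?Z i j)) (fstar B q w))"
    using tm by (intro sum.cong refl) simp
  also have "\<dots> = fmul B q (- q) (fmul B q 0 w ?S) (fstar B q w)"
  proof -
    let ?G = "\<lambda>z. fmul B q (- q) (fmul B q 0 w z) (fstar B q w)"
    have G: "clinear_map (F 0) ?G"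
      using w(1) star_closed[OF w(1)]
      by (intro clinear_map.intro clinear_onI N.sub) (simp_all add: mul_add_left mul_add_right mul_scale_left mul_scale_right)
    have "(\<Sum>i<n. \<Sum>j<n. ?G (?Z i j)) = (\<Sum>i<n. ?G (\<Sum>j<n. ?Z i j))"
      using Z by (intro sum.cong refl clinear_map.sum[OF G, symmetric]) auto
    also have "\<dots> = ?G ?S"
      using Z by (intro clinear_map.sum[OF G, symmetric] N.sum_in) auto
    finally show ?thesis .
  qed
  \<comment> \<open>Conjugation with \<open>w\<close> recovers the original sum, since
    \<open>w\<^sup>* w = 1\<close>.\<close>
  finally have "U.pos (fmul B (- q) q (fstar B q w) (fmul B 0 q (fmul B q (- q) (fmul B q 0 w ?S) (fstar B q w)) w))"
    using w(1) by (rule fib_conj_pos)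
  also have "fmul B 0 q (fmul B q (- q) (fmul B q 0 w ?S) (fstar B q w)) w = fmul B q 0 (fmul B q 0 w ?S) e1"
    using assoc[of "fmul B q 0 w ?S" q "fstar B q w" "- q" w q 0 0] w S by simp
  also have "\<dots> = fmul B q 0 w ?S" using w S by simp
  also have "fmul B (- q) q (fstar B q w) (fmul B q 0 w ?S) = fmul B 0 0 (fmul B (- q) q (fstar B q w) w) ?S"
    by (rule assoc[symmetric]) (use w S in simp_all)
  also have "\<dots> = ?S" using w(2) U.one_mul[of ?S] S by simp
  finally show ?thesis .
qed

text \<open>The coefficient of the operator of \<open>T(a\<^sup>* a')\<close> between
  \<open>d p b\<close> and \<open>d p' b'\<close>, see \<open>pd_form_coef\<close>. The condition
  says that this operator carries degree \<open>p'\<close> to degree \<open>p\<close>.\<close>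

definition pd_form :: "'g \<Rightarrow> 'b \<Rightarrow> 'g \<Rightarrow> 'b \<Rightarrow> 'g \<Rightarrow> 'b \<Rightarrow> 'g \<Rightarrow> 'b \<Rightarrow> 'b" where
  "pd_form h a p b h' a' p' b' = (if h + p = h' + p' then
     fmul B (- p') p' (fmul B (- p) (- h + h') (fstar B p b) (T (- h + h') (fmul B (- h) h' (fstar B h a) a'))) b' else 0)"

text \<open>The form splits according to the value \<open>q\<close> of \<open>h + p\<close>. Within
  one class \<open>h = q - p\<close>, which is the situation of \<open>pd_pos_shifted\<close> with
  degrees \<open>- p\<close> and with \<open>b\<^sup>*\<close> in place of \<open>b\<close>.\<close>

lemma pd_form_pos:
  assumes A: "finite A" and a: "\<And>\<alpha>. \<alpha> \<in> A \<Longrightarrow> a \<alpha> \<in> F (h \<alpha>)" and b: "\<And>\<alpha>. \<alpha> \<in> A \<Longrightarrow> b \<alpha> \<in> F (p \<alpha>)"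
  shows "U.pos (\<Sum>\<alpha>\<in>A. \<Sum>\<beta>\<in>A. pd_form (h \<alpha>) (a \<alpha>) (p \<alpha>) (b \<alpha>) (h \<beta>) (a \<beta>) (p \<beta>) (b \<beta>))"
proof -
  define k where "k \<alpha> = h \<alpha> + p \<alpha>" for \<alpha>
  let ?P = "\<lambda>\<alpha> \<beta>. pd_form (h \<alpha>) (a \<alpha>) (p \<alpha>) (b \<alpha>) (h \<beta>) (a \<beta>) (p \<beta>) (b \<beta>)"
  have "(\<Sum>\<alpha>\<in>A. \<Sum>\<beta>\<in>A. ?P \<alpha> \<beta>) = (\<Sum>q\<in>k ` A. \<Sum>\<alpha>\<in>{\<alpha>\<in>A. k \<alpha> = q}. \<Sum>\<beta>\<in>A. ?P \<alpha> \<beta>)"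
    by (rule sum.image_gen[OF A])
  also have "\<dots> = (\<Sum>q\<in>k ` A. \<Sum>\<alpha>\<in>{\<alpha>\<in>A. k \<alpha> = q}. \<Sum>\<beta>\<in>{\<beta>\<in>A. k \<beta> = q}. ?P \<alpha> \<beta>)"
    using A by (intro sum.cong refl sum.mono_neutral_right) (auto simp: k_def pd_form_def)
  finally have eq: "(\<Sum>\<alpha>\<in>A. \<Sum>\<beta>\<in>A. ?P \<alpha> \<beta>) = (\<Sum>q\<in>k ` A. \<Sum>\<alpha>\<in>{\<alpha>\<in>A. k \<alpha> = q}. \<Sum>\<beta>\<in>{\<beta>\<in>A. k \<beta> = q}. ?P \<alpha> \<beta>)" .
  show ?thesis unfolding eq
  proof (rule U.pos_sum)
    fix q
    let ?A = "{\<alpha>\<in>A. k \<alpha> = q}"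
    obtain e where e: "bij_betw e {0..<card ?A} ?A" using ex_bij_betw_nat_finite[of ?A] A by auto
    hence e': "bij_betw e {..<card ?A} ?A" by (simp add: lessThan_atLeast0)
    have eA: "e i \<in> A" "h (e i) = q + - p (e i)" if "i < card ?A" for i
    proof -
      have "e i \<in> ?A" using e' that by (auto simp: bij_betw_def)
      thus "e i \<in> A" "h (e i) = q + - p (e i)" by (auto simp: k_def add.assoc)
    qed
    let ?g = "\<lambda>i. - p (e i)"
    let ?Z = "\<lambda>i j. fmul B (?g j) (- ?g j) (fmul B (?g i) (- ?g i + ?g j) (fstar B (p (e i)) (b (e i)))
      (T (- ?g i + ?g j) (fmul B (- (q + ?g i)) (q + ?g j) (fstar B (q + ?g i) (a (e i))) (a (e j)))))
        (fstar B (?g j) (fstar B (p (e j)) (b (e j))))"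
    have "U.pos (\<Sum>i<card ?A. \<Sum>j<card ?A. ?Z i j)"
    proof (rule pd_pos_shifted)
      fix i assume i: "i < card ?A"
      show "a (e i) \<in> F (q + ?g i)" using a[OF eA(1)[OF i]] unfolding eA(2)[OF i] .
      show "fstar B (p (e i)) (b (e i)) \<in> F (?g i)" using b[OF eA(1)[OF i]] by simp
    qed
    also have "(\<Sum>i<card ?A. \<Sum>j<card ?A. ?Z i j) = (\<Sum>i<card ?A. \<Sum>j<card ?A. ?P (e i) (e j))"
    proof (intro sum.cong refl)
      fix i j assume "i \<in> {..<card ?A}" "j \<in> {..<card ?A}"
      hence ij: "i < card ?A" "j < card ?A" by simp_all
      have d: "- (q + - p (e i)) + (q + - p (e j)) = - ?g i + ?g j" by (rule shift_degree)
      show "?Z i j = ?P (e i) (e j)" using b[OF eA(1)[OF ij(2)]]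
        unfolding pd_form_def eA(2)[OF ij(1)] eA(2)[OF ij(2)] d by (simp add: star_star' add.assoc)
    qed
    also have "\<dots> = (\<Sum>\<alpha>\<in>?A. \<Sum>\<beta>\<in>?A. ?P \<alpha> \<beta>)"
      by (simp add: sum.reindex_bij_betw[OF e', of "\<lambda>\<beta>. ?P _ \<beta>"] sum.reindex_bij_betw[OF e', of "\<lambda>\<alpha>. \<Sum>\<beta>\<in>?A. ?P \<alpha> \<beta>"])
    finally show "U.pos (\<Sum>\<alpha>\<in>?A. \<Sum>\<beta>\<in>?A. ?P \<alpha> \<beta>)" .
  qed
qed

lemma T_star: assumes c: "c \<in> F g" shows "T (- g) (fstar B g c) = fstar B g (T g c)"
proof (cases "c = 0")
  case True thus ?thesis by (simp add: clinear_map.zero[OF T_linear])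
next
  case False
  then obtain v where v: "v \<in> F g" "fmul B (- g) g (fstar B g v) v = e1" using isometry[OF c] by blast
  let ?X = "fmul B g (- g) (T g c) (fstar B g v)" and ?Y = "fmul B g (- g) v (T (- g) (fstar B g c))"
  note [simp] = c v(1) star_closed[OF c]
  have XY [simp]: "?X \<in> F 0" "?Y \<in> F 0" by simp_all
  let ?P = "\<lambda>s. fmul B 0 0 (fmul B 0 0 s (T 0 e1)) (fstar B 0 s)"
  let ?Q = "fmul B g (- g) (fmul B g 0 v (T 0 (fmul B (- g) g (fstar B g c) c))) (fstar B g v)"
  have P: "U.pos (?P s)" if "s \<in> F 0" for s using pd_pos[of 1 "\<lambda>_. e1" "\<lambda>_. 0" "\<lambda>_. s"] that by simp
  have Q: "U.pos ?Q" using pd_pos[of 1 "\<lambda>_. c" "\<lambda>_. g" "\<lambda>_. v"] by simp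
  have R: "U.sa (fmul B 0 0 s ?X + fmul B 0 0 ?Y (fstar B 0 s))" if s: "s \<in> F 0" for s
  proof -
    have e: "fmul B g (- g) (fmul B 0 g s (T g c)) (fstar B g v) = fmul B 0 0 s ?X"
      by (rule assoc) (use s in simp_all)
    have "U.pos (?P s + fmul B g (- g) (fmul B 0 g s (T g c)) (fstar B g v) +
        (fmul B 0 0 (fmul B g (- g) v (T (- g) (fstar B g c))) (fstar B 0 s) + ?Q))"
      using pd_pos[of 2 "\<lambda>i. if i = 0 then e1 else c" "\<lambda>i. if i = 0 then 0 else g" "\<lambda>i. if i = 0 then s else v"] s
      by (simp add: numeral_2_eq_2)
    hence "U.sa ((?P s + fmul B 0 0 s ?X + (fmul B 0 0 ?Y (fstar B 0 s) + ?Q)) - ?P s - ?Q)"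
      unfolding e by (rule U.sa_intros(2)[OF U.sa_intros(2)[OF U.posD(3) U.posD(3)[OF P[OF s]]] U.posD(3)[OF Q]])
    thus ?thesis by (simp add: algebra_simps)
  qed
  have "U.sa (?X + ?Y)" using R[OF e1_in] U.one_mul[of ?X] U.mul_one[of ?Y] by simp
  hence 1: "fstar B 0 ?X + fstar B 0 ?Y = ?X + ?Y" by (simp add: U.sa_def star_add)
  have "fmul B 0 0 ?Y (- (\<i> *\<^sub>C e1)) = - (\<i> *\<^sub>C ?Y)"
    using U.mul_minus(1)[of ?Y "\<i> *\<^sub>C e1"] U.mul_one[of ?Y] by (simp add: mul_scale_right)
  hence "U.sa (\<i> *\<^sub>C ?X + - (\<i> *\<^sub>C ?Y))" using R[of "\<i> *\<^sub>C e1"] U.one_mul[of ?X]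
    by (simp add: mul_scale_left star_scale)
  hence "fstar B 0 (\<i> *\<^sub>C (?X - ?Y)) = \<i> *\<^sub>C (?X - ?Y)" by (simp add: U.sa_def cv.scale_right_diff_distrib)
  moreover have "fstar B 0 (\<i> *\<^sub>C (?X - ?Y)) = \<i> *\<^sub>C (- (fstar B 0 ?X - fstar B 0 ?Y))"
    by (simp only: star_scale[OF N.diff_in[OF XY]] star_sub[OF XY] complex_cnj_i cv.scale_minus_left cv.scale_minus_right)
  ultimately have "\<i> *\<^sub>C (- (fstar B 0 ?X - fstar B 0 ?Y)) = \<i> *\<^sub>C (?X - ?Y)" by (simp only:)
  hence "- (fstar B 0 ?X - fstar B 0 ?Y) = ?X - ?Y"
    by (rule cv.scale_left_imp_eq[OF complex_i_not_zero])
  hence 2: "- (fstar B 0 ?X - fstar B 0 ?Y) - (?X - ?Y) = 0" by (simp only: right_minus_eq)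
  have "2 *\<^sub>C (fstar B 0 ?Y - ?X) = (fstar B 0 ?X + fstar B 0 ?Y - (?X + ?Y)) + (- (fstar B 0 ?X - fstar B 0 ?Y) - (?X - ?Y))"
    by (simp only: scaleC_two) (simp add: algebra_simps)
  hence XY': "?X = fstar B 0 ?Y" using 1 2 by simp
  have stY: "fstar B 0 ?Y = fmul B g (- g) (fstar B (- g) (T (- g) (fstar B g c))) (fstar B g v)"
    by (rule star_mul') simp_all
  have can: "fmul B 0 g (fmul B g (- g) y (fstar B g v)) v = y" if "y \<in> F g" for y
    using assoc[OF that star_closed[OF v(1)] v(1), of 0 0] v that by simp
  have "T g c = fmul B 0 g ?X v" by (simp add: can)
  also have "\<dots> = fstar B (- g) (T (- g) (fstar B g c))" unfolding XY' stY by (simp add: can)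
  finally show ?thesis by (simp add: star_star')
qed

text \<open>Right linearity, carried to the other side by the involution and
  \<open>T_star\<close>.\<close>

lemma left_linear: assumes "a \<in> F 0" "b \<in> F g" shows "T g (fmul B 0 g a b) = fmul B 0 g a (T g b)"
proof -
  have "T g (fmul B 0 g a b) = fstar B (- g) (T (- g) (fstar B g (fmul B 0 g a b)))"
    using assms by (simp add: T_star star_star')
  also have "fstar B g (fmul B 0 g a b) = fmul B (- g) 0 (fstar B g b) (fstar B 0 a)"
    using assms by (simp add: star_mul')
  also have "T (- g) \<dots> = fmul B (- g) 0 (fstar B g (T g b)) (fstar B 0 a)"
    using assms by (simp add: right_linear T_star)
  also have "fstar B (- g) \<dots> = fmul B 0 g a (T g b)"
    using assms by (simp add: star_mul' star_star')
  finally show ?thesis .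
qed

end

section \<open>The multiplier on the reduced algebra\<close>

locale pd_map = sec_completion B L \<iota> + pd_bundle B T
  for B :: "('g::group_add, 'b::complex_vector) fell_data"
    and L :: "('l::complex_vector, 'b) hmodule" and \<iota> :: "('g \<Rightarrow> 'b) \<Rightarrow> 'l" and T :: "'g \<Rightarrow> 'b \<Rightarrow> 'b"
begin

lemma lam_T_linear: "clinear_map (F g) (\<lambda>b. lam g (T g b))"
  by (intro clinear_map.intro clinear_onI N.sub)
    (simp_all add: clinear_map.add[OF T_linear] clinear_map.scale[OF T_linear]
      clinear_map.add[OF lam_linear] clinear_map.scale[OF lam_linear])

text \<open>Acts on sections rather than on the operators \<open>Lam f\<close>; that
  \<open>Lam f \<mapsto> Qm f\<close> extends to the algebra rests on
  \<open>Qm_bound\<close>.\<close>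

definition Qm :: "('g \<Rightarrow> 'b) \<Rightarrow> 'l \<Rightarrow> 'l" where "Qm = sec_sum (\<lambda>g b. lam g (T g b))"

lemma Qm_linear: "clinear_map S0 Qm" unfolding Qm_def by (rule sec_sum_linear[OF lam_T_linear])

lemma Qm_single [simp]: "Qm (single g b) = lam g (T g b)" unfolding Qm_def by (rule sec_sum_single[OF lam_T_linear])

lemma Qm_D [simp]: "f \<in> S0 \<Longrightarrow> Qm f \<in> ccar D"
  unfolding Qm_def sec_sum_def by (intro cv.subspace_sum[OF D_subspace] lam_D T_in S0D)

lemma Qm_star: assumes f: "f \<in> S0" shows "Qm (sec_star f) = L.adj (Qm f)"
proof -
  have "Qm (sec_star f) = (\<Sum>g\<in>supp f. lam (- g) (T (- g) (fstar B g (f g))))"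
    unfolding sec_star_def using f by (subst clinear_map.sum[OF Qm_linear]) (simp_all add: S0D)
  also have "\<dots> = (\<Sum>g\<in>supp f. L.adj (lam g (T g (f g))))" using f by (simp add: lam_star S0D T_star)
  also have "\<dots> = L.adj (Qm f)" using L.Adj.star_sum[of "supp f" "\<lambda>g. lam g (T g (f g))"] f
    by (simp add: Qm_def sec_sum_def S0D)
  finally show ?thesis .
qed

lemma pd_form_coef:
  assumes a: "a \<in> F h" "a' \<in> F h'" and b: "b \<in> F p" "b' \<in> F p'"
  shows "hip L (d p b) (lam (- h + h') (T (- h + h') (fmul B (- h) h' (fstar B h a) a')) (d p' b')) =
    pd_form h a p b h' a' p' b'"
proof (cases "h + p = h' + p'")
  case True
  have p: "p = - h + h' + p'" using True by (metis add.assoc minus_add_cancel)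
  let ?c = "T (- h + h') (fmul B (- h) h' (fstar B h a) a')"
  have c: "?c \<in> F (- h + h')" using a by simp
  have "fmul B (- p') p' (fmul B (- p) (- h + h') (fstar B p b) ?c) b' = fmul B (- p) p (fstar B p b) (fmul B (- h + h') p' ?c b')"
    by (rule assoc) (use b c p in \<open>simp_all add: minus_add add.assoc\<close>)
  thus ?thesis using b c p True by (simp add: lam_d ip_d pd_form_def)
next
  case False
  hence "p \<noteq> - h + h' + p'" by (metis add.assoc add.right_inverse add_0)
  moreover have "T (- h + h') (fmul B (- h) h' (fstar B h a) a') \<in> F (- h + h')" using a by simp
  ultimately show ?thesis using b False by (simp add: lam_d ip_d pd_form_def)
qed

lemma Qm_inner:
  assumes f: "f \<in> S0" "f' \<in> S0" and x: "\<xi> \<in> S0" "\<eta> \<in> S0"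
  shows "hip L (\<iota> \<xi>) (Qm (sec_inner f f') (\<iota> \<eta>)) =
    (\<Sum>x\<in>supp f \<times> supp \<xi>. \<Sum>y\<in>supp f' \<times> supp \<eta>.
      pd_form (fst x) (f (fst x)) (snd x) (\<xi> (snd x)) (fst y) (f' (fst y)) (snd y) (\<eta> (snd y)))"
proof -
  let ?K = "\<lambda>h h'. lam (- h + h') (T (- h + h') (fmul B (- h) h' (fstar B h (f h)) (f' h')))"
  have K: "?K h h' \<in> L.ops" for h h' using f by (intro lam_in T_in mul_in[OF star_closed]) (simp_all add: S0D)
  have "Qm (sec_inner f f') = (\<Sum>x\<in>supp f \<times> supp f'. ?K (fst x) (snd x))"
    unfolding sec_inner_def case_prod_unfold using f
    by (subst clinear_map.sum[OF Qm_linear]) (simp_all add: S0D)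
  also have "\<dots> = (\<Sum>h\<in>supp f. \<Sum>h'\<in>supp f'. ?K h h')"
    by (simp add: sum.cartesian_product case_prod_unfold)
  finally have Q: "Qm (sec_inner f f') x = (\<Sum>h\<in>supp f. \<Sum>h'\<in>supp f'. ?K h h' x)" for x
    by (simp add: sum_fun_apply)
  have dx: "d p (\<xi> p) \<in> HL" "d p (\<eta> p) \<in> HL" for p using x by (simp_all add: S0D)
  have Kd: "?K h h' (d p (\<eta> p)) \<in> HL" for h h' p by (rule L.opsD(1)[OF K dx(2)])
  have y: "Qm (sec_inner f f') (\<iota> \<eta>) = (\<Sum>h\<in>supp f. \<Sum>h'\<in>supp f'. \<Sum>p'\<in>supp \<eta>. ?K h h' (d p' (\<eta> p')))"
    unfolding Q \<iota>_expand[OF x(2) S0D(2)[OF x(2)] order_refl]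
    by (intro sum.cong refl clinear_map.sum[OF L.opsD(5)[OF K]] dx)
  have "hip L (\<iota> \<xi>) (Qm (sec_inner f f') (\<iota> \<eta>)) =
      (\<Sum>p\<in>supp \<xi>. hip L (d p (\<xi> p)) (Qm (sec_inner f f') (\<iota> \<eta>)))"
    unfolding \<iota>_expand[OF x(1) S0D(2)[OF x(1)] order_refl]
    using dx Kd by (intro L.ip_sum_left) (simp_all add: y L.X.sum_in)
  also have "\<dots> = (\<Sum>p\<in>supp \<xi>. \<Sum>h\<in>supp f. \<Sum>h'\<in>supp f'. \<Sum>p'\<in>supp \<eta>. hip L (d p (\<xi> p)) (?K h h' (d p' (\<eta> p'))))"
    using dx Kd by (intro sum.cong refl) (simp add: y L.ip_sum L.X.sum_in)
  also have "\<dots> = (\<Sum>h\<in>supp f. \<Sum>p\<in>supp \<xi>. \<Sum>h'\<in>supp f'. \<Sum>p'\<in>supp \<eta>. hip L (d p (\<xi> p)) (?K h h' (d p' (\<eta> p'))))"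
    by (rule sum.swap)
  also have "\<dots> = (\<Sum>h\<in>supp f. \<Sum>p\<in>supp \<xi>. \<Sum>h'\<in>supp f'. \<Sum>p'\<in>supp \<eta>. pd_form h (f h) p (\<xi> p) h' (f' h') p' (\<eta> p'))"
    using f x by (intro sum.cong refl pd_form_coef) (simp_all add: S0D)
  also have "\<dots> = (\<Sum>h\<in>supp f. \<Sum>p\<in>supp \<xi>. \<Sum>y\<in>supp f' \<times> supp \<eta>.
      pd_form h (f h) p (\<xi> p) (fst y) (f' (fst y)) (snd y) (\<eta> (snd y)))"
    by (intro sum.cong refl) (simp add: sum.cartesian_product case_prod_unfold)
  also have "\<dots> = (\<Sum>x\<in>supp f \<times> supp \<xi>. \<Sum>y\<in>supp f' \<times> supp \<eta>.
      pd_form (fst x) (f (fst x)) (snd x) (\<xi> (snd x)) (fst y) (f' (fst y)) (snd y) (\<eta> (snd y)))"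
    by (subst sum.cartesian_product) (simp only: case_prod_unfold)
  finally show ?thesis .
qed

text \<open>The indices \<open>i\<close> together with the degrees occurring in \<open>f i\<close>
  and \<open>\<xi> i\<close> form one finite index set, to which \<open>pd_form_pos\<close>
  applies.\<close>

lemma Qm_pos:
  fixes n :: nat
  assumes f: "\<And>i. i < n \<Longrightarrow> f i \<in> S0" and x: "\<And>i. i < n \<Longrightarrow> \<xi> i \<in> S0"
  shows "U.pos (\<Sum>i<n. \<Sum>j<n. hip L (\<iota> (\<xi> i)) (Qm (sec_inner (f i) (f j)) (\<iota> (\<xi> j))))"
proof -
  let ?S = "\<lambda>i. supp (f i) \<times> supp (\<xi> i)"
  let ?A = "SIGMA i:{..<n}. ?S i"
  let ?P = "\<lambda>i x j y. pd_form (fst x) (f i (fst x)) (snd x) (\<xi> i (snd x)) (fst y) (f j (fst y)) (snd y) (\<xi> j (snd y))"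
  have fin: "finite (?S i)" if "i < n" for i using f[OF that] x[OF that] by (simp add: S0D)
  have "(\<Sum>i<n. \<Sum>j<n. hip L (\<iota> (\<xi> i)) (Qm (sec_inner (f i) (f j)) (\<iota> (\<xi> j)))) =
      (\<Sum>i<n. \<Sum>j<n. \<Sum>x\<in>?S i. \<Sum>y\<in>?S j. ?P i x j y)"
    using f x by (intro sum.cong refl Qm_inner) auto
  also have "\<dots> = (\<Sum>i<n. \<Sum>x\<in>?S i. \<Sum>j<n. \<Sum>y\<in>?S j. ?P i x j y)"
    by (intro sum.cong refl sum.swap)
  also have "\<dots> = (\<Sum>\<alpha>\<in>?A. \<Sum>\<beta>\<in>?A. ?P (fst \<alpha>) (snd \<alpha>) (fst \<beta>) (snd \<beta>))"
    using fin by (simp add: sum.Sigma case_prod_unfold)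
  finally have eq: "(\<Sum>i<n. \<Sum>j<n. hip L (\<iota> (\<xi> i)) (Qm (sec_inner (f i) (f j)) (\<iota> (\<xi> j)))) =
      (\<Sum>\<alpha>\<in>?A. \<Sum>\<beta>\<in>?A. ?P (fst \<alpha>) (snd \<alpha>) (fst \<beta>) (snd \<beta>))" .
  show ?thesis unfolding eq
  proof (rule pd_form_pos)
    show "finite ?A" by (rule finite_SigmaI, simp, rule fin, simp)
  qed (use f x in \<open>auto simp: S0D\<close>)
qed

text \<open>Cauchy-Schwarz for \<open>d k (r k)\<close> and \<open>Lam r \<xi>0\<close>, whose inner
  product is the square of the coefficient at \<open>k\<close>.\<close>

lemma coef_bound: assumes r: "r \<in> S0" shows "fnorm B k (r k) \<le> L.opn (Lam r)"
proof (cases "r k = 0")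
  case True thus ?thesis using r by (simp add: L.opn_nonneg)
next
  case False
  have rk: "r k \<in> F k" by (rule S0D(1)[OF r])
  have "fmul B (- k) k (fstar B k (r k)) (r k) = hip L (\<iota> (single k (r k))) (\<iota> r)"
    using ip_\<iota>[OF single_in[OF rk] r, of "{k}"] single_supp[of k "r k"] by (simp add: single_def)
  hence "(fnorm B k (r k))\<^sup>2 = fnorm B 0 (hip L (d k (r k)) (Lam r \<xi>0))"
    using star_mul_norm[OF rk] r by (simp add: Lam_\<xi>0 d_def)
  also have "\<dots> \<le> hn (d k (r k)) * hn (Lam r \<xi>0)"
    using L.cauchy_schwarz[OF d_in[OF rk] L.opsD(1)[OF Lam_in[OF r] \<xi>0_in]] by simp
  also have "\<dots> \<le> fnorm B k (r k) * L.opn (Lam r)"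
    using hn_apply_\<xi>0[OF Lam_in[OF r]] N.nonneg[OF rk] by (simp add: hn_d[OF rk] mult_left_mono)
  finally have "fnorm B k (r k) * fnorm B k (r k) \<le> fnorm B k (r k) * L.opn (Lam r)" by (simp add: power2_eq_square)
  moreover have "fnorm B k (r k) > 0" using False N.nonneg[OF rk] N.eq_0[OF rk] by simp
  ultimately show ?thesis by simp
qed

lemma Qm_coef:
  assumes a: "a \<in> F p" and b: "b \<in> F p'" and r: "r \<in> S0"
  shows "hip L (d p a) (Qm r (d p' b)) = fmul B (- p) p (fstar B p a) (fmul B (p - p') p' (T (p - p') (r (p - p'))) b)"
  using r
proof (rule S0_induct[where P = "\<lambda>r. hip L (d p a) (Qm r (d p' b)) = fmul B (- p) p (fstar B p a) (fmul B (p - p') p' (T (p - p') (r (p - p'))) b)"])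
  have da: "d p a \<in> HL" "d p' b \<in> HL" using a b by simp_all
  note z = mul_0(2)[OF b] mul_0(1)[OF star_closed[OF a]]
  show "hip L (d p a) (Qm (single g c) (d p' b)) =
      fmul B (- p) p (fstar B p a) (fmul B (p - p') p' (T (p - p') (single g c (p - p'))) b)" if c: "c \<in> F g" for g c
  proof (cases "p = g + p'")
    case True
    hence "p - p' = g" by simp
    hence v: "p - p' = g" "single g c g = c" by (simp_all add: single_def)
    show ?thesis unfolding v using a b c True by (simp add: lam_d ip_d)
  next
    case False
    hence "p - p' \<noteq> g" by (metis diff_add_cancel)
    hence v: "single g c (p - p') = 0" by (simp add: single_def)
    show ?thesis unfolding v using a b c False by (simp add: lam_d ip_d clinear_map.zero[OF T_linear] z)
  qed
  show "hip L (d p a) (Qm 0 (d p' b)) = fmul B (- p) p (fstar B p a) (fmul B (p - p') p' (T (p - p') (0 (p - p'))) b)"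
    using da by (simp add: clinear_map.zero[OF Qm_linear] clinear_map.zero[OF T_linear] z)
  fix f f' assume f: "f \<in> S0" "f' \<in> S0"
    "hip L (d p a) (Qm f (d p' b)) = fmul B (- p) p (fstar B p a) (fmul B (p - p') p' (T (p - p') (f (p - p'))) b)"
    "hip L (d p a) (Qm f' (d p' b)) = fmul B (- p) p (fstar B p a) (fmul B (p - p') p' (T (p - p') (f' (p - p'))) b)"
  have Q: "Qm f (d p' b) \<in> HL" "Qm f' (d p' b) \<in> HL" using f da by (simp_all add: L.opsD(1))
  show "hip L (d p a) (Qm (f + f') (d p' b)) =
      fmul B (- p) p (fstar B p a) (fmul B (p - p') p' (T (p - p') ((f + f') (p - p'))) b)"
    using f a b da Q star_closed[OF a] by (simp add: clinear_map.add[OF Qm_linear] L.ip_add S0D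
        clinear_map.add[OF T_linear] mul_add_left mul_add_right)
qed

text \<open>Continuity with a constant depending on the two vectors, available before any norm bound
  of \<open>Qm\<close>. Only finitely many coefficients of \<open>r\<close> enter, and
  \<open>coef_bound\<close> controls each of them.\<close>

lemma Qm_form_bound:
  assumes x: "\<xi> \<in> S0" and y: "\<eta> \<in> S0"
  shows "\<exists>C. \<forall>r\<in>S0. fnorm B 0 (hip L (\<iota> \<xi>) (Qm r (\<iota> \<eta>))) \<le> C * L.opn (Lam r)"
  using x
proof (rule S0_induct[where P = "\<lambda>\<xi>. \<exists>C. \<forall>r\<in>S0. fnorm B 0 (hip L (\<iota> \<xi>) (Qm r (\<iota> \<eta>))) \<le> C * L.opn (Lam r)"])
  have Qi: "Qm r (\<iota> f) \<in> HL" if "r \<in> S0" "f \<in> S0" for r f using that by (simp add: L.opsD(1))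
  fix p a assume a: "a \<in> F p"
  show "\<exists>C. \<forall>r\<in>S0. fnorm B 0 (hip L (\<iota> (single p a)) (Qm r (\<iota> \<eta>))) \<le> C * L.opn (Lam r)"
    using y
  proof (rule S0_induct[where P = "\<lambda>\<eta>. \<exists>C. \<forall>r\<in>S0. fnorm B 0 (hip L (\<iota> (single p a)) (Qm r (\<iota> \<eta>))) \<le> C * L.opn (Lam r)"])
    fix p' b assume b: "b \<in> F p'"
    let ?k = "p - p'"
    obtain C where C: "\<And>c. c \<in> F ?k \<Longrightarrow> fnorm B ?k (T ?k c) \<le> C * fnorm B ?k c"
      using bounded[of ?k] by (auto simp: bounded_op_def bounded_on_def)
    show "\<exists>C. \<forall>r\<in>S0. fnorm B 0 (hip L (\<iota> (single p a)) (Qm r (\<iota> (single p' b)))) \<le> C * L.opn (Lam r)"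
    proof (intro exI ballI)
      fix r assume r: "r \<in> S0"
      have rk: "r ?k \<in> F ?k" by (rule S0D(1)[OF r])
      have n: "fnorm B ?k (T ?k (r ?k)) \<le> \<bar>C\<bar> * L.opn (Lam r)"
      proof -
        have "C * fnorm B ?k (r ?k) \<le> \<bar>C\<bar> * L.opn (Lam r)"
          using N.nonneg[OF rk] coef_bound[OF r, of ?k] by (intro mult_mono) auto
        thus ?thesis using C[OF rk] by simp
      qed
      have "fnorm B (- p + p) (fmul B (- p) p (fstar B p a) (fmul B ?k p' (T ?k (r ?k)) b))
          \<le> fnorm B p a * fnorm B (?k + p') (fmul B ?k p' (T ?k (r ?k)) b)"
        using mul_norm[of "fstar B p a" "- p" "fmul B ?k p' (T ?k (r ?k)) b" p] a b rk by (simp add: star_norm)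
      also have "\<dots> \<le> fnorm B p a * ((\<bar>C\<bar> * L.opn (Lam r)) * fnorm B p' b)"
        by (intro mult_left_mono order_trans[OF mul_norm] mult_right_mono n N.nonneg a b T_in rk)
      finally show "fnorm B 0 (hip L (\<iota> (single p a)) (Qm r (\<iota> (single p' b)))) \<le>
          fnorm B p a * \<bar>C\<bar> * fnorm B p' b * L.opn (Lam r)"
        using Qm_coef[OF a b r] by (simp add: d_def mult_ac)
    qed
  next
    show "\<exists>C. \<forall>r\<in>S0. fnorm B 0 (hip L (\<iota> (single p a)) (Qm r (\<iota> 0))) \<le> C * L.opn (Lam r)"
      by (intro exI[of _ 0]) (use a in \<open>simp add: clinear_map.zero[OF \<iota>_linear] clinear_map.zero[OF L.opsD(5)]\<close>)
    fix f f' assume f: "f \<in> S0" "f' \<in> S0"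
      "\<exists>C. \<forall>r\<in>S0. fnorm B 0 (hip L (\<iota> (single p a)) (Qm r (\<iota> f))) \<le> C * L.opn (Lam r)"
      "\<exists>C. \<forall>r\<in>S0. fnorm B 0 (hip L (\<iota> (single p a)) (Qm r (\<iota> f'))) \<le> C * L.opn (Lam r)"
    then obtain C C' where C: "\<And>r. r \<in> S0 \<Longrightarrow> fnorm B 0 (hip L (\<iota> (single p a)) (Qm r (\<iota> f))) \<le> C * L.opn (Lam r)"
      "\<And>r. r \<in> S0 \<Longrightarrow> fnorm B 0 (hip L (\<iota> (single p a)) (Qm r (\<iota> f'))) \<le> C' * L.opn (Lam r)" by blast
    show "\<exists>C. \<forall>r\<in>S0. fnorm B 0 (hip L (\<iota> (single p a)) (Qm r (\<iota> (f + f')))) \<le> C * L.opn (Lam r)"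
    proof (intro exI[of _ "C + C'"] ballI)
      fix r assume r: "r \<in> S0"
      have ia: "\<iota> (single p a) \<in> HL" using a by simp
      have "hip L (\<iota> (single p a)) (Qm r (\<iota> (f + f'))) = hip L (\<iota> (single p a)) (Qm r (\<iota> f)) + hip L (\<iota> (single p a)) (Qm r (\<iota> f'))"
        using f r ia Qi by (simp add: clinear_map.add[OF \<iota>_linear] clinear_map.add[OF L.opsD(5)] L.ip_add)
      thus "fnorm B 0 (hip L (\<iota> (single p a)) (Qm r (\<iota> (f + f')))) \<le> (C + C') * L.opn (Lam r)"
        using N.tri[of "hip L (\<iota> (single p a)) (Qm r (\<iota> f))" 0 "hip L (\<iota> (single p a)) (Qm r (\<iota> f'))"]
          L.ip_closed[OF ia Qi[OF r f(1)]] L.ip_closed[OF ia Qi[OF r f(2)]] C[OF r] by (simp add: algebra_simps)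
    qed
  qed
next
  have Qi: "Qm r (\<iota> \<eta>) \<in> HL" if "r \<in> S0" for r using that y by (simp add: L.opsD(1))
  show "\<exists>C. \<forall>r\<in>S0. fnorm B 0 (hip L (\<iota> 0) (Qm r (\<iota> \<eta>))) \<le> C * L.opn (Lam r)"
    by (intro exI[of _ 0]) (simp add: clinear_map.zero[OF \<iota>_linear] Qi)
  fix f f' assume f: "f \<in> S0" "f' \<in> S0"
    "\<exists>C. \<forall>r\<in>S0. fnorm B 0 (hip L (\<iota> f) (Qm r (\<iota> \<eta>))) \<le> C * L.opn (Lam r)"
    "\<exists>C. \<forall>r\<in>S0. fnorm B 0 (hip L (\<iota> f') (Qm r (\<iota> \<eta>))) \<le> C * L.opn (Lam r)"
  then obtain C C' where C: "\<And>r. r \<in> S0 \<Longrightarrow> fnorm B 0 (hip L (\<iota> f) (Qm r (\<iota> \<eta>))) \<le> C * L.opn (Lam r)"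
    "\<And>r. r \<in> S0 \<Longrightarrow> fnorm B 0 (hip L (\<iota> f') (Qm r (\<iota> \<eta>))) \<le> C' * L.opn (Lam r)" by blast
  show "\<exists>C. \<forall>r\<in>S0. fnorm B 0 (hip L (\<iota> (f + f')) (Qm r (\<iota> \<eta>))) \<le> C * L.opn (Lam r)"
  proof (intro exI[of _ "C + C'"] ballI)
    fix r assume r: "r \<in> S0"
    have "hip L (\<iota> (f + f')) (Qm r (\<iota> \<eta>)) = hip L (\<iota> f) (Qm r (\<iota> \<eta>)) + hip L (\<iota> f') (Qm r (\<iota> \<eta>))"
      using f r Qi by (simp add: clinear_map.add[OF \<iota>_linear] L.ip_add_left)
    thus "fnorm B 0 (hip L (\<iota> (f + f')) (Qm r (\<iota> \<eta>))) \<le> (C + C') * L.opn (Lam r)"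
      using N.tri[of "hip L (\<iota> f) (Qm r (\<iota> \<eta>))" 0 "hip L (\<iota> f') (Qm r (\<iota> \<eta>))"]
        L.ip_closed[OF \<iota>_in[OF f(1)] Qi[OF r]] L.ip_closed[OF \<iota>_in[OF f(2)] Qi[OF r]] C[OF r] by (simp add: algebra_simps)
  qed
qed

lemma lam_form_pos: assumes a: "U.pos a" and x: "x \<in> HL" shows "U.pos (hip L x (lam 0 a x))"
proof -
  obtain s where s: "U.sa s" "fmul B 0 0 s s = a" using U.pos_root[OF a] by (metis Ae_simps(2))
  hence s': "s \<in> F 0" "fstar B 0 s = s" by (auto simp: U.sa_def)
  have "lam 0 a = lam 0 s \<circ> lam 0 s" using lam_mul[OF s'(1) s'(1)] s(2) by simp
  moreover have "L.adj (lam 0 s) = lam 0 s" using lam_star[OF s'(1)] s'(2) by simp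
  moreover have "lam 0 s x \<in> HL" using s'(1) x by (simp add: L.opsD(1))
  ultimately have "hip L x (lam 0 a x) = hip L (lam 0 s x) (lam 0 s x)"
    using L.adj_spec(2)[of "lam 0 s" "lam 0 s x" x] s'(1) x by simp
  thus ?thesis using L.ip_self_pos[of "lam 0 s x"] s'(1) x by (simp add: L.opsD(1))
qed

lemma T_one_pos: "U.pos (T 0 e1)"
  using pd_pos[of 1 "\<lambda>_. e1" "\<lambda>_. 0" "\<lambda>_. e1"] U.one_mul[of e1] U.one_mul[of "T 0 e1"] U.mul_one[of "T 0 e1"] by simp

lemma unit_form_bound: assumes x: "x \<in> HL" shows "U.pos (hip L x x - hip L x (lam 0 (T 0 e1) x))"
proof -
  have "U.pos (rsc 1 e1 - T 0 e1)" using contractive by (intro U.pos_one_minus U.posD(3) T_one_pos) simp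
  hence "U.pos (hip L x (lam 0 (e1 - T 0 e1) x))" using x by (intro lam_form_pos) simp_all
  thus ?thesis using x by (simp add: clinear_map.diff[OF lam_linear] lam_one L.ip_diff L.opsD(1))
qed

text \<open>The operator \<open>t - \<Lambda>(f)\<close> is a square in the reduced algebra but not of a finitely supported section.
  For a fixed finitely supported vector the quadratic form of \<open>Qm\<close> is continuous, so the square root may
  be approximated.\<close>

lemma Qm_form_pos:
  assumes f: "f \<in> S0" and sa: "L.Adj.sa (Lam f)" and t: "L.opn (Lam f) \<le> t" and x: "\<xi> \<in> S0"
  shows "U.pos (rsc t (hip L (\<iota> \<xi>) (lam 0 (T 0 e1) (\<iota> \<xi>))) - hip L (\<iota> \<xi>) (Qm f (\<iota> \<xi>)))"
proof -
  have "L.Adj.pos (rsc t L.idop - Lam f)" using L.Adj.pos_one_minus[OF sa, of t] t by simp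
  then obtain R where R: "L.Adj.sa R" "R \<circ> R = rsc t L.idop - Lam f"
      "\<And>U. \<lbrakk>L.Adj.closed_alg U; rsc t L.idop - Lam f \<in> U; L.idop \<in> U\<rbrakk> \<Longrightarrow> R \<in> U"
    using L.Adj.pos_root by (metis L.Adj_simps(2) L.cunit_Adj)
  have RD: "R \<in> ccar D" "L.adj R = R"
    using R(1) by (auto intro!: R(3)[OF D_closed_alg] cv.subspace_diff[OF D_subspace] cv.subspace_scale[OF D_subspace] Lam_D f
        simp: L.Adj.sa_def)
  obtain s where s: "\<And>k. s k \<in> S0" "L.Adj.conv (\<lambda>k. Lam (s k)) R" using D_dense[OF RD(1)] by blast
  \<comment> \<open>The section of the defect \<open>t - \<Lambda>(f) - \<Lambda>(s\<^sub>k)\<^sup>*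
    \<Lambda>(s\<^sub>k)\<close>, which tends to 0 in norm since \<open>\<Lambda>(s\<^sub>k)\<close>
    tends to the root \<open>R\<close>.\<close>
  define r where "r k = rsc t (single 0 e1) - f - sec_inner (s k) (s k)" for k
  have r: "r k \<in> S0" for k unfolding r_def using s(1) f
    by (intro cv.subspace_diff[OF S0_subspace] cv.subspace_scale[OF S0_subspace]) simp_all
  have Lin: "W (r k) = rsc t (W (single 0 e1)) - W f - W (sec_inner (s k) (s k))" if W: "clinear_map S0 W"
    for W :: "('g \<Rightarrow> 'b) \<Rightarrow> 'v::complex_vector" and k
    unfolding r_def using s(1) f
    by (simp add: clinear_map.diff[OF W] clinear_map.scale[OF W] cv.subspace_diff[OF S0_subspace] cv.subspace_scale[OF S0_subspace])
  have "L.Adj.conv (\<lambda>k. (rsc t L.idop - Lam f) - (L.adj (Lam (s k)) \<circ> Lam (s k))) ((rsc t L.idop - Lam f) - (L.adj R \<circ> R))"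
    using L.Adj.conv_diff[OF L.Adj.conv_const L.Adj.conv_mul[OF L.Adj.conv_star[OF s(2)] s(2)], of "rsc t L.idop - Lam f"]
      f L.ops_diff L.ops_scale L.idop_in by simp
  hence "L.Adj.conv (\<lambda>k. Lam (r k)) 0"
    using s(1) by (simp add: RD(2) R(2) Lin[OF Lam_linear] Lam_inner lam_one)
  from L.Adj.convD(3)[OF this] have lim: "(\<lambda>k. L.opn (Lam (r k))) \<longlonglongrightarrow> 0" by simp
  define q where "q g = hip L (\<iota> \<xi>) (Qm g (\<iota> \<xi>))" for g
  have ix: "\<iota> \<xi> \<in> HL" using x by simp
  have ql: "clinear_map S0 q" unfolding q_def using ix
    by (intro clinear_map.intro S0_subspace clinear_onI)
      (simp_all add: clinear_map.add[OF Qm_linear] clinear_map.scale[OF Qm_linear] scaleC_apply L.ip_add L.ip_scale L.opsD(1))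
  have qin: "q g \<in> F 0" if "g \<in> S0" for g
    unfolding q_def using L.ip_closed[OF ix L.opsD(1)[OF D_ops[OF Qm_D[OF that]] ix]] by simp
  obtain C where C: "\<And>g. g \<in> S0 \<Longrightarrow> fnorm B 0 (q g) \<le> C * L.opn (Lam g)"
    using Qm_form_bound[OF x x] unfolding q_def by blast
  let ?q = "rsc t (q (single 0 e1)) - q f"
  have "U.conv (\<lambda>k. q (sec_inner (s k) (s k))) ?q"
  proof (rule U.convI_le)
    show "(\<lambda>k. C * L.opn (Lam (r k))) \<longlonglongrightarrow> 0" using tendsto_mult[OF tendsto_const lim, of C] by simp
    fix k
    have i: "q (sec_inner (s k) (s k)) \<in> F 0" "?q \<in> F 0" using qin s(1) f by simp_all
    thus "q (sec_inner (s k) (s k)) \<in> ccar Ae" by simp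
    have "q (r k) = ?q - q (sec_inner (s k) (s k))" using Lin[OF ql] by simp
    thus "cnorm Ae (q (sec_inner (s k) (s k)) - ?q) \<le> C * L.opn (Lam (r k))"
      using C[OF r, of k] N.norm_diff_commute[OF i] by simp
  qed (use qin f in simp)
  moreover have "U.pos (q (sec_inner (s k) (s k)))" for k
    using Qm_pos[of 1 "\<lambda>_. s k" "\<lambda>_. \<xi>"] s(1) x by (simp add: q_def)
  ultimately have "U.pos ?q" by (rule U.pos_closed)
  thus ?thesis by (simp add: q_def)
qed

text \<open>\<open>Qm_form_pos\<close> bounds the form of \<open>Qm f\<close> by \<open>t\<close>
  times that of \<open>lam 0 (T 0 e1)\<close>, which \<open>unit_form_bound\<close> compares with
  the identity. The same estimate for \<open>- f\<close> gives the bound from below.\<close>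

lemma Qm_bound_sa:
  assumes f: "f \<in> S0" and sa: "L.Adj.sa (Lam f)" "L.Adj.sa (Qm f)" and t: "L.opn (Lam f) \<le> t" "t > 0"
  shows "L.opn (Qm f) \<le> t"
proof (rule L.opn_le_of_form_bound[OF sa(2) t(2)])
  have main: "U.pos (rsc t (hip L x x) - hip L x (Qm f x))"
    if f: "f \<in> S0" and sa: "L.Adj.sa (Lam f)" and t: "L.opn (Lam f) \<le> t" "t > 0" and x: "x \<in> HL" for f x
  proof -
    obtain s where s: "\<And>k. s k \<in> S0" "L.X.conv (\<lambda>k. \<iota> (s k)) x" using \<iota>_conv[OF x] by blast
    have Qf: "Qm f \<in> L.ops" using f by simp
    have "U.conv (\<lambda>k. rsc t (hip L (\<iota> (s k)) (\<iota> (s k))) - hip L (\<iota> (s k)) (Qm f (\<iota> (s k))))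
        (rsc t (hip L x x) - hip L x (Qm f x))"
      by (intro U.conv_diff U.conv_scale L.conv_ip s(2) bdl_conv[OF ops_bdl[OF Qf]])
    moreover have "U.pos (rsc t (hip L (\<iota> (s k)) (\<iota> (s k))) - hip L (\<iota> (s k)) (Qm f (\<iota> (s k))))" for k
      using U.pos_add[OF U.pos_scale[OF unit_form_bound[OF \<iota>_in[OF s(1)[of k]]], of t] Qm_form_pos[OF f sa t(1) s(1)[of k]]] t(2)
      by (simp add: cv.scale_right_diff_distrib)
    ultimately show ?thesis by (rule U.pos_closed)
  qed
  fix x assume x: "x \<in> HL"
  show "U.pos (rsc t (hip L x x) - hip L x (Qm f x))" by (rule main[OF f sa(1) t x])
  have nf: "- f \<in> S0" by (rule cv.subspace_neg[OF S0_subspace f])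
  have "U.pos (rsc t (hip L x x) - hip L x (Qm (- f) x))"
  proof (rule main[OF nf _ _ t(2) x])
    show "L.Adj.sa (Lam (- f))" using L.Adj.sa_intros(3)[OF sa(1)] by (simp add: clinear_map.minus[OF Lam_linear f])
    show "L.opn (Lam (- f)) \<le> t" using L.Adj.norm_minus[of "Lam f"] f t(1) by (simp add: clinear_map.minus[OF Lam_linear f])
  qed
  moreover have "hip L x (Qm (- f) x) = - hip L x (Qm f x)"
    using L.ip_scale[OF x L.opsD(1)[OF D_ops[OF Qm_D[OF f]] x], of "-1"] by (simp add: clinear_map.minus[OF Qm_linear f])
  ultimately show "U.pos (rsc t (hip L x x) + hip L x (Qm f x))" by simp
qed

lemma Qm_bound: assumes f: "f \<in> S0" shows "L.opn (Qm f) \<le> 2 * L.opn (Lam f)"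
proof (rule field_le_epsilon)
  fix \<epsilon> :: real assume e: "\<epsilon> > 0"
  have fs: "sec_star f \<in> S0" using f by simp
  let ?t = "2 * L.opn (Lam f) + \<epsilon>"
  have t: "?t > 0" using e L.opn_nonneg[OF Lam_in[OF f]] by simp
  let ?h = "f + sec_star f" and ?k = "\<i> *\<^sub>C (f - sec_star f)"
  have h: "?h \<in> S0" "f - sec_star f \<in> S0" "?k \<in> S0"
    using f fs by (simp_all add: cv.subspace_add[OF S0_subspace] cv.subspace_diff[OF S0_subspace] cv.subspace_scale[OF S0_subspace])
  have sa: "L.Adj.sa (K + L.adj K)" "L.Adj.sa (\<i> *\<^sub>C (K - L.adj K))" if "K \<in> L.ops" for K
    using that L.Adj.expand by (simp_all add: L.Adj.sa_def L.ops_add L.ops_scale L.ops_diff L.adj_in L.adj_adj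
        L.Adj.star_add[simplified] L.Adj.star_diff[simplified] L.Adj.star_scale[simplified] cv.scale_right_diff_distrib algebra_simps)
  have Lh: "Lam ?h = Lam f + L.adj (Lam f)" "Qm ?h = Qm f + L.adj (Qm f)"
    using f fs by (simp_all add: clinear_map.add[OF Lam_linear] clinear_map.add[OF Qm_linear] Lam_star Qm_star)
  have Lk: "Lam ?k = \<i> *\<^sub>C (Lam f - L.adj (Lam f))" "Qm ?k = \<i> *\<^sub>C (Qm f - L.adj (Qm f))"
    using f fs h by (simp_all add: clinear_map.scale[OF Lam_linear] clinear_map.scale[OF Qm_linear]
        clinear_map.diff[OF Lam_linear] clinear_map.diff[OF Qm_linear] Lam_star Qm_star)
  have La: "Lam f \<in> L.ops" "L.adj (Lam f) \<in> L.ops" "Qm f \<in> L.ops" "L.adj (Qm f) \<in> L.ops" using f by (simp_all add: L.adj_in)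
  have nh: "L.opn (Lam ?h) \<le> ?t"
    using L.opn_tri[OF La(1,2)] L.opn_adj[OF La(1)] e unfolding Lh(1) by simp
  have nk: "L.opn (Lam ?k) \<le> ?t"
    using L.Adj.norm_diff_le[of "Lam f" "L.adj (Lam f)"] La L.opn_adj[OF La(1)] e L.opn_scale[OF L.ops_diff[OF La(1,2)], of \<i>]
    unfolding Lk(1) by simp
  have qh: "L.opn (Qm ?h) \<le> ?t"
    by (rule Qm_bound_sa[OF h(1) _ _ nh t]) (unfold Lh, rule sa, rule La, rule sa, rule La)
  have qk: "L.opn (Qm ?k) \<le> ?t"
    by (rule Qm_bound_sa[OF h(3) _ _ nk t]) (unfold Lk, rule sa, rule La, rule sa, rule La)
  have "2 *\<^sub>C Qm f = Qm ?h - \<i> *\<^sub>C Qm ?k"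
    unfolding Lh Lk by (simp only: scaleC_two) (simp add: algebra_simps)
  hence "2 * L.opn (Qm f) = L.opn (Qm ?h - \<i> *\<^sub>C Qm ?k)" using L.opn_scale[OF La(3), of 2] by simp
  also have "\<dots> \<le> L.opn (Qm ?h) + L.opn (Qm ?k)"
    using L.Adj.norm_diff_le[of "Qm ?h" "\<i> *\<^sub>C Qm ?k"] h L.opn_scale[of "Qm ?k" \<i>] by (simp add: L.ops_scale)
  finally show "L.opn (Qm f) \<le> ?t" using qh qk by simp
qed

end

section \<open>Matrices of operators\<close>

locale hmod_pow = hmod A X for A :: "'b::complex_vector cstar_data" and X :: "('x::complex_vector, 'b) hmodule" +
  fixes n :: nat
begin

text \<open>Vectors vanish from coordinate \<open>n\<close> on, so that a vector of length zero is
  the zero function.\<close>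

definition pmod :: "(nat \<Rightarrow> 'x, 'b) hmodule" where
  "pmod = \<lparr>hcar = {\<zeta>. (\<forall>i<n. \<zeta> i \<in> H) \<and> (\<forall>i\<ge>n. \<zeta> i = 0)},
     hact = (\<lambda>\<zeta> a i. if i < n then act (\<zeta> i) a else 0), hip = (\<lambda>\<zeta> \<eta>. \<Sum>i<n. ip (\<zeta> i) (\<eta> i))\<rparr>"

lemma pmod_simps: "hcar pmod = {\<zeta>. (\<forall>i<n. \<zeta> i \<in> H) \<and> (\<forall>i\<ge>n. \<zeta> i = 0)}"
    "hact pmod \<zeta> a = (\<lambda>i. if i < n then act (\<zeta> i) a else 0)" "hip pmod \<zeta> \<eta> = (\<Sum>i<n. ip (\<zeta> i) (\<eta> i))"
  by (simp_all add: pmod_def)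

lemma pmodD: "\<zeta> \<in> hcar pmod \<Longrightarrow> i < n \<Longrightarrow> \<zeta> i \<in> H" "\<zeta> \<in> hcar pmod \<Longrightarrow> \<not> i < n \<Longrightarrow> \<zeta> i = 0"
  by (simp_all add: pmod_simps)

lemma pmod_norm_le: assumes "\<zeta> \<in> hcar pmod" shows "hnorm A pmod \<zeta> \<le> sqrt (\<Sum>i<n. (hn (\<zeta> i))\<^sup>2)"
proof -
  have "cnorm A (hip pmod \<zeta> \<zeta>) \<le> (\<Sum>i<n. cnorm A (ip (\<zeta> i) (\<zeta> i)))"
    unfolding pmod_simps using pmodD(1)[OF assms] by (intro A.norm_sum_le) simp
  also have "\<dots> = (\<Sum>i<n. (hn (\<zeta> i))\<^sup>2)" using pmodD(1)[OF assms] by (simp add: norm_ip_self)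
  finally show ?thesis by (simp add: hnorm_def)
qed

lemma pmod_norm_le_sum: assumes "\<zeta> \<in> hcar pmod" shows "hnorm A pmod \<zeta> \<le> (\<Sum>i<n. hn (\<zeta> i))"
  using pmod_norm_le[OF assms] L2_set_le_sum[of "{..<n}" "\<lambda>i. hn (\<zeta> i)"] X.nonneg pmodD(1)[OF assms]
  by (auto simp: L2_set_def intro: order_trans)

lemma pmod_coord_pos: assumes "\<zeta> \<in> hcar pmod" "i < n" shows "A.pos (hip pmod \<zeta> \<zeta> - ip (\<zeta> i) (\<zeta> i))"
proof -
  have "hip pmod \<zeta> \<zeta> - ip (\<zeta> i) (\<zeta> i) = (\<Sum>k\<in>{..<n} - {i}. ip (\<zeta> k) (\<zeta> k))"
    using assms(2) by (simp add: pmod_simps sum.remove[of "{..<n}" i])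
  thus ?thesis using pmodD(1)[OF assms(1)] by (auto intro!: A.pos_sum ip_self_pos)
qed

lemma pmod_coord_norm: assumes "\<zeta> \<in> hcar pmod" "i < n" shows "hn (\<zeta> i) \<le> hnorm A pmod \<zeta>"
  using A.pos_norm_mono[OF ip_self_pos pmod_coord_pos[OF assms]] pmodD(1)[OF assms] by (simp add: hnorm_def)

lemma pmod_subspace: "csubspace (hcar pmod)"
  by (rule cv.subspaceI) (simp_all add: pmod_simps scaleC_apply)

lemma pmod_complete: "complete_on (hcar pmod) (hnorm A pmod)"
  unfolding complete_on_def
proof (intro allI impI)
  fix s :: "nat \<Rightarrow> nat \<Rightarrow> 'x" assume s: "(\<forall>k. s k \<in> hcar pmod) \<and> (\<forall>\<epsilon>>0. \<exists>N. \<forall>k\<ge>N. \<forall>l\<ge>N. hnorm A pmod (s k - s l) < \<epsilon>)"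
  have sin: "s k \<in> hcar pmod" for k using s by blast
  have ex: "\<exists>x\<in>H. (\<lambda>k. hn (s k i - x)) \<longlonglongrightarrow> 0" if i: "i < n" for i
  proof (rule complete_onD[OF complete])
    show "s k i \<in> H" for k using pmodD(1)[OF sin i] .
    show "\<forall>\<epsilon>>0. \<exists>N. \<forall>k\<ge>N. \<forall>l\<ge>N. hn (s k i - s l i) < \<epsilon>"
    proof (intro allI impI)
      fix \<epsilon> :: real assume "\<epsilon> > 0"
      then obtain N where N: "\<forall>k\<ge>N. \<forall>l\<ge>N. hnorm A pmod (s k - s l) < \<epsilon>" using s by blast
      have "hn (s k i - s l i) < \<epsilon>" if "k \<ge> N" "l \<ge> N" for k l
        using pmod_coord_norm[OF cv.subspace_diff[OF pmod_subspace sin sin] i, of k l] N that by fastforce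
      thus "\<exists>N. \<forall>k\<ge>N. \<forall>l\<ge>N. hn (s k i - s l i) < \<epsilon>" by blast
    qed
  qed
  define x where "x i = (if i < n then SOME y. y \<in> H \<and> (\<lambda>k. hn (s k i - y)) \<longlonglongrightarrow> 0 else 0)" for i
  have x: "x i \<in> H \<and> (\<lambda>k. hn (s k i - x i)) \<longlonglongrightarrow> 0" if "i < n" for i
  proof -
    have "\<exists>y. y \<in> H \<and> (\<lambda>k. hn (s k i - y)) \<longlonglongrightarrow> 0" using ex[OF that] by blast
    from someI_ex[OF this] show ?thesis using that by (simp add: x_def)
  qed
  have xin: "x \<in> hcar pmod" using x by (simp add: pmod_simps x_def)
  have "(\<lambda>k. sqrt (\<Sum>i<n. (hn (s k i - x i))\<^sup>2)) \<longlonglongrightarrow> sqrt (\<Sum>i<n. 0\<^sup>2)"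
    using x by (intro tendsto_real_sqrt tendsto_sum tendsto_power) auto
  hence lim: "(\<lambda>k. sqrt (\<Sum>i<n. (hn (s k i - x i))\<^sup>2)) \<longlonglongrightarrow> 0" by simp
  have "(\<lambda>k. hnorm A pmod (s k - x)) \<longlonglongrightarrow> 0"
  proof (rule Lim_null_comparison[OF always_eventually lim], rule allI)
    fix k
    have m: "s k - x \<in> hcar pmod" by (rule cv.subspace_diff[OF pmod_subspace sin xin])
    have "0 \<le> hnorm A pmod (s k - x)"
      unfolding hnorm_def pmod_simps using pmodD(1)[OF m] by (intro real_sqrt_ge_zero A.nonneg A.sum_in) simp
    thus "norm (hnorm A pmod (s k - x)) \<le> sqrt (\<Sum>i<n. (hn (s k i - x i))\<^sup>2)" using pmod_norm_le[OF m] by simp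
  qed
  with xin show "\<exists>x\<in>hcar pmod. (\<lambda>k. hnorm A pmod (s k - x)) \<longlonglongrightarrow> 0" by blast
qed

sublocale N: hmod A pmod
proof unfold_locales
  show "csubspace (hcar pmod)" by (rule pmod_subspace)
  show "complete_on (hcar pmod) (hnorm A pmod)" by (rule pmod_complete)
  fix x assume x: "x \<in> hcar pmod"
  show "cpos A (hip pmod x x)" unfolding A.cpos_iff pmod_simps using pmodD(1)[OF x] by (intro A.pos_sum ip_self_pos) simp
  show "x = 0" if z: "hip pmod x x = 0"
  proof
    fix i
    show "x i = 0 i"
    proof (cases "i < n")
      case True
      have "hn (x i) \<le> 0" using pmod_coord_norm[OF x True] z by (simp add: hnorm_def)
      thus ?thesis using X.nonneg[OF pmodD(1)[OF x True]] X.eq_0[OF pmodD(1)[OF x True]] by simp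
    qed (use pmodD(2)[OF x] in simp)
  qed
  fix y a assume y: "y \<in> hcar pmod"
  show "hip pmod x y \<in> ccar A" unfolding pmod_simps using pmodD(1)[OF x] pmodD(1)[OF y] by (intro A.sum_in ip_closed) simp_all
  show "cstar A (hip pmod x y) = hip pmod y x"
    unfolding pmod_simps using pmodD(1)[OF x] pmodD(1)[OF y] by (subst A.star_sum) (simp_all add: ip_star)
  show "hip pmod x (hact pmod y a) = cmul A (hip pmod x y) a" if "a \<in> ccar A"
    unfolding pmod_simps using pmodD(1)[OF x] pmodD(1)[OF y] that by (subst A.mul_sum_left) (simp_all add: ip_act)
qed (simp_all add: pmod_simps fun_eq_iff act_add_left act_add_right act_scale_left act_scale_right act_mul
    A.sum_in ip_add ip_scale ip_act ip_star scaleC_apply sum.distrib cv.scale_sum_right A.mul_sum_left A.star_sum)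

section \<open>Coordinates and matrix entries of operators on the direct power\<close>

definition inj_coord :: "nat \<Rightarrow> 'x \<Rightarrow> nat \<Rightarrow> 'x" where "inj_coord j x = (\<lambda>i. if i = j then x else 0)"

lemma inj_coord_in [simp]: "\<lbrakk>j < n; x \<in> H\<rbrakk> \<Longrightarrow> inj_coord j x \<in> hcar pmod"
  by (simp add: pmod_simps inj_coord_def)

lemma inj_coord_apply [simp]: "inj_coord j x i = (if i = j then x else 0)" by (simp add: inj_coord_def)

lemma ip_inj_coord: assumes "j < n" "x \<in> H" "\<zeta> \<in> hcar pmod"
  shows "hip pmod (inj_coord j x) \<zeta> = ip x (\<zeta> j)" "hip pmod \<zeta> (inj_coord j x) = ip (\<zeta> j) x"
proof -
  have "hip pmod (inj_coord j x) \<zeta> = (\<Sum>i<n. if i = j then ip x (\<zeta> j) else 0)"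
    unfolding pmod_simps using pmodD(1)[OF assms(3)] assms by (intro sum.cong) auto
  thus "hip pmod (inj_coord j x) \<zeta> = ip x (\<zeta> j)" using assms by simp
  have "hip pmod \<zeta> (inj_coord j x) = (\<Sum>i<n. if i = j then ip (\<zeta> j) x else 0)"
    unfolding pmod_simps using pmodD(1)[OF assms(3)] assms by (intro sum.cong) auto
  thus "hip pmod \<zeta> (inj_coord j x) = ip (\<zeta> j) x" using assms by simp
qed

lemma pmod_expand: assumes "\<zeta> \<in> hcar pmod" shows "\<zeta> = (\<Sum>j<n. inj_coord j (\<zeta> j))"
proof
  fix i
  have "(\<Sum>j<n. inj_coord j (\<zeta> j)) i = (\<Sum>j<n. if i = j then \<zeta> j else 0)" by (simp add: sum_fun_apply)
  thus "\<zeta> i = (\<Sum>j<n. inj_coord j (\<zeta> j)) i" using pmodD(2)[OF assms, of i] by (simp add: sum.delta')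
qed

lemma hn_inj_coord: "\<lbrakk>j < n; x \<in> H\<rbrakk> \<Longrightarrow> hnorm A pmod (inj_coord j x) = hn x"
  by (simp add: hnorm_def ip_inj_coord)

definition entry :: "((nat \<Rightarrow> 'x) \<Rightarrow> nat \<Rightarrow> 'x) \<Rightarrow> nat \<Rightarrow> nat \<Rightarrow> 'x \<Rightarrow> 'x" where
  "entry K i j x = (if x \<in> H then K (inj_coord j x) i else 0)"

lemma entry_in: assumes K: "K \<in> N.ops" and i: "i < n" and j: "j < n"
  shows "entry K i j \<in> ops" "opn (entry K i j) \<le> N.opn K" "adj (entry K i j) = entry (N.adj K) j i"
proof -
  have Kx: "K (inj_coord j x) \<in> hcar pmod" if "x \<in> H" for x using N.opsD(1)[OF K] j that by simp
  have Kx': "N.adj K (inj_coord i x) \<in> hcar pmod" if "x \<in> H" for x using N.opsD(1)[OF N.adj_in[OF K]] i that by simp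
  have b: "hn (entry K i j x) \<le> N.opn K * hn x" if "x \<in> H" for x
    using pmod_coord_norm[OF Kx[OF that] i] N.opn_bound[OF K inj_coord_in[OF j that]] that
    by (simp add: entry_def hn_inj_coord j)
  have b': "hn (entry (N.adj K) j i x) \<le> N.opn K * hn x" if "x \<in> H" for x
    using pmod_coord_norm[OF Kx'[OF that] j] N.opn_bound[OF N.adj_in[OF K] inj_coord_in[OF i that]] that
    by (simp add: entry_def hn_inj_coord i N.opn_adj[OF K])
  have ip': "ip (entry K i j x) y = ip x (entry (N.adj K) j i y)" if "x \<in> H" "y \<in> H" for x y
    using that i j N.adj_spec(2)[OF K inj_coord_in[OF i that(2)] inj_coord_in[OF j that(1)]]
    by (simp add: entry_def ip_inj_coord Kx Kx')
  show 1: "entry K i j \<in> ops"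
    by (rule opsI[where S' = "entry (N.adj K) j i", OF _ _ _ ip' b]) (simp_all add: entry_def pmodD(1)[OF Kx i] pmodD(1)[OF Kx' j])
  have 2: "entry (N.adj K) j i \<in> ops"
  proof (rule opsI[where S' = "entry K i j" and C = "N.opn K"])
    show "ip (entry (N.adj K) j i x) y = ip x (entry K i j y)" if "x \<in> H" "y \<in> H" for x y
      using arg_cong[OF ip'[OF that(2,1)], of "cstar A"] that
      by (simp add: ip_star pmodD(1)[OF Kx i] pmodD(1)[OF Kx' j] entry_def)
    show "hn (entry (N.adj K) j i x) \<le> N.opn K * hn x" if "x \<in> H" for x using b'[OF that] .
  qed (simp_all add: entry_def pmodD(1)[OF Kx i] pmodD(1)[OF Kx' j])
  show "opn (entry K i j) \<le> N.opn K" by (rule opn_le[OF b N.opn_nonneg[OF K]])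
  show "adj (entry K i j) = entry (N.adj K) j i" by (rule adj_eqI[OF 1 2 ip'])
qed

lemma entry_comp:
  assumes K: "K \<in> N.ops" and R: "R \<in> N.ops" and i: "i < n" and j: "j < n"
  shows "entry (K \<circ> R) i j = (\<Sum>k<n. entry K i k \<circ> entry R k j)"
proof
  fix x
  show "entry (K \<circ> R) i j x = (\<Sum>k<n. entry K i k \<circ> entry R k j) x"
  proof (cases "x \<in> H")
    case True
    have Rx: "R (inj_coord j x) \<in> hcar pmod" using N.opsD(1)[OF R] j True by simp
    have "K (R (inj_coord j x)) = K (\<Sum>k<n. inj_coord k (R (inj_coord j x) k))" by (rule arg_cong[OF pmod_expand[OF Rx]])
    also have "\<dots> = (\<Sum>k<n. K (inj_coord k (R (inj_coord j x) k)))"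
      using pmodD(1)[OF Rx] by (intro clinear_map.sum[OF N.opsD(5)[OF K]] inj_coord_in) auto
    finally show ?thesis using True pmodD(1)[OF Rx] by (simp add: entry_def sum_fun_apply)
  next
    case False
    have "entry K i k 0 = 0" if "k < n" for k
      by (rule clinear_map.zero[OF opsD(5)[OF entry_in(1)[OF K i that]]])
    thus ?thesis using False by (simp add: entry_def[of R] entry_def[of "K \<circ> R"] sum_fun_apply)
  qed
qed

definition mat_op :: "(nat \<Rightarrow> nat \<Rightarrow> 'x \<Rightarrow> 'x) \<Rightarrow> (nat \<Rightarrow> 'x) \<Rightarrow> nat \<Rightarrow> 'x" where
  "mat_op M \<zeta> = (\<lambda>i. if i < n \<and> \<zeta> \<in> hcar pmod then \<Sum>j<n. M i j (\<zeta> j) else 0)"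

lemma mat_op_in:
  assumes M: "\<And>i j. \<lbrakk>i < n; j < n\<rbrakk> \<Longrightarrow> M i j \<in> ops"
  shows "mat_op M \<in> N.ops" "\<And>i j. \<lbrakk>i < n; j < n\<rbrakk> \<Longrightarrow> entry (mat_op M) i j = M i j"
    "N.adj (mat_op M) = mat_op (\<lambda>i j. adj (M j i))"
proof -
  have cl: "mat_op M \<zeta> \<in> hcar pmod" if z: "\<zeta> \<in> hcar pmod" and M: "\<And>i j. \<lbrakk>i < n; j < n\<rbrakk> \<Longrightarrow> M i j \<in> ops" for M \<zeta>
  proof -
    have "mat_op M \<zeta> i \<in> H" if "i < n" for i
    proof -
      have "(\<Sum>j<n. M i j (\<zeta> j)) \<in> H" by (rule X.sum_in, rule opsD(1))
          (simp_all add: M[OF \<open>i < n\<close>] pmodD(1)[OF z])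
      thus ?thesis using that z by (simp add: mat_op_def)
    qed
    thus ?thesis by (simp add: pmod_simps(1)) (simp add: mat_op_def)
  qed
  have bd: "hnorm A pmod (mat_op M \<zeta>) \<le> (\<Sum>i<n. \<Sum>j<n. opn (M i j)) * hnorm A pmod \<zeta>"
    if z: "\<zeta> \<in> hcar pmod" and M: "\<And>i j. \<lbrakk>i < n; j < n\<rbrakk> \<Longrightarrow> M i j \<in> ops" for M \<zeta>
  proof -
    have "hnorm A pmod (mat_op M \<zeta>) \<le> (\<Sum>i<n. hn (mat_op M \<zeta> i))" by (rule pmod_norm_le_sum[OF cl[OF z M]])
    also have "\<dots> \<le> (\<Sum>i<n. \<Sum>j<n. opn (M i j) * hnorm A pmod \<zeta>)"
    proof (rule sum_mono)
      fix i assume "i \<in> {..<n}"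
      hence i: "i < n" by simp
      have "hn (mat_op M \<zeta> i) \<le> (\<Sum>j<n. hn (M i j (\<zeta> j)))"
      proof -
        have "hn (\<Sum>j<n. M i j (\<zeta> j)) \<le> (\<Sum>j<n. hn (M i j (\<zeta> j)))"
          by (rule X.norm_sum_le, rule opsD(1)) (simp_all add: M[OF i] pmodD(1)[OF z])
        thus ?thesis using i z by (simp add: mat_op_def)
      qed
      also have "\<dots> \<le> (\<Sum>j<n. opn (M i j) * hnorm A pmod \<zeta>)"
      proof (rule sum_mono)
        fix j assume "j \<in> {..<n}"
        hence j: "j < n" by simp
        have "hn (M i j (\<zeta> j)) \<le> opn (M i j) * hn (\<zeta> j)" by (rule opn_bound[OF M[OF i j] pmodD(1)[OF z j]])
        also have "\<dots> \<le> opn (M i j) * hnorm A pmod \<zeta>"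
          by (rule mult_left_mono[OF pmod_coord_norm[OF z j] opn_nonneg[OF M[OF i j]]])
        finally show "hn (M i j (\<zeta> j)) \<le> opn (M i j) * hnorm A pmod \<zeta>" .
      qed
      finally show "hn (mat_op M \<zeta> i) \<le> (\<Sum>j<n. opn (M i j) * hnorm A pmod \<zeta>)" .
    qed
    finally show ?thesis by (simp add: sum_distrib_right)
  qed
  have M': "adj (M j i) \<in> ops" if "i < n" "j < n" for i j using M[OF that(2,1)] by (rule adj_in)
  have ip': "hip pmod (mat_op M \<zeta>) \<eta> = hip pmod \<zeta> (mat_op (\<lambda>i j. adj (M j i)) \<eta>)"
    if z: "\<zeta> \<in> hcar pmod" "\<eta> \<in> hcar pmod" for \<zeta> \<eta>
  proof -
    have "hip pmod (mat_op M \<zeta>) \<eta> = (\<Sum>i<n. \<Sum>j<n. ip (M i j (\<zeta> j)) (\<eta> i))"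
      unfolding pmod_simps
    proof (intro sum.cong refl)
      fix i assume "i \<in> {..<n}"
      hence i: "i < n" by simp
      have "ip (\<Sum>j<n. M i j (\<zeta> j)) (\<eta> i) = (\<Sum>j<n. ip (M i j (\<zeta> j)) (\<eta> i))"
        by (rule ip_sum_left[OF pmodD(1)[OF z(2) i]]) (simp add: opsD(1)[OF M[OF i]] pmodD(1)[OF z(1)])
      thus "ip (mat_op M \<zeta> i) (\<eta> i) = (\<Sum>j<n. ip (M i j (\<zeta> j)) (\<eta> i))" using i z by (simp add: mat_op_def)
    qed
    also have "\<dots> = (\<Sum>j<n. \<Sum>i<n. ip (M i j (\<zeta> j)) (\<eta> i))" by (rule sum.swap)
    also have "\<dots> = (\<Sum>j<n. \<Sum>i<n. ip (\<zeta> j) (adj (M i j) (\<eta> i)))"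
      using pmodD(1)[OF z(1)] pmodD(1)[OF z(2)] M by (intro sum.cong refl adj_spec(2)) auto
    also have "\<dots> = hip pmod \<zeta> (mat_op (\<lambda>i j. adj (M j i)) \<eta>)"
      unfolding pmod_simps
    proof (intro sum.cong refl)
      fix j assume "j \<in> {..<n}"
      hence j: "j < n" by simp
      have "ip (\<zeta> j) (\<Sum>i<n. adj (M i j) (\<eta> i)) = (\<Sum>i<n. ip (\<zeta> j) (adj (M i j) (\<eta> i)))"
        by (rule ip_sum[OF pmodD(1)[OF z(1) j]]) (simp add: adj_spec(1)[OF M[OF _ j]] pmodD(1)[OF z(2)])
      thus "(\<Sum>i<n. ip (\<zeta> j) (adj (M i j) (\<eta> i))) = ip (\<zeta> j) (mat_op (\<lambda>i j. adj (M j i)) \<eta> j)"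
        using j z by (simp add: mat_op_def)
    qed
    finally show ?thesis .
  qed
  have off: "mat_op M \<zeta> = 0" if "\<zeta> \<notin> hcar pmod" for M \<zeta> using that by (simp add: mat_op_def fun_eq_iff)
  show 1: "mat_op M \<in> N.ops"
    by (rule N.opsI[OF cl[OF _ M] off cl[OF _ M'] ip' bd[OF _ M]])
  have ip'': "hip pmod (mat_op (\<lambda>i j. adj (M j i)) \<zeta>) \<eta> = hip pmod \<zeta> (mat_op M \<eta>)"
    if z: "\<zeta> \<in> hcar pmod" "\<eta> \<in> hcar pmod" for \<zeta> \<eta>
    using arg_cong[OF ip'[OF z(2,1)], of "cstar A"] N.ip_star[OF cl[OF z(2) M] z(1)]
      N.ip_star[OF z(2) cl[OF z(1) M']] by simp
  have 2: "mat_op (\<lambda>i j. adj (M j i)) \<in> N.ops"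
    by (rule N.opsI[OF cl[OF _ M'] off cl[OF _ M] ip'' bd[OF _ M']])
  show "N.adj (mat_op M) = mat_op (\<lambda>i j. adj (M j i))" by (rule N.adj_eqI[OF 1 2 ip'])
  show "entry (mat_op M) i j = M i j" if "i < n" "j < n" for i j
  proof
    fix x
    have z: "M i k 0 = 0" if "k < n" for k by (rule clinear_map.zero[OF opsD(5)[OF M[OF \<open>i < n\<close> that]]])
    have "(\<Sum>k<n. M i k (if k = j then x else 0)) = (\<Sum>k<n. if k = j then M i j x else 0)"
      using z by (intro sum.cong) auto
    thus "entry (mat_op M) i j x = M i j x" using that M[OF that] by (simp add: entry_def mat_op_def opsD(2))
  qed
qed

text \<open>Operators on the power with entries in \<open>U\<close> form a closed algebra, so the
  root \<open>R\<close> of \<open>mat_op M\<close> provided by \<open>form_pos_root\<close> has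
  entries in \<open>U\<close>. As \<open>R\<close> is self-adjoint, \<open>R \<circ> R\<close> is
  \<open>R\<^sup>* R\<close>, whose entries are the required sums.\<close>

theorem matrix_root:
  assumes U: "Adj.closed_alg U" "U \<subseteq> ops" "idop \<in> U" "\<And>x. x \<in> U \<Longrightarrow> adj x \<in> U"
    and M: "\<And>i j. \<lbrakk>i < n; j < n\<rbrakk> \<Longrightarrow> M i j \<in> U" "\<And>i j. \<lbrakk>i < n; j < n\<rbrakk> \<Longrightarrow> adj (M i j) = M j i"
    and pos: "\<And>\<zeta>. (\<And>i. i < n \<Longrightarrow> \<zeta> i \<in> H) \<Longrightarrow> A.pos (\<Sum>i<n. \<Sum>j<n. ip (\<zeta> i) (M i j (\<zeta> j)))"
  shows "\<exists>c. (\<forall>i<n. \<forall>j<n. c i j \<in> U) \<and> (\<forall>i<n. \<forall>j<n. M i j = (\<Sum>k<n. adj (c k i) \<circ> c k j))"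
proof -
  have Mo: "M i j \<in> ops" if "i < n" "j < n" for i j using M(1)[OF that] U(2) by blast
  have K: "mat_op M \<in> N.ops" "\<And>i j. \<lbrakk>i < n; j < n\<rbrakk> \<Longrightarrow> entry (mat_op M) i j = M i j"
      "N.adj (mat_op M) = mat_op (\<lambda>i j. adj (M j i))"
    using mat_op_in[of M] Mo by simp_all
  have Us: "csubspace U" using U(1) by (simp add: Adj.closed_alg_def)
  have Uc: "x \<circ> y \<in> U" if "x \<in> U" "y \<in> U" for x y using U(1) that by (simp add: Adj.closed_alg_def)
  define S where "S = {K \<in> N.ops. \<forall>i<n. \<forall>j<n. entry K i j \<in> U}"
  have ent_lin: "entry (K + R) i j = entry K i j + entry R i j" "entry (c *\<^sub>C K) i j = c *\<^sub>C entry K i j" for K R i j c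
    by (auto simp: entry_def fun_eq_iff scaleC_apply)
  have ent_diff: "entry (K - R) i j = entry K i j - entry R i j" for K R i j
    by (auto simp: entry_def fun_eq_iff)
  have "N.Adj.closed_alg S" unfolding N.Adj.closed_alg_def
  proof (intro conjI ballI allI impI)
    have "entry 0 i j = 0" for i j by (auto simp: entry_def fun_eq_iff)
    thus "csubspace S" using cv.subspace_0[OF N.ops_subspace] cv.subspace_0[OF Us]
      by (intro cv.subspaceI) (auto simp: S_def N.ops_add N.ops_scale ent_lin intro: cv.subspace_add[OF Us] cv.subspace_scale[OF Us])
    show "cmul N.Adj x y \<in> S" if "x \<in> S" "y \<in> S" for x y
      using that by (auto simp: S_def N.ops_comp entry_comp intro!: cv.subspace_sum[OF Us] Uc)
    fix s x assume s: "(\<forall>k. s k \<in> S) \<and> N.Adj.conv s x"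
    have x: "x \<in> N.ops" "s k \<in> N.ops" for k using s N.Adj.convD(2)[of s x] by (auto simp: S_def)
    have lim: "(\<lambda>k. N.opn (s k - x)) \<longlonglongrightarrow> 0" using s N.Adj.convD(3)[of s x] by simp
    have "entry x i j \<in> U" if ij: "i < n" "j < n" for i j
    proof -
      have "Adj.conv (\<lambda>k. entry (s k) i j) (entry x i j)"
        by (rule Adj.convI_le[OF _ _ _ lim])
          (use x ij entry_in(2)[OF N.ops_diff[OF x(2) x(1)] ij] in \<open>simp_all add: entry_in(1) flip: ent_diff\<close>)
      moreover have "entry (s k) i j \<in> U" for k using s ij by (simp add: S_def)
      moreover have "\<forall>s x. (\<forall>k. s k \<in> U) \<and> Adj.conv s x \<longrightarrow> x \<in> U"
        using U(1) unfolding Adj.closed_alg_def by (elim conjE)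
      ultimately show ?thesis by (elim allE[of _ "\<lambda>k. entry (s k) i j"] allE[of _ "entry x i j"]) simp
    qed
    thus "x \<in> S" using x by (simp add: S_def)
  qed
  moreover have "mat_op M \<in> S" using K M(1) by (simp add: S_def)
  moreover have "N.idop \<in> S"
  proof -
    have "entry N.idop i j = (if i = j then idop else 0)" if "i < n" "j < n" for i j
      using that by (auto simp: entry_def fun_eq_iff idop_def)
    thus ?thesis using U(3) cv.subspace_0[OF Us] by (simp add: S_def N.idop_in)
  qed
  moreover have "mat_op (\<lambda>i j. adj (M j i)) = mat_op M"
    using M(2) by (auto simp: mat_op_def fun_eq_iff intro!: sum.cong)
  hence "N.Adj.sa (mat_op M)" using K by (simp add: N.Adj.sa_def)
  moreover have "A.pos (hip pmod \<zeta> (mat_op M \<zeta>))" if z: "\<zeta> \<in> hcar pmod" for \<zeta>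
  proof -
    have "hip pmod \<zeta> (mat_op M \<zeta>) = (\<Sum>i<n. \<Sum>j<n. ip (\<zeta> i) (M i j (\<zeta> j)))"
      unfolding pmod_simps
    proof (intro sum.cong refl)
      fix i assume "i \<in> {..<n}"
      hence i: "i < n" by simp
      have "mat_op M \<zeta> i = (\<Sum>j<n. M i j (\<zeta> j))" using i z by (simp add: mat_op_def)
      moreover have "ip (\<zeta> i) (\<Sum>j<n. M i j (\<zeta> j)) = (\<Sum>j<n. ip (\<zeta> i) (M i j (\<zeta> j)))"
        by (rule ip_sum[OF pmodD(1)[OF z i]]) (simp add: opsD(1)[OF Mo[OF i]] pmodD(1)[OF z])
      ultimately show "ip (\<zeta> i) (mat_op M \<zeta> i) = (\<Sum>j<n. ip (\<zeta> i) (M i j (\<zeta> j)))" by simp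
    qed
    thus ?thesis using pos[of \<zeta>] pmodD(1)[OF z] by simp
  qed
  ultimately obtain R where R: "R \<in> S" "R \<in> N.ops" "N.adj R = R" "R \<circ> R = mat_op M"
    using N.form_pos_root[of "mat_op M" S] by metis
  have "M i j = (\<Sum>k<n. adj (entry R k i) \<circ> entry R k j)" if ij: "i < n" "j < n" for i j
  proof -
    have "M i j = entry (R \<circ> R) i j" using K(2)[OF ij] R(4) by simp
    also have "\<dots> = (\<Sum>k<n. entry R i k \<circ> entry R k j)" by (rule entry_comp[OF R(2) R(2) ij])
    also have "\<dots> = (\<Sum>k<n. adj (entry R k i) \<circ> entry R k j)"
      using entry_in(3)[OF R(2) _ ij(1)] R(3) by (intro sum.cong refl) simp
    finally show ?thesis .
  qed
  thus ?thesis using R(1) by (intro exI[of _ "entry R"]) (simp add: S_def)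
qed

end

section \<open>Complete positivity of the multiplier\<close>

context sec_completion
begin

lemma D_complete: "complete_on (ccar D) L.opn"
  unfolding complete_on_def
proof (intro allI impI)
  fix s :: "nat \<Rightarrow> 'l \<Rightarrow> 'l" assume s: "(\<forall>k. s k \<in> ccar D) \<and> (\<forall>\<epsilon>>0. \<exists>N. \<forall>k\<ge>N. \<forall>l\<ge>N. L.opn (s k - s l) < \<epsilon>)"
  have sD: "s k \<in> ccar D" for k using s by blast
  obtain x where x: "x \<in> L.ops" "(\<lambda>k. L.opn (s k - x)) \<longlonglongrightarrow> 0"
    using complete_onD[where s = s, OF L.ops_complete _ conjunct2[OF s]] D_ops[OF sD] by blast
  have "x \<in> ccar D" by (rule D_closed[of s, OF sD]) (unfold L.Adj.conv_def, use x sD in simp)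
  with x show "\<exists>x\<in>ccar D. (\<lambda>k. L.opn (s k - x)) \<longlonglongrightarrow> 0" by blast
qed

lemma D_conv: "\<lbrakk>L.Adj.conv s x; \<And>k. s k \<in> ccar D; x \<in> ccar D\<rbrakk> \<Longrightarrow> normed_carrier.conv (ccar D) L.opn s x"
  using L.Adj.convD(3)[of s x] by (simp add: normed_carrier.conv_def[OF D_normed])

end

context pd_map
begin

lemma Phi_ex: "\<exists>\<Psi>. (\<forall>x\<in>ccar D. \<Psi> x \<in> ccar D) \<and> clinear_on (ccar D) \<Psi> \<and> (\<forall>x\<in>ccar D. L.opn (\<Psi> x) \<le> 2 * L.opn x) \<and>
    (\<forall>f\<in>S0. \<Psi> (Lam f) = Qm f)"
proof -
  have dense: "\<exists>f\<in>S0. L.opn (Lam f - x) < \<epsilon>" if x: "x \<in> ccar D" and e: "\<epsilon> > 0" for x \<epsilon>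
  proof -
    obtain s where s: "\<And>k. s k \<in> S0" "L.Adj.conv (\<lambda>k. Lam (s k)) x" using D_dense[OF x] by blast
    have "(\<lambda>l. L.opn (Lam (s l) - x)) \<longlonglongrightarrow> 0" using L.Adj.convD(3)[OF s(2)] by simp
    from LIMSEQ_D[OF this e] obtain l where "L.opn (Lam (s l) - x) < \<epsilon>"
      by (metis abs_less_iff diff_zero order_refl real_norm_def)
    thus ?thesis using s(1) by blast
  qed
  show ?thesis
  proof (rule bounded_extension[where X = "ccar D" and Y = "ccar D" and n = L.opn and m = L.opn and S = S0 and
      P = Lam and Q = Qm and C = 2, OF D_normed D_normed D_complete S0_subspace Lam_D clinear_map.lin[OF Lam_linear]
      Qm_D clinear_map.lin[OF Qm_linear] dense Qm_bound])
    fix \<Psi> assume "\<And>x. x \<in> ccar D \<Longrightarrow> \<Psi> x \<in> ccar D" "clinear_on (ccar D) \<Psi>"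
      "\<And>x. x \<in> ccar D \<Longrightarrow> L.opn (\<Psi> x) \<le> 2 * L.opn x" "\<And>f. f \<in> S0 \<Longrightarrow> \<Psi> (Lam f) = Qm f"
    thus ?thesis by blast
  qed simp_all
qed

definition Phi :: "('l \<Rightarrow> 'l) \<Rightarrow> 'l \<Rightarrow> 'l" where
  "Phi = (SOME \<Psi>. (\<forall>x\<in>ccar D. \<Psi> x \<in> ccar D) \<and> clinear_on (ccar D) \<Psi> \<and> (\<forall>x\<in>ccar D. L.opn (\<Psi> x) \<le> 2 * L.opn x) \<and>
    (\<forall>f\<in>S0. \<Psi> (Lam f) = Qm f))"

lemma Phi_spec: "(\<forall>x\<in>ccar D. Phi x \<in> ccar D) \<and> clinear_on (ccar D) Phi \<and> (\<forall>x\<in>ccar D. L.opn (Phi x) \<le> 2 * L.opn x) \<and>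
    (\<forall>f\<in>S0. Phi (Lam f) = Qm f)"
  unfolding Phi_def by (rule someI_ex[OF Phi_ex])

lemma Phi_D [simp]: "x \<in> ccar D \<Longrightarrow> Phi x \<in> ccar D" using Phi_spec by blast
lemma Phi_linear: "clinear_map (ccar D) Phi" using Phi_spec D_subspace by (simp add: clinear_map_def)
lemma Phi_bound: "x \<in> ccar D \<Longrightarrow> L.opn (Phi x) \<le> 2 * L.opn x" using Phi_spec by blast
lemma Phi_Lam: "f \<in> S0 \<Longrightarrow> Phi (Lam f) = Qm f" using Phi_spec by blast
lemma Phi_lam: "b \<in> F g \<Longrightarrow> Phi (lam g b) = lam g (T g b)" using Phi_Lam[of "single g b"] by simp

lemma Phi_conv:
  assumes "L.Adj.conv s x" "\<And>k. s k \<in> ccar D" "x \<in> ccar D" shows "L.Adj.conv (\<lambda>k. Phi (s k)) (Phi x)"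
proof -
  have "normed_carrier.conv (ccar D) L.opn (\<lambda>k. Phi (s k)) (Phi x)"
    by (rule bounded_conv[where f = Phi and C = 2, OF D_normed D_normed Phi_D clinear_map.diff[OF Phi_linear] Phi_bound D_conv[OF assms]])
  hence "(\<lambda>k. L.opn (Phi (s k) - Phi x)) \<longlonglongrightarrow> 0" by (simp add: normed_carrier.conv_def[OF D_normed])
  thus ?thesis using assms(2,3) unfolding L.Adj.conv_def by simp
qed

lemma Phi_adj: assumes "x \<in> ccar D" shows "Phi (L.adj x) = L.adj (Phi x)"
  using assms
proof (rule D_induct[where P = "\<lambda>x. Phi (L.adj x) = L.adj (Phi x)"])
  show "Phi (L.adj (lam g b)) = L.adj (Phi (lam g b))" if "b \<in> F g" for g b
    using that by (simp add: lam_star Phi_lam T_star)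
  show "Phi (L.adj (x + y)) = L.adj (Phi (x + y))"
    if "x \<in> ccar D" "y \<in> ccar D" "Phi (L.adj x) = L.adj (Phi x)" "Phi (L.adj y) = L.adj (Phi y)" for x y
    using that L.Adj.star_add[of x y] L.Adj.star_add[of "Phi x" "Phi y"] by (simp add: clinear_map.add[OF Phi_linear])
  fix s x assume s: "\<And>k. s k \<in> ccar D" "x \<in> ccar D" "\<And>k. Phi (L.adj (s k)) = L.adj (Phi (s k))" "L.Adj.conv s x"
  have "L.Adj.conv (\<lambda>k. Phi (L.adj (s k))) (Phi (L.adj x))"
    using L.Adj.conv_star[OF s(4)] s by (intro Phi_conv) simp_all
  moreover have "L.Adj.conv (\<lambda>k. L.adj (Phi (s k))) (L.adj (Phi x))"
    using L.Adj.conv_star[OF Phi_conv[OF s(4,1,2)]] by simp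
  ultimately show "Phi (L.adj x) = L.adj (Phi x)" unfolding s(3) by (rule L.Adj.conv_unique)
qed

text \<open>Two passages to the limit from \<open>Qm_pos\<close>: for fixed operators
  \<open>Lam f\<close> the vectors are approximated by sections, and then the operators
  \<open>x i\<close> by operators \<open>Lam f\<close>.\<close>

lemma Phi_form_pos:
  fixes m :: nat
  assumes x: "\<And>i. i < m \<Longrightarrow> x i \<in> ccar D" and z: "\<And>i. i < m \<Longrightarrow> \<zeta> i \<in> HL"
  shows "U.pos (\<Sum>i<m. \<Sum>j<m. hip L (\<zeta> i) (Phi (L.adj (x i) \<circ> x j) (\<zeta> j)))"
proof -
  have "\<forall>i. \<exists>s. i < m \<longrightarrow> (\<forall>k. s k \<in> S0) \<and> L.Adj.conv (\<lambda>k. Lam (s k)) (x i)" using D_dense x by blast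
  then obtain s where s: "\<And>i k. i < m \<Longrightarrow> s i k \<in> S0" "\<And>i. i < m \<Longrightarrow> L.Adj.conv (\<lambda>k. Lam (s i k)) (x i)" by metis
  have "\<forall>i. \<exists>t. i < m \<longrightarrow> (\<forall>k. t k \<in> S0) \<and> L.X.conv (\<lambda>k. \<iota> (t k)) (\<zeta> i)" using \<iota>_conv z by blast
  then obtain t where t: "\<And>i k. i < m \<Longrightarrow> t i k \<in> S0" "\<And>i. i < m \<Longrightarrow> L.X.conv (\<lambda>k. \<iota> (t i k)) (\<zeta> i)" by metis
  have "U.conv (\<lambda>k. \<Sum>i<m. \<Sum>j<m. hip L (\<zeta> i) (Phi (L.adj (Lam (s i k)) \<circ> Lam (s j k)) (\<zeta> j)))
      (\<Sum>i<m. \<Sum>j<m. hip L (\<zeta> i) (Phi (L.adj (x i) \<circ> x j) (\<zeta> j)))"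
  proof (intro U.conv_sum)
    fix i j assume "i \<in> {..<m}" "j \<in> {..<m}"
    hence ij: "i < m" "j < m" by simp_all
    have "L.Adj.conv (\<lambda>k. Phi (L.adj (Lam (s i k)) \<circ> Lam (s j k))) (Phi (L.adj (x i) \<circ> x j))"
      using L.Adj.conv_mul[OF L.Adj.conv_star[OF s(2)[OF ij(1)]] s(2)[OF ij(2)]] s(1) x ij by (intro Phi_conv) simp_all
    thus "U.conv (\<lambda>k. hip L (\<zeta> i) (Phi (L.adj (Lam (s i k)) \<circ> Lam (s j k)) (\<zeta> j))) (hip L (\<zeta> i) (Phi (L.adj (x i) \<circ> x j) (\<zeta> j)))"
      by (intro L.conv_ip_right L.conv_apply z ij)
  qed
  moreover have "U.pos (\<Sum>i<m. \<Sum>j<m. hip L (\<zeta> i) (Phi (L.adj (Lam (s i k)) \<circ> Lam (s j k)) (\<zeta> j)))" for k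
  proof -
    let ?K = "\<lambda>i j. Qm (sec_inner (s i k) (s j k))"
    have K: "Phi (L.adj (Lam (s i k)) \<circ> Lam (s j k)) = ?K i j" "?K i j \<in> L.ops" if "i < m" "j < m" for i j
      using s(1) that by (simp_all add: Phi_Lam flip: Lam_inner)
    have "U.conv (\<lambda>l. \<Sum>i<m. \<Sum>j<m. hip L (\<iota> (t i l)) (?K i j (\<iota> (t j l)))) (\<Sum>i<m. \<Sum>j<m. hip L (\<zeta> i) (?K i j (\<zeta> j)))"
    proof (intro U.conv_sum)
      fix i j assume "i \<in> {..<m}" "j \<in> {..<m}"
      hence ij: "i < m" "j < m" by simp_all
      show "U.conv (\<lambda>l. hip L (\<iota> (t i l)) (?K i j (\<iota> (t j l)))) (hip L (\<zeta> i) (?K i j (\<zeta> j)))"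
        by (rule L.conv_ip[OF t(2)[OF ij(1)] bdl_conv[OF ops_bdl[OF K(2)[OF ij]] t(2)[OF ij(2)]]])
    qed
    moreover have "U.pos (\<Sum>i<m. \<Sum>j<m. hip L (\<iota> (t i l)) (?K i j (\<iota> (t j l))))" for l
      using s(1) t(1) by (intro Qm_pos)
    ultimately have "U.pos (\<Sum>i<m. \<Sum>j<m. hip L (\<zeta> i) (?K i j (\<zeta> j)))" by (rule U.pos_closed)
    thus ?thesis using K(1) by simp
  qed
  ultimately show ?thesis by (rule U.pos_closed)
qed

lemma Phi_cp: "completely_positive D Phi"
  unfolding completely_positive_def
proof (intro conjI ballI allI impI)
  show "clinear_on (ccar D) Phi" by (rule clinear_map.lin[OF Phi_linear])
  fix m and x :: "nat \<Rightarrow> nat \<Rightarrow> 'l \<Rightarrow> 'l" assume "mat_pos D m x"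
  then obtain c where c: "\<And>i j. \<lbrakk>i < m; j < m\<rbrakk> \<Longrightarrow> c i j \<in> ccar D"
      "\<And>i j. \<lbrakk>i < m; j < m\<rbrakk> \<Longrightarrow> x i j = (\<Sum>k<m. L.adj (c k i) \<circ> c k j)"
    unfolding mat_pos_def D_simps by blast
  interpret P: hmod_pow Ae L m by unfold_locales
  have Px: "Phi (x i j) = (\<Sum>k<m. Phi (L.adj (c k i) \<circ> c k j))" if "i < m" "j < m" for i j
    unfolding c(2)[OF that] using c(1) that by (intro clinear_map.sum[OF Phi_linear]) simp
  have xD: "x i j \<in> ccar D" if "i < m" "j < m" for i j
    unfolding c(2)[OF that] using c(1) that by (intro cv.subspace_sum[OF D_subspace]) simp
  have "\<exists>e. (\<forall>i<m. \<forall>j<m. e i j \<in> ccar D) \<and> (\<forall>i<m. \<forall>j<m. Phi (x i j) = (\<Sum>k<m. L.adj (e k i) \<circ> e k j))"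
  \<comment> \<open>Taking \<open>ccar D\<close> as the closed algebra puts the entries of the root
    into \<open>D\<close>, as \<open>mat_pos D\<close> demands.\<close>
  proof (rule P.matrix_root[OF D_closed_alg D_sub D_one D_adj])
    show "Phi (x i j) \<in> ccar D" if "i < m" "j < m" for i j using xD[OF that] by simp
    show "L.adj (Phi (x i j)) = Phi (x j i)" if ij: "i < m" "j < m" for i j
    proof -
      have "L.adj (x i j) = x j i"
        unfolding c(2)[OF ij] c(2)[OF ij(2,1)]
        using c(1) ij L.Adj.star_sum[of "{..<m}" "\<lambda>k. L.adj (c k i) \<circ> c k j"]
          L.Adj.star_mul[of "L.adj (c _ i)" "c _ j"]
        by (simp add: L.ops_comp L.adj_in L.adj_adj)
      thus ?thesis using Phi_adj[OF xD[OF ij]] by simp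
    qed
    fix \<zeta> assume z: "\<And>i. i < m \<Longrightarrow> \<zeta> i \<in> HL"
    have "(\<Sum>i<m. \<Sum>j<m. hip L (\<zeta> i) (Phi (x i j) (\<zeta> j))) =
        (\<Sum>i<m. \<Sum>j<m. \<Sum>k<m. hip L (\<zeta> i) (Phi (L.adj (c k i) \<circ> c k j) (\<zeta> j)))"
    proof (intro sum.cong refl)
      fix i j assume "i \<in> {..<m}" "j \<in> {..<m}"
      hence ij: "i < m" "j < m" by simp_all
      show "hip L (\<zeta> i) (Phi (x i j) (\<zeta> j)) = (\<Sum>k<m. hip L (\<zeta> i) (Phi (L.adj (c k i) \<circ> c k j) (\<zeta> j)))"
        unfolding Px[OF ij] sum_fun_apply
        using c(1) ij z by (intro L.ip_sum) (simp_all add: L.opsD(1))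
    qed
    also have "\<dots> = (\<Sum>i<m. \<Sum>k<m. \<Sum>j<m. hip L (\<zeta> i) (Phi (L.adj (c k i) \<circ> c k j) (\<zeta> j)))"
      by (intro sum.cong refl sum.swap)
    also have "\<dots> = (\<Sum>k<m. \<Sum>i<m. \<Sum>j<m. hip L (\<zeta> i) (Phi (L.adj (c k i) \<circ> c k j) (\<zeta> j)))"
      by (rule sum.swap)
    finally have eq: "(\<Sum>i<m. \<Sum>j<m. hip L (\<zeta> i) (Phi (x i j) (\<zeta> j))) =
        (\<Sum>k<m. \<Sum>i<m. \<Sum>j<m. hip L (\<zeta> i) (Phi (L.adj (c k i) \<circ> c k j) (\<zeta> j)))" .
    show "U.pos (\<Sum>i<m. \<Sum>j<m. hip L (\<zeta> i) (Phi (x i j) (\<zeta> j)))"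
      unfolding eq using c(1) z by (intro U.pos_sum Phi_form_pos) simp_all
  qed
  thus "mat_pos D m (\<lambda>i j. Phi (x i j))" unfolding mat_pos_def D_simps by blast
qed simp

lemma Phi_bimodule: "bimodule_map Ae D (lam 0) Phi"
  unfolding bimodule_map_def D_simps
proof (intro ballI)
  fix a x b assume ab: "a \<in> ccar Ae" "b \<in> ccar Ae" and x: "x \<in> ccar D"
  have l: "lam 0 a \<in> L.ops" "lam 0 b \<in> L.ops" "lam 0 a \<in> ccar D" "lam 0 b \<in> ccar D" using ab by simp_all
  show "Phi (lam 0 a \<circ> x \<circ> lam 0 b) = lam 0 a \<circ> Phi x \<circ> lam 0 b"
    using x
  proof (rule D_induct[where P = "\<lambda>x. Phi (lam 0 a \<circ> x \<circ> lam 0 b) = lam 0 a \<circ> Phi x \<circ> lam 0 b"])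
    show "Phi (lam 0 a \<circ> lam g c \<circ> lam 0 b) = lam 0 a \<circ> Phi (lam g c) \<circ> lam 0 b" if "c \<in> F g" for g c
      using that ab by (simp add: lam_mul Phi_lam left_linear right_linear)
    show "Phi (lam 0 a \<circ> (x + y) \<circ> lam 0 b) = lam 0 a \<circ> Phi (x + y) \<circ> lam 0 b"
      if "x \<in> ccar D" "y \<in> ccar D" "Phi (lam 0 a \<circ> x \<circ> lam 0 b) = lam 0 a \<circ> Phi x \<circ> lam 0 b"
        "Phi (lam 0 a \<circ> y \<circ> lam 0 b) = lam 0 a \<circ> Phi y \<circ> lam 0 b" for x y
    proof -
      have d: "lam 0 a \<circ> (x + y) \<circ> lam 0 b = (lam 0 a \<circ> x \<circ> lam 0 b) + (lam 0 a \<circ> y \<circ> lam 0 b)"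
        if "x \<in> L.ops" "y \<in> L.ops" for x y
        using that l L.Adj.mul_add_right[of "lam 0 a" x y] L.Adj.mul_add_left[of "lam 0 a \<circ> x" "lam 0 a \<circ> y" "lam 0 b"]
        by (simp add: L.ops_comp)
      have "Phi (lam 0 a \<circ> (x + y) \<circ> lam 0 b) = Phi (lam 0 a \<circ> x \<circ> lam 0 b) + Phi (lam 0 a \<circ> y \<circ> lam 0 b)"
        unfolding d[OF D_ops[OF that(1)] D_ops[OF that(2)]] using that(1,2) l
        by (intro clinear_map.add[OF Phi_linear] D_mul)
      also have "\<dots> = lam 0 a \<circ> Phi (x + y) \<circ> lam 0 b"
        unfolding that(3,4) clinear_map.add[OF Phi_linear that(1,2)] using that(1,2) by (simp add: d)
      finally show ?thesis .
    qed
    fix s x assume s: "\<And>k. s k \<in> ccar D" "x \<in> ccar D"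
      "\<And>k. Phi (lam 0 a \<circ> s k \<circ> lam 0 b) = lam 0 a \<circ> Phi (s k) \<circ> lam 0 b" "L.Adj.conv s x"
    have cl: "L.Adj.conv (\<lambda>k. lam 0 a \<circ> y k \<circ> lam 0 b) (lam 0 a \<circ> z \<circ> lam 0 b)" if "L.Adj.conv y z" for y z
      using L.Adj.conv_mul[OF L.Adj.conv_mul[OF L.Adj.conv_const that, of "lam 0 a"] L.Adj.conv_const, of "lam 0 b"] l by simp
    have "L.Adj.conv (\<lambda>k. Phi (lam 0 a \<circ> s k \<circ> lam 0 b)) (Phi (lam 0 a \<circ> x \<circ> lam 0 b))"
      using s l by (intro Phi_conv cl) simp_all
    thus "Phi (lam 0 a \<circ> x \<circ> lam 0 b) = lam 0 a \<circ> Phi x \<circ> lam 0 b"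
      unfolding s(3) by (rule L.Adj.conv_unique[OF _ cl[OF Phi_conv[OF s(4,1,2)]]])
  qed
qed

text \<open>On generators only the unit fibre contributes, and there
  \<open>T 0 b = T 0 (e1 b)\<close> is the product of \<open>T 0 e1\<close> and \<open>b\<close> by
  right linearity.\<close>

lemma Phi_Ex: assumes "x \<in> ccar D" shows "Ex (Phi x) = fmul B 0 0 (T 0 e1) (Ex x)"
  using assms
proof (rule D_induct[where P = "\<lambda>x. Ex (Phi x) = fmul B 0 0 (T 0 e1) (Ex x)"])
  have z: "T 0 e1 \<in> F 0" by simp
  show "Ex (Phi (lam g b)) = fmul B 0 0 (T 0 e1) (Ex (lam g b))" if "b \<in> F g" for g b
    using that right_linear[of e1 0 b] U.one_mul[of b] mul_0(1)[OF z, of 0] by (auto simp: Phi_lam Ex_lam)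
  show "Ex (Phi (x + y)) = fmul B 0 0 (T 0 e1) (Ex (x + y))"
    if "x \<in> ccar D" "y \<in> ccar D" "Ex (Phi x) = fmul B 0 0 (T 0 e1) (Ex x)" "Ex (Phi y) = fmul B 0 0 (T 0 e1) (Ex y)" for x y
    using that z by (simp add: clinear_map.add[OF Phi_linear] clinear_map.add[OF Ex_linear] mul_add_right)
  fix s x assume s: "\<And>k. s k \<in> ccar D" "x \<in> ccar D" "\<And>k. Ex (Phi (s k)) = fmul B 0 0 (T 0 e1) (Ex (s k))" "L.Adj.conv s x"
  have "U.conv (\<lambda>k. Ex (Phi (s k))) (Ex (Phi x))" using s by (intro Ex_conv Phi_conv) simp_all
  moreover have "U.conv (\<lambda>k. fmul B 0 0 (T 0 e1) (Ex (s k))) (fmul B 0 0 (T 0 e1) (Ex x))"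
    using U.conv_mul[OF U.conv_const Ex_conv[OF s(4,1,2)], of "T 0 e1"] z by simp
  ultimately show "Ex (Phi x) = fmul B 0 0 (T 0 e1) (Ex x)" unfolding s(3) by (rule U.conv_unique)
qed

text \<open>Since \<open>T 0\<close> is linear on both sides, \<open>z = T 0 e1\<close> is central
  in the unit fibre. For \<open>Ex x = a\<^sup>* a\<close> the difference
  \<open>Ex x - z Ex x\<close> is therefore \<open>a\<^sup>* (1 - z) a\<close>, which is positive
  because \<open>z \<le> 1\<close>.\<close>

lemma Phi_Ex_le: assumes x: "x \<in> ccar D" and pos: "cpos D x" shows "cle Ae (Ex (Phi x)) (Ex x)"
proof -
  let ?z = "T 0 e1"
  have z: "?z \<in> F 0" "U.pos ?z" by (simp_all add: T_one_pos)
  obtain a where a: "a \<in> F 0" "Ex x = fmul B 0 0 (fstar B 0 a) a"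
    using Ex_spec x pos unfolding faithful_conditional_expectation_def cpos_def by auto
  have central: "fmul B 0 0 b ?z = fmul B 0 0 ?z b" if "b \<in> F 0" for b
    using left_linear[OF that e1_in] right_linear[OF e1_in that] U.one_mul[of b] U.mul_one[of b] that by simp
  have "U.pos (rsc 1 e1 - ?z)" using contractive z(2) by (intro U.pos_one_minus U.posD(3)) simp_all
  from U.pos_conj[OF this, of a] have "U.pos (fmul B 0 0 (fstar B 0 a) (fmul B 0 0 (e1 - ?z) a))" using a by simp
  also have "fmul B 0 0 (fstar B 0 a) (fmul B 0 0 (e1 - ?z) a) = Ex x - fmul B 0 0 ?z (Ex x)"
    using a z star_closed[OF a(1)] U.one_mul[of a] central[of "fstar B 0 a"]
      U.mul_assoc[of "fstar B 0 a" ?z a] U.mul_assoc[of ?z "fstar B 0 a" a]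
      U.mul_diff_left[of e1 ?z a] U.mul_diff_right[of "fstar B 0 a" a "fmul B 0 0 ?z a"] by simp
  finally show ?thesis by (simp add: cle_def U.cpos_iff Phi_Ex[OF x])
qed

end

section \<open>Compact maps\<close>

lemma sum_lessThan_add:
  fixes f :: "nat \<Rightarrow> 'a::comm_monoid_add"
  shows "(\<Sum>i<m + k. f i) = (\<Sum>i<m. f i) + (\<Sum>i<k. f (m + i))"
  by (induction k) (simp_all add: add.assoc)

context hmod
begin

lemma act_zero [simp]: "x \<in> H \<Longrightarrow> act x 0 = 0" using act_scale_right[of x 0 0] by simp

lemma finite_rank_closed: assumes "finite_rank X F" "x \<in> H" shows "F x \<in> H"
proof -
  obtain m and \<xi> \<eta> where "\<forall>i<m. \<xi> i \<in> H \<and> \<eta> i \<in> H" "\<forall>x\<in>H. F x = (\<Sum>i<(m::nat). act (\<xi> i) (ip (\<eta> i) x))"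
    using assms(1) unfolding finite_rank_def by blast
  thus ?thesis using assms(2) by (auto intro!: X.sum_in)
qed

lemma finite_rank_ops: assumes "finite_rank X F" shows "(\<lambda>x. if x \<in> H then F x else 0) \<in> ops"
proof -
  obtain m and \<xi> \<eta> where xe: "\<And>i. i < m \<Longrightarrow> \<xi> i \<in> H" "\<And>i. i < m \<Longrightarrow> \<eta> i \<in> H"
      and F: "\<And>x. x \<in> H \<Longrightarrow> F x = (\<Sum>i<(m::nat). act (\<xi> i) (ip (\<eta> i) x))"
    using assms(1) unfolding finite_rank_def by blast
  show ?thesis
  proof (rule opsI[where S' = "\<lambda>y. \<Sum>i<m. act (\<eta> i) (ip (\<xi> i) y)" and C = "\<Sum>i<m. hn (\<xi> i) * hn (\<eta> i)"])
    show "(if x \<in> H then F x else 0) \<in> H" if "x \<in> H" for x using finite_rank_closed[OF assms that] that by simp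
    show "(\<Sum>i<m. act (\<eta> i) (ip (\<xi> i) y)) \<in> H" if "y \<in> H" for y using xe that by (intro X.sum_in) simp
    show "ip (if x \<in> H then F x else 0) y = ip x (\<Sum>i<m. act (\<eta> i) (ip (\<xi> i) y))" if "x \<in> H" "y \<in> H" for x y
    proof -
      have "ip (F x) y = (\<Sum>i<m. ip (act (\<xi> i) (ip (\<eta> i) x)) y)"
        unfolding F[OF that(1)] using xe that by (intro ip_sum_left) simp_all
      also have "\<dots> = (\<Sum>i<m. ip x (act (\<eta> i) (ip (\<xi> i) y)))"
        using xe that by (intro sum.cong refl) (simp add: ip_act ip_act_left ip_star)
      also have "\<dots> = ip x (\<Sum>i<m. act (\<eta> i) (ip (\<xi> i) y))"
        using xe that by (intro ip_sum[symmetric]) simp_all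
      finally show ?thesis using that by simp
    qed
    fix x assume x: "x \<in> H"
    have "hn (F x) \<le> (\<Sum>i<m. hn (act (\<xi> i) (ip (\<eta> i) x)))"
      unfolding F[OF x] using xe x by (intro X.norm_sum_le) simp
    also have "\<dots> \<le> (\<Sum>i<m. hn (\<xi> i) * (hn (\<eta> i) * hn x))"
    proof (rule sum_mono)
      fix i assume "i \<in> {..<m}"
      hence i: "\<xi> i \<in> H" "\<eta> i \<in> H" using xe by auto
      have "hn (act (\<xi> i) (ip (\<eta> i) x)) \<le> hn (\<xi> i) * cnorm A (ip (\<eta> i) x)" using i x by (intro hnorm_act_le) simp_all
      also have "\<dots> \<le> hn (\<xi> i) * (hn (\<eta> i) * hn x)" using i x by (intro mult_left_mono cauchy_schwarz X.nonneg)
      finally show "hn (act (\<xi> i) (ip (\<eta> i) x)) \<le> hn (\<xi> i) * (hn (\<eta> i) * hn x)" .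
    qed
    finally show "hn (if x \<in> H then F x else 0) \<le> (\<Sum>i<m. hn (\<xi> i) * hn (\<eta> i)) * hn x"
      using x by (simp add: sum_distrib_right mult.assoc)
  qed simp
qed

lemma finite_rank_zero: "finite_rank X (\<lambda>x. 0)"
  unfolding finite_rank_def by (intro exI[of _ 0]) simp

lemma finite_rank_add: assumes "finite_rank X F" "finite_rank X G" shows "finite_rank X (\<lambda>x. F x + G x)"
proof -
  obtain m and \<xi> \<eta> where F: "\<And>i. i < m \<Longrightarrow> \<xi> i \<in> H \<and> \<eta> i \<in> H" "\<And>x. x \<in> H \<Longrightarrow> F x = (\<Sum>i<(m::nat). act (\<xi> i) (ip (\<eta> i) x))"
    using assms(1) unfolding finite_rank_def by blast
  obtain m' and \<xi>' \<eta>' where G: "\<And>i. i < m' \<Longrightarrow> \<xi>' i \<in> H \<and> \<eta>' i \<in> H" "\<And>x. x \<in> H \<Longrightarrow> G x = (\<Sum>i<(m'::nat). act (\<xi>' i) (ip (\<eta>' i) x))"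
    using assms(2) unfolding finite_rank_def by blast
  let ?\<xi> = "\<lambda>i. if i < m then \<xi> i else \<xi>' (i - m)" and ?\<eta> = "\<lambda>i. if i < m then \<eta> i else \<eta>' (i - m)"
  have "F x + G x = (\<Sum>i<m + m'. act (?\<xi> i) (ip (?\<eta> i) x))" if "x \<in> H" for x
    using F(2)[OF that] G(2)[OF that] by (simp add: sum_lessThan_add)
  thus ?thesis unfolding finite_rank_def using F(1) G(1)
    by (intro exI[of _ "m + m'"] exI[of _ ?\<xi>] exI[of _ ?\<eta>]) auto
qed

lemma finite_rank_sum:
  "finite G \<Longrightarrow> (\<And>g. g \<in> G \<Longrightarrow> finite_rank X (F g)) \<Longrightarrow> finite_rank X (\<lambda>x. \<Sum>g\<in>G. F g x)"
  by (induction G rule: finite_induct) (simp_all add: finite_rank_zero finite_rank_add)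

lemma finite_rank_scale: assumes "finite_rank X F" shows "finite_rank X (\<lambda>x. c *\<^sub>C F x)"
proof -
  obtain m and \<xi> \<eta> where F: "\<And>i. i < m \<Longrightarrow> \<xi> i \<in> H \<and> \<eta> i \<in> H" "\<And>x. x \<in> H \<Longrightarrow> F x = (\<Sum>i<(m::nat). act (\<xi> i) (ip (\<eta> i) x))"
    using assms unfolding finite_rank_def by blast
  show ?thesis unfolding finite_rank_def
    by (intro exI[of _ m] exI[of _ "\<lambda>i. c *\<^sub>C \<xi> i"] exI[of _ \<eta>])
      (auto simp: F act_scale_left cv.scale_sum_right intro!: sum.cong)
qed

text \<open>Norm approximation by finite rank maps in pointwise form. Being free of suprema, it can
  be assembled fibre by fibre.\<close>

definition approx :: "('x \<Rightarrow> 'x) \<Rightarrow> bool" where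
  "approx K \<longleftrightarrow> (\<forall>\<epsilon>>0. \<exists>F. finite_rank X F \<and> (\<forall>x\<in>H. hn (F x - K x) \<le> \<epsilon> * hn x))"

lemma finite_rank_diff_bounded:
  assumes F: "finite_rank X F" and K: "bounded_op H hn K"
  shows "bounded_on H hn (\<lambda>x. F x - K x)" "\<And>x. x \<in> H \<Longrightarrow> F x - K x \<in> H"
proof -
  obtain C where C: "\<And>x. x \<in> H \<Longrightarrow> hn (K x) \<le> C * hn x" and Kx: "\<And>x. x \<in> H \<Longrightarrow> K x \<in> H"
    using K by (auto simp: bounded_op_def bounded_on_def)
  show cl: "F x - K x \<in> H" if "x \<in> H" for x using finite_rank_closed[OF F that] Kx[OF that] by simp
  have "hn (F x - K x) \<le> (opn (\<lambda>x. if x \<in> H then F x else 0) + C) * hn x" if x: "x \<in> H" for x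
    using X.norm_diff_le[OF finite_rank_closed[OF F x] Kx[OF x]] opn_bound[OF finite_rank_ops[OF F] x] C[OF x] x
    by (simp add: algebra_simps)
  thus "bounded_on H hn (\<lambda>x. F x - K x)" unfolding bounded_on_def by blast
qed

lemma compact_approx: assumes "compact_map A X K" shows "approx K"
  unfolding approx_def
proof (intro allI impI)
  fix \<epsilon> :: real assume e: "\<epsilon> > 0"
  obtain F where F: "\<And>k. finite_rank X (F k)" "(\<lambda>k. opn (\<lambda>x. F k x - K x)) \<longlonglongrightarrow> 0"
    using assms unfolding compact_map_def by blast
  have K: "bounded_op H hn K" using assms by (simp add: compact_map_def)
  obtain k where k: "opn (\<lambda>x. F k x - K x) < \<epsilon>"
    using LIMSEQ_D[OF F(2) e] by (metis abs_less_iff diff_zero order_refl real_norm_def)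
  have "hn (F k x - K x) \<le> \<epsilon> * hn x" if x: "x \<in> H" for x
  proof -
    have "hn (F k x - K x) \<le> opn (\<lambda>x. F k x - K x) * hn x"
      using X.le_op_norm[OF finite_rank_diff_bounded[OF F(1) K] x] by simp
    also have "\<dots> \<le> \<epsilon> * hn x" using k X.nonneg[OF x] by (intro mult_right_mono) auto
    finally show ?thesis .
  qed
  thus "\<exists>F. finite_rank X F \<and> (\<forall>x\<in>H. hn (F x - K x) \<le> \<epsilon> * hn x)" using F(1) by blast
qed

lemma approx_seq: assumes "approx K"
  obtains F where "\<And>k. finite_rank X (F k)" "\<And>k x. x \<in> H \<Longrightarrow> hn (F k x - K x) \<le> 1 / real (Suc k) * hn x"
proof -
  have "\<forall>k. \<exists>F. finite_rank X F \<and> (\<forall>x\<in>H. hn (F x - K x) \<le> 1 / real (Suc k) * hn x)"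
  proof
    fix k
    have "0 < 1 / real (Suc k)" by simp
    with assms show "\<exists>F. finite_rank X F \<and> (\<forall>x\<in>H. hn (F x - K x) \<le> 1 / real (Suc k) * hn x)"
      unfolding approx_def by blast
  qed
  thus ?thesis using that by metis
qed

lemma approx_compact: assumes "approx K" "bounded_op H hn K" shows "compact_map A X K"
proof -
  obtain F where F: "\<And>k. finite_rank X (F k)" "\<And>k x. x \<in> H \<Longrightarrow> hn (F k x - K x) \<le> 1 / real (Suc k) * hn x"
    using approx_seq[OF assms(1)] by metis
  have "(\<lambda>k. opn (\<lambda>x. F k x - K x)) \<longlonglongrightarrow> 0"
  proof (rule Lim_null_comparison[OF always_eventually LIMSEQ_Suc[OF lim_1_over_n]], rule allI)
    fix k
    have "opn (\<lambda>x. F k x - K x) \<le> 1 / real (Suc k)" by (rule X.op_norm_le[OF F(2)]) simp_all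
    moreover have "0 \<le> opn (\<lambda>x. F k x - K x)" by (rule X.op_norm_nonneg[OF finite_rank_diff_bounded[OF F(1) assms(2)]])
    ultimately show "norm (opn (\<lambda>x. F k x - K x)) \<le> 1 / real (Suc k)" by simp
  qed
  thus ?thesis using F(1) assms(2) unfolding compact_map_def by blast
qed

text \<open>Finite rank maps have explicit adjoints, and the adjointable operators are complete.
  This turns compactness of \<open>T\<^sub>g\<close> into adjointability, from which right linearity
  and the inequalities in \<open>Ae\<close> follow.\<close>

lemma approx_ops: assumes K: "approx K" and cl: "\<And>x. x \<in> H \<Longrightarrow> K x \<in> H" shows "(\<lambda>x. if x \<in> H then K x else 0) \<in> ops"
proof -
  obtain F where F: "\<And>k. finite_rank X (F k)" "\<And>k x. x \<in> H \<Longrightarrow> hn (F k x - K x) \<le> 1 / real (Suc k) * hn x"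
    using approx_seq[OF K] by metis
  define G where "G k = (\<lambda>x. if x \<in> H then F k x else 0)" for k
  have G: "G k \<in> ops" for k unfolding G_def by (rule finite_rank_ops[OF F(1)])
  have Gx: "G k x \<in> H" if "x \<in> H" for k x by (rule opsD(1)[OF G that])
  have GK: "hn (G k x - K x) \<le> 1 / real (Suc k) * hn x" if "x \<in> H" for k x using F(2)[OF that] that by (simp add: G_def)
  have dif: "opn (G k - G l) \<le> 1 / real (Suc k) + 1 / real (Suc l)" for k l
  proof (rule opn_le)
    fix x assume x: "x \<in> H"
    have "hn (G k x - G l x) \<le> hn (G k x - K x) + hn (K x - G l x)" using x cl Gx by (intro X.tri_diff)
    also have "\<dots> \<le> 1 / real (Suc k) * hn x + 1 / real (Suc l) * hn x"
      using GK[OF x] X.norm_diff_commute[OF cl[OF x] Gx[OF x]] by (intro add_mono) auto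
    finally show "hn ((G k - G l) x) \<le> (1 / real (Suc k) + 1 / real (Suc l)) * hn x" by (simp add: distrib_right)
  qed simp
  have "\<exists>R\<in>ops. (\<lambda>k. opn (G k - R)) \<longlonglongrightarrow> 0"
  proof (rule complete_onD[OF ops_complete G], intro allI impI)
    fix \<epsilon> :: real assume e: "\<epsilon> > 0"
    obtain N where N: "inverse (real (Suc N)) < \<epsilon> / 2" using reals_Archimedean[OF half_gt_zero[OF e]] by blast
    have small: "1 / real (Suc k) < \<epsilon> / 2" if "k \<ge> N" for k
    proof -
      have "1 / real (Suc k) \<le> 1 / real (Suc N)" using that by (intro divide_left_mono) auto
      thus ?thesis using N by (simp add: inverse_eq_divide)
    qed
    have "opn (G k - G l) < \<epsilon>" if "k \<ge> N" "l \<ge> N" for k l using dif[of k l] small[OF that(1)] small[OF that(2)] by linarith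
    thus "\<exists>N. \<forall>k\<ge>N. \<forall>l\<ge>N. opn (G k - G l) < \<epsilon>" by blast
  qed
  then obtain R where R: "R \<in> ops" "(\<lambda>k. opn (G k - R)) \<longlonglongrightarrow> 0" by blast
  have conv: "Adj.conv G R" unfolding Adj.conv_def using G R by simp
  have "(\<lambda>x. if x \<in> H then K x else 0) = R"
  proof
    fix x
    show "(if x \<in> H then K x else 0) = R x"
    proof (cases "x \<in> H")
      case True
      have "X.conv (\<lambda>k. G k x) (K x)"
      proof (rule X.convI_le[OF Gx[OF True] cl[OF True] GK[OF True]])
        show "(\<lambda>k. 1 / real (Suc k) * hn x) \<longlonglongrightarrow> 0"
          using tendsto_mult[OF LIMSEQ_Suc[OF lim_1_over_n] tendsto_const, of "hn x"] by simp
      qed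
      from X.conv_unique[OF this conv_apply[OF conv True]] True show ?thesis by simp
    qed (simp add: opsD(2)[OF R(1)])
  qed
  thus ?thesis using R(1) by simp
qed

end

context fell_unital
begin

text \<open>Every basis vector is an isometry. The index set cannot be empty, since the expansion of
  \<open>b \<noteq> 0\<close> would then be the empty sum.\<close>

lemma isometry_of_basis:
  assumes onb: "orthonormal_basis Ae (fibre_module B g) J u" and b: "b \<in> F g" "b \<noteq> 0"
  shows "\<exists>v\<in>F g. fmul B (- g) g (fstar B g v) v = e1"
proof (cases "J = {}")
  case True
  have "((\<lambda>F. hnorm Ae (fibre_module B g) (b - (\<Sum>j\<in>F. fmul B g 0 (u j) (c j)))) \<longlongrightarrow> 0) (finite_subsets_at_top J) \<longrightarrow> False" for c
  proof
    assume "((\<lambda>F. hnorm Ae (fibre_module B g) (b - (\<Sum>j\<in>F. fmul B g 0 (u j) (c j)))) \<longlongrightarrow> 0) (finite_subsets_at_top J)"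
    hence "((\<lambda>F. hnorm Ae (fibre_module B g) (b - (\<Sum>j\<in>F. fmul B g 0 (u j) (c j)))) \<longlongrightarrow> 0) (principal {{}})"
      unfolding True finite_subsets_at_top_finite[OF finite.emptyI] .
    hence "hnorm Ae (fibre_module B g) b = 0"
      using tendsto_unique[OF _ tendsto_principal_singleton] by (fastforce simp: principal_eq_bot_iff)
    thus False using b N.eq_0[OF b(1)] by (simp add: fibre_norm)
  qed
  thus ?thesis using onb b(1) unfolding orthonormal_basis_def fibre_simps by blast
next
  case False
  then obtain j where "j \<in> J" by blast
  thus ?thesis using onb unfolding orthonormal_basis_def fibre_simps by (intro bexI[of _ "u j"]) auto
qed

end

section \<open>The induced maps on the completion\<close>

context sec_completion
begin

lemma bdl_add: assumes f: "bdl f" and g: "bdl g" shows "bdl (\<lambda>x. f x + g x)"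
proof -
  obtain C C' where C: "\<And>x. x \<in> HL \<Longrightarrow> hn (f x) \<le> C * hn x" "\<And>x. x \<in> HL \<Longrightarrow> hn (g x) \<le> C' * hn x"
    using bdlD(3)[OF f] bdlD(3)[OF g] unfolding bounded_on_def by blast
  have "hn (f x + g x) \<le> (C + C') * hn x" if x: "x \<in> HL" for x
    using L.X.tri[OF bdlD(1)[OF f x] bdlD(1)[OF g x]] C[OF x] by (simp add: algebra_simps)
  hence "bounded_on HL hn (\<lambda>x. f x + g x)" unfolding bounded_on_def by blast
  moreover have "clinear_on HL (\<lambda>x. f x + g x)"
    by (rule clinear_onI) (simp_all add: clinear_map.add[OF bdlD(2)[OF f]] clinear_map.add[OF bdlD(2)[OF g]]
        clinear_map.scale[OF bdlD(2)[OF f]] clinear_map.scale[OF bdlD(2)[OF g]] cv.scale_right_distrib)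
  ultimately show ?thesis using bdlD(1)[OF f] bdlD(1)[OF g] by (simp add: bdl_def bounded_op_def)
qed

text \<open>The vectors \<open>\<xi>\<close> and \<open>\<eta>\<close> are transported by
  \<open>d g\<close>; orthogonality of the fibres makes the result vanish on all other
  coordinates.\<close>

lemma lift_finite_rank:
  assumes "finite_rank (fibre_module B g) F'"
  shows "\<exists>G. finite_rank L G \<and> (\<forall>h. \<forall>c\<in>F h. G (d h c) = (if h = g then d g (F' c) else 0))"
proof -
  obtain m and \<xi> \<eta> where xe: "\<And>i. i < m \<Longrightarrow> \<xi> i \<in> F g" "\<And>i. i < m \<Longrightarrow> \<eta> i \<in> F g"
      and F': "\<And>x. x \<in> F g \<Longrightarrow> F' x = (\<Sum>i<(m::nat). fmul B g 0 (\<xi> i) (fmul B (- g) g (fstar B g (\<eta> i)) x))"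
    using assms unfolding finite_rank_def fibre_simps by blast
  let ?G = "\<lambda>x. \<Sum>i<m. hact L (d g (\<xi> i)) (hip L (d g (\<eta> i)) x)"
  have "finite_rank L ?G" unfolding finite_rank_def
    by (intro exI[of _ m] exI[of _ "\<lambda>i. d g (\<xi> i)"] exI[of _ "\<lambda>i. d g (\<eta> i)"]) (simp add: xe)
  moreover have "?G (d h c) = (if h = g then d g (F' c) else 0)" if c: "c \<in> F h" for h c
  proof (cases "h = g")
    case True
    have in0: "fmul B (- g) g (fstar B g (\<eta> i)) c \<in> F 0" if "i < m" for i using xe(2)[OF that] c True by simp
    have "?G (d h c) = (\<Sum>i<m. d g (fmul B g 0 (\<xi> i) (fmul B (- g) g (fstar B g (\<eta> i)) c)))"
      using xe c True in0 by (intro sum.cong refl) (simp add: ip_d d_act)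
    also have "\<dots> = d g (\<Sum>i<m. fmul B g 0 (\<xi> i) (fmul B (- g) g (fstar B g (\<eta> i)) c))"
      using xe in0 by (intro clinear_map.sum[OF d_linear, symmetric]) simp
    finally show ?thesis using F'[of c] c True by simp
  next
    case False
    hence "?G (d h c) = (\<Sum>i<m. 0)" using xe c by (intro sum.cong refl) (simp add: ip_d)
    thus ?thesis using False by simp
  qed
  ultimately show ?thesis by blast
qed

end

locale haagerup_mult = alg_completion B L \<iota> H j + pd_map B L \<iota> T
  for B :: "('g::group_add, 'b::complex_vector) fell_data"
    and L :: "('l::complex_vector, 'b) hmodule" and \<iota> :: "('g \<Rightarrow> 'b) \<Rightarrow> 'l"
    and H :: "('h::complex_vector, 'b) hmodule" and j :: "('l \<Rightarrow> 'l) \<Rightarrow> 'h" and T :: "'g \<Rightarrow> 'b \<Rightarrow> 'b" +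
  assumes T_approx: "\<And>g. M.approx g (T g)"
    and T_c0: "\<And>\<epsilon>. \<epsilon> > 0 \<Longrightarrow> \<exists>G. finite G \<and> (\<forall>g. g \<notin> G \<longrightarrow> (\<forall>b\<in>fib B g. fnorm B g (T g b) \<le> \<epsilon> * fnorm B g b))"
begin

lemma fnorm_le_lam: "b \<in> F g \<Longrightarrow> fnorm B g b \<le> L.opn (lam g b)"
  using hn_apply_\<xi>0[OF lam_in] by (simp add: lam_\<xi>0 hn_d)

text \<open>The map \<open>lam g\<close> is isometric on each fibre, so the bound of
  \<open>Phi\<close> descends to \<open>T g\<close> with the same constant for all
  \<open>g\<close>.\<close>

lemma T_norm: assumes b: "b \<in> F g" shows "fnorm B g (T g b) \<le> 2 * fnorm B g b"
  using fnorm_le_lam[of "T g b" g] Phi_bound[of "lam g b"] lam_spec(2)[OF b] b by (simp add: Phi_lam)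

lemma leq_of_ops:
  assumes R: "R \<in> M.ops g" and r: "\<And>b. b \<in> F g \<Longrightarrow> fnorm B g (R b) \<le> r * fnorm B g b" "r \<ge> 0" and b: "b \<in> F g"
  shows "U.leq (fmul B (- g) g (fstar B g (R b)) (R b)) (rsc (r\<^sup>2) (fmul B (- g) g (fstar B g b) b))"
proof -
  have cl: "R b \<in> F g" if "b \<in> F g" for b using M.opsD(1)[OF R] that by simp
  have "M.opn g R \<le> r" by (rule M.opn_le) (use r cl in \<open>simp_all add: fibre_norm\<close>)
  from M.ops_leq[OF R this, of b] b show ?thesis by simp
qed

definition Psi :: "'h \<Rightarrow> 'h" where "Psi = induced_map Ae (expectation_module B L \<iota>) H j Phi"

lemma K_d: "K.d g b = j (lam g b)" by (simp add: K.d_def)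

text \<open>The block diagonal operator with blocks \<open>T g\<close> is bounded by
  \<open>coord_map\<close> and agrees with \<open>Phi\<close> on the generators, hence on the
  algebra. A bounded extension is unique by density, so the description in
  \<open>induced_map\<close> picks this operator.\<close>

lemma Psi_spec: "K.bdl Psi" "\<And>x. x \<in> hcar H \<Longrightarrow> hnorm Ae H (Psi x) \<le> 2 * hnorm Ae H x"
  "\<And>x. x \<in> ccar D \<Longrightarrow> Psi (j x) = j (Phi x)"
proof -
  have ops: "(\<lambda>b. if b \<in> F g then T g b else 0) \<in> M.ops g" for g
    using M.approx_ops[OF T_approx, of g] by simp
  obtain \<Psi> where P: "K.bdl \<Psi>" "\<And>x. x \<in> hcar H \<Longrightarrow> hnorm Ae H (\<Psi> x) \<le> 2 * hnorm Ae H x" "\<And>x. x \<notin> hcar H \<Longrightarrow> \<Psi> x = 0"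
    "\<And>g b. b \<in> F g \<Longrightarrow> \<Psi> (K.d g b) = K.d g (T g b)"
  proof (rule K.coord_map[of "\<lambda>g. g" T 2])
    show "clinear_on (F g) (T g)" for g by (rule clinear_map.lin[OF T_linear])
    show "U.leq (fmul B (- g) g (fstar B g (T g b)) (T g b)) (rsc (2\<^sup>2) (fmul B (- g) g (fstar B g b) b))" if "b \<in> F g" for g b
      using leq_of_ops[OF ops, of g 2 b] T_norm that by simp
  qed simp_all
  have Pj: "\<Psi> (j x) = j (Phi x)" if "x \<in> ccar D" for x
    using that
  proof (rule D_induct[where P = "\<lambda>x. \<Psi> (j x) = j (Phi x)"])
    show "\<Psi> (j (lam g b)) = j (Phi (lam g b))" if "b \<in> F g" for g b using P(4)[OF that] that by (simp add: K_d Phi_lam)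
    show "\<Psi> (j (x + y)) = j (Phi (x + y))"
      if "x \<in> ccar D" "y \<in> ccar D" "\<Psi> (j x) = j (Phi x)" "\<Psi> (j y) = j (Phi y)" for x y
      using that by (simp add: clinear_map.add[OF Phi_linear] clinear_map.add[OF j_linear] clinear_map.add[OF K.bdlD(2)[OF P(1)]])
    fix s x assume s: "\<And>k. s k \<in> ccar D" "x \<in> ccar D" "\<And>k. \<Psi> (j (s k)) = j (Phi (s k))" "L.Adj.conv s x"
    have "H.X.conv (\<lambda>k. \<Psi> (j (s k))) (\<Psi> (j x))" by (rule K.bdl_conv[OF P(1) j_conv[OF s(4,1,2)]])
    moreover have "H.X.conv (\<lambda>k. j (Phi (s k))) (j (Phi x))" using s by (intro j_conv Phi_conv) simp_all
    ultimately show "\<Psi> (j x) = j (Phi x)" unfolding s(3) by (rule H.X.conv_unique)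
  qed
  have "Psi = \<Psi>" unfolding Psi_def induced_map_def
  proof (rule the_equality)
    show "bounded_op (hcar H) (hnorm Ae H) \<Psi> \<and> (\<forall>h. h \<notin> hcar H \<longrightarrow> \<Psi> h = 0) \<and>
        (\<forall>x\<in>hcar (expectation_module B L \<iota>). \<Psi> (j x) = j (Phi x))"
      using P(1,3) Pj by (simp add: K.bdl_def)
    fix \<Psi>' assume P': "bounded_op (hcar H) (hnorm Ae H) \<Psi>' \<and> (\<forall>h. h \<notin> hcar H \<longrightarrow> \<Psi>' h = 0) \<and>
        (\<forall>x\<in>hcar (expectation_module B L \<iota>). \<Psi>' (j x) = j (Phi x))"
    have b': "K.bdl \<Psi>'" using P' by (simp add: K.bdl_def)
    show "\<Psi>' = \<Psi>"
    proof
      fix x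
      show "\<Psi>' x = \<Psi> x"
      proof (cases "x \<in> hcar H")
        case True
        show ?thesis
          by (rule K.bdl_eqI[OF b' P(1) _ True]) (use P' Pj in \<open>simp add: K_d\<close>)
      qed (use P' P(3) in simp)
    qed
  qed
  thus "K.bdl Psi" "\<And>x. x \<in> hcar H \<Longrightarrow> hnorm Ae H (Psi x) \<le> 2 * hnorm Ae H x" "\<And>x. x \<in> ccar D \<Longrightarrow> Psi (j x) = j (Phi x)"
    using P Pj by simp_all
qed

lemma Psi_d: "b \<in> F g \<Longrightarrow> Psi (K.d g b) = K.d g (T g b)"
  by (simp add: K_d Psi_spec(3) Phi_lam)

text \<open>Outside a finite set of degrees the blocks are already bounded by
  \<open>\<epsilon>\<close>; on that set each block is replaced by a finite rank map within
  \<open>\<epsilon>\<close>. The error is block diagonal with all blocks bounded by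
  \<open>\<epsilon>\<close>, and \<open>coord_map\<close> bounds it as a whole.\<close>

lemma Psi_approx: "H.approx Psi"
  unfolding H.approx_def
proof (intro allI impI)
  fix \<epsilon> :: real assume e: "\<epsilon> > 0"
  obtain G where G: "finite G" "\<And>g b. g \<notin> G \<Longrightarrow> b \<in> F g \<Longrightarrow> fnorm B g (T g b) \<le> \<epsilon> * fnorm B g b"
    using T_c0[OF e] by blast
  have "\<forall>g. \<exists>F'. finite_rank (fibre_module B g) F' \<and> (\<forall>b\<in>F g. fnorm B g (F' b - T g b) \<le> \<epsilon> * fnorm B g b)"
  proof
    fix g
    obtain F' where F': "finite_rank (fibre_module B g) F'"
      "\<forall>b\<in>F g. hnorm Ae (fibre_module B g) (F' b - T g b) \<le> \<epsilon> * hnorm Ae (fibre_module B g) b"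
      using T_approx[of g] e unfolding M.approx_def fibre_simps by blast
    have "F' b \<in> F g" if "b \<in> F g" for b using M.finite_rank_closed[OF F'(1)] that by simp
    thus "\<exists>F'. finite_rank (fibre_module B g) F' \<and> (\<forall>b\<in>F g. fnorm B g (F' b - T g b) \<le> \<epsilon> * fnorm B g b)"
      using F' by (intro exI[of _ F']) (simp add: fibre_norm)
  qed
  then obtain F' where F': "\<And>g. finite_rank (fibre_module B g) (F' g)"
    "\<And>g b. b \<in> F g \<Longrightarrow> fnorm B g (F' g b - T g b) \<le> \<epsilon> * fnorm B g b" by metis
  have F'cl: "F' g b \<in> F g" if "b \<in> F g" for g b using M.finite_rank_closed[OF F'(1)] that by simp
  obtain E where E: "\<And>g. finite_rank H (E g)" "\<And>g h c. c \<in> F h \<Longrightarrow> E g (K.d h c) = (if h = g then K.d g (F' g c) else 0)"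
    using K.lift_finite_rank[OF F'(1)] by metis
  let ?E = "\<lambda>x. \<Sum>g\<in>G. E g x"
  have Efr: "finite_rank H ?E" by (rule H.finite_rank_sum[OF G(1) E(1)])
  have Ed: "?E (K.d h c) = (if h \<in> G then K.d h (F' h c) else 0)" if "c \<in> F h" for h c
  proof -
    have "?E (K.d h c) = (\<Sum>g\<in>G. if h = g then K.d h (F' h c) else 0)" using E(2)[OF that] by (intro sum.cong) auto
    thus ?thesis using G(1) by simp
  qed
  \<comment> \<open>Cutting off outside the fibre turns the blocks into members of
    \<open>M.ops\<close>, to which \<open>leq_of_ops\<close> applies.\<close>
  let ?T = "\<lambda>g b. if b \<in> F g then T g b else 0" and ?F = "\<lambda>g b. if b \<in> F g then F' g b else 0"
  define R where "R g = (if g \<in> G then ?F g - ?T g else - ?T g)" for g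
  have Rb: "R g b = (if g \<in> G then F' g b - T g b else - T g b)" if "b \<in> F g" for g b using that by (simp add: R_def)
  have Rops: "R g \<in> M.ops g" for g
    using M.approx_ops[OF T_approx, of g] M.finite_rank_ops[OF F'(1), of g]
      M.ops_diff[of "?F g" g "?T g"] cv.subspace_neg[OF M.ops_subspace, of "?T g" g] by (simp add: R_def)
  have Rle: "fnorm B g (R g b) \<le> \<epsilon> * fnorm B g b" if "b \<in> F g" for g b
    using F'(2)[OF that] G(2)[OF _ that] N.norm_minus[of "T g b" g] that by (simp add: Rb)
  obtain \<Theta> where Th: "K.bdl \<Theta>" "\<And>x. x \<in> hcar H \<Longrightarrow> hnorm Ae H (\<Theta> x) \<le> \<epsilon> * hnorm Ae H x"
    "\<And>g b. b \<in> F g \<Longrightarrow> \<Theta> (K.d g b) = K.d g (R g b)"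
  proof (rule K.coord_map[of "\<lambda>g. g" R \<epsilon>])
    show "R g b \<in> F g" if "b \<in> F g" for g b using M.opsD(1)[OF Rops] that by simp
    show "clinear_on (F g) (R g)" for g using M.opsD(3)[OF Rops, of g] by simp
    show "U.leq (fmul B (- g) g (fstar B g (R g b)) (R g b)) (rsc (\<epsilon>\<^sup>2) (fmul B (- g) g (fstar B g b) b))" if "b \<in> F g" for g b
      using leq_of_ops[OF Rops Rle _ that] e by simp
  qed (use e in simp_all)
  have eq: "?E x = Psi x + \<Theta> x" if x: "x \<in> hcar H" for x
  proof -
    have "(if x \<in> hcar H then ?E x else 0) = Psi x + \<Theta> x"
    proof (rule K.bdl_eqI[OF K.ops_bdl[OF H.finite_rank_ops[OF Efr]] K.bdl_add[OF Psi_spec(1) Th(1)] _ x])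
      fix h c assume c: "c \<in> F h"
      have "Psi (K.d h c) + \<Theta> (K.d h c) = K.d h (T h c + R h c)"
        using c M.opsD(1)[OF Rops, of c h] by (simp add: Psi_d Th(3) clinear_map.add[OF K.d_linear])
      also have "\<dots> = ?E (K.d h c)"
        using c clinear_map.zero[OF K.d_linear] by (simp add: Rb Ed)
      finally show "(if K.d h c \<in> hcar H then ?E (K.d h c) else 0) = Psi (K.d h c) + \<Theta> (K.d h c)" using c by simp
    qed
    thus ?thesis using x by simp
  qed
  show "\<exists>F. finite_rank H F \<and> (\<forall>x\<in>hcar H. hnorm Ae H (F x - Psi x) \<le> \<epsilon> * hnorm Ae H x)"
    using Efr eq Th(2) by (intro exI[of _ ?E]) simp
qed

lemma Psi_compact: "compact_map Ae H Psi"
  using H.approx_compact[OF Psi_approx] Psi_spec(1) by (simp add: K.bdl_def)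

lemma Psi_op_norm: "op_norm (hcar H) (hnorm Ae H) Psi \<le> 2"
  by (rule H.X.op_norm_le) (simp_all add: Psi_spec(2))

text \<open>Write \<open>x\<close> as \<open>Lam f\<close> minus the remainder
  \<open>Lam f - x\<close>. The constant 3 is the bound 2 of \<open>Psi\<close> plus 1 for the
  identity on the remainder, while on \<open>Lam f\<close> only the finitely many coefficients of
  \<open>f\<close> matter.\<close>

lemma Psi_near:
  assumes x: "x \<in> ccar D" and f: "f \<in> S0"
  shows "hnorm Ae H (Psi (j x) - j x) \<le> 3 * L.opn (Lam f - x) + (\<Sum>g\<in>supp f. fnorm B g (T g (f g) - f g))"
proof -
  let ?y = "Lam f - x"
  have y: "?y \<in> ccar D" by (rule cv.subspace_diff[OF D_subspace Lam_D[OF f] x])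
  have Pcl: "Psi h \<in> hcar H" if "h \<in> hcar H" for h by (rule K.bdlD(1)[OF Psi_spec(1) that])
  have jf: "j (Lam f) = (\<Sum>g\<in>supp f. K.d g (f g))" by (rule K.\<iota>_expand[OF f S0D(2)[OF f] order_refl])
  have "Psi (j (Lam f)) - j (Lam f) = (\<Sum>g\<in>supp f. K.d g (T g (f g) - f g))"
    unfolding jf using f by (subst clinear_map.sum[OF K.bdlD(2)[OF Psi_spec(1)]])
      (simp_all add: S0D Psi_d clinear_map.diff[OF K.d_linear] sum_subtractf)
  hence 1: "hnorm Ae H (Psi (j (Lam f)) - j (Lam f)) \<le> (\<Sum>g\<in>supp f. fnorm B g (T g (f g) - f g))"
    using H.X.norm_sum_le[of "supp f" "\<lambda>g. K.d g (T g (f g) - f g)"] f by (simp add: S0D K.hn_d)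
  have jx: "j x = j (Lam f) - j ?y" using clinear_map.diff[OF j_linear Lam_D[OF f] x] by simp
  have eq: "Psi (j x) - j x = (Psi (j (Lam f)) - j (Lam f)) - (Psi (j ?y) - j ?y)"
    unfolding jx using f y by (subst clinear_map.diff[OF K.bdlD(2)[OF Psi_spec(1)]]) simp_all
  have "hnorm Ae H (Psi (j x) - j x) \<le> hnorm Ae H (Psi (j (Lam f)) - j (Lam f)) + (hnorm Ae H (Psi (j ?y)) + hnorm Ae H (j ?y))"
  proof -
    have p: "Psi (j (Lam f)) - j (Lam f) \<in> hcar H" "Psi (j ?y) \<in> hcar H" "j ?y \<in> hcar H"
      by (rule H.X.diff_in[OF Pcl[OF j_in[OF Lam_D[OF f]]] j_in[OF Lam_D[OF f]]], rule Pcl[OF j_in[OF y]], rule j_in[OF y])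
    show ?thesis unfolding eq using H.X.norm_diff_le[OF p(1) H.X.diff_in[OF p(2,3)]] H.X.norm_diff_le[OF p(2,3)] by linarith
  qed
  also have "\<dots> \<le> (\<Sum>g\<in>supp f. fnorm B g (T g (f g) - f g)) + (2 * L.opn ?y + L.opn ?y)"
    by (rule add_mono[OF 1 add_mono[OF order_trans[OF Psi_spec(2)[OF j_in[OF y]]] hn_j(2)[OF y]]])
      (simp add: hn_j(2)[OF y])
  finally show ?thesis by (simp add: add.commute)
qed

text \<open>Collects the facts without reference to \<open>Psi\<close>, so that outside of the
  locale one existentially chosen map carries all of them.\<close>

lemma Phi_properties:
  "completely_positive D Phi \<and> bimodule_map Ae D (lam 0) Phi \<and>
    (\<forall>x\<in>ccar D. cpos D x \<longrightarrow> cle Ae (cond_exp B L \<iota> (Phi x)) (cond_exp B L \<iota> x)) \<and>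
    compact_map Ae H (induced_map Ae (expectation_module B L \<iota>) H j Phi) \<and>
    op_norm (hcar H) (hnorm Ae H) (induced_map Ae (expectation_module B L \<iota>) H j Phi) \<le> 2 \<and>
    (\<forall>x\<in>ccar D. \<forall>f\<in>S0. hnorm Ae H (induced_map Ae (expectation_module B L \<iota>) H j Phi (j x) - j x) \<le>
      3 * op_norm (hcar L) (hnorm Ae L) (Lam f - x) + (\<Sum>g\<in>supp f. fnorm B g (T g (f g) - f g)))"
  using Phi_cp Phi_bimodule Phi_Ex_le Psi_compact Psi_op_norm Psi_near
  by (simp add: cond_exp_eq flip: Psi_def)

end

section \<open>The implementing net\<close>

lemma net_eventuallyI:
  assumes "i \<in> I" "\<And>k. \<lbrakk>k \<in> I; le i k\<rbrakk> \<Longrightarrow> P k" shows "eventually P (net_filter I le)"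
  unfolding net_filter_def by (rule eventually_INF1[OF assms(1)]) (simp add: eventually_principal assms(2))

text \<open>Directedness makes the tails \<open>{k \<in> I. le i k}\<close> a filter base, and each
  tail contains \<open>i\<close> itself by reflexivity.\<close>

lemma net_eventuallyD:
  assumes dir: "directed_set I le" and ev: "eventually P (net_filter I le)" shows "\<exists>i\<in>I. P i"
proof -
  have "(\<exists>i\<in>I. eventually P (principal {k \<in> I. le i k}))"
  proof (subst eventually_INF_base[symmetric])
    show "I \<noteq> {}" using dir by (simp add: directed_set_def)
    show "eventually P (INF b\<in>I. principal {k \<in> I. le b k})" using ev by (simp add: net_filter_def)
    fix a b assume ab: "a \<in> I" "b \<in> I"
    then obtain c where c: "c \<in> I" "le a c" "le b c" using dir unfolding directed_set_def by blast
    have "\<And>k. k \<in> I \<Longrightarrow> le c k \<Longrightarrow> le a k \<and> le b k" using dir ab c unfolding directed_set_def by blast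
    thus "\<exists>x\<in>I. principal {k \<in> I. le x k} \<le> inf (principal {k \<in> I. le a k}) (principal {k \<in> I. le b k})"
      using c(1) by (intro bexI[of _ c]) auto
  qed
  then obtain i where "i \<in> I" "\<forall>k\<in>I. le i k \<longrightarrow> P k" by (auto simp: eventually_principal)
  thus ?thesis using dir unfolding directed_set_def by blast
qed

text \<open>Dividing by \<open>max 1 \<parallel>T\<^sub>e(1)\<parallel>\<close> makes the multiplier decrease the conditional expectation. Along the
  net the divisors converge to 1.\<close>

context fell_unital
begin

definition rescale :: "('g \<Rightarrow> 'b \<Rightarrow> 'b) \<Rightarrow> 'g \<Rightarrow> 'b \<Rightarrow> 'b" where
  "rescale S g b = rsc (1 / max 1 (fnorm B 0 (S 0 e1))) (S g b)"

lemma rescale_near: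
  assumes S: "\<And>b. b \<in> F g \<Longrightarrow> S g b \<in> F g" "S 0 e1 \<in> F 0" and b: "b \<in> F g"
  shows "fnorm B g (rescale S g b - b) \<le> fnorm B g (S g b - b) + fnorm B 0 (S 0 e1 - e1) * fnorm B g b"
proof -
  define s where "s = 1 / max 1 (fnorm B 0 (S 0 e1))"
  let ?\<delta> = "fnorm B 0 (S 0 e1 - e1)"
  have d: "?\<delta> \<ge> 0" using S(2) by (intro N.nonneg) simp
  have "fnorm B 0 (S 0 e1) \<le> ?\<delta> + fnorm B 0 e1" using N.tri[of "S 0 e1 - e1" 0 e1] S(2) by simp
  hence "max 1 (fnorm B 0 (S 0 e1)) \<le> 1 + ?\<delta>" using U.norm_unit d by simp
  \<comment> \<open>The divisor lies between 1 and \<open>1 + ?\<delta>\<close>, so its inverse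
    \<open>s\<close> differs from 1 by at most \<open>?\<delta>\<close>.\<close>
  hence "1 / (1 + ?\<delta>) \<le> s" unfolding s_def by (intro divide_left_mono) auto
  moreover have "1 - ?\<delta> \<le> 1 / (1 + ?\<delta>)"
  proof -
    have "(1 - ?\<delta>) * (1 + ?\<delta>) \<le> 1" by (simp add: algebra_simps)
    thus ?thesis using d by (simp add: pos_le_divide_eq)
  qed
  moreover have s1: "0 \<le> s" "s \<le> 1" by (simp_all add: s_def)
  ultimately have sd: "\<bar>s - 1\<bar> \<le> ?\<delta>" by linarith
  have "rescale S g b - b = rsc s (S g b - b) + rsc (s - 1) b"
    by (simp add: rescale_def s_def cv.scale_right_diff_distrib cv.scale_left_diff_distrib)
  hence "fnorm B g (rescale S g b - b) \<le> s * fnorm B g (S g b - b) + \<bar>s - 1\<bar> * fnorm B g b"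
    using N.tri[of "rsc s (S g b - b)" g "rsc (s - 1) b"] S(1)[OF b] b s1
      N.norm_scale[of "S g b - b" g "complex_of_real s"] N.norm_scale[of b g "complex_of_real (s - 1)"]
    by (simp del: of_real_diff)
  also have "\<dots> \<le> 1 * fnorm B g (S g b - b) + ?\<delta> * fnorm B g b"
    using s1 sd S(1)[OF b] b by (intro add_mono mult_right_mono N.nonneg) auto
  finally show ?thesis by simp
qed

end

context alg_completion
begin

lemma haagerup_mult_rescale:
  assumes bm: "bundle_map B S" and pd: "positive_definite B S"
    and c0: "((\<lambda>g. op_norm (F g) (fnorm B g) (S g)) \<longlongrightarrow> 0) cofinite"
    and comp: "\<And>g. compact_map Ae (fibre_module B g) (S g)"
    and iso: "\<And>g b. \<lbrakk>b \<in> F g; b \<noteq> 0\<rbrakk> \<Longrightarrow> \<exists>v\<in>F g. fmul B (- g) g (fstar B g v) v = e1"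
  shows "haagerup_mult B L \<iota> H j (rescale S)"
proof -
  define s where "s = 1 / max 1 (fnorm B 0 (S 0 e1))"
  have s: "0 \<le> s" "s \<le> 1" by (simp_all add: s_def)
  have T: "rescale S g b = rsc s (S g b)" for g b by (simp add: rescale_def s_def)
  have Sin: "S g b \<in> F g" if "b \<in> F g" for g b using bm that by (simp add: bundle_map_def bounded_op_def)
  have Sl: "clinear_map (F g) (S g)" for g using bm N.sub by (simp add: bundle_map_def bounded_op_def clinear_map_def)
  have Sb: "bounded_on (F g) (fnorm B g) (S g)" for g using bm by (simp add: bundle_map_def bounded_op_def)
  have Tn: "fnorm B g (rescale S g b) \<le> fnorm B g (S g b)" if "b \<in> F g" for g b
    using N.norm_scale[OF Sin[OF that], of "complex_of_real s"] s N.nonneg[OF Sin[OF that]]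
    by (simp add: T mult_left_le_one_le)
  have "pd_bundle_axioms B (rescale S)"
  proof (rule pd_bundle_axioms.intro)
    fix g
    obtain C where C: "\<And>b. b \<in> F g \<Longrightarrow> fnorm B g (S g b) \<le> C * fnorm B g b" using Sb unfolding bounded_on_def by blast
    have "clinear_on (F g) (rescale S g)" by (rule clinear_onI)
        (simp_all add: T clinear_map.add[OF Sl] clinear_map.scale[OF Sl] cv.scale_right_distrib mult.commute)
    moreover have "bounded_on (F g) (fnorm B g) (rescale S g)" unfolding bounded_on_def
      using order_trans[OF Tn C] by blast
    ultimately show "bounded_op (F g) (fnorm B g) (rescale S g)" by (simp add: bounded_op_def T Sin)
    fix b a assume ba: "b \<in> F g" "a \<in> F 0"
    \<comment> \<open>Compactness enters here: the map is adjointable, hence right linear over the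
      unit fibre.\<close>
    have "(\<lambda>x. if x \<in> F g then S g x else 0) \<in> M.ops g"
      using M.approx_ops[OF M.compact_approx[OF comp], of g] Sin by simp
    from M.ops_act[OF this, of b a] have "S g (fmul B g 0 b a) = fmul B g 0 (S g b) a" using ba by simp
    thus "rescale S g (fmul B g 0 b a) = fmul B g 0 (rescale S g b) a" using ba Sin by (simp add: T mul_scale_left)
  next
    show "positive_definite B (rescale S)" unfolding positive_definite_def
    proof (intro allI impI)
      fix n :: nat and g :: "nat \<Rightarrow> 'g" and a b assume ab: "\<forall>i<n. a i \<in> F (g i) \<and> b i \<in> F (g i)"
      let ?Z = "\<lambda>S i j. fmul B (g j) (- g j) (fmul B (g i) (- g i + g j) (b i)
          (S (- g i + g j) (fmul B (- g i) (g j) (fstar B (g i) (a i)) (a j)))) (fstar B (g j) (b j))"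
      have Z: "?Z (rescale S) i j = rsc s (?Z S i j)" if "i < n" "j < n" for i j
      proof -
        have m: "S (- g i + g j) (fmul B (- g i) (g j) (fstar B (g i) (a i)) (a j)) \<in> F (- g i + g j)"
          using ab that by (intro Sin mul_closed star_closed) auto
        have "fmul B (g i) (- g i + g j) (b i) (S (- g i + g j) (fmul B (- g i) (g j) (fstar B (g i) (a i)) (a j))) \<in> F (g j)"
          using mul_closed[OF _ m, of "b i" "g i"] ab that by (simp add: add.assoc[symmetric])
        thus ?thesis using ab that m star_closed[of "b j" "g j"] by (simp add: T mul_scale_right mul_scale_left)
      qed
      have "U.pos (\<Sum>i<n. \<Sum>j<n. ?Z S i j)"
        using pd[unfolded positive_definite_def, rule_format, of n a g b] ab by (simp add: U.cpos_iff)
      from U.pos_scale[OF this s(1)] have "U.pos (\<Sum>i<n. \<Sum>j<n. ?Z (rescale S) i j)"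
        using Z by (simp add: cv.scale_sum_right)
      thus "cpos Ae (\<Sum>i<n. \<Sum>j<n. ?Z (rescale S) i j)" by (simp add: U.cpos_iff)
    qed
    show "fnorm B 0 (rescale S 0 e1) \<le> 1"
      using N.norm_scale[OF Sin[OF e1_in], of "complex_of_real s"] s(1) by (simp add: T) (simp add: s_def divide_simps)
  qed (rule iso)
  moreover have "haagerup_mult_axioms B (rescale S)"
  proof (rule haagerup_mult_axioms.intro)
    fix g
    show "M.approx g (rescale S g)" unfolding M.approx_def
    proof (intro allI impI)
      fix \<epsilon> :: real assume "\<epsilon> > 0"
      then obtain E where E: "finite_rank (fibre_module B g) E"
          "\<forall>x\<in>F g. hnorm Ae (fibre_module B g) (E x - S g x) \<le> \<epsilon> * hnorm Ae (fibre_module B g) x"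
        using M.compact_approx[OF comp, of g] unfolding M.approx_def fibre_simps by blast
      have "hnorm Ae (fibre_module B g) (rsc s (E x) - rescale S g x) \<le> \<epsilon> * hnorm Ae (fibre_module B g) x" if x: "x \<in> F g" for x
      proof -
        have m: "E x - S g x \<in> F g" using M.finite_rank_closed[OF E(1)] Sin x by simp
        have "rsc s (E x) - rescale S g x = rsc s (E x - S g x)" by (simp add: T cv.scale_right_diff_distrib)
        hence "hnorm Ae (fibre_module B g) (rsc s (E x) - rescale S g x) = s * hnorm Ae (fibre_module B g) (E x - S g x)"
          using m s N.norm_scale[OF m, of "complex_of_real s"] by (simp add: fibre_norm)
        also have "\<dots> \<le> hnorm Ae (fibre_module B g) (E x - S g x)"
          using s m N.nonneg[OF m] by (simp add: fibre_norm mult_left_le_one_le)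
        finally show ?thesis using E(2) x by force
      qed
      thus "\<exists>F. finite_rank (fibre_module B g) F \<and>
          (\<forall>x\<in>hcar (fibre_module B g). hnorm Ae (fibre_module B g) (F x - rescale S g x) \<le> \<epsilon> * hnorm Ae (fibre_module B g) x)"
        using M.finite_rank_scale[OF E(1), of "complex_of_real s"] by (intro exI[of _ "\<lambda>x. rsc s (E x)"]) simp
    qed
  next
    fix \<epsilon> :: real assume e: "\<epsilon> > 0"
    let ?G = "{g. \<not> op_norm (F g) (fnorm B g) (S g) < \<epsilon>}"
    have "finite ?G" using order_tendstoD(2)[OF c0 e] by (simp add: eventually_cofinite)
    moreover have "fnorm B g (rescale S g b) \<le> \<epsilon> * fnorm B g b" if "g \<notin> ?G" "b \<in> F g" for g b
    proof -
      have "fnorm B g (S g b) \<le> op_norm (F g) (fnorm B g) (S g) * fnorm B g b" by (rule N.le_op_norm[OF Sb Sin that(2)])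
      also have "\<dots> \<le> \<epsilon> * fnorm B g b" using that by (intro mult_right_mono N.nonneg) auto
      finally show ?thesis using Tn[OF that(2)] by simp
    qed
    ultimately show "\<exists>G. finite G \<and> (\<forall>g. g \<notin> G \<longrightarrow> (\<forall>b\<in>F g. fnorm B g (rescale S g b) \<le> \<epsilon> * fnorm B g b))" by blast
  qed
  ultimately show ?thesis
    by (intro haagerup_mult.intro alg_completion_axioms pd_map.intro sec_completion_axioms pd_bundle.intro fell_unital_axioms)
qed

end

theorem theorem6p10:
  fixes B :: "('g::group_add, 'b::complex_vector) fell_data"
    and I :: "'i set" and le :: "'i \<Rightarrow> 'i \<Rightarrow> bool" and T :: "'i \<Rightarrow> 'g \<Rightarrow> 'b \<Rightarrow> 'b"
    and J :: "'g \<Rightarrow> 'j set" and u :: "'g \<Rightarrow> 'j \<Rightarrow> 'b"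
    and L :: "('l::complex_vector, 'b) hmodule" and \<iota> :: "('g \<Rightarrow> 'b) \<Rightarrow> 'l"
    and H :: "('h::complex_vector, 'b) hmodule" and j :: "('l \<Rightarrow> 'l) \<Rightarrow> 'h"
  assumes "fell_bundle B"
    and "cunital (unit_fibre B)"
    and "haagerup_PD_net B I le T"
    and "\<And>i g. i \<in> I \<Longrightarrow> compact_map (unit_fibre B) (fibre_module B g) (T i g)"
    and "\<And>g. orthonormal_basis (unit_fibre B) (fibre_module B g) (J g) (u g)"
    and "hilbert_completion (unit_fibre B) (sections_module B) L \<iota>"
    and "hilbert_completion (unit_fibre B) (expectation_module B L \<iota>) H j"
  shows "hilbert_module_haagerup B L \<iota> H j"
proof -
  interpret alg_completion B L \<iota> H j
    using assms(1,2,6,7)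
    by (intro alg_completion.intro sec_completion.intro fell_unital.intro fell_unital_axioms.intro
        sec_completion_axioms.intro alg_completion_axioms.intro)
  have dir: "directed_set I le" and net: "\<And>i. i \<in> I \<Longrightarrow> bundle_map B (T i)" "\<And>i. i \<in> I \<Longrightarrow> positive_definite B (T i)"
      "\<And>i. i \<in> I \<Longrightarrow> ((\<lambda>g. op_norm (F g) (fnorm B g) (T i g)) \<longlongrightarrow> 0) cofinite"
    and lim: "\<And>g b. b \<in> F g \<Longrightarrow> ((\<lambda>i. fnorm B g (T i g b - b)) \<longlongrightarrow> 0) (net_filter I le)"
    using assms(3) unfolding haagerup_PD_net_def by blast+
  let ?ind = "induced_map Ae (expectation_module B L \<iota>) H j"
  let ?nH = "hnorm Ae H"
  \<comment> \<open>The last clause is a quantitative form of convergence. It depends on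
    \<open>i\<close> only through the rescaled \<open>T i\<close>, so limits can be taken after the
    maps are chosen.\<close>
  define P where "P i \<Phi> \<longleftrightarrow> completely_positive D \<Phi> \<and> bimodule_map Ae D (lam 0) \<Phi> \<and>
    (\<forall>x\<in>ccar D. cpos D x \<longrightarrow> cle Ae (cond_exp B L \<iota> (\<Phi> x)) (cond_exp B L \<iota> x)) \<and>
    compact_map Ae H (?ind \<Phi>) \<and> op_norm (hcar H) ?nH (?ind \<Phi>) \<le> 2 \<and>
    (\<forall>x\<in>ccar D. \<forall>f\<in>S0. ?nH (?ind \<Phi> (j x) - j x) \<le>
      3 * L.opn (Lam f - x) + (\<Sum>g\<in>supp f. fnorm B g (rescale (T i) g (f g) - f g)))" for i \<Phi>
  have "\<forall>i\<in>I. \<exists>\<Phi>. P i \<Phi>"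
  proof
    fix i assume i: "i \<in> I"
    have "haagerup_mult B L \<iota> H j (rescale (T i))"
      by (rule haagerup_mult_rescale[OF net(1-3)[OF i] assms(4)[OF i] isometry_of_basis[OF assms(5)]])
    from haagerup_mult.Phi_properties[OF this] show "\<exists>\<Phi>. P i \<Phi>" unfolding P_def by blast
  qed
  then obtain \<Phi> where \<Phi>: "\<And>i. i \<in> I \<Longrightarrow> P i (\<Phi> i)" by metis
  have inI: "eventually (\<lambda>i. i \<in> I) (net_filter I le)"
    using dir net_eventuallyI[of _ I le "\<lambda>i. i \<in> I"] unfolding directed_set_def by blast
  have Tin: "T i g b \<in> F g" if "i \<in> I" "b \<in> F g" for i g b
    using net(1)[OF that(1)] that(2) by (simp add: bundle_map_def bounded_op_def)
  have lim': "((\<lambda>i. fnorm B g (rescale (T i) g b - b)) \<longlongrightarrow> 0) (net_filter I le)" if b: "b \<in> F g" for g b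
  proof (rule Lim_null_comparison)
    show "((\<lambda>i. fnorm B g (T i g b - b) + fnorm B 0 (T i 0 e1 - e1) * fnorm B g b) \<longlongrightarrow> 0) (net_filter I le)"
      using tendsto_add[OF lim[OF b] tendsto_mult[OF lim[OF e1_in] tendsto_const, of "fnorm B g b"]] by simp
    show "\<forall>\<^sub>F i in net_filter I le. norm (fnorm B g (rescale (T i) g b - b)) \<le>
        fnorm B g (T i g b - b) + fnorm B 0 (T i 0 e1 - e1) * fnorm B g b"
      using inI
    proof eventually_elim
      case (elim i)
      have "rescale (T i) g b \<in> F g" using Tin[OF elim b] by (simp add: rescale_def)
      thus ?case using rescale_near[of g "T i" b] Tin[OF elim] b N.nonneg[of "rescale (T i) g b - b" g] by simp
    qed
  qed
  have conv: "((\<lambda>i. ?nH (?ind (\<Phi> i) (j x) - j x)) \<longlongrightarrow> 0) (net_filter I le)" if x: "x \<in> ccar D" for x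
  proof (rule tendstoI)
    fix e :: real assume e: "e > 0"
    obtain s where s: "\<And>k. s k \<in> S0" "L.Adj.conv (\<lambda>k. Lam (s k)) x" using D_dense[OF x] by blast
    have "(\<lambda>l. L.opn (Lam (s l) - x)) \<longlonglongrightarrow> 0" using L.Adj.convD(3)[OF s(2)] by simp
    \<comment> \<open>The factor 3 in \<open>P\<close> turns \<open>e / 6\<close> into one half of
      \<open>e\<close>; the finite sum takes the other half.\<close>
    moreover have "e / 6 > 0" using e by simp
    ultimately obtain l where l: "L.opn (Lam (s l) - x) < e / 6"
      using LIMSEQ_D[of "\<lambda>l. L.opn (Lam (s l) - x)" 0 "e / 6"] by (metis abs_less_iff diff_zero order_refl real_norm_def)
    let ?f = "s l"
    have "((\<lambda>i. \<Sum>g\<in>supp ?f. fnorm B g (rescale (T i) g (?f g) - ?f g)) \<longlongrightarrow> (\<Sum>g\<in>supp ?f. 0)) (net_filter I le)"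
      by (intro tendsto_sum lim' S0D(1) s(1))
    hence "((\<lambda>i. \<Sum>g\<in>supp ?f. fnorm B g (rescale (T i) g (?f g) - ?f g)) \<longlongrightarrow> 0) (net_filter I le)" by simp
    from order_tendstoD(2)[OF this half_gt_zero[OF e]] inI
    show "\<forall>\<^sub>F i in net_filter I le. dist (?nH (?ind (\<Phi> i) (j x) - j x)) 0 < e"
    proof eventually_elim
      case (elim i)
      have "?nH (?ind (\<Phi> i) (j x) - j x) \<le>
          3 * L.opn (Lam ?f - x) + (\<Sum>g\<in>supp ?f. fnorm B g (rescale (T i) g (?f g) - ?f g))"
        using \<Phi>[OF elim(2)] x s(1) unfolding P_def by blast
      moreover have "?ind (\<Phi> i) (j x) \<in> hcar H"
        using \<Phi>[OF elim(2)] j_in[OF x] unfolding P_def compact_map_def bounded_op_def by blast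
      hence "0 \<le> ?nH (?ind (\<Phi> i) (j x) - j x)" using x by (intro H.X.nonneg) simp
      ultimately show ?case using elim(1) l by (simp add: dist_real_def)
    qed
  qed
  \<comment> \<open>Passage to the index type prescribed by \<open>hilbert_module_haagerup\<close>:
    for a finite set and an accuracy, a member of the net is chosen that is good for all elements of
    the set.\<close>
  define I' where "I' = {p :: ('l \<Rightarrow> 'l) set \<times> nat. finite (fst p) \<and> fst p \<subseteq> ccar D}"
  define le' where "le' p q \<longleftrightarrow> fst p \<subseteq> fst q \<and> snd p \<le> snd q" for p q :: "('l \<Rightarrow> 'l) set \<times> nat"
  have "\<forall>p\<in>I'. \<exists>i\<in>I. \<forall>x\<in>fst p. ?nH (?ind (\<Phi> i) (j x) - j x) < 1 / real (Suc (snd p))"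
  proof
    fix p assume p: "p \<in> I'"
    have "\<forall>\<^sub>F i in net_filter I le. \<forall>x\<in>fst p. ?nH (?ind (\<Phi> i) (j x) - j x) < 1 / real (Suc (snd p))"
    proof (rule eventually_ball_finite)
      show "finite (fst p)" using p by (simp add: I'_def)
      show "\<forall>x\<in>fst p. \<forall>\<^sub>F i in net_filter I le. ?nH (?ind (\<Phi> i) (j x) - j x) < 1 / real (Suc (snd p))"
        using p conv by (auto simp: I'_def intro!: order_tendstoD(2))
    qed
    thus "\<exists>i\<in>I. \<forall>x\<in>fst p. ?nH (?ind (\<Phi> i) (j x) - j x) < 1 / real (Suc (snd p))" by (rule net_eventuallyD[OF dir])
  qed
  then obtain idx where idx: "\<And>p. p \<in> I' \<Longrightarrow> idx p \<in> I"
      "\<And>p x. \<lbrakk>p \<in> I'; x \<in> fst p\<rbrakk> \<Longrightarrow> ?nH (?ind (\<Phi> (idx p)) (j x) - j x) < 1 / real (Suc (snd p))" by metis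
  have ne: "({}, 0) \<in> I'" by (simp add: I'_def)
  have dir': "directed_set I' le'" unfolding directed_set_def
  proof (intro conjI ballI impI)
    fix p q assume "p \<in> I'" "q \<in> I'"
    thus "\<exists>r\<in>I'. le' p r \<and> le' q r"
      by (intro bexI[of _ "(fst p \<union> fst q, max (snd p) (snd q))"]) (auto simp: I'_def le'_def)
  qed (use ne in \<open>auto simp: le'_def\<close>)
  have conv': "((\<lambda>p. ?nH (?ind (\<Phi> (idx p)) (j x) - j x)) \<longlongrightarrow> 0) (net_filter I' le')" if x: "x \<in> ccar D" for x
  proof (rule tendstoI)
    fix e :: real assume e: "e > 0"
    obtain m where m: "inverse (real (Suc m)) < e" using reals_Archimedean[OF e] by blast
    show "\<forall>\<^sub>F p in net_filter I' le'. dist (?nH (?ind (\<Phi> (idx p)) (j x) - j x)) 0 < e"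
    proof (rule net_eventuallyI[of "({x}, m)"])
      show "({x}, m) \<in> I'" using x by (simp add: I'_def)
      fix p assume p: "p \<in> I'" "le' ({x}, m) p"
      have "?nH (?ind (\<Phi> (idx p)) (j x) - j x) < 1 / real (Suc (snd p))" using idx(2)[OF p(1)] p(2) by (simp add: le'_def)
      also have "\<dots> \<le> 1 / real (Suc m)" using p(2) by (intro divide_left_mono) (auto simp: le'_def)
      finally have "?nH (?ind (\<Phi> (idx p)) (j x) - j x) < e" using m by (simp add: inverse_eq_divide)
      moreover have "?ind (\<Phi> (idx p)) (j x) \<in> hcar H"
        using \<Phi>[OF idx(1)[OF p(1)]] j_in[OF x] unfolding P_def compact_map_def bounded_op_def by blast
      hence "0 \<le> ?nH (?ind (\<Phi> (idx p)) (j x) - j x)" using x by (intro H.X.nonneg) simp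
      ultimately show "dist (?nH (?ind (\<Phi> (idx p)) (j x) - j x)) 0 < e" by (simp add: dist_real_def)
    qed
  qed
  have bdd: "bdd_above ((\<lambda>p. op_norm (hcar H) ?nH (?ind (\<Phi> (idx p)))) ` I')"
  proof (rule bdd_aboveI2)
    show "op_norm (hcar H) ?nH (?ind (\<Phi> (idx p))) \<le> 2" if "p \<in> I'" for p
      using \<Phi>[OF idx(1)[OF that]] by (simp add: P_def)
  qed
  have main: "completely_positive D (\<Phi> (idx p)) \<and> bimodule_map Ae D (lam 0) (\<Phi> (idx p)) \<and>
      (\<forall>x\<in>ccar D. cpos D x \<longrightarrow> cle Ae (cond_exp B L \<iota> (\<Phi> (idx p) x)) (cond_exp B L \<iota> x)) \<and>
      compact_map Ae H (?ind (\<Phi> (idx p)))" if "p \<in> I'" for p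
    using \<Phi>[OF idx(1)[OF that]] unfolding P_def by blast
  show ?thesis unfolding hilbert_module_haagerup_def Let_def
    by (intro exI[of _ I'] exI[of _ le'] exI[of _ "\<lambda>p. \<Phi> (idx p)"] conjI ballI dir' bdd conv' main)
qed

end
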